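(* Let $k$ be a field, and let $(\Sigma,w)$ be a $k$-balanced fan of dimension $2$. Suppose $H_q^{BM}(\Sigma,F_p^k)=0$ for all $q\ne2$ and all $p$. Then $\Sigma$ satisfies tropical Poincaré duality over $k$ if and only if each of the stars $(\mathrm{Star}_\tau,w)$, for $\tau\in\Sigma^1$, satisfies tropical Poincaré duality over $k$.
   Context: Below $R$ is a commutative ring; the claim uses $R=k$. **Fans.** Let $N\cong\mathbb{Z}^n$ be a lattice, $N_{\mathbb{R}}=N\otimes\mathbb{R}$. A rational polyhedral cone is a strictly convex cone generated by finitely many vectors of $N$; for a cone $\sigma$, $L_{\mathbb{Z}}(\sigma)=N\cap\mathrm{span}(\sigma)$ and $\dim\sigma=\mathrm{rank}\,L_{\mathbb{Z}}(\sigma)$. A (rational polyhedral) fan $\Sigma$ is a finite nonempty collection of such cones, closed under taking faces, any two meeting in a common face; fans are assumed pure dimensional (all maximal cones have the same dimension $d=\dim\Sigma$). Cones are also called faces. $\Sigma^i$ is the set of $i$-dimensional cones, $\tau\preceq\sigma$ means $\tau$ is a face of $\sigma$, and $v=\{0\}\in\Sigma$ is the vertex, the only compact cone. Fix an orientation of each cone; for $\tau\prec\sigma$ with $\dim\tau=\dim\sigma-1$ let $\mathcal{O}(\tau,\sigma)=\pm1$ be the relative orientation sign. **Stars.** For $\gamma\in\Sigma$, $\mathrm{Star}_\gamma$ is the fan with underlying set $\bigcup_{\kappa\succeq\gamma}\widetilde\kappa$, $\widetilde\kappa=\{t(x-y):t\ge0,\,x\in\kappa,\,y\in\gamma\}$,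 subdivided (in any way) into strictly convex rational cones forming a fan; $\mathrm{Star}_v=\Sigma$. A weight function $w$ on $\Sigma$ induces one on $\mathrm{Star}_\gamma$, also denoted $w$: a maximal cone contained in $\widetilde\alpha$ ($\alpha\in\Sigma^d$, $\alpha\succeq\gamma$) gets weight $w(\alpha)$. If $(\Sigma,w)$ is $R$-balanced (below), so is $(\mathrm{Star}_\gamma,w)$. **Tropical (co)homology.** $F_p^{\mathbb{Z}}(\sigma)=\sum_{\gamma\succeq\sigma}\bigwedge^pL_{\mathbb{Z}}(\gamma)\subseteq\bigwedge^pN$ (with $F_0^{\mathbb{Z}}(\sigma)=\mathbb{Z}$), $F_p^R(\sigma)=F_p^{\mathbb{Z}}(\sigma)\otimes_{\mathbb{Z}}R$, and for $\tau\preceq\sigma$ the map $\iota_{\sigma,\tau}:F_p^R(\sigma)\to F_p^R(\tau)$ is induced by inclusion. $F^p_R(\sigma)=\mathrm{Hom}_R(F_p^R(\sigma),R)$ with $\rho_{\tau,\sigma}:F_R^p(\tau)\to F_R^p(\sigma)$ dual to $\iota_{\sigma,\tau}$. $C_q^{BM}(\Sigma,F_p^R)=\bigoplus_{\sigma\in\Sigma^q}F_p^R(\sigma)$, with boundary having components $\mathcal{O}(\tau,\sigma)\iota_{\sigma,\tau}$; its homology is $H_q^{BM}(\Sigma,F_p^R)$. $C^q(\Sigma,F_R^p)=\bigoplus F_R^p(\sigma)$ over compact $\sigma\in\Sigma^q$, with coboundary having components $\mathcal{O}(\tau,\sigma)\rho_{\tau,\sigma}$; its cohomology is $H^q(\Sigma,F_R^p)$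 (so $C^0=F_R^p(v)$ and $C^q=0$ for $q>0$). **Balancing.** For $\alpha\in\Sigma^d$, $\Lambda_\alpha\in F_d^R(\alpha)=\bigwedge^dL_{\mathbb{Z}}(\alpha)\otimes R\cong R$ is the image of the generator of $\bigwedge^dL_{\mathbb{Z}}(\alpha)$ compatible with the orientation of $\alpha$. An $R$-weight function is $w:\Sigma^d\to R$ with no $w(\alpha)$ a zero-divisor. $(\Sigma,w)$ is $R$-balanced if the fundamental chain $\mathrm{Ch}(\Sigma,w)=(w(\alpha)\Lambda_\alpha)_\alpha\in C_d^{BM}(\Sigma,F_d^R)$ is a cycle; its class is the fundamental class $[\Sigma,w]\in H_d^{BM}(\Sigma,F_d^R)$. **Cap product and duality.** For $y=y_1\wedge\dots\wedge y_m$ in $\bigwedge^mM$ ($M$ free of finite rank) and $x=x_1\wedge\dots\wedge x_p\in\bigwedge^pM^*$, $p\le m$, the contraction is $x\lrcorner y=(-1)^{p(p-1)/2}\sum_a\mathrm{sign}(a)\left(\prod_{i=1}^px_i(y_{a(i)})\right)y_{a(p+1)}\wedge\dots\wedge y_{a(m)}\in\bigwedge^{m-p}M$, summing over permutations $a\in S_m$ increasing on $1,\dots,p$ and on $p+1,\dots,m$. The cap product $\frown[\Sigma,w]:H^q(\Sigma,F_R^p)\to H_{d-q}^{BM}(\Sigma,F_{d-p}^R)$ is induced by $(u_\gamma)_{\gamma\in\Sigma^q}\mapsto\left(\sum_{\alpha\in\Sigma^d,\ \gamma,\tau\preceq\alpha}w(\alpha)\,\iota_{\alpha,\tau}(\rho_{\gamma,\alpha}(u_\gamma)\lrcorner\Lambda_\alpha)\right)_{\tau\in\Sigma^{d-q}}$;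 for $q=0$ it is $u\mapsto(\rho_{v,\alpha}(u)\lrcorner w(\alpha)\Lambda_\alpha)_{\alpha\in\Sigma^d}$. An $R$-balanced $(\Sigma,w)$ satisfies tropical Poincaré duality (TPD) over $R$ if $\frown[\Sigma,w]:H^q(\Sigma,F_R^p)\to H_{d-q}^{BM}(\Sigma,F_{d-p}^R)$ is an isomorphism for all $p,q\in\{0,\dots,d\}$.
   Formalization: In the cap product, the contraction's coefficient is the value of x on y_{a(1)}∧…∧y_{a(p)}, i.e. det(x_i(y_{a(j)})), in place of the product of the x_i(y_{a(i)}), which is not alternating in x and so is ill-defined for p≥2. *)

theory Defs
  imports
    "HOL-Analysis.Analysis"
    "HOL-Algebra.Module"
    "HOL-Algebra.AbelCoset"
    "HOL-Library.Poly_Mapping"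
    "HOL-Library.Function_Algebras"
begin

section \<open>Modules over a commutative ring\<close>

text \<open>
  Modules are records of HOL-Algebra whose scalars are all elements of a type of class
  \<open>comm_ring_1\<close>. The fields \<open>mult\<close> and \<open>one\<close>, which the record type inherits from rings, have
  no meaning for modules and are left unspecified.
\<close>

definition subgroup_gen :: "'b::ab_group_add set \<Rightarrow> 'b set" where
  "subgroup_gen S = (\<lambda>G. 0 \<in> G \<and> (\<forall>x\<in>G. \<forall>y\<in>G. x - y \<in> G)) hull S"

definition scalar_module :: "('r::comm_ring_1, 'r) module" where
  "scalar_module = \<lparr>carrier = UNIV, mult = undefined, one = undefined, zero = 0, add = (+), smult = (*)\<rparr>"

definition linear_maps :: "('r::comm_ring_1, 'm, 'x) module_scheme \<Rightarrow> ('r, 'n, 'y) module_scheme \<Rightarrow> ('m \<Rightarrow> 'n) set"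
  where "linear_maps M M' = {f \<in> carrier M \<rightarrow> carrier M'.
     (\<forall>x\<in>carrier M. \<forall>y\<in>carrier M. f (x \<oplus>\<^bsub>M\<^esub> y) = f x \<oplus>\<^bsub>M'\<^esub> f y) \<and>
     (\<forall>c. \<forall>x\<in>carrier M. f (c \<odot>\<^bsub>M\<^esub> x) = c \<odot>\<^bsub>M'\<^esub> f x)}"

definition linear_isos :: "('r::comm_ring_1, 'm, 'x) module_scheme \<Rightarrow> ('r, 'n, 'y) module_scheme \<Rightarrow> ('m \<Rightarrow> 'n) set"
  where "linear_isos M M' = {f \<in> linear_maps M M'. bij_betw f (carrier M) (carrier M')}"

definition zero_module :: "('r::comm_ring_1, 'm, 'x) module_scheme \<Rightarrow> bool" where
  "zero_module M \<longleftrightarrow> carrier M = {\<zero>\<^bsub>M\<^esub>}"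

definition dual_module :: "('r::comm_ring_1, 'm, 'x) module_scheme \<Rightarrow> ('r, 'm \<Rightarrow> 'r) module" where
  "dual_module M = \<lparr>carrier = linear_maps M (scalar_module :: ('r, 'r) module) \<inter> extensional (carrier M),
     mult = undefined, one = undefined,
     zero = (\<lambda>x\<in>carrier M. 0),
     add = (\<lambda>f g. \<lambda>x\<in>carrier M. f x + g x),
     smult = (\<lambda>c f. \<lambda>x\<in>carrier M. c * f x)\<rparr>"

text \<open>Used for finite \<open>I\<close> only, where direct sum and direct product agree.\<close>

definition direct_sum :: "'i set \<Rightarrow> ('i \<Rightarrow> ('r, 'm, 'x) module_scheme) \<Rightarrow> ('r, 'i \<Rightarrow> 'm) module" where
  "direct_sum I M = \<lparr>carrier = (\<Pi>\<^sub>E i\<in>I. carrier (M i)), mult = undefined, one = undefined,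
     zero = (\<lambda>i\<in>I. \<zero>\<^bsub>M i\<^esub>),
     add = (\<lambda>x y. \<lambda>i\<in>I. x i \<oplus>\<^bsub>M i\<^esub> y i),
     smult = (\<lambda>c x. \<lambda>i\<in>I. c \<odot>\<^bsub>M i\<^esub> x i)\<rparr>"

definition quotient_module :: "('r, 'm, 'x) module_scheme \<Rightarrow> 'm set \<Rightarrow> ('r, 'm set) module" where
  "quotient_module M B = \<lparr>carrier = a_rcosets\<^bsub>M\<^esub> B, mult = undefined, one = undefined,
     zero = B,
     add = set_add M,
     smult = (\<lambda>c X. \<Union>x\<in>X. B +>\<^bsub>M\<^esub> (c \<odot>\<^bsub>M\<^esub> x))\<rparr>"

text \<open>The map from a quotient module to \<open>quotient_module M' B'\<close> induced by \<open>f\<close>.\<close>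

definition induced_map :: "('r, 'n, 'y) module_scheme \<Rightarrow> 'n set \<Rightarrow> ('m \<Rightarrow> 'n) \<Rightarrow> 'm set \<Rightarrow> 'n set" where
  "induced_map M' B' f X = (\<Union>x\<in>X. B' +>\<^bsub>M'\<^esub> f x)"

definition free_module :: "'b set \<Rightarrow> ('r::comm_ring_1, 'b \<Rightarrow>\<^sub>0 'r) module" where
  "free_module A = \<lparr>carrier = {f. Poly_Mapping.keys f \<subseteq> A}, mult = undefined, one = undefined,
     zero = 0, add = (+), smult = (\<lambda>c. Poly_Mapping.map (\<lambda>x. c * x))\<rparr>"

text \<open>
  Extension of scalars: for a subgroup \<open>A\<close> of an abelian group, the \<open>R\<close>-module \<open>A \<otimes>\<^sub>\<int> R\<close> is the free
  \<open>R\<close>-module on the set \<open>A\<close> modulo the submodule generated by the elements \<open>[a + b] - [a] - [b]\<close>.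
  The tensor product is formed with the abstract group \<open>A\<close>: the inclusion \<open>A \<subseteq> A'\<close> induces a map
  \<open>A \<otimes> R \<rightarrow> A' \<otimes> R\<close> that need not be injective.
\<close>

definition tensor_rel :: "'b::ab_group_add set \<Rightarrow> ('b \<Rightarrow>\<^sub>0 'r::comm_ring_1) set" where
  "tensor_rel A = subgroup_gen {Poly_Mapping.single (a + b) c - Poly_Mapping.single a c
     - Poly_Mapping.single b c | a b c. a \<in> A \<and> b \<in> A}"

definition tensor :: "'b::ab_group_add set \<Rightarrow> ('r::comm_ring_1, ('b \<Rightarrow>\<^sub>0 'r) set) module" where
  "tensor A = quotient_module (free_module A) (tensor_rel A)"

text \<open>The element \<open>a \<otimes> 1\<close>.\<close>

definition tensor_of :: "'b::ab_group_add set \<Rightarrow> 'b \<Rightarrow> ('b \<Rightarrow>\<^sub>0 'r::comm_ring_1) set" where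
  "tensor_of A a =
     tensor_rel A +>\<^bsub>(free_module A :: ('r, 'b \<Rightarrow>\<^sub>0 'r) module)\<^esub> Poly_Mapping.single a 1"

definition tensor_incl :: "'b::ab_group_add set \<Rightarrow> ('b \<Rightarrow>\<^sub>0 'r::comm_ring_1) set \<Rightarrow> ('b \<Rightarrow>\<^sub>0 'r) set" where
  "tensor_incl A' = induced_map (free_module A' :: ('r, 'b \<Rightarrow>\<^sub>0 'r) module) (tensor_rel A') (\<lambda>x. x)"


section \<open>Fans\<close>

definition is_lattice :: "'a::euclidean_space set \<Rightarrow> bool" where
  "is_lattice N \<longleftrightarrow> (\<exists>B. independent B \<and> span B = UNIV \<and> N = subgroup_gen B)"

definition rational_cone :: "'a::euclidean_space set \<Rightarrow> 'a set \<Rightarrow> bool" where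
  "rational_cone N \<sigma> \<longleftrightarrow> (\<exists>S. finite S \<and> S \<subseteq> N \<and> \<sigma> = convex_cone hull S) \<and> \<sigma> \<inter> uminus ` \<sigma> = {0}"

definition fan_dim :: "'a::euclidean_space set set \<Rightarrow> nat" where
  "fan_dim \<Sigma> = Max (dim ` \<Sigma>)"

text \<open>
  For the library relation \<open>face_of\<close> the empty set is a face of every convex set; it is not a
  cone, and it is excluded here.
\<close>

definition fan :: "'a::euclidean_space set \<Rightarrow> 'a set set \<Rightarrow> bool" where
  "fan N \<Sigma> \<longleftrightarrow> finite \<Sigma> \<and> \<Sigma> \<noteq> {} \<and>
     (\<forall>\<sigma>\<in>\<Sigma>. rational_cone N \<sigma>) \<and>
     (\<forall>\<sigma>\<in>\<Sigma>. \<forall>\<tau>. \<tau> face_of \<sigma> \<and> \<tau> \<noteq> {} \<longrightarrow> \<tau> \<in> \<Sigma>) \<and>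
     (\<forall>\<sigma>\<in>\<Sigma>. \<forall>\<sigma>'\<in>\<Sigma>. (\<sigma> \<inter> \<sigma>') face_of \<sigma> \<and> (\<sigma> \<inter> \<sigma>') face_of \<sigma>') \<and>
     (\<forall>\<sigma>\<in>\<Sigma>. (\<forall>\<sigma>'\<in>\<Sigma>. \<sigma> face_of \<sigma>' \<longrightarrow> \<sigma>' = \<sigma>) \<longrightarrow> dim \<sigma> = fan_dim \<Sigma>)"

definition cones :: "'a::euclidean_space set set \<Rightarrow> nat \<Rightarrow> 'a set set" where
  "cones \<Sigma> q = {\<sigma> \<in> \<Sigma>. dim \<sigma> = q}"

definition cone_lattice :: "'a::euclidean_space set \<Rightarrow> 'a set \<Rightarrow> 'a set" where
  "cone_lattice N \<sigma> = N \<inter> span \<sigma>"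

text \<open>
  The exterior product \<open>v\<^sub>1 \<and> \<dots> \<and> v\<^sub>p\<close> as an alternating form,
  \<open>(u\<^sub>1, \<dots>, u\<^sub>p) \<mapsto> det (v\<^sub>i \<bullet> u\<^sub>j)\<close>. This embeds the \<open>p\<close>-th exterior power of a lattice \<open>N\<close> in the
  space of functions on lists: it is the subgroup generated by the products of \<open>p\<close> elements
  of \<open>N\<close>, and exterior powers of saturated sublattices are subgroups of it.
\<close>

definition wedge :: "'a::euclidean_space list \<Rightarrow> 'a list \<Rightarrow> real" where
  "wedge vs = (\<lambda>us. if length us = length vs
     then \<Sum>\<pi> | \<pi> permutes {..<length vs}. of_int (sign \<pi>) * (\<Prod>i<length vs. (vs ! i) \<bullet> (us ! \<pi> i))
     else 0)"

text \<open>
  An orientation of a cone \<open>\<sigma>\<close> is given by an ordered basis of \<open>L\<^sub>\<int>(\<sigma>)\<close>; only its orientation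
  class, equivalently its exterior product, is used below.
\<close>

definition orientation :: "'a::euclidean_space set \<Rightarrow> 'a set set \<Rightarrow> ('a set \<Rightarrow> 'a list) \<Rightarrow> bool" where
  "orientation N \<Sigma> ori \<longleftrightarrow> (\<forall>\<sigma>\<in>\<Sigma>. distinct (ori \<sigma>) \<and> independent (set (ori \<sigma>)) \<and>
     subgroup_gen (set (ori \<sigma>)) = cone_lattice N \<sigma>)"

text \<open>
  Relative orientation of a facet \<open>\<tau>\<close> of \<open>\<sigma>\<close>, with the convention that a vector pointing out of
  \<open>\<sigma>\<close> comes first; a vector \<open>x \<in> \<sigma> - \<tau>\<close> points into \<open>\<sigma>\<close>.
\<close>

definition rel_sign :: "('a::euclidean_space set \<Rightarrow> 'a list) \<Rightarrow> 'a set \<Rightarrow> 'a set \<Rightarrow> int" where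
  "rel_sign ori \<tau> \<sigma> =
     (if \<exists>x\<in>\<sigma> - \<tau>. \<exists>c>0. wedge (- x # ori \<tau>) = (\<lambda>us. c * wedge (ori \<sigma>) us) then 1 else - 1)"


section \<open>Stars\<close>

definition star_cone :: "'a::euclidean_space set \<Rightarrow> 'a set \<Rightarrow> 'a set" where
  "star_cone \<gamma> \<kappa> = {t *\<^sub>R (x - y) | t x y. t \<ge> 0 \<and> x \<in> \<kappa> \<and> y \<in> \<gamma>}"

text \<open>\<open>T\<close> is a fan structure on the star of \<open>\<gamma>\<close>, obtained by subdividing the sets \<open>star_cone \<gamma> \<kappa>\<close>.\<close>

definition is_star :: "'a::euclidean_space set \<Rightarrow> 'a set set \<Rightarrow> 'a set \<Rightarrow> 'a set set \<Rightarrow> bool" where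
  "is_star N \<Sigma> \<gamma> T \<longleftrightarrow> fan N T \<and>
     \<Union>T = (\<Union>\<kappa>\<in>{\<kappa>\<in>\<Sigma>. \<gamma> face_of \<kappa>}. star_cone \<gamma> \<kappa>) \<and>
     (\<forall>\<rho>\<in>T. \<exists>\<kappa>\<in>\<Sigma>. \<gamma> face_of \<kappa> \<and> \<rho> \<subseteq> star_cone \<gamma> \<kappa>)"

definition star_weight :: "'a::euclidean_space set set \<Rightarrow> 'a set \<Rightarrow> ('a set \<Rightarrow> 'r) \<Rightarrow> 'a set \<Rightarrow> 'r" where
  "star_weight \<Sigma> \<gamma> w \<rho> =
     w (THE \<alpha>. \<alpha> \<in> cones \<Sigma> (fan_dim \<Sigma>) \<and> \<gamma> face_of \<alpha> \<and> \<rho> \<subseteq> star_cone \<gamma> \<alpha>)"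


section \<open>Tropical homology and cohomology\<close>

definition F_int :: "'a::euclidean_space set \<Rightarrow> 'a set set \<Rightarrow> nat \<Rightarrow> 'a set \<Rightarrow> ('a list \<Rightarrow> real) set" where
  "F_int N \<Sigma> p \<sigma> = subgroup_gen {wedge vs | vs \<gamma>.
     \<gamma> \<in> \<Sigma> \<and> \<sigma> face_of \<gamma> \<and> length vs = p \<and> set vs \<subseteq> cone_lattice N \<gamma>}"

type_synonym ('a, 'r) coef = "(('a list \<Rightarrow> real) \<Rightarrow>\<^sub>0 'r) set"

definition F_lower :: "'a::euclidean_space set \<Rightarrow> 'a set set \<Rightarrow> nat \<Rightarrow> 'a set
    \<Rightarrow> ('r::comm_ring_1, ('a, 'r) coef) module" where
  "F_lower N \<Sigma> p \<sigma> = tensor (F_int N \<Sigma> p \<sigma>)"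

text \<open>The map \<open>\<iota>\<^bsub>\<sigma>,\<tau>\<^esub>\<close> depends on its source \<open>\<sigma>\<close> only through its argument.\<close>

definition iota :: "'a::euclidean_space set \<Rightarrow> 'a set set \<Rightarrow> nat \<Rightarrow> 'a set
    \<Rightarrow> ('a, 'r::comm_ring_1) coef \<Rightarrow> ('a, 'r) coef" where
  "iota N \<Sigma> p \<tau> = tensor_incl (F_int N \<Sigma> p \<tau>)"

definition F_upper :: "'a::euclidean_space set \<Rightarrow> 'a set set \<Rightarrow> nat \<Rightarrow> 'a set
    \<Rightarrow> ('r::comm_ring_1, ('a, 'r) coef \<Rightarrow> 'r) module" where
  "F_upper N \<Sigma> p \<sigma> = dual_module (F_lower N \<Sigma> p \<sigma>)"

definition rho :: "'a::euclidean_space set \<Rightarrow> 'a set set \<Rightarrow> nat \<Rightarrow> 'a set \<Rightarrow> 'a set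
    \<Rightarrow> (('a, 'r::comm_ring_1) coef \<Rightarrow> 'r) \<Rightarrow> ('a, 'r) coef \<Rightarrow> 'r" where
  "rho N \<Sigma> p \<tau> \<sigma> u =
     (\<lambda>x\<in>carrier (F_lower N \<Sigma> p \<sigma> :: ('r, ('a, 'r) coef) module). u (iota N \<Sigma> p \<tau> x))"

definition bm_chains :: "'a::euclidean_space set \<Rightarrow> 'a set set \<Rightarrow> nat \<Rightarrow> nat
    \<Rightarrow> ('r::comm_ring_1, 'a set \<Rightarrow> ('a, 'r) coef) module" where
  "bm_chains N \<Sigma> p q = direct_sum (cones \<Sigma> q) (F_lower N \<Sigma> p)"

text \<open>The boundary map from degree \<open>Suc q\<close> to degree \<open>q\<close>.\<close>

definition bm_boundary :: "'a::euclidean_space set \<Rightarrow> 'a set set \<Rightarrow> ('a set \<Rightarrow> 'a list) \<Rightarrow> nat \<Rightarrow> nat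
    \<Rightarrow> ('a set \<Rightarrow> ('a, 'r::comm_ring_1) coef) \<Rightarrow> 'a set \<Rightarrow> ('a, 'r) coef" where
  "bm_boundary N \<Sigma> ori p q x = (\<lambda>\<tau>\<in>cones \<Sigma> q.
     finsum (F_lower N \<Sigma> p \<tau>)
       (\<lambda>\<sigma>. of_int (rel_sign ori \<tau> \<sigma>) \<odot>\<^bsub>F_lower N \<Sigma> p \<tau>\<^esub> iota N \<Sigma> p \<tau> (x \<sigma>))
       {\<sigma> \<in> cones \<Sigma> (Suc q). \<tau> face_of \<sigma>})"

definition bm_cycles :: "'a::euclidean_space set \<Rightarrow> 'a set set \<Rightarrow> ('a set \<Rightarrow> 'a list) \<Rightarrow> nat \<Rightarrow> nat
    \<Rightarrow> ('a set \<Rightarrow> ('a, 'r::comm_ring_1) coef) set" where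
  "bm_cycles N \<Sigma> ori p q = (case q of
       0 \<Rightarrow> carrier (bm_chains N \<Sigma> p 0)
     | Suc r \<Rightarrow> {x \<in> carrier (bm_chains N \<Sigma> p (Suc r)).
         bm_boundary N \<Sigma> ori p r x = \<zero>\<^bsub>bm_chains N \<Sigma> p r\<^esub>})"

definition bm_boundaries :: "'a::euclidean_space set \<Rightarrow> 'a set set \<Rightarrow> ('a set \<Rightarrow> 'a list) \<Rightarrow> nat \<Rightarrow> nat
    \<Rightarrow> ('a set \<Rightarrow> ('a, 'r::comm_ring_1) coef) set" where
  "bm_boundaries N \<Sigma> ori p q = bm_boundary N \<Sigma> ori p q ` carrier (bm_chains N \<Sigma> p (Suc q))"

definition bm_homology :: "'a::euclidean_space set \<Rightarrow> 'a set set \<Rightarrow> ('a set \<Rightarrow> 'a list) \<Rightarrow> nat \<Rightarrow> nat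
    \<Rightarrow> ('r::comm_ring_1, ('a set \<Rightarrow> ('a, 'r) coef) set) module" where
  "bm_homology N \<Sigma> ori p q =
     quotient_module ((bm_chains N \<Sigma> p q)\<lparr>carrier := bm_cycles N \<Sigma> ori p q\<rparr>) (bm_boundaries N \<Sigma> ori p q)"

definition compact_cones :: "'a::euclidean_space set set \<Rightarrow> nat \<Rightarrow> 'a set set" where
  "compact_cones \<Sigma> q = {\<sigma> \<in> cones \<Sigma> q. compact \<sigma>}"

definition cochains :: "'a::euclidean_space set \<Rightarrow> 'a set set \<Rightarrow> nat \<Rightarrow> nat
    \<Rightarrow> ('r::comm_ring_1, 'a set \<Rightarrow> ('a, 'r) coef \<Rightarrow> 'r) module" where
  "cochains N \<Sigma> p q = direct_sum (compact_cones \<Sigma> q) (F_upper N \<Sigma> p)"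

text \<open>The coboundary map from degree \<open>q\<close> to degree \<open>Suc q\<close>.\<close>

definition coboundary :: "'a::euclidean_space set \<Rightarrow> 'a set set \<Rightarrow> ('a set \<Rightarrow> 'a list) \<Rightarrow> nat \<Rightarrow> nat
    \<Rightarrow> ('a set \<Rightarrow> ('a, 'r::comm_ring_1) coef \<Rightarrow> 'r) \<Rightarrow> 'a set \<Rightarrow> ('a, 'r) coef \<Rightarrow> 'r" where
  "coboundary N \<Sigma> ori p q u = (\<lambda>\<sigma>\<in>compact_cones \<Sigma> (Suc q).
     finsum (F_upper N \<Sigma> p \<sigma>)
       (\<lambda>\<tau>. of_int (rel_sign ori \<tau> \<sigma>) \<odot>\<^bsub>F_upper N \<Sigma> p \<sigma>\<^esub> rho N \<Sigma> p \<tau> \<sigma> (u \<tau>))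
       {\<tau> \<in> compact_cones \<Sigma> q. \<tau> face_of \<sigma>})"

definition cocycles :: "'a::euclidean_space set \<Rightarrow> 'a set set \<Rightarrow> ('a set \<Rightarrow> 'a list) \<Rightarrow> nat \<Rightarrow> nat
    \<Rightarrow> ('a set \<Rightarrow> ('a, 'r::comm_ring_1) coef \<Rightarrow> 'r) set" where
  "cocycles N \<Sigma> ori p q = {u \<in> carrier (cochains N \<Sigma> p q).
     coboundary N \<Sigma> ori p q u = \<zero>\<^bsub>cochains N \<Sigma> p (Suc q)\<^esub>}"

definition coboundaries :: "'a::euclidean_space set \<Rightarrow> 'a set set \<Rightarrow> ('a set \<Rightarrow> 'a list) \<Rightarrow> nat \<Rightarrow> nat
    \<Rightarrow> ('a set \<Rightarrow> ('a, 'r::comm_ring_1) coef \<Rightarrow> 'r) set" where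
  "coboundaries N \<Sigma> ori p q = (case q of
       0 \<Rightarrow> {\<zero>\<^bsub>cochains N \<Sigma> p 0\<^esub>}
     | Suc r \<Rightarrow> coboundary N \<Sigma> ori p r ` carrier (cochains N \<Sigma> p r))"

definition cohomology :: "'a::euclidean_space set \<Rightarrow> 'a set set \<Rightarrow> ('a set \<Rightarrow> 'a list) \<Rightarrow> nat \<Rightarrow> nat
    \<Rightarrow> ('r::comm_ring_1, ('a set \<Rightarrow> ('a, 'r) coef \<Rightarrow> 'r) set) module" where
  "cohomology N \<Sigma> ori p q =
     quotient_module ((cochains N \<Sigma> p q)\<lparr>carrier := cocycles N \<Sigma> ori p q\<rparr>) (coboundaries N \<Sigma> ori p q)"


section \<open>Balancing, cap product and duality\<close>

definition weight_function :: "'a::euclidean_space set set \<Rightarrow> ('a set \<Rightarrow> 'r::comm_ring_1) \<Rightarrow> bool" where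
  "weight_function \<Sigma> w \<longleftrightarrow> (\<forall>\<alpha>\<in>cones \<Sigma> (fan_dim \<Sigma>). \<forall>r. w \<alpha> * r = 0 \<longrightarrow> r = 0)"

definition fundamental_chain :: "'a::euclidean_space set \<Rightarrow> 'a set set \<Rightarrow> ('a set \<Rightarrow> 'a list)
    \<Rightarrow> ('a set \<Rightarrow> 'r::comm_ring_1) \<Rightarrow> 'a set \<Rightarrow> ('a, 'r) coef" where
  "fundamental_chain N \<Sigma> ori w = (\<lambda>\<alpha>\<in>cones \<Sigma> (fan_dim \<Sigma>).
     w \<alpha> \<odot>\<^bsub>F_lower N \<Sigma> (fan_dim \<Sigma>) \<alpha>\<^esub> tensor_of (F_int N \<Sigma> (fan_dim \<Sigma>) \<alpha>) (wedge (ori \<alpha>)))"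

definition balanced :: "'a::euclidean_space set \<Rightarrow> 'a set set \<Rightarrow> ('a set \<Rightarrow> 'a list)
    \<Rightarrow> ('a set \<Rightarrow> 'r::comm_ring_1) \<Rightarrow> bool" where
  "balanced N \<Sigma> ori w \<longleftrightarrow> weight_function \<Sigma> w \<and>
     fundamental_chain N \<Sigma> ori w \<in> bm_cycles N \<Sigma> ori (fan_dim \<Sigma>) (fan_dim \<Sigma>)"

text \<open>
  The contraction of \<open>y\<^sub>1 \<and> \<dots> \<and> y\<^sub>m\<close> with an element \<open>u\<close> of the dual of the \<open>p\<close>-th exterior power,
  for \<open>p \<le> m\<close> and a basis \<open>ys\<close> of \<open>L\<^sub>\<int>(\<alpha>)\<close>, where \<open>\<alpha>\<close> is a maximal cone. The coefficient
  \<open>u (y\<^bsub>a 1\<^esub> \<and> \<dots> \<and> y\<^bsub>a p\<^esub>)\<close> is \<open>det (x\<^sub>i y\<^bsub>a j\<^esub>)\<close> if \<open>u = x\<^sub>1 \<and> \<dots> \<and> x\<^sub>p\<close>.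
\<close>

definition contraction :: "'a::euclidean_space set \<Rightarrow> 'a set set \<Rightarrow> 'a set \<Rightarrow> nat
    \<Rightarrow> (('a, 'r::comm_ring_1) coef \<Rightarrow> 'r) \<Rightarrow> 'a list \<Rightarrow> ('a, 'r) coef" where
  "contraction N \<Sigma> \<alpha> p u ys = (let m = length ys in
     finsum (F_lower N \<Sigma> (m - p) \<alpha>)
       (\<lambda>a. ((- 1) ^ (p * (p - 1) div 2) * of_int (sign a) *
               u (tensor_of (F_int N \<Sigma> p \<alpha>) (wedge (map (\<lambda>i. ys ! a i) [0..<p]))))
            \<odot>\<^bsub>F_lower N \<Sigma> (m - p) \<alpha>\<^esub>
            tensor_of (F_int N \<Sigma> (m - p) \<alpha>) (wedge (map (\<lambda>i. ys ! a i) [p..<m])))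
       {a. a permutes {..<m} \<and> strict_mono_on {..<p} a \<and> strict_mono_on {p..<m} a})"

definition cap :: "'a::euclidean_space set \<Rightarrow> 'a set set \<Rightarrow> ('a set \<Rightarrow> 'a list) \<Rightarrow> ('a set \<Rightarrow> 'r::comm_ring_1)
    \<Rightarrow> nat \<Rightarrow> nat \<Rightarrow> ('a set \<Rightarrow> ('a, 'r) coef \<Rightarrow> 'r) \<Rightarrow> 'a set \<Rightarrow> ('a, 'r) coef" where
  "cap N \<Sigma> ori w p q u = (let d = fan_dim \<Sigma> in
     (\<lambda>\<tau>\<in>cones \<Sigma> (d - q).
       finsum (F_lower N \<Sigma> (d - p) \<tau>)
         (\<lambda>(\<gamma>, \<alpha>). w \<alpha> \<odot>\<^bsub>F_lower N \<Sigma> (d - p) \<tau>\<^esub>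
            iota N \<Sigma> (d - p) \<tau> (contraction N \<Sigma> \<alpha> p (rho N \<Sigma> p \<gamma> \<alpha> (u \<gamma>)) (ori \<alpha>)))
         {(\<gamma>, \<alpha>). \<gamma> \<in> compact_cones \<Sigma> q \<and> \<alpha> \<in> cones \<Sigma> d \<and> \<gamma> face_of \<alpha> \<and> \<tau> face_of \<alpha>}))"

definition cap_product :: "'a::euclidean_space set \<Rightarrow> 'a set set \<Rightarrow> ('a set \<Rightarrow> 'a list) \<Rightarrow> ('a set \<Rightarrow> 'r::comm_ring_1)
    \<Rightarrow> nat \<Rightarrow> nat \<Rightarrow> ('a set \<Rightarrow> ('a, 'r) coef \<Rightarrow> 'r) set \<Rightarrow> ('a set \<Rightarrow> ('a, 'r) coef) set" where
  "cap_product N \<Sigma> ori w p q = (let d = fan_dim \<Sigma> in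
     induced_map (bm_chains N \<Sigma> (d - p) (d - q) :: ('r, 'a set \<Rightarrow> ('a, 'r) coef) module)
       (bm_boundaries N \<Sigma> ori (d - p) (d - q)) (cap N \<Sigma> ori w p q))"

definition tropical_poincare_duality :: "'a::euclidean_space set \<Rightarrow> 'a set set \<Rightarrow> ('a set \<Rightarrow> 'a list)
    \<Rightarrow> ('a set \<Rightarrow> 'r::comm_ring_1) \<Rightarrow> bool" where
  "tropical_poincare_duality N \<Sigma> ori w \<longleftrightarrow> (\<forall>p\<in>{0..fan_dim \<Sigma>}. \<forall>q\<in>{0..fan_dim \<Sigma>}.
     cap_product N \<Sigma> ori w p q \<in> linear_isos
       (cohomology N \<Sigma> ori p q :: ('r, ('a set \<Rightarrow> ('a, 'r) coef \<Rightarrow> 'r) set) module)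
       (bm_homology N \<Sigma> ori (fan_dim \<Sigma> - p) (fan_dim \<Sigma> - q) :: ('r, ('a set \<Rightarrow> ('a, 'r) coef) set) module))"

end

theory Submission
  imports Defs
begin

text \<open>
  Both sides of the equivalence are reduced to one numerical condition at each ray. If the homology
  of a balanced two-dimensional fan is concentrated in degree two, then the fan satisfies duality
  if and only if every ray \<open>\<rho>\<close> fulfils \<open>dim F\<^sub>2(\<rho>) + 1 = m(\<rho>)\<close>, where \<open>m(\<rho>)\<close> is the number of
  two-dimensional cones at \<open>\<rho>\<close>. Indeed the cap product is injective because the contraction is
  perfect on each maximal cone and weights do not vanish; surjectivity is then an equality of
  dimensions, and the dimension of the space of cycles is an Euler characteristic. The balancing condition is a linear
  relation with nonzero coefficients between the \<open>m(\<rho>)\<close> generators of \<open>F\<^sub>2(\<rho>)\<close>, so that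
  \<open>dim F\<^sub>2(\<rho>) + 1 \<le> m(\<rho>)\<close>; duality for \<open>p = 1\<close> forces equality at every ray, and conversely
  equality at every ray gives the right dimensions for all \<open>p\<close>.

  The star of a ray \<open>\<tau>\<close> is balanced and, without any assumption on \<open>\<Sigma>\<close>, its homology is concentrated
  in degree two, since chains can be pushed to the ray \<open>\<tau>\<close>. Its rays are \<open>\<tau>\<close> and \<open>-\<tau>\<close>, which carry the same data as
  \<open>\<tau>\<close> in \<open>\<Sigma>\<close>, and rays in the interior of a half-plane, which satisfy the condition
  trivially (\<open>m = 2\<close> and \<open>dim F\<^sub>2 = 1\<close>). Hence duality for the star of \<open>\<tau>\<close> is the condition at the single ray \<open>\<tau>\<close>.
\<close>

section \<open>Spaces of functions with values in a field\<close>

text \<open>The maps \<open>iota\<close> need not be injective after tensoring with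
  \<open>k\<close>, so the coefficient modules cannot be treated as subspaces of one exterior power.
  Each module is instead embedded into a space of scalar functions: an element of a tensor product
  is recorded by its values at additive functions to \<open>k\<close>. Inclusions of groups become
  restrictions, a boundary map becomes a signed sum of values at one and the same additive function,
  and all dimensions are counted in one kind of vector space. The characteristic of \<open>k\<close>
  matters for the relation dim F_1(\<rho>) = dim F_2(\<rho>) + 1 at a ray: the generator of the ray
  is primitive in \<open>N\<close>, hence stays nonzero modulo every prime. With this relation the
  defect of duality for \<open>p = 1\<close> is the sum over the rays of m(\<rho>) - dim F_2(\<rho>)
  - 1, whose terms are nonnegative; this is why \<open>p = 1\<close> decides at each ray separately.
  For \<open>p = 0\<close> and \<open>p = 2\<close> the Euler characteristics determine only the sum
  of the two defects, which is enough because neither is negative.\<close>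

definition fscale :: "'k::field \<Rightarrow> ('x \<Rightarrow> 'k) \<Rightarrow> 'x \<Rightarrow> 'k" where
  "fscale c f = (\<lambda>x. c * f x)"

lemma fscale_apply: "fscale c f x = c * f x"
  by (simp add: fscale_def)

lemma const_zero_fun [simp]: "(\<lambda>x. 0) = 0"
  by (simp add: fun_eq_iff)

interpretation fs: vector_space fscale
  by unfold_locales (auto simp: fscale_apply fun_eq_iff algebra_simps)

interpretation fsp: vector_space_pair fscale fscale
  by unfold_locales

abbreviation flinear :: "(('x \<Rightarrow> 'k::field) \<Rightarrow> 'y \<Rightarrow> 'k) \<Rightarrow> bool" where
  "flinear \<equiv> Vector_Spaces.linear fscale fscale"

lemma flinearI:
  assumes "\<And>f g. h (f + g) = h f + h g" "\<And>c f. h (fscale c f) = fscale c (h f)"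
  shows "flinear h"
  unfolding Vector_Spaces.linear_iff using assms by (auto intro: fs.vector_space_axioms)

lemma sum_fun_apply: "(\<Sum>i\<in>I. f i) x = (\<Sum>i\<in>I. f i x)" for f :: "'i \<Rightarrow> 'x \<Rightarrow> 'r::comm_monoid_add"
  by (induct I rule: infinite_finite_induct) auto

text \<open>\<open>fs.dim\<close> is the cardinality of a basis and is 0 when no finite basis
  exists; the dimension counts below are therefore made for subspaces that lie in the span of a
  finite set.\<close>

definition fin_space :: "('x \<Rightarrow> 'k::field) set \<Rightarrow> bool" where
  "fin_space V \<longleftrightarrow> fs.subspace V \<and> (\<exists>S. finite S \<and> V \<subseteq> fs.span S)"

lemma fin_space_subspace: "fin_space V \<Longrightarrow> fs.subspace V"
  by (simp add: fin_space_def)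

lemma fin_spaceI: "fs.subspace V \<Longrightarrow> finite S \<Longrightarrow> V \<subseteq> fs.span S \<Longrightarrow> fin_space V"
  by (auto simp: fin_space_def)

lemma fin_space_subset: "fin_space W \<Longrightarrow> fs.subspace V \<Longrightarrow> V \<subseteq> W \<Longrightarrow> fin_space V"
  by (auto simp: fin_space_def)

lemma fin_space_basis:
  assumes "fin_space V"
  obtains B where "finite B" "fs.independent B" "B \<subseteq> V" "fs.span B = V" "card B = fs.dim V"
proof -
  obtain B where B: "B \<subseteq> V" "fs.independent B" "V \<subseteq> fs.span B" "card B = fs.dim V"
    using fs.basis_exists by blast
  obtain S where S: "finite S" "V \<subseteq> fs.span S"
    using assms by (auto simp: fin_space_def)
  have "finite B"
    using fs.independent_span_bound[of S B] S B by auto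
  moreover have "fs.span B = V"
    using B assms fs.span_minimal[of B V] by (auto simp: fin_space_def)
  ultimately show thesis
    using that B by blast
qed

lemma independent_card_le_dim:
  assumes "fin_space W" "fs.independent B" "B \<subseteq> W"
  shows "finite B \<and> card B \<le> fs.dim W"
proof -
  obtain C where C: "finite C" "fs.span C = W" "card C = fs.dim W"
    using fin_space_basis[OF assms(1)] by metis
  show ?thesis
    using fs.independent_span_bound[OF C(1) assms(2)] assms(3) C by auto
qed

lemma dim_mono:
  assumes "fin_space W" "fs.subspace V" "V \<subseteq> W"
  shows "fs.dim V \<le> fs.dim W"
proof -
  obtain B where "fs.independent B" "B \<subseteq> V" "card B = fs.dim V"
    using fin_space_basis[OF fin_space_subset[OF assms]] by metis
  then show ?thesis
    using independent_card_le_dim[OF assms(1), of B] assms(3) by auto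
qed

lemma subspace_dim_equal:
  assumes "fin_space W" "fs.subspace V" "V \<subseteq> W" "fs.dim W \<le> fs.dim V"
  shows "V = W"
proof -
  obtain B where B: "finite B" "fs.independent B" "B \<subseteq> V" "fs.span B = V" "card B = fs.dim V"
    using fin_space_basis[OF fin_space_subset[OF assms(1-3)]] by metis
  have "w \<in> fs.span B" if "w \<in> W" for w
  proof (rule ccontr)
    assume "w \<notin> fs.span B"
    then have "fs.independent (insert w B)" "w \<notin> B"
      using B fs.independent_insertI fs.span_base by auto
    then have "card (insert w B) \<le> fs.dim W"
      using independent_card_le_dim[OF assms(1), of "insert w B"] B assms(3) that by auto
    then show False
      using B \<open>w \<notin> B\<close> assms(4) by simp
  qed
  then show ?thesis
    using B assms(3) by auto
qed

text \<open>A basis \<open>B\<close> of the kernel is extended to a basis \<open>C\<close> of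
  \<open>V\<close>. The span of \<open>C - B\<close> meets the kernel only in 0, so \<open>h\<close>
  maps \<open>C - B\<close> injectively onto a basis of the image.\<close>

lemma rank_nullity:
  assumes h: "flinear h" and V: "fin_space V"
  shows "fs.dim V = fs.dim (h ` V) + fs.dim {x \<in> V. h x = 0}"
proof -
  let ?K = "{x \<in> V. h x = 0}"
  have sV: "fs.subspace V"
    using V by (rule fin_space_subspace)
  have K: "fs.subspace ?K"
    using sV fs.subspace_inter[OF sV fsp.linear_subspace_kernel[OF h]] by (simp add: Int_def)
  obtain B where B: "finite B" "fs.independent B" "B \<subseteq> ?K" "fs.span B = ?K" "card B = fs.dim ?K"
    using fin_space_basis[OF fin_space_subset[OF V K]] by (metis (no_types, lifting) mem_Collect_eq subsetI)
  obtain C where C: "B \<subseteq> C" "C \<subseteq> V" "fs.independent C" "V \<subseteq> fs.span C"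
    using fs.maximal_independent_subset_extend[of B V] B by blast
  have fC: "finite C"
    using independent_card_le_dim[OF V C(3,2)] by simp
  have dV: "fs.dim V = card C"
    using fs.basis_card_eq_dim[OF C(2,4,3)] by simp
  let ?D = "C - B"
  have zero: "fs.span ?D \<inter> ?K = {0}"
  proof -
    have "fs.span ?D \<inter> fs.span B = {0}"
      using C fC B(1)
    proof -
      have "x = 0" if "x \<in> fs.span ?D" "x \<in> fs.span B" for x
      proof -
        have "x \<in> range (\<lambda>u. \<Sum>v\<in>?D. fscale (u v) v)"
          using that(1) fC by (subst fs.span_finite[symmetric]) simp_all
        then obtain u where u: "x = (\<Sum>v\<in>?D. fscale (u v) v)"
          by (rule rangeE)
        have "x \<in> range (\<lambda>u. \<Sum>v\<in>B. fscale (u v) v)"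
          using that(2) B(1) by (subst fs.span_finite[symmetric]) simp_all
        then obtain w where w: "x = (\<Sum>v\<in>B. fscale (w v) v)"
          by (rule rangeE)
        \<comment> \<open>A vector in both spans has an expansion over \<open>C - B\<close> and one
          over \<open>B\<close>; their difference is a linear relation on \<open>C\<close>, with
          these coefficients.\<close>
        define z where "z v = (if v \<in> B then - w v else u v)" for v
        have "(\<Sum>v\<in>C. fscale (z v) v) = (\<Sum>v\<in>?D. fscale (z v) v) + (\<Sum>v\<in>B. fscale (z v) v)"
          by (rule sum.subset_diff[OF C(1) fC])
        also have "(\<Sum>v\<in>?D. fscale (z v) v) = x"
          unfolding u by (rule sum.cong) (auto simp: z_def)
        also have "(\<Sum>v\<in>B. fscale (z v) v) = - x"
          unfolding w by (simp add: z_def sum_negf[symmetric])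
        finally have "(\<Sum>v\<in>C. fscale (z v) v) = 0"
          by simp
        then have "z v = 0" if "v \<in> C" for v
          using fs.independentD[OF C(3) fC order_refl] that by blast
        then have "u v = 0" if "v \<in> ?D" for v
          using that unfolding z_def by (metis DiffE)
        then show "x = 0"
          unfolding u by simp
      qed
      then show ?thesis
        using fs.span_zero by blast
    qed
    then show ?thesis
      using B(4) by simp
  qed
  have inj: "inj_on h (fs.span ?D)"
  proof (rule inj_onI)
    fix x y assume xy: "x \<in> fs.span ?D" "y \<in> fs.span ?D" "h x = h y"
    have "fs.span ?D \<subseteq> V"
      using fs.span_minimal[OF _ sV, of ?D] C(2) by blast
    then have "x - y \<in> ?K"
      using xy fs.subspace_diff[OF sV] fsp.linear_diff[OF h, of x y] by auto
    moreover have "x - y \<in> fs.span ?D"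
      using xy by (simp add: fs.span_diff)
    ultimately have "x - y = 0"
      using zero by blast
    then show "x = y"
      by simp
  qed
  have iD: "fs.independent ?D"
    using C(3) fs.independent_mono by blast
  have "fs.independent (h ` ?D)"
    using fsp.linear_independent_injective_image[OF h iD inj] .
  moreover have "h ` V = fs.span (h ` ?D)"
  proof -
    have "h ` V = h ` fs.span C"
      using fs.span_minimal[OF C(2) sV] C(4) by (intro arg_cong[where f = "\<lambda>X. h ` X"]) auto
    also have "\<dots> = fs.span (h ` C)"
      by (simp add: fsp.linear_span_image[OF h])
    also have "\<dots> = fs.span (h ` ?D)"
    proof (rule antisym)
      have "h ` C \<subseteq> fs.span (h ` ?D)"
      proof
        fix y assume "y \<in> h ` C"
        then obtain x where x: "x \<in> C" "y = h x" by blast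
        show "y \<in> fs.span (h ` ?D)"
        proof (cases "x \<in> B")
          case True
          then have "y = 0" using B(3) x(2) by auto
          then show ?thesis by (simp add: fs.span_zero)
        next
          case False
          then show ?thesis using x by (auto intro: fs.span_base)
        qed
      qed
      then show "fs.span (h ` C) \<subseteq> fs.span (h ` ?D)"
        by (rule fs.span_minimal) (rule fs.subspace_span)
      show "fs.span (h ` ?D) \<subseteq> fs.span (h ` C)"
        by (rule fs.span_mono) blast
    qed
    finally show ?thesis .
  qed
  moreover have "card (h ` ?D) = card ?D"
    by (rule card_image[OF inj_on_subset[OF inj fs.span_superset]])
  ultimately have "fs.dim (h ` V) = card ?D"
    by (simp add: fs.dim_eq_card_independent)
  then show ?thesis
    using dV B(5) card_Diff_subset[OF B(1) C(1)] card_mono[OF fC C(1)] by simp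
qed

lemma dim_zero_space [simp]: "fs.dim {0 :: 'x \<Rightarrow> 'k::field} = 0"
  using fs.dim_le_card[of "{0}" "{}"] by auto

lemma dim_image_inj:
  assumes "flinear h" "fin_space V" "\<And>x. x \<in> V \<Longrightarrow> h x = 0 \<Longrightarrow> x = 0"
  shows "fs.dim (h ` V) = fs.dim V"
proof -
  have "{x \<in> V. h x = 0} = {0}"
    using assms fsp.linear_0[OF assms(1)] fs.subspace_0[OF fin_space_subspace[OF assms(2)]] by auto
  then show ?thesis
    using rank_nullity[OF assms(1,2)] by simp
qed

text \<open>Finiteness of \<open>V\<close> is part of the conclusion: an independent set in
  \<open>V\<close> stays independent in \<open>W\<close>, which bounds its size.\<close>

lemma fin_space_inj:
  assumes h: "flinear h" and V: "fs.subspace V" and W: "fin_space W" "h ` V \<subseteq> W"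
    and ker: "\<And>x. x \<in> V \<Longrightarrow> h x = 0 \<Longrightarrow> x = 0"
  shows "fin_space V \<and> fs.dim V \<le> fs.dim W"
proof -
  obtain B where B: "B \<subseteq> V" "fs.independent B" "V \<subseteq> fs.span B" "card B = fs.dim V"
    using fs.basis_exists by blast
  have sp: "fs.span B \<subseteq> V"
    using fs.span_minimal[OF B(1) V] .
  have inj: "inj_on h (fs.span B)"
  proof (rule inj_onI)
    fix x y assume xy: "x \<in> fs.span B" "y \<in> fs.span B" "h x = h y"
    then have "h (x - y) = 0" "x - y \<in> V"
      using fsp.linear_diff[OF h, of x y] fs.span_diff[OF xy(1,2)] sp by auto
    then show "x = y"
      using ker by force
  qed
  have "fs.independent (h ` B)" "h ` B \<subseteq> W"
    using fsp.linear_independent_injective_image[OF h B(2) inj] B(1) W(2) by auto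
  then have "finite (h ` B)" "card (h ` B) \<le> fs.dim W"
    using independent_card_le_dim[OF W(1)] by auto
  moreover have "inj_on h B"
    using inj inj_on_subset fs.span_superset by blast
  ultimately show ?thesis
    using B V by (auto simp: card_image finite_image_iff intro: fin_spaceI)
qed

lemma dim_support:
  assumes "finite X"
  shows "fin_space {f :: 'x \<Rightarrow> 'k::field. \<forall>x. x \<notin> X \<longrightarrow> f x = 0} \<and>
    fs.dim {f :: 'x \<Rightarrow> 'k. \<forall>x. x \<notin> X \<longrightarrow> f x = 0} \<le> card X"
proof -
  let ?V = "{f :: 'x \<Rightarrow> 'k. \<forall>x. x \<notin> X \<longrightarrow> f x = 0}"
  let ?d = "\<lambda>x y :: 'x. if x = y then 1 :: 'k else 0"
  have sub: "fs.subspace ?V"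
    by (rule fs.subspaceI) (auto simp: fscale_apply)
  have "f \<in> fs.span (?d ` X)" if "f \<in> ?V" for f
  proof -
    have "f z = (\<Sum>x\<in>X. fscale (f x) (?d x)) z" for z
    proof -
      have "(\<Sum>x\<in>X. fscale (f x) (?d x)) z = (\<Sum>x\<in>X. if x = z then f z else 0)"
        unfolding sum_fun_apply fscale_apply by (rule sum.cong) auto
      then show ?thesis
        using that assms by auto
    qed
    then have "f = (\<Sum>x\<in>X. fscale (f x) (?d x))"
      by blast
    also have "\<dots> \<in> fs.span (?d ` X)"
      by (intro fs.span_sum fs.span_scale fs.span_base) auto
    finally show ?thesis .
  qed
  then have sp: "?V \<subseteq> fs.span (?d ` X)"
    by blast
  then have "fs.dim ?V \<le> card (?d ` X)"
    using assms by (intro fs.dim_le_card) auto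
  then show ?thesis
    using card_image_le[OF assms, of ?d] sub sp assms by (auto intro: fin_spaceI[of _ "?d ` X"])
qed

text \<open>The pairing is evaluation, and it is nondegenerate on both sides: \<open>U\<close>
  embeds into the functions on a basis of \<open>V\<close>, and \<open>V\<close> into the functions
  on a basis of \<open>U\<close>. Elements of \<open>V\<close> are arbitrary functions that are
  linear on \<open>U\<close> only; tensors act on additive functions in this way.\<close>

lemma dim_pairing:
  fixes U :: "('b \<Rightarrow> 'k::field) set" and V :: "(('b \<Rightarrow> 'k) \<Rightarrow> 'k) set"
  assumes V: "fin_space V" and U: "fs.subspace U"
    and add: "\<And>g \<phi> \<psi>. g \<in> V \<Longrightarrow> \<phi> \<in> U \<Longrightarrow> \<psi> \<in> U \<Longrightarrow> g (\<phi> + \<psi>) = g \<phi> + g \<psi>"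
    and scale: "\<And>g c \<phi>. g \<in> V \<Longrightarrow> \<phi> \<in> U \<Longrightarrow> g (fscale c \<phi>) = c * g \<phi>"
    and U0: "\<And>\<phi>. \<phi> \<in> U \<Longrightarrow> (\<And>g. g \<in> V \<Longrightarrow> g \<phi> = 0) \<Longrightarrow> \<phi> = 0"
    and V0: "\<And>g. g \<in> V \<Longrightarrow> (\<And>\<phi>. \<phi> \<in> U \<Longrightarrow> g \<phi> = 0) \<Longrightarrow> g = 0"
  shows "fin_space U \<and> fs.dim U = fs.dim V"
proof -
  obtain B where B: "finite B" "fs.independent B" "B \<subseteq> V" "fs.span B = V" "card B = fs.dim V"
    using fin_space_basis[OF V] by metis
  obtain C where C: "C \<subseteq> U" "fs.independent C" "U \<subseteq> fs.span C" "card C = fs.dim U"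
    using fs.basis_exists by blast
  have dimU: "finite C \<and> fs.dim U \<le> card B"
  proof -
    define h where "h \<phi> = (\<lambda>g. if g \<in> B then g \<phi> else 0)" for \<phi> :: "'b \<Rightarrow> 'k"
    \<comment> \<open>\<open>h\<close> is linear on \<open>U\<close> only. The map \<open>h'\<close>
      is linear everywhere and agrees with \<open>h\<close> on the basis \<open>C\<close>, hence on
      \<open>U\<close>.\<close>
    have "\<exists>h'. flinear h' \<and> (\<forall>\<phi>\<in>C. h' \<phi> = h \<phi>)"
      by (rule fsp.linear_independent_extend[OF C(2)])
    then obtain h' where h': "flinear h'" "\<forall>\<phi>\<in>C. h' \<phi> = h \<phi>"
      by (elim exE conjE)
    have h_add: "h (\<phi> + \<psi>) = h \<phi> + h \<psi>" if "\<phi> \<in> U" "\<psi> \<in> U" for \<phi> \<psi>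
    proof
      fix g show "h (\<phi> + \<psi>) g = (h \<phi> + h \<psi>) g"
        using add[OF _ that, of g] B(3) by (cases "g \<in> B") (auto simp: h_def)
    qed
    have h_scale: "h (fscale c \<phi>) = fscale c (h \<phi>)" if "\<phi> \<in> U" for c \<phi>
    proof
      fix g show "h (fscale c \<phi>) g = fscale c (h \<phi>) g"
        using scale[OF _ that, of g c] B(3) by (cases "g \<in> B") (auto simp: h_def fscale_apply)
    qed
    have h_0: "h 0 = 0"
      using h_scale[OF fs.subspace_0[OF U], of 0] by simp
    have "fs.subspace {\<phi> \<in> U. h' \<phi> = h \<phi>}"
    proof (rule fs.subspaceI)
      show "0 \<in> {\<phi> \<in> U. h' \<phi> = h \<phi>}"
        using fs.subspace_0[OF U] h_0 fsp.linear_0[OF h'(1)] by simp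
    qed (simp_all add: fs.subspace_add[OF U] fs.subspace_scale[OF U] h_add h_scale
        fsp.linear_add[OF h'(1)] fsp.linear_scale[OF h'(1)])
    moreover have "C \<subseteq> {\<phi> \<in> U. h' \<phi> = h \<phi>}"
      using C(1) h'(2) by auto
    ultimately have eq: "h' \<phi> = h \<phi>" if "\<phi> \<in> U" for \<phi>
      using fs.span_minimal[of C "{\<phi> \<in> U. h' \<phi> = h \<phi>}"] C(3) that by auto
    let ?W = "{f :: _ \<Rightarrow> 'k. \<forall>x. x \<notin> B \<longrightarrow> f x = 0}"
    have W: "fin_space ?W" "fs.dim ?W \<le> card B"
      using dim_support[OF B(1)] by auto
    have "fin_space U \<and> fs.dim U \<le> fs.dim ?W"
    proof (rule fin_space_inj[OF h'(1) U W(1)])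
      show "h' ` U \<subseteq> ?W"
        using eq by (auto simp: h_def)
      fix \<phi> assume \<phi>: "\<phi> \<in> U" "h' \<phi> = 0"
      have B0: "g \<phi> = 0" if "g \<in> B" for g
        using fun_cong[OF \<phi>(2), of g] eq[OF \<phi>(1)] that by (simp add: h_def)
      have "fs.span B \<subseteq> {g. g \<phi> = 0}"
        by (rule fs.span_minimal[OF _ fs.subspaceI]) (use B0 in \<open>auto simp: fscale_apply\<close>)
      then show "\<phi> = 0"
        using U0[OF \<phi>(1)] B(4) by blast
    qed
    then show ?thesis
      using independent_card_le_dim[OF _ C(2,1)] W(2) by (meson le_trans)
  qed
  then have finU: "fin_space U"
    using U C by (auto intro: fin_spaceI)
  have "fs.dim V \<le> fs.dim U"
  proof -
    define h where "h g = (\<lambda>\<phi>. if \<phi> \<in> C then g \<phi> else 0)" for g :: "('b \<Rightarrow> 'k) \<Rightarrow> 'k"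
    let ?W = "{f :: _ \<Rightarrow> 'k. \<forall>x. x \<notin> C \<longrightarrow> f x = 0}"
    have le: "fin_space V \<and> fs.dim V \<le> fs.dim ?W"
    proof (rule fin_space_inj[of h])
      show "flinear h"
        by (rule flinearI) (auto simp: h_def fscale_apply fun_eq_iff)
      show "fs.subspace V" using V by (simp add: fin_space_def)
      show "fin_space ?W" using dim_support dimU by blast
      show "h ` V \<subseteq> ?W" by (auto simp: h_def)
      fix g assume g: "g \<in> V" "h g = 0"
      have "\<phi> \<in> U \<and> g \<phi> = 0" if "\<phi> \<in> fs.span C" for \<phi>
        using that
      proof (induct rule: fs.span_induct_alt)
        case base
        show ?case using scale[OF g(1) fs.subspace_0[OF U], of 0] fs.subspace_0[OF U] by simp
      next
        case (step c x y)
        then have "x \<in> U" "g x = 0"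
          using C g(2) by (auto simp: h_def fscale_apply fun_eq_iff split: if_splits)
        moreover have "fscale c x \<in> U"
          using calculation fs.subspace_scale[OF U] by blast
        moreover have "y \<in> U" "g y = 0"
          using step by blast+
        ultimately have "g (fscale c x + y) = 0" "fscale c x + y \<in> U"
          using add[OF g(1), of "fscale c x" y] scale[OF g(1), of x c] fs.subspace_add[OF U] by (force, blast)
        then show ?case
          by blast
      qed
      then show "g = 0"
        using V0[OF g(1)] C(3) by blast
    qed
    have "fs.dim ?W \<le> card C"
      using conjunct2[OF dim_support[OF conjunct1[OF dimU]]] .
    with le C(4) show ?thesis
      by linarith
  qed
  then show ?thesis
    using dimU finU B(5) by simp
qed

text \<open>A family is stored as one function of pairs that is 0 at indices outside
  \<open>I\<close>. The direct sum is then again a space of scalar functions, to which the preceding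
  lemmas apply.\<close>

definition dsum :: "'i set \<Rightarrow> ('i \<Rightarrow> ('y \<Rightarrow> 'k::field) set) \<Rightarrow> ('i \<times> 'y \<Rightarrow> 'k) set" where
  "dsum I V = {x. (\<forall>i\<in>I. (\<lambda>y. x (i, y)) \<in> V i) \<and> (\<forall>i y. i \<notin> I \<longrightarrow> x (i, y) = 0)}"

lemma subspace_dsum:
  assumes "\<And>i. i \<in> I \<Longrightarrow> fs.subspace (V i)"
  shows "fs.subspace (dsum I V)"
proof (rule fs.subspaceI)
  have "(\<lambda>y. 0) \<in> V i" if "i \<in> I" for i
    using fs.subspace_0[OF assms[OF that]] by simp
  then show "0 \<in> dsum I V"
    by (auto simp: dsum_def)
  have "(\<lambda>y. x (i, y) + x' (i, y)) \<in> V i"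
    if "i \<in> I" "(\<lambda>y. x (i, y)) \<in> V i" "(\<lambda>y. x' (i, y)) \<in> V i" for i x x'
    using fs.subspace_add[OF assms[OF that(1)] that(2,3)] by (simp add: plus_fun_def)
  then show "x + x' \<in> dsum I V" if "x \<in> dsum I V" "x' \<in> dsum I V" for x x'
    using that by (auto simp: dsum_def)
  have "(\<lambda>y. c * x (i, y)) \<in> V i" if "i \<in> I" "(\<lambda>y. x (i, y)) \<in> V i" for i x c
    using fs.subspace_scale[OF assms[OF that(1)] that(2), of c] by (simp add: fscale_def)
  then show "fscale c x \<in> dsum I V" if "x \<in> dsum I V" for c x
    using that by (auto simp: dsum_def fscale_apply)
qed

text \<open>Induction on \<open>I\<close>: the projection to the new component is onto, and its
  kernel is the direct sum over the old index set.\<close>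

lemma dim_dsum:
  assumes "finite I" "\<And>i. i \<in> I \<Longrightarrow> fin_space (V i)"
  shows "fin_space (dsum I V) \<and> fs.dim (dsum I V) = (\<Sum>i\<in>I. fs.dim (V i))"
  using assms
proof (induct I)
  case empty
  have "dsum {} V = {0}"
    by (auto simp: dsum_def fun_eq_iff)
  moreover have "fin_space {0 :: 'a \<times> 'b \<Rightarrow> 'c}"
    by (rule fin_spaceI[of _ "{}"]) auto
  ultimately show ?case
    by simp
next
  case (insert i I)
  define h :: "('a \<times> 'b \<Rightarrow> 'c) \<Rightarrow> 'b \<Rightarrow> 'c" where "h x = (\<lambda>y. x (i, y))" for x
  define e :: "('b \<Rightarrow> 'c) \<Rightarrow> 'a \<times> 'b \<Rightarrow> 'c" where "e f = (\<lambda>(j, y). if j = i then f y else 0)" for f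
  have h: "flinear h" and e: "flinear e"
    by (auto intro!: flinearI simp: h_def e_def fscale_apply fun_eq_iff)
  have sub: "fs.subspace (dsum (insert i I) V)"
    using insert by (intro subspace_dsum) (auto simp: fin_space_def)
  have IH: "fin_space (dsum I V)" "fs.dim (dsum I V) = (\<Sum>i\<in>I. fs.dim (V i))"
    using insert by auto
  have V0: "(\<lambda>y. 0) \<in> V j" if "j \<in> insert i I" for j
    using insert that fs.subspace_0[of "V j"] by (auto simp: fin_space_def)
  have Vi: "fin_space (V i)"
    using insert by simp
  obtain S where S: "finite S" "fs.span S = V i"
    using fin_space_basis[OF Vi] by metis
  obtain S' where S': "finite S'" "fs.span S' = dsum I V"
    using fin_space_basis[OF IH(1)] by metis
  have "x \<in> fs.span (e ` S \<union> S')" if "x \<in> dsum (insert i I) V" for x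
  proof -
    define x' where "x' = (\<lambda>(j, y). if j = i then 0 else x (j, y))"
    have "x = e (h x) + x'"
      by (auto simp: fscale_apply fun_eq_iff e_def h_def x'_def)
    moreover have "x' \<in> fs.span S'"
    proof -
      have "(\<lambda>y. x' (j, y)) \<in> V j" if "j \<in> I" for j
      proof -
        have "(\<lambda>y. x' (j, y)) = (\<lambda>y. x (j, y))"
          using that insert(2) by (auto simp: x'_def)
        then show ?thesis
          using \<open>x \<in> dsum (insert i I) V\<close> that by (simp add: dsum_def)
      qed
      then show ?thesis
        using that unfolding S'(2) by (auto simp: dsum_def x'_def)
    qed
    moreover have "h x \<in> fs.span S"
      using that by (auto simp: S(2) dsum_def h_def)
    then have "e (h x) \<in> fs.span (e ` S)"
      by (auto simp: fsp.linear_span_image[OF e])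
    ultimately show ?thesis
      using fs.span_add[of "e (h x)" "e ` S \<union> S'" x'] fs.span_mono[of "e ` S" "e ` S \<union> S'"]
        fs.span_mono[of S' "e ` S \<union> S'"] by (metis (no_types, lifting) Un_upper1 Un_upper2 subsetD)
  qed
  then have fin: "fin_space (dsum (insert i I) V)"
    using sub S S' by (intro fin_spaceI[of _ "e ` S \<union> S'"]) auto
  have "h ` dsum (insert i I) V = V i"
  proof (intro equalityI subsetI)
    fix f assume "f \<in> V i"
    moreover have "(\<lambda>y. e f (j, y)) = 0" if "j \<in> I" for j
      using that insert(2) by (auto simp: e_def fun_eq_iff)
    moreover have "(\<lambda>y. e f (i, y)) = f"
      by (simp add: e_def)
    ultimately have "e f \<in> dsum (insert i I) V"
      using V0 by (auto simp: dsum_def) (auto simp: e_def)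
    moreover have "h (e f) = f"
      by (simp add: h_def e_def)
    ultimately show "f \<in> h ` dsum (insert i I) V"
      by force
  qed (auto simp: dsum_def h_def)
  moreover have "{x \<in> dsum (insert i I) V. h x = 0} = dsum I V"
  proof -
    have "(\<lambda>y. x (i, y)) = 0" if "x \<in> dsum I V" for x
      using that insert(2) by (auto simp: dsum_def fun_eq_iff)
    moreover have "x \<in> dsum (insert i I) V" if "x \<in> dsum I V" for x
      using that insert(2) V0[of i] by (auto simp: dsum_def)
    moreover have "x \<in> dsum I V" if "x \<in> dsum (insert i I) V" "(\<lambda>y. x (i, y)) = 0" for x
      using that by (auto simp: dsum_def fun_eq_iff)
    ultimately show ?thesis
      unfolding h_def by blast
  qed
  ultimately show ?case
    using rank_nullity[OF h fin] IH fin insert(1,2) by simp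
qed

section \<open>Subgroups\<close>

definition add_subgroup :: "'b::ab_group_add set \<Rightarrow> bool" where
  "add_subgroup G \<longleftrightarrow> 0 \<in> G \<and> (\<forall>x\<in>G. \<forall>y\<in>G. x - y \<in> G)"

lemma add_subgroup_gen [simp]: "add_subgroup (subgroup_gen S)"
  unfolding subgroup_gen_def add_subgroup_def
  by (rule hull_in[of "\<lambda>G. 0 \<in> G \<and> (\<forall>x\<in>G. \<forall>y\<in>G. x - y \<in> G)"]) auto

lemma subgroup_gen_superset: "S \<subseteq> subgroup_gen S"
  by (simp add: subgroup_gen_def hull_subset)

lemma subgroup_gen_base: "x \<in> S \<Longrightarrow> x \<in> subgroup_gen S"
  using subgroup_gen_superset by blast

lemma subgroup_gen_minimal: "S \<subseteq> G \<Longrightarrow> add_subgroup G \<Longrightarrow> subgroup_gen S \<subseteq> G"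
  unfolding subgroup_gen_def add_subgroup_def by (rule hull_minimal) auto

lemma subgroup_gen_mono: "S \<subseteq> T \<Longrightarrow> subgroup_gen S \<subseteq> subgroup_gen T"
  by (meson subgroup_gen_minimal add_subgroup_gen subgroup_gen_superset order_trans)

lemma add_subgroup_0: "add_subgroup G \<Longrightarrow> 0 \<in> G"
  and add_subgroup_diff: "add_subgroup G \<Longrightarrow> x \<in> G \<Longrightarrow> y \<in> G \<Longrightarrow> x - y \<in> G"
  by (auto simp: add_subgroup_def)

lemma add_subgroup_uminus: "add_subgroup G \<Longrightarrow> x \<in> G \<Longrightarrow> - x \<in> G"
  using add_subgroup_diff[of G 0 x] add_subgroup_0 by force

lemma add_subgroup_add: "add_subgroup G \<Longrightarrow> x \<in> G \<Longrightarrow> y \<in> G \<Longrightarrow> x + y \<in> G"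
  using add_subgroup_diff[of G x "- y"] add_subgroup_uminus by fastforce

text \<open>Additivity is required on \<open>A\<close> only, and values outside \<open>A\<close> are
  free. One function can thus be additive on several groups at once, which lets it be evaluated on
  coefficients at different cones.\<close>

definition additive_on :: "'b::ab_group_add set \<Rightarrow> ('b \<Rightarrow> 'r::comm_ring_1) set" where
  "additive_on A = {\<phi>. \<forall>a\<in>A. \<forall>b\<in>A. \<phi> (a + b) = \<phi> a + \<phi> b}"

lemma additive_onD: "\<phi> \<in> additive_on A \<Longrightarrow> a \<in> A \<Longrightarrow> b \<in> A \<Longrightarrow> \<phi> (a + b) = \<phi> a + \<phi> b"
  by (simp add: additive_on_def)

lemma additive_on_subset: "A \<subseteq> A' \<Longrightarrow> \<phi> \<in> additive_on A' \<Longrightarrow> \<phi> \<in> additive_on A"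
  by (auto simp: additive_on_def)

lemma additive_on_0: "\<phi> \<in> additive_on A \<Longrightarrow> add_subgroup A \<Longrightarrow> \<phi> 0 = 0"
  using additive_onD[of \<phi> A 0 0] add_subgroup_0 by auto

lemma additive_on_diff:
  assumes "\<phi> \<in> additive_on A" "add_subgroup A" "a \<in> A" "b \<in> A"
  shows "\<phi> (a - b) = \<phi> a - \<phi> b"
  using additive_onD[OF assms(1) add_subgroup_diff[OF assms(2-4)] assms(4)] by simp

lemma additive_on_uminus:
  assumes "\<phi> \<in> additive_on A" "add_subgroup A" "a \<in> A"
  shows "\<phi> (- a) = - \<phi> a"
  using additive_on_diff[OF assms(1,2) add_subgroup_0[OF assms(2)] assms(3)] additive_on_0[OF assms(1,2)] by simp

lemma additive_on_zero_gen:
  assumes "\<phi> \<in> additive_on (subgroup_gen S)" "\<And>s. s \<in> S \<Longrightarrow> \<phi> s = 0" "a \<in> subgroup_gen S"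
  shows "\<phi> a = 0"
proof -
  let ?G = "{a \<in> subgroup_gen S. \<phi> a = 0}"
  have "add_subgroup ?G"
    using additive_on_0[OF assms(1)] additive_on_diff[OF assms(1)] add_subgroup_gen[of S]
    by (auto simp: add_subgroup_def)
  then have "subgroup_gen S \<subseteq> ?G"
    using assms(2) by (intro subgroup_gen_minimal) (auto intro: subgroup_gen_base)
  then show ?thesis
    using assms(3) by blast
qed

lemma add_subgroup_of_int_mult:
  fixes x :: "'b::comm_ring_1"
  assumes "add_subgroup G" "x \<in> G"
  shows "of_int n * x \<in> G"
proof (induct n rule: int_induct[of _ 0])
  case base then show ?case using add_subgroup_0 assms by simp
next
  case (step1 i) then show ?case using add_subgroup_add[OF assms(1) _ assms(2)] by (simp add: ring_distribs)
next
  case (step2 i) then show ?case using add_subgroup_diff[OF assms(1) _ assms(2)] by (simp add: ring_distribs)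
qed

lemma add_subgroup_of_int_scaleR:
  fixes x :: "'b::real_vector"
  assumes "add_subgroup G" "x \<in> G"
  shows "of_int n *\<^sub>R x \<in> G"
proof (induct n rule: int_induct[of _ 0])
  case base then show ?case using add_subgroup_0 assms by simp
next
  case (step1 i) then show ?case using add_subgroup_add[OF assms(1) _ assms(2)] by (simp add: scaleR_add_left)
next
  case (step2 i) then show ?case using add_subgroup_diff[OF assms(1) _ assms(2)] by (simp add: scaleR_diff_left)
qed

lemma additive_on_of_int_mult:
  fixes a :: "'b::comm_ring_1"
  assumes "\<phi> \<in> additive_on A" "add_subgroup A" "a \<in> A"
  shows "\<phi> (of_int n * a) = of_int n * \<phi> a"
proof (induct n rule: int_induct[of _ 0])
  case base then show ?case using additive_on_0[OF assms(1,2)] by simp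
next
  case (step1 i) then show ?case
    using additive_onD[OF assms(1) add_subgroup_of_int_mult[OF assms(2,3), of i] assms(3)] by (simp add: ring_distribs)
next
  case (step2 i) then show ?case
    using additive_on_diff[OF assms(1,2) add_subgroup_of_int_mult[OF assms(2,3), of i] assms(3)] by (simp add: ring_distribs)
qed

section \<open>Extension of scalars\<close>

definition pm_scale :: "'r::comm_ring_1 \<Rightarrow> ('b \<Rightarrow>\<^sub>0 'r) \<Rightarrow> 'b \<Rightarrow>\<^sub>0 'r" where
  "pm_scale c = Poly_Mapping.map (\<lambda>x. c * x)"

lemma lookup_pm_scale: "Poly_Mapping.lookup (pm_scale c f) a = c * Poly_Mapping.lookup f a"
  unfolding pm_scale_def by transfer (simp add: when_def)

lemma pm_scale_single: "pm_scale c (Poly_Mapping.single a d) = Poly_Mapping.single a (c * d)"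
  by (simp add: poly_mapping_eq_iff fun_eq_iff lookup_pm_scale lookup_single when_def)

lemma pm_scale_diff: "pm_scale c (f - g) = pm_scale c f - pm_scale c g"
  by (simp add: poly_mapping_eq_iff fun_eq_iff lookup_pm_scale lookup_minus algebra_simps)

interpretation pm: vector_space "pm_scale :: 'k::field \<Rightarrow> _"
  by unfold_locales (auto simp: poly_mapping_eq_iff fun_eq_iff lookup_pm_scale lookup_add algebra_simps)

interpretation pmk: vector_space_pair "pm_scale :: 'k::field \<Rightarrow> _" "(*)"
  by unfold_locales (auto simp: algebra_simps)

text \<open>The linear extension of \<open>\<phi>\<close> from the basis to the free module,
  evaluated at \<open>f\<close>.\<close>

definition pm_eval :: "('b \<Rightarrow>\<^sub>0 'r::comm_ring_1) \<Rightarrow> ('b \<Rightarrow> 'r) \<Rightarrow> 'r" where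
  "pm_eval f \<phi> = (\<Sum>a\<in>Poly_Mapping.keys f. Poly_Mapping.lookup f a * \<phi> a)"

lemma pm_eval_superset:
  assumes "finite S" "Poly_Mapping.keys f \<subseteq> S"
  shows "pm_eval f \<phi> = (\<Sum>a\<in>S. Poly_Mapping.lookup f a * \<phi> a)"
  unfolding pm_eval_def using assms by (intro sum.mono_neutral_left) (auto simp: in_keys_iff)

lemma pm_eval_add: "pm_eval (f + g) \<phi> = pm_eval f \<phi> + pm_eval g \<phi>"
proof -
  let ?S = "Poly_Mapping.keys f \<union> Poly_Mapping.keys g"
  have "Poly_Mapping.keys (f + g) \<subseteq> ?S"
    by (rule keys_add)
  then show ?thesis
    by (simp add: pm_eval_superset[of ?S] lookup_add algebra_simps sum.distrib)
qed

lemma pm_eval_diff: "pm_eval (f - g) \<phi> = pm_eval f \<phi> - pm_eval g \<phi>"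
  using pm_eval_add[of "f - g" g \<phi>] by simp

lemma pm_eval_scale: "pm_eval (pm_scale c f) \<phi> = c * pm_eval f \<phi>"
proof -
  have "Poly_Mapping.keys (pm_scale c f) \<subseteq> Poly_Mapping.keys f"
    by (auto simp: in_keys_iff lookup_pm_scale)
  then show ?thesis
    by (simp add: pm_eval_superset[of "Poly_Mapping.keys f"] lookup_pm_scale sum_distrib_left mult.assoc)
qed

lemma pm_eval_0 [simp]: "pm_eval 0 \<phi> = 0"
  by (simp add: pm_eval_def)

lemma pm_eval_single [simp]: "pm_eval (Poly_Mapping.single a c) \<phi> = c * \<phi> a"
  by (cases "c = 0") (simp_all add: pm_eval_def)

lemma pm_eval_fun_add: "pm_eval f (\<phi> + \<psi>) = pm_eval f \<phi> + pm_eval f \<psi>"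
  by (simp add: pm_eval_def algebra_simps sum.distrib)

lemma pm_eval_fun_scale: "pm_eval f (fscale c \<phi>) = c * pm_eval f \<phi>" for \<phi> :: "_ \<Rightarrow> 'k::field"
  by (simp add: pm_eval_def fscale_apply algebra_simps sum_distrib_left)

definition supported :: "'b set \<Rightarrow> ('b \<Rightarrow>\<^sub>0 'r::zero) set" where
  "supported A = {f. Poly_Mapping.keys f \<subseteq> A}"

lemma supported_iff: "f \<in> supported A \<longleftrightarrow> (\<forall>a. a \<notin> A \<longrightarrow> Poly_Mapping.lookup f a = 0)"
  by (auto simp: supported_def in_keys_iff)

lemma supported_0 [simp]: "0 \<in> supported A"
  and supported_add: "f \<in> supported A \<Longrightarrow> g \<in> supported A \<Longrightarrow> f + g \<in> supported A"
  and supported_diff: "f \<in> supported A \<Longrightarrow> g \<in> supported A \<Longrightarrow> f - g \<in> supported A"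
  and supported_uminus: "f \<in> supported A \<Longrightarrow> - f \<in> supported A"
  and supported_scale: "f \<in> supported A \<Longrightarrow> pm_scale c f \<in> supported A"
  and supported_single: "a \<in> A \<Longrightarrow> Poly_Mapping.single a c \<in> supported A"
  for f g :: "'b \<Rightarrow>\<^sub>0 'r::comm_ring_1"
  by (auto simp: supported_iff lookup_add lookup_minus lookup_pm_scale lookup_single when_def)

lemma supported_mono: "A \<subseteq> A' \<Longrightarrow> supported A \<subseteq> supported A'"
  by (auto simp: supported_def)

lemma add_subgroup_tensor_rel: "add_subgroup (tensor_rel A)"
  by (simp add: tensor_rel_def)

lemma tensor_rel_mono: "A \<subseteq> A' \<Longrightarrow> tensor_rel A \<subseteq> tensor_rel A'"
  unfolding tensor_rel_def by (rule subgroup_gen_mono) blast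

lemma tensor_rel_supported:
  assumes "add_subgroup A"
  shows "tensor_rel A \<subseteq> supported A"
  unfolding tensor_rel_def
  by (rule subgroup_gen_minimal)
    (auto simp: add_subgroup_def intro!: supported_diff supported_single add_subgroup_add[OF assms])

lemma tensor_rel_scale:
  fixes f :: "'b::ab_group_add \<Rightarrow>\<^sub>0 'r::comm_ring_1"
  assumes "f \<in> tensor_rel A"
  shows "pm_scale c f \<in> tensor_rel A"
proof -
  define S where "S = {Poly_Mapping.single (a + b) (d::'r) - Poly_Mapping.single a d - Poly_Mapping.single b d |
    a b d. a \<in> A \<and> b \<in> A}"
  have T: "tensor_rel A = subgroup_gen S"
    by (simp add: tensor_rel_def S_def)
  have S: "pm_scale c f \<in> S" if "f \<in> S" for f
  proof -
    from that obtain a b d where "a \<in> A" "b \<in> A"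
        "f = Poly_Mapping.single (a + b) d - Poly_Mapping.single a d - Poly_Mapping.single b d"
      by (auto simp: S_def)
    then have "pm_scale c f = Poly_Mapping.single (a + b) (c * d) - Poly_Mapping.single a (c * d)
        - Poly_Mapping.single b (c * d)"
      by (simp only: pm_scale_diff pm_scale_single)
    with \<open>a \<in> A\<close> \<open>b \<in> A\<close> show ?thesis
      unfolding S_def by (intro CollectI exI conjI)
  qed
  have "pm_scale c 0 = (0 :: 'b \<Rightarrow>\<^sub>0 'r)"
    by (simp add: poly_mapping_eq_iff fun_eq_iff lookup_pm_scale)
  then have "add_subgroup {f. pm_scale c f \<in> subgroup_gen S}"
    using add_subgroup_gen[of S] by (simp add: add_subgroup_def pm_scale_diff)
  moreover have "S \<subseteq> {f. pm_scale c f \<in> subgroup_gen S}"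
    using S subgroup_gen_base by blast
  ultimately have "subgroup_gen S \<subseteq> {f. pm_scale c f \<in> subgroup_gen S}"
    by (intro subgroup_gen_minimal)
  then show ?thesis
    using assms unfolding T by blast
qed

lemma pm_eval_tensor_rel:
  assumes "f \<in> tensor_rel A" "\<phi> \<in> additive_on A"
  shows "pm_eval f \<phi> = 0"
proof -
  have "tensor_rel A \<subseteq> {f. pm_eval f \<phi> = 0}"
    unfolding tensor_rel_def
    by (rule subgroup_gen_minimal)
      (use assms(2) in \<open>auto simp: add_subgroup_def pm_eval_diff additive_onD ring_distribs\<close>)
  then show ?thesis
    using assms(1) by blast
qed

text \<open>Over a field the relations form a subspace, so some linear functional vanishes on them
  and not at \<open>f\<close>; its values on the basis elements define an additive function.
  Together with \<open>pm_eval_tensor_rel\<close> this says that the relations are exactly the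
  elements annihilated by all additive functions.\<close>

lemma pm_eval_separates:
  fixes f :: "'b::ab_group_add \<Rightarrow>\<^sub>0 'k::field"
  assumes "f \<notin> tensor_rel A"
  obtains \<phi> where "\<phi> \<in> additive_on A" "pm_eval f \<phi> \<noteq> 0"
proof -
  let ?T = "tensor_rel A :: ('b \<Rightarrow>\<^sub>0 'k) set"
  have sub: "pm.subspace ?T"
    using add_subgroup_tensor_rel[of A] tensor_rel_scale
    by (intro pm.subspaceI) (auto intro: add_subgroup_0 add_subgroup_add)
  obtain B where B: "B \<subseteq> ?T" "pm.independent B" "?T \<subseteq> pm.span B" "card B = pm.dim ?T"
    by (rule pm.basis_exists)
  have sp: "pm.span B = ?T"
    using B(3) pm.span_minimal[OF B(1) sub] by (rule antisym[rotated])
  then have "pm.independent (insert f B)"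
    using assms B(2) by (intro pm.independent_insertI) simp_all
  then have "\<exists>g. Vector_Spaces.linear pm_scale (*) g \<and> (\<forall>x\<in>insert f B. g x = (if x = f then 1 else 0))"
    by (rule pmk.linear_independent_extend)
  then obtain g where g: "Vector_Spaces.linear pm_scale (*) g" "\<forall>x\<in>insert f B. g x = (if x = f then 1 else 0)"
    by (elim exE conjE)
  have "f \<notin> B"
    using assms B(1) by blast
  have g0: "g x = 0" if "x \<in> ?T" for x
    using that unfolding sp[symmetric]
  proof (induct rule: pm.span_induct_alt)
    case base then show ?case by (rule pmk.linear_0[OF g(1)])
  next
    case (step c x y)
    then have "g x = 0" using g(2) \<open>f \<notin> B\<close> by auto
    then show ?case using step by (simp add: pmk.linear_add[OF g(1)] pmk.linear_scale[OF g(1)])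
  qed
  define \<phi> where "\<phi> a = g (Poly_Mapping.single a 1)" for a
  have "\<phi> \<in> additive_on A"
    unfolding additive_on_def
  proof (intro CollectI ballI)
    fix a b assume ab: "a \<in> A" "b \<in> A"
    have "Poly_Mapping.single (a + b) (1::'k) - Poly_Mapping.single a 1 - Poly_Mapping.single b 1 \<in> ?T"
      unfolding tensor_rel_def using ab by (intro subgroup_gen_base) blast
    from g0[OF this] have "g (Poly_Mapping.single (a + b) 1) - g (Poly_Mapping.single a 1) - g (Poly_Mapping.single b 1) = 0"
      by (simp only: pmk.linear_diff[OF g(1)])
    then show "\<phi> (a + b) = \<phi> a + \<phi> b"
      by (simp add: \<phi>_def algebra_simps)
  qed
  moreover have "pm_eval f \<phi> = g f"
  proof -
    have f: "f = (\<Sum>a\<in>Poly_Mapping.keys f. pm_scale (Poly_Mapping.lookup f a) (Poly_Mapping.single a 1))"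
    proof (rule poly_mapping_eqI)
      fix k
      show "Poly_Mapping.lookup f k = Poly_Mapping.lookup (\<Sum>a\<in>Poly_Mapping.keys f.
          pm_scale (Poly_Mapping.lookup f a) (Poly_Mapping.single a 1)) k"
        by (auto simp: lookup_sum pm_scale_single lookup_single when_def in_keys_iff)
    qed
    have "g f = (\<Sum>a\<in>Poly_Mapping.keys f. Poly_Mapping.lookup f a * \<phi> a)"
      by (subst f) (simp add: pmk.linear_sum[OF g(1)] pmk.linear_scale[OF g(1)] \<phi>_def)
    then show ?thesis
      by (simp add: pm_eval_def)
  qed
  ultimately show thesis
    using that g(2) by simp
qed

lemma abelian_group_free_module: "abelian_group (free_module A)"
proof (rule abelian_groupI)
  fix x :: "'a \<Rightarrow>\<^sub>0 'b" assume "x \<in> carrier (free_module A)"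
  then show "\<exists>y\<in>carrier (free_module A). y \<oplus>\<^bsub>free_module A\<^esub> x = \<zero>\<^bsub>free_module A\<^esub>"
    using supported_uminus[of x A] by (intro bexI[of _ "- x"]) (auto simp: free_module_def supported_def)
qed (use keys_add in \<open>fastforce simp: free_module_def algebra_simps\<close>)+

lemma a_inv_free_module:
  assumes "x \<in> supported A"
  shows "\<ominus>\<^bsub>free_module A\<^esub> x = - x"
proof -
  interpret abelian_group "free_module A :: ('b, 'a \<Rightarrow>\<^sub>0 'b) module"
    by (rule abelian_group_free_module)
  show ?thesis
    by (rule minus_equality) (use assms supported_uminus[of x A] in \<open>auto simp: free_module_def supported_def\<close>)
qed

lemma abelian_subgroup_tensor_rel:
  assumes "add_subgroup A"
  shows "abelian_subgroup (tensor_rel A) (free_module A)"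
proof -
  interpret abelian_group "free_module A :: ('b, 'a \<Rightarrow>\<^sub>0 'b) module"
    by (rule abelian_group_free_module)
  have "subgroup (tensor_rel A) (add_monoid (free_module A :: ('b, 'a \<Rightarrow>\<^sub>0 'b) module))"
  proof (rule add.subgroupI)
    show "tensor_rel A \<subseteq> carrier (free_module A :: ('b, 'a \<Rightarrow>\<^sub>0 'b) module)"
      using tensor_rel_supported[OF assms] by (auto simp: free_module_def supported_def)
    show "tensor_rel A \<noteq> {}"
      using add_subgroup_0[OF add_subgroup_tensor_rel] by blast
    fix x y :: "'a \<Rightarrow>\<^sub>0 'b" assume x: "x \<in> tensor_rel A"
    then show "\<ominus>\<^bsub>free_module A\<^esub> x \<in> tensor_rel A"
      using a_inv_free_module[of x A] tensor_rel_supported[OF assms] add_subgroup_uminus[OF add_subgroup_tensor_rel]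
      by (metis subsetD)
    assume "y \<in> tensor_rel A"
    with x show "x \<oplus>\<^bsub>free_module A\<^esub> y \<in> tensor_rel A"
      by (simp add: free_module_def add_subgroup_add[OF add_subgroup_tensor_rel])
  qed
  then show ?thesis
    by (intro abelian_subgroupI3 abelian_group_free_module) (simp add: additive_subgroup_def)
qed

text \<open>The class in the tensor product of an element of the free module; the operations on the
  tensor product are rewritten in terms of these classes.\<close>

definition tcls :: "'b::ab_group_add set \<Rightarrow> ('b \<Rightarrow>\<^sub>0 'r::comm_ring_1) \<Rightarrow> ('b \<Rightarrow>\<^sub>0 'r) set" where
  "tcls A f = {r + f | r. r \<in> tensor_rel A}"

lemma a_r_coset_tcls: "tensor_rel A +>\<^bsub>free_module A\<^esub> f = tcls A f"
  by (auto simp: a_r_coset_def' tcls_def free_module_def)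

lemma carrier_tensor: "carrier (tensor A) = tcls A ` supported A"
  unfolding tensor_def quotient_module_def A_RCOSETS_def RCOSETS_def
  by (auto simp: a_r_coset_tcls[unfolded a_r_coset_def] supported_def)
    (auto simp: free_module_def)

lemma tcls_eq_iff: "tcls A f = tcls A g \<longleftrightarrow> f - g \<in> tensor_rel A"
proof
  assume "tcls A f = tcls A g"
  moreover have "f \<in> tcls A f"
    using add_subgroup_0[OF add_subgroup_tensor_rel] by (force simp: tcls_def)
  ultimately obtain r where "r \<in> tensor_rel A" "f = r + g"
    by (auto simp: tcls_def)
  then show "f - g \<in> tensor_rel A" by simp
next
  have sub: "tcls A f \<subseteq> tcls A g" if "f - g \<in> tensor_rel A" for f g :: "'a \<Rightarrow>\<^sub>0 'b"
  proof
    fix x assume "x \<in> tcls A f"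
    then obtain r where r: "r \<in> tensor_rel A" "x = r + f" by (auto simp: tcls_def)
    then have "x = (r + (f - g)) + g" by simp
    then show "x \<in> tcls A g"
      using add_subgroup_add[OF add_subgroup_tensor_rel r(1) that] unfolding tcls_def by blast
  qed
  assume fg: "f - g \<in> tensor_rel A"
  then have "g - f \<in> tensor_rel A"
    using add_subgroup_uminus[OF add_subgroup_tensor_rel fg] by simp
  then show "tcls A f = tcls A g"
    using sub fg by blast
qed

lemma tcls_add:
  assumes "add_subgroup A" "f \<in> supported A" "g \<in> supported A"
  shows "tcls A f \<oplus>\<^bsub>tensor A\<^esub> tcls A g = tcls A (f + g)"
proof -
  interpret abelian_subgroup "tensor_rel A :: ('a \<Rightarrow>\<^sub>0 'b) set" "free_module A :: ('b, 'a \<Rightarrow>\<^sub>0 'b) module"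
    by (rule abelian_subgroup_tensor_rel[OF assms(1)])
  show ?thesis
    using a_rcos_sum[of f g] assms(2,3)
    by (simp add: tensor_def quotient_module_def a_r_coset_tcls) (simp add: free_module_def supported_def)
qed

lemma tcls_smult: "c \<odot>\<^bsub>tensor A\<^esub> tcls A f = tcls A (pm_scale c f)"
proof -
  have *: "tcls A (pm_scale c x) = tcls A (pm_scale c f)" if x: "x \<in> tcls A f" for x
  proof -
    obtain r where "r \<in> tensor_rel A" "x = r + f" using x unfolding tcls_def by blast
    then have "pm_scale c x - pm_scale c f = pm_scale c r"
      by (simp add: pm_scale_diff[symmetric])
    then show ?thesis
      using tensor_rel_scale[OF \<open>r \<in> tensor_rel A\<close>, of c] by (simp add: tcls_eq_iff)
  qed
  have "f \<in> tcls A f"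
    using add_subgroup_0[OF add_subgroup_tensor_rel] by (force simp: tcls_def)
  have "c \<odot>\<^bsub>tensor A\<^esub> tcls A f = (\<Union>x\<in>tcls A f. tcls A (pm_scale c x))"
    by (simp add: tensor_def quotient_module_def a_r_coset_tcls) (simp add: free_module_def pm_scale_def)
  also have "\<dots> = (\<Union>x\<in>tcls A f. tcls A (pm_scale c f))"
    by (rule SUP_cong[OF refl *])
  also have "\<dots> = tcls A (pm_scale c f)"
    unfolding UN_constant using \<open>f \<in> tcls A f\<close> by (simp only: empty_iff if_False split: if_split) blast
  finally show ?thesis .
qed

lemma tensor_zero: "\<zero>\<^bsub>tensor A\<^esub> = tcls A 0"
  by (simp add: tensor_def quotient_module_def tcls_def)

lemma tensor_of_tcls: "tensor_of A a = tcls A (Poly_Mapping.single a 1)"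
  by (simp add: tensor_of_def a_r_coset_tcls)

lemma tensor_incl_tcls:
  assumes "A \<subseteq> A'"
  shows "tensor_incl A' (tcls A f) = tcls A' f"
proof -
  have *: "tcls A' x = tcls A' f" if x: "x \<in> tcls A f" for x
  proof -
    obtain r where "r \<in> tensor_rel A" "x = r + f" using x unfolding tcls_def by blast
    then show ?thesis using tensor_rel_mono[OF assms] by (auto simp: tcls_eq_iff)
  qed
  have "f \<in> tcls A f"
    using add_subgroup_0[OF add_subgroup_tensor_rel] by (force simp: tcls_def)
  have "tensor_incl A' (tcls A f) = (\<Union>x\<in>tcls A f. tcls A' x)"
    by (simp add: tensor_incl_def induced_map_def a_r_coset_tcls)
  also have "\<dots> = (\<Union>x\<in>tcls A f. tcls A' f)"
    by (rule SUP_cong[OF refl *])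
  also have "\<dots> = tcls A' f"
    unfolding UN_constant using \<open>f \<in> tcls A f\<close> by (simp only: empty_iff if_False split: if_split) blast
  finally show ?thesis .
qed

lemma abelian_monoid_tensor:
  assumes "add_subgroup A"
  shows "abelian_monoid (tensor A)"
proof (rule abelian_monoidI)
  show "\<zero>\<^bsub>tensor A\<^esub> \<in> carrier (tensor A)"
    by (auto simp: tensor_zero carrier_tensor)
qed (auto simp: carrier_tensor tcls_add[OF assms] supported_add tensor_zero add_ac)

text \<open>Over a field, an element of \<open>A \<otimes> k\<close> is determined by the values on it of the additive
  functions \<open>A \<rightarrow> k\<close>; the extension of scalars of an inclusion becomes a restriction to fewer such functions.\<close>

definition tval :: "'b::ab_group_add set \<Rightarrow> ('b \<Rightarrow>\<^sub>0 'r::comm_ring_1) set \<Rightarrow> ('b \<Rightarrow> 'r) \<Rightarrow> 'r" where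
  "tval A X \<phi> = (if \<phi> \<in> additive_on A then pm_eval (SOME f. f \<in> X) \<phi> else 0)"

lemma tval_outside: "\<phi> \<notin> additive_on A \<Longrightarrow> tval A X \<phi> = 0"
  by (simp add: tval_def)

lemma tval_tcls: "tval A (tcls A f) \<phi> = (if \<phi> \<in> additive_on A then pm_eval f \<phi> else 0)"
proof -
  have "f \<in> tcls A f"
    using add_subgroup_0[OF add_subgroup_tensor_rel] by (force simp: tcls_def)
  then have "(SOME x. x \<in> tcls A f) \<in> tcls A f"
    by (rule someI)
  then obtain r where "r \<in> tensor_rel A" "(SOME x. x \<in> tcls A f) = r + f"
    by (auto simp: tcls_def)
  then show ?thesis
    by (simp add: tval_def pm_eval_add pm_eval_tensor_rel)
qed

lemma tval_inj:
  fixes X Y :: "('b::ab_group_add \<Rightarrow>\<^sub>0 'k::field) set"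
  assumes "X \<in> carrier (tensor A)" "Y \<in> carrier (tensor A)" "\<And>\<phi>. \<phi> \<in> additive_on A \<Longrightarrow> tval A X \<phi> = tval A Y \<phi>"
  shows "X = Y"
proof -
  obtain f g where fg: "X = tcls A f" "Y = tcls A g"
    using assms(1,2) by (auto simp: carrier_tensor)
  have "f - g \<in> tensor_rel A"
  proof (rule ccontr)
    assume "f - g \<notin> tensor_rel A"
    then obtain \<phi> where "\<phi> \<in> additive_on A" "pm_eval (f - g) \<phi> \<noteq> 0"
      using pm_eval_separates by blast
    then show False
      using assms(3)[of \<phi>] by (simp add: fg tval_tcls pm_eval_diff)
  qed
  then show ?thesis
    by (simp add: fg tcls_eq_iff)
qed

lemma tensor_closed:
  assumes "add_subgroup A"
  shows "\<zero>\<^bsub>tensor A\<^esub> \<in> carrier (tensor A)"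
    and "X \<in> carrier (tensor A) \<Longrightarrow> Y \<in> carrier (tensor A) \<Longrightarrow> X \<oplus>\<^bsub>tensor A\<^esub> Y \<in> carrier (tensor A)"
    and "X \<in> carrier (tensor A) \<Longrightarrow> c \<odot>\<^bsub>tensor A\<^esub> X \<in> carrier (tensor A)"
    and "a \<in> A \<Longrightarrow> tensor_of A a \<in> carrier (tensor A)"
    and "A \<subseteq> A' \<Longrightarrow> X \<in> carrier (tensor A) \<Longrightarrow> tensor_incl A' X \<in> carrier (tensor A')"
proof -
  show "A \<subseteq> A' \<Longrightarrow> X \<in> carrier (tensor A) \<Longrightarrow> tensor_incl A' X \<in> carrier (tensor A')"
    using supported_mono[of A A'] by (fastforce simp: carrier_tensor tensor_incl_tcls)
qed (auto simp: carrier_tensor tensor_zero tcls_add[OF assms] tcls_smult tensor_of_tcls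
    intro: supported_add supported_scale supported_single)

lemma tval_simps:
  assumes "add_subgroup A" "\<phi> \<in> additive_on A"
  shows "tval A \<zero>\<^bsub>tensor A\<^esub> \<phi> = 0"
    and "X \<in> carrier (tensor A) \<Longrightarrow> Y \<in> carrier (tensor A) \<Longrightarrow>
      tval A (X \<oplus>\<^bsub>tensor A\<^esub> Y) \<phi> = tval A X \<phi> + tval A Y \<phi>"
    and "X \<in> carrier (tensor A) \<Longrightarrow> tval A (c \<odot>\<^bsub>tensor A\<^esub> X) \<phi> = c * tval A X \<phi>"
    and "tval A (tensor_of A a) \<phi> = \<phi> a"
  using assms(2) by (auto simp: carrier_tensor tensor_zero tcls_add[OF assms(1)] tcls_smult tensor_of_tcls
      tval_tcls pm_eval_add pm_eval_scale)

lemma tval_incl: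
  assumes "A \<subseteq> A'" "\<phi> \<in> additive_on A'" "X \<in> carrier (tensor A)"
  shows "tval A' (tensor_incl A' X) \<phi> = tval A X \<phi>"
  using assms additive_on_subset[OF assms(1,2)] by (auto simp: carrier_tensor tensor_incl_tcls tval_tcls)

lemma finsum_tensor:
  fixes A :: "'b::ab_group_add set" and X :: "'i \<Rightarrow> ('b \<Rightarrow>\<^sub>0 'k::comm_ring_1) set"
  assumes "add_subgroup A" "\<And>i. i \<in> I \<Longrightarrow> X i \<in> carrier (tensor A)" "finite I"
  shows "finsum (tensor A) X I \<in> carrier (tensor A)"
    and "\<phi> \<in> additive_on A \<Longrightarrow> tval A (finsum (tensor A) X I) \<phi> = (\<Sum>i\<in>I. tval A (X i) \<phi>)"
proof -
  interpret abelian_monoid "tensor A :: ('k, ('b \<Rightarrow>\<^sub>0 'k) set) module"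
    by (rule abelian_monoid_tensor[OF assms(1)])
  show "finsum (tensor A) X I \<in> carrier (tensor A)"
    using assms(2) by (intro finsum_closed) auto
  assume \<phi>: "\<phi> \<in> additive_on A"
  show "tval A (finsum (tensor A) X I) \<phi> = (\<Sum>i\<in>I. tval A (X i) \<phi>)"
    using assms(3,2)
  proof (induct I)
    case empty
    then show ?case by (simp add: tval_simps[OF assms(1) \<phi>])
  next
    case (insert i I)
    then have "finsum (tensor A) X I \<in> carrier (tensor A)"
      by (intro finsum_closed) auto
    with insert show ?case
      by (subst finsum_insert) (auto simp: tval_simps[OF assms(1) \<phi>])
  qed
qed

text \<open>The tensor product of \<open>A\<close> with \<open>k\<close>, as a space of functions on
  additive functions. It is spanned by the evaluations \<open>tdelta A a\<close>, the images of the
  elements a \<otimes> 1.\<close>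

definition tspace :: "'b::ab_group_add set \<Rightarrow> (('b \<Rightarrow> 'k::field) \<Rightarrow> 'k) set" where
  "tspace A = tval A ` carrier (tensor A)"

definition tdelta :: "'b::ab_group_add set \<Rightarrow> 'b \<Rightarrow> ('b \<Rightarrow> 'k::field) \<Rightarrow> 'k" where
  "tdelta A a \<phi> = (if \<phi> \<in> additive_on A then \<phi> a else 0)"

lemma tdelta_tensor_of: "add_subgroup A \<Longrightarrow> tdelta A a = tval A (tensor_of A a)"
  by (auto simp: fun_eq_iff tdelta_def tval_simps tval_outside)

lemma tdelta_in_tspace: "add_subgroup A \<Longrightarrow> a \<in> A \<Longrightarrow> tdelta A a \<in> tspace A"
  by (simp add: tdelta_tensor_of tspace_def tensor_closed)

lemma tspace_outside: "g \<in> tspace A \<Longrightarrow> \<phi> \<notin> additive_on A \<Longrightarrow> g \<phi> = 0"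
  by (auto simp: tspace_def tval_outside)

lemma subspace_tspace:
  assumes "add_subgroup A"
  shows "fs.subspace (tspace A)"
proof (rule fs.subspaceI)
  show "0 \<in> tspace A"
  proof -
    have "0 = tval A \<zero>\<^bsub>tensor A\<^esub>"
      by (auto simp: fun_eq_iff tval_outside) (metis tval_simps(1) assms tval_outside)
    then show ?thesis
      unfolding tspace_def using tensor_closed(1)[OF assms] by blast
  qed
  show "x + y \<in> tspace A" if xy: "x \<in> tspace A" "y \<in> tspace A" for x y
  proof -
    obtain X Y where XY: "X \<in> carrier (tensor A)" "Y \<in> carrier (tensor A)" "x = tval A X" "y = tval A Y"
      using xy by (auto simp: tspace_def)
    then have "x + y = tval A (X \<oplus>\<^bsub>tensor A\<^esub> Y)"
      by (auto simp: fun_eq_iff) (metis add.right_neutral assms tval_outside tval_simps(2))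
    then show ?thesis
      unfolding tspace_def using tensor_closed(2)[OF assms XY(1,2)] by blast
  qed
  show "fscale c x \<in> tspace A" if x: "x \<in> tspace A" for c x
  proof -
    obtain X where X: "X \<in> carrier (tensor A)" "x = tval A X"
      using x by (auto simp: tspace_def)
    then have "fscale c x = tval A (c \<odot>\<^bsub>tensor A\<^esub> X)"
      by (auto simp: fun_eq_iff fscale_apply) (metis mult_zero_right assms tval_outside tval_simps(3))
    then show ?thesis
      unfolding tspace_def using tensor_closed(3)[OF assms X(1)] by blast
  qed
qed

lemma tspace_add_arg: "g \<in> tspace A \<Longrightarrow> \<phi> \<in> additive_on A \<Longrightarrow> \<psi> \<in> additive_on A \<Longrightarrow> g (\<phi> + \<psi>) = g \<phi> + g \<psi>"
  and tspace_scale_arg: "g \<in> tspace A \<Longrightarrow> \<phi> \<in> additive_on A \<Longrightarrow> g (fscale c \<phi>) = c * g \<phi>"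
  by (auto simp: tspace_def carrier_tensor tval_tcls pm_eval_fun_add pm_eval_fun_scale)
    (auto simp: additive_on_def fscale_apply algebra_simps)

text \<open>A tensor involves only elements of \<open>A\<close>, so its value at an additive
  function depends on the values on \<open>A\<close> alone.\<close>

lemma tspace_cong_arg:
  assumes "g \<in> tspace A" "\<phi> \<in> additive_on A" "\<And>a. a \<in> A \<Longrightarrow> \<phi> a = \<psi> a" "add_subgroup A"
  shows "g \<phi> = g \<psi>"
proof -
  obtain f where f: "f \<in> supported A" "g = tval A (tcls A f)"
    using assms(1) by (auto simp: tspace_def carrier_tensor)
  have "\<psi> \<in> additive_on A"
    using assms(2-4) add_subgroup_add[OF assms(4)] by (auto simp: additive_on_def)
  moreover have "pm_eval f \<phi> = pm_eval f \<psi>"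
    unfolding pm_eval_def using f(1) assms(3) by (intro sum.cong) (auto simp: supported_def)
  ultimately show ?thesis
    using assms(2) by (simp add: f tval_tcls)
qed

lemma tspace_eq_span: "add_subgroup A \<Longrightarrow> tspace A = fs.span (tdelta A ` A)"
proof (rule antisym)
  assume A: "add_subgroup A"
  show "fs.span (tdelta A ` A) \<subseteq> tspace A"
    using tdelta_in_tspace[OF A] subspace_tspace[OF A] by (intro fs.span_minimal) auto
  show "tspace A \<subseteq> fs.span (tdelta A ` A)"
  proof
    fix g assume "g \<in> tspace A"
    then obtain f where f: "f \<in> supported A" "g = tval A (tcls A f)"
      by (auto simp: tspace_def carrier_tensor)
    have "g = (\<Sum>a\<in>Poly_Mapping.keys f. fscale (Poly_Mapping.lookup f a) (tdelta A a))"
      by (auto simp: fun_eq_iff f tval_tcls pm_eval_def sum_fun_apply tdelta_def fscale_apply)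
    also have "\<dots> \<in> fs.span (tdelta A ` A)"
      using f(1) by (intro fs.span_sum fs.span_scale fs.span_base) (auto simp: supported_def)
    finally show "g \<in> fs.span (tdelta A ` A)" .
  qed
qed

text \<open>The elements whose evaluation lies in the span of the generators form a subgroup, since
  \<open>tdelta\<close> is additive on the group. The dimension of the tensor product is thereby
  bounded by the number of generators.\<close>

lemma tspace_subgroup_gen: "tspace (subgroup_gen S) = fs.span (tdelta (subgroup_gen S) ` S)"
proof (rule antisym)
  let ?A = "subgroup_gen S"
  have "?A \<subseteq> {a \<in> ?A. tdelta ?A a \<in> fs.span (tdelta ?A ` S)}"
  proof (rule subgroup_gen_minimal)
    show "S \<subseteq> {a \<in> ?A. tdelta ?A a \<in> fs.span (tdelta ?A ` S)}"
      by (auto intro: subgroup_gen_base fs.span_base)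
    have z: "tdelta ?A 0 = 0"
      by (auto simp: fun_eq_iff tdelta_def additive_on_0)
    have d: "tdelta ?A (a - b) = tdelta ?A a - tdelta ?A b" if "a \<in> ?A" "b \<in> ?A" for a b
      using that by (auto simp: fun_eq_iff tdelta_def additive_on_diff)
    show "add_subgroup {a \<in> ?A. tdelta ?A a \<in> fs.span (tdelta ?A ` S)}"
      using add_subgroup_0[OF add_subgroup_gen] add_subgroup_diff[OF add_subgroup_gen]
      by (auto simp: add_subgroup_def z d fs.span_zero fs.span_diff)
  qed
  then show "tspace ?A \<subseteq> fs.span (tdelta ?A ` S)"
    using fs.span_minimal[OF _ fs.subspace_span, of "tdelta ?A ` ?A" "tdelta ?A ` S"]
    by (auto simp: tspace_eq_span)
  show "fs.span (tdelta ?A ` S) \<subseteq> tspace ?A"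
    using fs.span_mono[of "tdelta ?A ` S" "tdelta ?A ` ?A"] subgroup_gen_superset[of S]
    by (auto simp: tspace_eq_span)
qed

text \<open>The homomorphisms from \<open>A\<close> to \<open>k\<close>, each represented once by
  extension with 0. They model the dual space of the tensor product, and so the cochains of degree
  0.\<close>

definition addf :: "'b::ab_group_add set \<Rightarrow> ('b \<Rightarrow> 'k::field) set" where
  "addf A = {\<phi> \<in> additive_on A. \<forall>a. a \<notin> A \<longrightarrow> \<phi> a = 0}"

lemma subspace_addf: "fs.subspace (addf A)"
  by (rule fs.subspaceI) (auto simp: addf_def additive_on_def fscale_apply algebra_simps)

lemma addf_restrict: "\<phi> \<in> additive_on A \<Longrightarrow> add_subgroup A \<Longrightarrow> (\<lambda>a. if a \<in> A then \<phi> a else 0) \<in> addf A"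
  by (auto simp: addf_def additive_on_def add_subgroup_add)

text \<open>Evaluation pairs homomorphisms with tensors, and it is nondegenerate on both
  sides.\<close>

lemma dim_addf:
  assumes A: "add_subgroup A" and fin: "fin_space (tspace A :: (('b::ab_group_add \<Rightarrow> 'k::field) \<Rightarrow> 'k) set)"
  shows "fin_space (addf A :: ('b \<Rightarrow> 'k) set) \<and> fs.dim (addf A :: ('b \<Rightarrow> 'k) set) = fs.dim (tspace A :: (('b \<Rightarrow> 'k) \<Rightarrow> 'k) set)"
proof (rule dim_pairing[OF fin subspace_addf])
  fix \<phi> :: "'b \<Rightarrow> 'k" assume \<phi>: "\<phi> \<in> addf A" "\<And>g. g \<in> tspace A \<Longrightarrow> g \<phi> = 0"
  have "\<phi> a = 0" for a
    using \<phi>(2)[OF tdelta_in_tspace[OF A, of a]] \<phi>(1) by (cases "a \<in> A") (auto simp: tdelta_def addf_def)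
  then show "\<phi> = 0" by (simp add: fun_eq_iff)
next
  fix g :: "('b \<Rightarrow> 'k) \<Rightarrow> 'k" assume g: "g \<in> tspace A" "\<And>\<phi>. \<phi> \<in> addf A \<Longrightarrow> g \<phi> = 0"
  have "g \<phi> = 0" for \<phi>
  proof (cases "\<phi> \<in> additive_on A")
    case True
    then show ?thesis
      using g(2)[OF addf_restrict[OF True A]] tspace_cong_arg[OF g(1) True _ A, of "\<lambda>a. if a \<in> A then \<phi> a else 0"]
      by simp
  qed (simp add: tspace_outside[OF g(1)])
  then show "g = 0" by (simp add: fun_eq_iff)
qed (auto simp: addf_def tspace_add_arg tspace_scale_arg)

section \<open>Exterior products of at most two vectors\<close>

text \<open>Groups of forms consist of functions, which also form a ring. An integer multiple of a
  form is written as a product with \<open>of_int n\<close>, that is, with a constant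
  function.\<close>

lemma of_int_fun_apply: "of_int n x = (of_int n :: 'r::ring_1)"
  by (cases n) auto

lemma of_int_mult_fscale: "of_int n * f = fscale (of_int n) f" for f :: "'x \<Rightarrow> 'k::field"
  by (simp add: fun_eq_iff fscale_apply of_int_fun_apply)

lemma wedge_Nil: "wedge [] = (\<lambda>us. if us = [] then 1 else 0)"
proof
  fix us :: "'a list"
  have "{\<pi>. \<pi> permutes {..<0::nat}} = {id}"
    by (auto simp: permutes_empty)
  then show "wedge [] us = (if us = [] then 1 else 0)"
    by (simp add: wedge_def sign_id del: permutes_empty)
qed

lemma lessThan_Suc_0: "{..<Suc 0} = {0}"
  by auto

lemma lessThan_2: "{..<2::nat} = {0, 1}"
  by auto

lemma wedge_1: "wedge [x] = (\<lambda>us. if length us = 1 then x \<bullet> (us ! 0) else 0)"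
proof
  fix us
  have "{\<pi>. \<pi> permutes {..<Suc 0}} = {id}"
    using permutes_sing[of _ "0::nat"] by (auto simp: lessThan_Suc_0 permutes_id)
  then show "wedge [x] us = (if length us = 1 then x \<bullet> (us ! 0) else 0)"
    by (simp add: wedge_def lessThan_Suc_0 sign_id)
qed

lemma wedge_2: "wedge [x, y] = (\<lambda>us. if length us = 2 then (x \<bullet> us ! 0) * (y \<bullet> us ! 1) - (x \<bullet> us ! 1) * (y \<bullet> us ! 0) else 0)"
proof
  fix us
  have P: "{\<pi>. \<pi> permutes {..<2::nat}} = {id, Transposition.transpose 0 1}"
    unfolding lessThan_2 permutes_doubleton_iff by auto
  have ne: "id \<noteq> Transposition.transpose 0 (1::nat)"
    by (metis id_apply transpose_apply_first zero_neq_one)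
  have "wedge [x, y] us = (if length us = 2 then \<Sum>\<pi>\<in>{id, Transposition.transpose 0 1}.
      of_int (sign \<pi>) * (\<Prod>i<2. ([x, y] ! i) \<bullet> (us ! \<pi> i)) else 0)"
    unfolding wedge_def by (simp only: length_Cons list.size P[symmetric] numeral_2_eq_2)
  also have "\<dots> = (if length us = 2 then (x \<bullet> us ! 0) * (y \<bullet> us ! 1) - (x \<bullet> us ! 1) * (y \<bullet> us ! 0) else 0)"
    using ne by (simp add: lessThan_2 sign_id sign_swap_id)
  finally show "wedge [x, y] us = (if length us = 2 then (x \<bullet> us ! 0) * (y \<bullet> us ! 1) - (x \<bullet> us ! 1) * (y \<bullet> us ! 0) else 0)" .
qed

lemma wedge_1_add: "wedge [x + y] = wedge [x] + wedge [y]"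
  and wedge_1_diff: "wedge [x - y] = wedge [x] - wedge [y]"
  and wedge_1_scale: "wedge [c *\<^sub>R x] = fscale c (wedge [x])"
  by (auto simp: wedge_1 fun_eq_iff fscale_apply inner_add_left inner_diff_left)

lemma wedge_2_add_right: "wedge [z, x + y] = wedge [z, x] + wedge [z, y]"
  and wedge_2_diff_right: "wedge [z, x - y] = wedge [z, x] - wedge [z, y]"
  and wedge_2_scale_right: "wedge [z, c *\<^sub>R x] = fscale c (wedge [z, x])"
  and wedge_2_scale_left: "wedge [c *\<^sub>R z, x] = fscale c (wedge [z, x])"
  and wedge_2_swap: "wedge [x, y] = fscale (- 1) (wedge [y, x])"
  and wedge_2_minus_left: "wedge [- x, y] = wedge [y, x]"
  and wedge_2_same: "wedge [x, x] = 0"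
  by (auto simp: wedge_2 fun_eq_iff fscale_apply inner_add_left inner_diff_left algebra_simps)

text \<open>The inverse of the embedding of vectors as 1-forms: the coordinates are the values at
  the basis vectors.\<close>

definition unwedge_1 :: "('a::euclidean_space list \<Rightarrow> real) \<Rightarrow> 'a" where
  "unwedge_1 g = (\<Sum>b\<in>Basis. g [b] *\<^sub>R b)"

lemma unwedge_1_wedge [simp]: "unwedge_1 (wedge [x]) = x"
  by (simp add: unwedge_1_def wedge_1 euclidean_representation)

text \<open>Independence of the pair and not of the set \<open>{u, v}\<close>, which would allow u =
  v.\<close>

definition indep2 :: "'a::real_vector \<Rightarrow> 'a \<Rightarrow> bool" where
  "indep2 u v \<longleftrightarrow> (\<forall>a b. a *\<^sub>R u + b *\<^sub>R v = 0 \<longrightarrow> a = 0 \<and> b = 0)"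

lemma indep2D: "indep2 u v \<Longrightarrow> a *\<^sub>R u + b *\<^sub>R v = 0 \<Longrightarrow> a = 0 \<and> b = 0"
  by (auto simp: indep2_def)

lemma indep2_eqD:
  assumes "indep2 u v" "a *\<^sub>R u + b *\<^sub>R v = c *\<^sub>R u + d *\<^sub>R v"
  shows "a = c" "b = d"
  using indep2D[OF assms(1), of "a - c" "b - d"] assms(2) by (auto simp: algebra_simps)

lemma indep2_nonzero: "indep2 u v \<Longrightarrow> u \<noteq> 0 \<and> v \<noteq> 0"
  using indep2D[of u v 1 0] indep2D[of u v 0 1] by auto

lemma indep2_swap: "indep2 u v \<Longrightarrow> indep2 v u"
  by (metis add.commute indep2_def)

lemma span_2: "span {u, v} = {a *\<^sub>R u + b *\<^sub>R v | a b. True}"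
proof -
  have "(\<exists>k. x - k *\<^sub>R u \<in> span {v}) \<longleftrightarrow> (\<exists>a b. x = a *\<^sub>R u + b *\<^sub>R v)" for x
    by (auto simp: span_singleton) (metis add.commute diff_add_cancel, metis add_diff_cancel_left' rangeI)
  then have "x \<in> span {u, v} \<longleftrightarrow> (\<exists>a b. x = a *\<^sub>R u + b *\<^sub>R v)" for x
    by (simp only: span_breakdown_eq)
  then show ?thesis
    by blast
qed

lemma indep2_not_span: "indep2 u v \<Longrightarrow> u \<notin> span {v}"
  using indep2D[of u v 1] by (auto simp: span_singleton) (metis add.right_inverse neg_eq_iff_add_eq_0 scaleR_minus_left scaleR_one zero_neq_one)

lemma not_span_indep2: "v \<noteq> 0 \<Longrightarrow> u \<notin> span {v} \<Longrightarrow> indep2 u v"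
  unfolding indep2_def
proof (intro allI impI)
  fix a b assume v: "v \<noteq> 0" "u \<notin> span {v}" and ab: "a *\<^sub>R u + b *\<^sub>R v = 0"
  have "a = 0"
  proof (rule ccontr)
    assume "a \<noteq> 0"
    then have "u = (- b / a) *\<^sub>R v"
      using ab by (metis add.commute add_eq_0_iff divide_inverse_commute eq_vector_fraction_iff scaleR_minus_left scaleR_scaleR)
    then show False
      using v(2) by (metis rangeI span_singleton)
  qed
  then show "a = 0 \<and> b = 0"
    using ab v(1) by simp
qed

lemma dim_indep2: "indep2 u v \<Longrightarrow> dim {u, v} = 2" for u v :: "'a::euclidean_space"
  using indep2_not_span[of u v] indep2_nonzero[of u v] by (simp add: dim_insert)

lemma indep2_dim: "dim {u, v} = 2 \<Longrightarrow> indep2 u v" for u v :: "'a::euclidean_space"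
  by (rule not_span_indep2) (auto simp: dim_insert split: if_splits)

text \<open>Evaluating the form at \<open>u\<close> and an arbitrary \<open>z\<close> shows that v
  times \<open>u \<bullet> u\<close> equals u times \<open>v \<bullet> u\<close>.\<close>

lemma wedge_2_eq_0D:
  fixes u v :: "'a::euclidean_space"
  assumes "wedge [u, v] = 0" "u \<noteq> 0"
  shows "v \<in> span {u}"
proof -
  have "(u \<bullet> u) * (v \<bullet> z) = (u \<bullet> z) * (v \<bullet> u)" for z
    using fun_cong[OF assms(1), of "[u, z]"] by (simp add: wedge_2)
  then have "((u \<bullet> u) *\<^sub>R v - (v \<bullet> u) *\<^sub>R u) \<bullet> z = 0" for z
    by (simp add: inner_diff_left algebra_simps)
  then have "(u \<bullet> u) *\<^sub>R v = (v \<bullet> u) *\<^sub>R u"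
    by (metis eq_iff_diff_eq_0 inner_eq_zero_iff)
  then have "v = ((v \<bullet> u) / (u \<bullet> u)) *\<^sub>R u"
    using assms(2) by (metis divide_inverse_commute inner_eq_zero_iff eq_vector_fraction_iff scaleR_scaleR)
  then show ?thesis
    by (metis span_base span_scale singletonI)
qed

lemma wedge_indep2: "indep2 u v \<Longrightarrow> wedge [u, v] \<noteq> 0" for u v :: "'a::euclidean_space"
  using wedge_2_eq_0D[of u v] indep2_not_span[OF indep2_swap] indep2_nonzero by blast

section \<open>Subgroups of rank one and two\<close>

lemma subgroup_gen_1: "subgroup_gen {u} = {of_int n *\<^sub>R u | n. True}" for u :: "'a::real_vector"
proof
  have "add_subgroup {of_int n *\<^sub>R u | n. True}"
    by (auto simp: add_subgroup_def simp flip: scaleR_diff_left of_int_diff intro: exI[of _ 0])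
  then show "subgroup_gen {u} \<subseteq> {of_int n *\<^sub>R u | n. True}"
    by (rule subgroup_gen_minimal[rotated]) (auto intro: exI[of _ 1])
  show "{of_int n *\<^sub>R u | n. True} \<subseteq> subgroup_gen {u}"
    by (auto intro: add_subgroup_of_int_scaleR subgroup_gen_base)
qed

lemma subgroup_gen_2:
  "subgroup_gen {u, v} = {of_int n *\<^sub>R u + of_int m *\<^sub>R v | n m. True}" for u v :: "'a::real_vector"
proof
  let ?A = "{of_int n *\<^sub>R u + of_int m *\<^sub>R v | n m. True}"
  have "x - y \<in> ?A" if xy: "x \<in> ?A" "y \<in> ?A" for x y
  proof -
    obtain n m n' m' where "x = of_int n *\<^sub>R u + of_int m *\<^sub>R v" "y = of_int n' *\<^sub>R u + of_int m' *\<^sub>R v"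
      using xy by blast
    then have "x - y = of_int (n - n') *\<^sub>R u + of_int (m - m') *\<^sub>R v"
      by (simp add: algebra_simps)
    then show ?thesis by blast
  qed
  moreover have "0 \<in> ?A"
    by (auto intro!: exI[of _ 0])
  ultimately have sub: "add_subgroup ?A"
    by (simp add: add_subgroup_def)
  have "u \<in> ?A" "v \<in> ?A"
    by (rule CollectI, rule exI[of _ 1], rule exI[of _ 0], simp,
        rule CollectI, rule exI[of _ 0], rule exI[of _ 1], simp)
  then have uv: "{u, v} \<subseteq> ?A"
    by (simp only: insert_subset empty_subsetI simp_thms)
  show "subgroup_gen {u, v} \<subseteq> ?A"
    by (rule subgroup_gen_minimal[OF uv sub])
  have "u \<in> subgroup_gen {u, v}" "v \<in> subgroup_gen {u, v}"
    by (simp_all add: subgroup_gen_base)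
  then show "?A \<subseteq> subgroup_gen {u, v}"
    by (auto intro: add_subgroup_add[OF add_subgroup_gen] add_subgroup_of_int_scaleR[OF add_subgroup_gen])
qed

section \<open>Cones of dimension at most two\<close>

definition pointed_cone :: "'a::euclidean_space set \<Rightarrow> bool" where
  "pointed_cone \<sigma> \<longleftrightarrow> convex_cone \<sigma> \<and> (\<forall>x\<in>\<sigma>. - x \<in> \<sigma> \<longrightarrow> x = 0)"

lemma pointed_cone_facts:
  assumes "pointed_cone \<sigma>"
  shows "0 \<in> \<sigma>" and "x \<in> \<sigma> \<Longrightarrow> y \<in> \<sigma> \<Longrightarrow> x + y \<in> \<sigma>" and "c \<ge> 0 \<Longrightarrow> x \<in> \<sigma> \<Longrightarrow> c *\<^sub>R x \<in> \<sigma>"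
    and "x \<in> \<sigma> \<Longrightarrow> - x \<in> \<sigma> \<Longrightarrow> x = 0" and "convex \<sigma>"
proof -
  show "convex \<sigma>"
    using assms by (simp add: pointed_cone_def convex_cone_def)
qed (use assms in \<open>auto simp: pointed_cone_def convex_cone_iff\<close>)

lemma rational_cone_pointed:
  assumes "rational_cone N \<sigma>"
  shows "pointed_cone \<sigma>" "closed \<sigma>"
proof -
  obtain S where S: "finite S" "\<sigma> = convex_cone hull S" and p: "\<sigma> \<inter> uminus ` \<sigma> = {0}"
    using assms by (auto simp: rational_cone_def)
  have "x = 0" if "x \<in> \<sigma>" "- x \<in> \<sigma>" for x
  proof -
    have "x \<in> uminus ` \<sigma>"
      using that(2) by (metis imageI minus_minus)
    then show ?thesis using that(1) p by blast
  qed
  then show "pointed_cone \<sigma>"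
    by (simp add: pointed_cone_def S(2) convex_cone_convex_cone_hull)
  show "closed \<sigma>"
    using S closed_convex_cone_hull by blast
qed

text \<open>The relation \<open>face_of\<close> speaks of open segments. For cones it implies an
  additive condition, namely that a sum lies in the face only if both summands do, and this is the
  form in which faces are used.\<close>

lemma face_of_pointed_cone:
  assumes \<sigma>: "pointed_cone \<sigma>" and F: "F face_of \<sigma>" "F \<noteq> {}"
  shows "pointed_cone F" and "F \<subseteq> \<sigma>" and "x \<in> \<sigma> \<Longrightarrow> y \<in> \<sigma> \<Longrightarrow> x + y \<in> F \<Longrightarrow> x \<in> F \<and> y \<in> F"
proof -
  note [simp] = pointed_cone_facts(1)[OF \<sigma>]
  show sub: "F \<subseteq> \<sigma>"
    using F(1) face_of_imp_subset by blast
  have F0: "0 \<in> F"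
  proof -
    obtain x where x: "x \<in> F" using F(2) by blast
    show ?thesis
    proof (cases "x = 0")
      case False
      \<comment> \<open>\<open>x\<close> is the midpoint of 0 and 2x, and both end points lie in the
        cone.\<close>
      have "x \<in> open_segment 0 (2 *\<^sub>R x)"
        using False by (auto simp: in_segment intro!: exI[of _ "1/2"])
      then show ?thesis
        using face_ofD[OF F(1), of x 0 "2 *\<^sub>R x"] x sub pointed_cone_facts(3)[OF \<sigma>] by auto
    qed (use x in simp)
  qed
  have conv: "convex F"
    using F(1) by (rule face_of_imp_convex)
  have scale: "c *\<^sub>R x \<in> F" if "x \<in> F" "c \<ge> 0" for c x
  proof (cases "c \<le> 1 \<or> x = 0")
    case True
    have "(1 - c) *\<^sub>R 0 + c *\<^sub>R x \<in> F" if "c \<le> 1"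
      using convexD[OF conv F0 \<open>x \<in> F\<close>, of "1 - c" c] that \<open>c \<ge> 0\<close> by simp
    then show ?thesis using True F0 by auto
  next
    case False
    then have "x \<in> open_segment 0 (c *\<^sub>R x)"
      by (auto simp: in_segment intro!: exI[of _ "1/c"])
    then show ?thesis
      using face_ofD[OF F(1), of x 0 "c *\<^sub>R x"] that sub pointed_cone_facts(3)[OF \<sigma>] by auto
  qed
  have add: "x + y \<in> F" if "x \<in> F" "y \<in> F" for x y
  proof -
    have "(1/2) *\<^sub>R x + (1/2) *\<^sub>R y \<in> F"
      using convexD[OF conv that, of "1/2" "1/2"] by simp
    from scale[OF this, of 2] show ?thesis
      by (simp add: algebra_simps)
  qed
  show "pointed_cone F"
    unfolding pointed_cone_def convex_cone_iff
  proof (intro conjI ballI allI impI)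
    show "0 \<in> F" by (rule F0)
    show "x + y \<in> F" if "x \<in> F" "y \<in> F" for x y using that by (rule add)
    show "c *\<^sub>R x \<in> F" if "x \<in> F" "0 \<le> c" for x c using that by (rule scale)
    show "x = 0" if "x \<in> F" "- x \<in> F" for x using that sub by (intro pointed_cone_facts(4)[OF \<sigma>]) auto
  qed
  assume xy: "x \<in> \<sigma>" "y \<in> \<sigma>" "x + y \<in> F"
  have mid: "(1/2) *\<^sub>R (x + y) \<in> F"
    using scale[OF xy(3)] by simp
  show "x \<in> F \<and> y \<in> F"
  proof (cases "x = y")
    case True
    have "(1/2) *\<^sub>R (x + x) = x"
      by (simp add: scaleR_2[symmetric])
    then show ?thesis using mid True by simp
  next
    case False
    then have "(1/2) *\<^sub>R (x + y) \<in> open_segment x y"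
      unfolding in_segment by (intro conjI exI[of _ "1/2"]) (simp_all add: scaleR_add_right)
    then show ?thesis
      using face_ofD[OF F(1)] xy mid by blast
  qed
qed

lemma face_of_pointed_coneI:
  assumes \<sigma>: "pointed_cone \<sigma>" and F: "F \<subseteq> \<sigma>" "convex_cone F"
    and split: "\<And>x y. x \<in> \<sigma> \<Longrightarrow> y \<in> \<sigma> \<Longrightarrow> x + y \<in> F \<Longrightarrow> x \<in> F \<and> y \<in> F"
  shows "F face_of \<sigma>"
  unfolding face_of_def
proof (intro conjI ballI impI)
  show "F \<subseteq> \<sigma>" "convex F"
    using F by (simp_all add: convex_cone_def)
  fix a b x assume "a \<in> \<sigma>" "b \<in> \<sigma>" "x \<in> F" "x \<in> open_segment a b"
  then obtain u where u: "0 < u" "u < 1" "x = (1 - u) *\<^sub>R a + u *\<^sub>R b"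
    by (auto simp: in_segment)
  have ab: "(1 - u) *\<^sub>R a \<in> F \<and> u *\<^sub>R b \<in> F"
    using split[of "(1 - u) *\<^sub>R a" "u *\<^sub>R b"] u \<open>a \<in> \<sigma>\<close> \<open>b \<in> \<sigma>\<close> \<open>x \<in> F\<close>
    by (simp add: pointed_cone_facts[OF \<sigma>])
  have "(1 / (1 - u)) *\<^sub>R ((1 - u) *\<^sub>R a) \<in> F" "(1 / u) *\<^sub>R (u *\<^sub>R b) \<in> F"
    using ab u F(2) by (auto intro!: convex_cone_scaleR simp del: scaleR_scaleR)
  then show "a \<in> F" "b \<in> F"
    using u by simp_all
qed

text \<open>A proper face has smaller affine dimension, and for sets containing 0 the affine and the
  linear dimension agree.\<close>

lemma face_of_dim_eq:
  assumes \<sigma>: "pointed_cone \<sigma>" and F: "F face_of \<sigma>" "F \<noteq> {}" "dim F = dim \<sigma>"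
  shows "F = \<sigma>"
proof (rule ccontr)
  assume "F \<noteq> \<sigma>"
  then have "aff_dim F < aff_dim \<sigma>"
    using face_of_aff_dim_lt[OF pointed_cone_facts(5)[OF \<sigma>] F(1)] by simp
  moreover have "0 \<in> affine hull F" "0 \<in> affine hull \<sigma>"
    using pointed_cone_facts(1)[OF \<sigma>] pointed_cone_facts(1)[OF face_of_pointed_cone(1)[OF \<sigma> F(1,2)]]
    by (auto intro: hull_inc)
  ultimately show False
    using F(3) by (simp add: aff_dim_zero)
qed

definition ray :: "'a::real_vector \<Rightarrow> 'a set" where
  "ray u = {c *\<^sub>R u | c. c \<ge> 0}"

definition quad :: "'a::real_vector \<Rightarrow> 'a \<Rightarrow> 'a set" where
  "quad u v = {a *\<^sub>R u + b *\<^sub>R v | a b. a \<ge> 0 \<and> b \<ge> 0}"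

lemma ray_base: "u \<in> ray u"
  unfolding ray_def by (rule CollectI, rule exI[of _ 1]) simp

lemma quad_base: "u \<in> quad u v" "v \<in> quad u v"
  unfolding quad_def by (rule CollectI, rule exI[of _ 1], rule exI[of _ 0], simp)
    (rule CollectI, rule exI[of _ 0], rule exI[of _ 1], simp)

lemma quad_swap: "quad u v = quad v u"
  unfolding quad_def by (subst add.commute) blast

lemma quadI: "a \<ge> 0 \<Longrightarrow> b \<ge> 0 \<Longrightarrow> a *\<^sub>R u + b *\<^sub>R v \<in> quad u v"
  by (auto simp: quad_def)

lemma convex_cone_ray: "convex_cone (ray u)"
  unfolding convex_cone_iff
proof (intro conjI ballI allI impI)
  show "0 \<in> ray u" unfolding ray_def by (rule CollectI, rule exI[of _ 0]) simp
  show "x + y \<in> ray u" if xy: "x \<in> ray u" "y \<in> ray u" for x y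
  proof -
    obtain a b where "x = a *\<^sub>R u" "y = b *\<^sub>R u" "a \<ge> 0" "b \<ge> 0"
      using xy by (auto simp: ray_def)
    then have "x + y = (a + b) *\<^sub>R u" "a + b \<ge> 0" by (auto simp: algebra_simps)
    then show ?thesis by (auto simp: ray_def)
  qed
  show "c *\<^sub>R x \<in> ray u" if "x \<in> ray u" "c \<ge> 0" for x c
    using that by (auto simp: ray_def)
qed

lemma convex_cone_quad: "convex_cone (quad u v)"
  unfolding convex_cone_iff
proof (intro conjI ballI allI impI)
  show "0 \<in> quad u v" using quadI[of 0 0 u v] by simp
  show "x + y \<in> quad u v" if xy: "x \<in> quad u v" "y \<in> quad u v" for x y
  proof -
    obtain a b a' b' where "x = a *\<^sub>R u + b *\<^sub>R v" "y = a' *\<^sub>R u + b' *\<^sub>R v" "a \<ge> 0" "b \<ge> 0" "a' \<ge> 0" "b' \<ge> 0"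
      using xy by (auto simp: quad_def)
    then show ?thesis using quadI[of "a + a'" "b + b'" u v] by (simp add: algebra_simps)
  qed
  show "c *\<^sub>R x \<in> quad u v" if xc: "x \<in> quad u v" "c \<ge> 0" for x c
  proof -
    obtain a b where "x = a *\<^sub>R u + b *\<^sub>R v" "a \<ge> 0" "b \<ge> 0"
      using xc by (auto simp: quad_def)
    then show ?thesis using quadI[of "c * a" "c * b" u v] xc(2) by (simp add: algebra_simps)
  qed
qed

lemma pointed_cone_quad: "indep2 u v \<Longrightarrow> pointed_cone (quad u v)"
proof -
  assume u: "indep2 u v"
  have "x = 0" if x: "x \<in> quad u v" "- x \<in> quad u v" for x
  proof -
    obtain a b a' b' where ab: "x = a *\<^sub>R u + b *\<^sub>R v" "- x = a' *\<^sub>R u + b' *\<^sub>R v" "a \<ge> 0" "b \<ge> 0" "a' \<ge> 0" "b' \<ge> 0"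
      using x by (auto simp: quad_def)
    then have "(a + a') *\<^sub>R u + (b + b') *\<^sub>R v = x + - x"
      by (simp add: algebra_simps)
    then have "a = 0 \<and> b = 0" using indep2D[OF u, of "a + a'" "b + b'"] ab by simp
    then show ?thesis using ab by simp
  qed
  then show ?thesis by (simp add: pointed_cone_def convex_cone_quad)
qed

lemma span_ray: "span (ray u) = span {u}"
proof (rule span_eq[THEN iffD2], intro conjI)
  show "ray u \<subseteq> span {u}" by (auto simp: ray_def span_singleton)
  show "{u} \<subseteq> span (ray u)" by (simp add: ray_base span_base)
qed

lemma span_quad: "span (quad u v) = span {u, v}"
proof (rule span_eq[THEN iffD2], intro conjI)
  show "quad u v \<subseteq> span {u, v}" by (auto simp: quad_def span_2)
  show "{u, v} \<subseteq> span (quad u v)" by (simp add: quad_base span_base)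
qed

lemma dim_ray: "u \<noteq> 0 \<Longrightarrow> dim (ray u) = 1" for u :: "'a::euclidean_space"
  by (metis span_ray dim_span dim_singleton)

lemma dim_quad: "indep2 u v \<Longrightarrow> dim (quad u v) = 2" for u v :: "'a::euclidean_space"
  by (metis span_quad dim_span dim_indep2)

lemma ray_scale: "t > 0 \<Longrightarrow> ray (t *\<^sub>R u) = ray u"
proof (intro equalityI subsetI)
  fix x assume t: "t > 0"
  show "x \<in> ray u" if "x \<in> ray (t *\<^sub>R u)"
    using that t by (auto simp: ray_def)
  assume "x \<in> ray u"
  then obtain c where "c \<ge> 0" "x = (c / t) *\<^sub>R (t *\<^sub>R u)" using t by (auto simp: ray_def)
  then show "x \<in> ray (t *\<^sub>R u)"
    using t unfolding ray_def by (intro CollectI exI[of _ "c / t"]) simp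
qed

lemma dim1_cone:
  assumes \<sigma>: "pointed_cone \<sigma>" and d: "dim \<sigma> = 1"
  obtains u where "u \<noteq> 0" "\<sigma> = ray u"
proof -
  obtain u where u: "u \<in> \<sigma>" "u \<noteq> 0"
    using d dim_eq_0[of \<sigma>] by fastforce
  have "span {u} = span \<sigma>"
    using u d by (intro dim_eq_span) (auto simp: dim_insert)
  have "x \<in> ray u" if x: "x \<in> \<sigma>" for x
  proof -
    obtain c where c: "x = c *\<^sub>R u"
      using span_base[OF x] \<open>span {u} = span \<sigma>\<close> by (auto simp: span_singleton)
    have "c \<ge> 0"
    proof (rule ccontr)
      assume "\<not> c \<ge> 0"
      then have "(- (1 / c)) *\<^sub>R x \<in> \<sigma>"
        using pointed_cone_facts(3)[OF \<sigma>, of "- (1/c)" x] x by (simp add: divide_nonneg_neg)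
      moreover have "(- (1 / c)) *\<^sub>R x = - u"
        using c \<open>\<not> c \<ge> 0\<close> by simp
      ultimately show False
        using pointed_cone_facts(4)[OF \<sigma> u(1)] u(2) by simp
    qed
    then show ?thesis using c by (auto simp: ray_def)
  qed
  moreover have "ray u \<subseteq> \<sigma>"
    using u(1) pointed_cone_facts(3)[OF \<sigma>] by (auto simp: ray_def)
  ultimately show thesis
    using that u(2) by blast
qed

lemma convex_cone_sum: "convex_cone \<sigma> \<Longrightarrow> (\<And>i. i \<in> I \<Longrightarrow> f i \<in> \<sigma>) \<Longrightarrow> sum f I \<in> \<sigma>"
  by (induct I rule: infinite_finite_induct) (auto simp: convex_cone_iff)

text \<open>A hyperplane on which \<open>h\<close> equals 1 cuts the cone in a compact convex set of
  dimension at most one, that is, a segment; its end points generate the cone.\<close>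

lemma dim2_cone:
  assumes rat: "rational_cone N \<sigma>" and d: "dim \<sigma> = 2"
  obtains u v where "indep2 u v" "\<sigma> = quad u v"
proof -
  obtain S where S: "finite S" "\<sigma> = convex_cone hull S"
    using rat by (auto simp: rational_cone_def)
  note \<sigma> = rational_cone_pointed(1)[OF rat]
  define S' where "S' = S - {0}"
  have fS': "finite S'" and S'\<sigma>: "S' \<subseteq> \<sigma>"
    using S hull_subset[of S convex_cone] by (auto simp: S'_def)
  have "S' \<noteq> {}"
  proof
    assume "S' = {}"
    then have "S \<subseteq> {0}" by (auto simp: S'_def)
    then have "\<sigma> \<subseteq> {0}" unfolding S(2) by (rule hull_minimal) simp
    then show False using d dim_eq_0[of \<sigma>] by simp
  qed
  \<comment> \<open>A convex combination equal to 0 would put a positive multiple of a generator and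
    its negative into the cone, against strict convexity. Hence some linear functional is positive
    on all nonzero generators.\<close>
  have "0 \<notin> convex hull S'"
  proof
    assume "0 \<in> convex hull S'"
    then obtain c where c: "\<forall>x\<in>S'. 0 \<le> c x" "sum c S' = 1" "(\<Sum>x\<in>S'. c x *\<^sub>R x) = 0"
      by (auto simp: convex_hull_finite[OF fS'])
    obtain s where s: "s \<in> S'" "c s > 0"
      using c(1,2) by (metis less_eq_real_def sum.neutral zero_neq_one)
    have "(\<Sum>x\<in>S'-{s}. c x *\<^sub>R x) \<in> \<sigma>"
      using c(1) S'\<sigma> by (intro convex_cone_sum) (auto simp: S(2) convex_cone_convex_cone_hull intro!: convex_cone_scaleR)
    moreover have "(\<Sum>x\<in>S'. c x *\<^sub>R x) = c s *\<^sub>R s + (\<Sum>x\<in>S'-{s}. c x *\<^sub>R x)"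
      using fS' s(1) by (simp add: sum.remove)
    ultimately have "- (c s *\<^sub>R s) \<in> \<sigma>"
      using c(3) by (simp add: add_eq_0_iff)
    moreover have "c s *\<^sub>R s \<in> \<sigma>"
      using s S'\<sigma> pointed_cone_facts(3)[OF \<sigma>, of "c s" s] by auto
    ultimately have "c s *\<^sub>R s = 0"
      using pointed_cone_facts(4)[OF \<sigma>] by blast
    then show False
      using s by (auto simp: S'_def)
  qed
  then obtain h b where h: "0 < b" "\<And>x. x \<in> convex hull S' \<Longrightarrow> h \<bullet> x > b"
    using separating_hyperplane_closed_0[of "convex hull S'"] fS'
    by (metis compact_convex_hull compact_imp_closed convex_convex_hull finite_imp_compact)
  have h_pos: "h \<bullet> s > 0" if "s \<in> S'" for s
    using h(1) h(2)[OF hull_inc[OF that]] by linarith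
  \<comment> \<open>The generators are rescaled to height 1 with respect to
    \<open>h\<close>.\<close>
  define K where "K = convex hull ((\<lambda>s. (1 / (h \<bullet> s)) *\<^sub>R s) ` S')"
  have hK: "h \<bullet> x = 1" if "x \<in> K" for x
  proof -
    have "convex {x. h \<bullet> x = 1}"
      by (rule convex_hyperplane)
    then have "K \<subseteq> {x. h \<bullet> x = 1}"
      unfolding K_def using h_pos by (intro hull_minimal) force+
    then show ?thesis using that by blast
  qed
  have K\<sigma>: "K \<subseteq> \<sigma>"
    unfolding K_def using S'\<sigma> h_pos pointed_cone_facts(3,5)[OF \<sigma>]
    by (intro hull_minimal) (auto simp: less_imp_le)
  have "aff_dim K \<le> 1"
  proof -
    have "affine {x. h \<bullet> x = 1}"
      by (rule affine_hyperplane)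
    then have "affine hull K \<subseteq> {x. h \<bullet> x = 1}"
      using hK by (intro hull_minimal) auto
    then have "0 \<notin> affine hull K"
      by auto
    \<comment> \<open>The hyperplane misses the origin, so adding 0 to \<open>K\<close> raises the
      affine dimension by one.\<close>
    then have "aff_dim K + 1 = aff_dim (insert 0 K)"
      by (simp add: aff_dim_insert)
    also have "\<dots> = int (dim (insert 0 K))"
      by (intro aff_dim_zero hull_inc) simp
    also have "\<dots> \<le> int (dim \<sigma>)"
      using K\<sigma> pointed_cone_facts(1)[OF \<sigma>] by (intro iffD2[OF of_nat_le_iff] dim_subset) auto
    finally show ?thesis using d by simp
  qed
  moreover have "K \<noteq> {}" "compact K" "convex K"
    using \<open>S' \<noteq> {}\<close> fS' by (auto simp: K_def intro: finite_imp_compact_convex_hull)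
  ultimately obtain p q where pq: "K = closed_segment p q"
    using compact_convex_collinear_segment[of K] by (auto simp: collinear_aff_dim)
  then have pq\<sigma>: "p \<in> \<sigma>" "q \<in> \<sigma>"
    using K\<sigma> by auto
  have "S \<subseteq> quad p q"
  proof
    fix s assume "s \<in> S"
    show "s \<in> quad p q"
    proof (cases "s = 0")
      case True
      then show ?thesis using convex_cone_contains_0[OF convex_cone_quad] by simp
    next
      case False
      then have s: "s \<in> S'" using \<open>s \<in> S\<close> by (simp add: S'_def)
      then have "(1 / (h \<bullet> s)) *\<^sub>R s \<in> closed_segment p q"
        unfolding pq[symmetric] K_def by (intro hull_inc) blast
      then obtain u where "0 \<le> u" "u \<le> 1" "(1 / (h \<bullet> s)) *\<^sub>R s = (1 - u) *\<^sub>R p + u *\<^sub>R q"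
        by (auto simp: in_segment)
      then have "(1 / (h \<bullet> s)) *\<^sub>R s \<in> quad p q"
        using quadI[of "1 - u" u p q] by simp
      then have "(h \<bullet> s) *\<^sub>R ((1 / (h \<bullet> s)) *\<^sub>R s) \<in> quad p q"
        using convex_cone_scaleR[OF convex_cone_quad _ \<open>(1 / (h \<bullet> s)) *\<^sub>R s \<in> quad p q\<close>, of "h \<bullet> s"] h_pos[OF s]
        by linarith
      moreover have "(h \<bullet> s) *\<^sub>R ((1 / (h \<bullet> s)) *\<^sub>R s) = s"
        using h_pos[OF s] by simp
      ultimately show ?thesis by metis
    qed
  qed
  then have "\<sigma> \<subseteq> quad p q"
    unfolding S(2) by (intro hull_minimal convex_cone_quad)
  moreover have "quad p q \<subseteq> \<sigma>"
    using pq\<sigma> pointed_cone_facts(2,3)[OF \<sigma>] by (auto simp: quad_def)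
  ultimately have eq: "\<sigma> = quad p q" by blast
  then have "dim {p, q} = 2"
    using d by (metis dim_span span_quad)
  then show thesis
    using that[OF indep2_dim eq] by blast
qed

text \<open>The face is spanned by a nonnegative combination of \<open>u\<close> and
  \<open>v\<close> and contains both summands; if both were nonzero it would have dimension
  two.\<close>

lemma quad_cases:
  fixes u v :: "'a::euclidean_space"
  assumes "F face_of quad u v" "indep2 u v" "dim F = 1"
  shows "F = ray u \<or> F = ray v"
proof -
  note P = pointed_cone_quad[OF assms(2)]
  have ne: "F \<noteq> {}"
    using assms(3) by auto
  note F = face_of_pointed_cone[OF P assms(1) ne]
  obtain x where x: "x \<noteq> 0" "F = ray x"
    using dim1_cone[OF F(1) assms(3)] .
  then have "x \<in> quad u v"
    using F(2) ray_base by blast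
  then obtain a b where ab: "x = a *\<^sub>R u + b *\<^sub>R v" "a \<ge> 0" "b \<ge> 0"
    by (auto simp: quad_def)
  have "a *\<^sub>R u \<in> quad u v" "b *\<^sub>R v \<in> quad u v"
    using quadI[of a 0 u v] quadI[of 0 b u v] ab by auto
  then have in_F: "a *\<^sub>R u \<in> F" "b *\<^sub>R v \<in> F"
    using F(3)[of "a *\<^sub>R u" "b *\<^sub>R v"] ab(1) x(2) ray_base by auto
  consider "a = 0" | "b = 0" | "a > 0" "b > 0"
    using ab by linarith
  then show ?thesis
  proof cases
    case 1
    then show ?thesis using ab x ray_scale[of b v] by (cases "b = 0") auto
  next
    case 2
    then show ?thesis using ab x ray_scale[of a u] by (cases "a = 0") auto
  next
    case 3
    have "(1 / a) *\<^sub>R (a *\<^sub>R u) \<in> F" "(1 / b) *\<^sub>R (b *\<^sub>R v) \<in> F"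
      using in_F 3 pointed_cone_facts(3)[OF F(1)] by (auto simp del: scaleR_scaleR)
    then have "{u, v} \<subseteq> F" using 3 by simp
    then have "dim {u, v} \<le> dim F" by (rule dim_subset)
    then show ?thesis using assms(2,3) by (simp add: dim_indep2)
  qed
qed

lemma ray_face_quad:
  fixes u v :: "'a::euclidean_space"
  assumes "indep2 u v"
  shows "ray u face_of quad u v"
proof (rule face_of_pointed_coneI[OF pointed_cone_quad[OF assms] _ convex_cone_ray])
  show "ray u \<subseteq> quad u v"
    using quadI[of _ 0 u v] by (auto simp: ray_def)
  fix x y assume "x \<in> quad u v" "y \<in> quad u v" "x + y \<in> ray u"
  then obtain a b a' b' c where ab: "x = a *\<^sub>R u + b *\<^sub>R v" "y = a' *\<^sub>R u + b' *\<^sub>R v" "x + y = c *\<^sub>R u"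
      "a \<ge> 0" "b \<ge> 0" "a' \<ge> 0" "b' \<ge> 0"
    unfolding quad_def ray_def by blast
  then have "(a + a') *\<^sub>R u + (b + b') *\<^sub>R v = c *\<^sub>R u + 0 *\<^sub>R v"
    by (simp add: algebra_simps)
  then have "b + b' = 0"
    by (rule indep2_eqD(2)[OF assms])
  then have "b = 0" "b' = 0" using ab by auto
  then show "x \<in> ray u \<and> y \<in> ray u"
    using ab by (auto simp: ray_def)
qed

lemma ray_eq_indep2: "indep2 u v \<Longrightarrow> ray u \<noteq> ray v"
  using indep2_not_span[of u v] ray_base[of u] by (auto simp: ray_def span_singleton)

lemma zero_face_of: "pointed_cone \<sigma> \<Longrightarrow> {0} face_of \<sigma>"
proof (rule face_of_pointed_coneI)
  assume \<sigma>: "pointed_cone \<sigma>"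
  show "{0} \<subseteq> \<sigma>" using pointed_cone_facts(1)[OF \<sigma>] by simp
  fix x y assume xy: "x \<in> \<sigma>" "y \<in> \<sigma>" "x + y \<in> {0}"
  then have "y = - x" by (simp add: add_eq_0_iff)
  then have "x = 0" using xy pointed_cone_facts(4)[OF \<sigma>] by blast
  then show "x \<in> {0} \<and> y \<in> {0}" using \<open>y = - x\<close> by simp
qed auto

lemma subgroup_gen_subset_span: "subgroup_gen B \<subseteq> span B" for B :: "'a::real_vector set"
  by (rule subgroup_gen_minimal) (auto simp: add_subgroup_def span_base span_zero span_diff)

lemma subgroup_gen_ring_1: "subgroup_gen {g} = {of_int n * g | n. True}" for g :: "'b::comm_ring_1"
proof
  have "x - y \<in> {of_int n * g | n. True}" if xy: "x \<in> {of_int n * g | n. True}" "y \<in> {of_int n * g | n. True}" for x y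
  proof -
    obtain n m where "x = of_int n * g" "y = of_int m * g" using xy by blast
    then have "x - y = of_int (n - m) * g" by (simp add: algebra_simps)
    then show ?thesis by blast
  qed
  moreover have "0 \<in> {of_int n * g | n. True}"
    by (rule CollectI, rule exI[of _ 0]) simp
  ultimately have "add_subgroup {of_int n * g | n. True}"
    by (simp add: add_subgroup_def)
  moreover have "g \<in> {of_int n * g | n. True}"
    by (rule CollectI, rule exI[of _ 1]) simp
  ultimately show "subgroup_gen {g} \<subseteq> {of_int n * g | n. True}"
    by (intro subgroup_gen_minimal) blast+
  show "{of_int n * g | n. True} \<subseteq> subgroup_gen {g}"
    by (auto intro: add_subgroup_of_int_mult[OF add_subgroup_gen] subgroup_gen_base)
qed

lemma of_int_scaleR_eq:
  fixes u :: "'a::real_vector"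
  shows "(of_int n :: real) *\<^sub>R u = of_int m *\<^sub>R u \<Longrightarrow> u \<noteq> 0 \<Longrightarrow> n = m"
  by (simp only: scaleR_cancel_right of_int_eq_iff) simp

locale fan2 =
  fixes N :: "'a::euclidean_space set" and \<Sigma> :: "'a set set" and ori :: "'a set \<Rightarrow> 'a list"
  assumes lattice: "is_lattice N" and fan: "fan N \<Sigma>" and fan_dim_2: "fan_dim \<Sigma> = 2"
    and ori: "orientation N \<Sigma> ori"
begin

lemma finite_fan: "finite \<Sigma>"
  and cone_pointed: "\<sigma> \<in> \<Sigma> \<Longrightarrow> pointed_cone \<sigma>"
  and cone_closed: "\<sigma> \<in> \<Sigma> \<Longrightarrow> closed \<sigma>"
  and cone_rational: "\<sigma> \<in> \<Sigma> \<Longrightarrow> rational_cone N \<sigma>"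
  and face_in_fan: "\<sigma> \<in> \<Sigma> \<Longrightarrow> \<tau> face_of \<sigma> \<Longrightarrow> \<tau> \<noteq> {} \<Longrightarrow> \<tau> \<in> \<Sigma>"
  and Int_face: "\<sigma> \<in> \<Sigma> \<Longrightarrow> \<sigma>' \<in> \<Sigma> \<Longrightarrow> \<sigma> \<inter> \<sigma>' face_of \<sigma>"
  and Int_face2: "\<sigma> \<in> \<Sigma> \<Longrightarrow> \<sigma>' \<in> \<Sigma> \<Longrightarrow> \<sigma> \<inter> \<sigma>' face_of \<sigma>'"
proof -
  have f: "finite \<Sigma>" "\<And>\<sigma>. \<sigma> \<in> \<Sigma> \<Longrightarrow> rational_cone N \<sigma>"
    "\<And>\<sigma> \<tau>. \<sigma> \<in> \<Sigma> \<Longrightarrow> \<tau> face_of \<sigma> \<Longrightarrow> \<tau> \<noteq> {} \<Longrightarrow> \<tau> \<in> \<Sigma>"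
    "\<And>\<sigma> \<sigma>'. \<sigma> \<in> \<Sigma> \<Longrightarrow> \<sigma>' \<in> \<Sigma> \<Longrightarrow> (\<sigma> \<inter> \<sigma>') face_of \<sigma> \<and> (\<sigma> \<inter> \<sigma>') face_of \<sigma>'"
    using fan[unfolded fan_def, THEN conjunct1] fan[unfolded fan_def, THEN conjunct2, THEN conjunct2, THEN conjunct1, THEN bspec]
      fan[unfolded fan_def, THEN conjunct2, THEN conjunct2, THEN conjunct2, THEN conjunct1, THEN bspec, THEN spec, THEN mp, OF _ conjI]
      fan[unfolded fan_def, THEN conjunct2, THEN conjunct2, THEN conjunct2, THEN conjunct2, THEN conjunct1, THEN bspec, THEN bspec]
    by - assumption+
  show "finite \<Sigma>" by (rule f(1))
  show "\<sigma> \<in> \<Sigma> \<Longrightarrow> pointed_cone \<sigma>" "\<sigma> \<in> \<Sigma> \<Longrightarrow> closed \<sigma>" "\<sigma> \<in> \<Sigma> \<Longrightarrow> rational_cone N \<sigma>"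
    using f(2) rational_cone_pointed by blast+
  show "\<sigma> \<in> \<Sigma> \<Longrightarrow> \<tau> face_of \<sigma> \<Longrightarrow> \<tau> \<noteq> {} \<Longrightarrow> \<tau> \<in> \<Sigma>" by (rule f(3))
  show "\<sigma> \<in> \<Sigma> \<Longrightarrow> \<sigma>' \<in> \<Sigma> \<Longrightarrow> \<sigma> \<inter> \<sigma>' face_of \<sigma>" "\<sigma> \<in> \<Sigma> \<Longrightarrow> \<sigma>' \<in> \<Sigma> \<Longrightarrow> \<sigma> \<inter> \<sigma>' face_of \<sigma>'"
    using f(4) by blast+
qed

lemma zero_in_cone: "\<sigma> \<in> \<Sigma> \<Longrightarrow> 0 \<in> \<sigma>"
  using pointed_cone_facts(1)[OF cone_pointed] .

lemma dim_le_2: "\<sigma> \<in> \<Sigma> \<Longrightarrow> dim \<sigma> \<le> 2"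
  using Max_ge[OF finite_imageI[OF finite_fan, of dim] imageI[of \<sigma> \<Sigma> dim]] fan_dim_2 unfolding fan_dim_def by metis

lemma cones_empty: "q > 2 \<Longrightarrow> cones \<Sigma> q = {}"
  using dim_le_2 by (fastforce simp: cones_def)

lemma finite_cones [simp]: "finite (cones \<Sigma> q)"
  using finite_fan by (simp add: cones_def)

lemma coneD: "\<sigma> \<in> cones \<Sigma> q \<Longrightarrow> \<sigma> \<in> \<Sigma>"
  and cone_dim: "\<sigma> \<in> cones \<Sigma> q \<Longrightarrow> dim \<sigma> = q"
  by (auto simp: cones_def)

lemma face_refl: "\<sigma> \<in> \<Sigma> \<Longrightarrow> \<sigma> face_of \<sigma>"
  using face_of_refl pointed_cone_facts(5)[OF cone_pointed] by blast

lemma zero_face: "\<sigma> \<in> \<Sigma> \<Longrightarrow> {0} face_of \<sigma>"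
  using zero_face_of[OF cone_pointed] .

lemma zero_in_fan: "{0} \<in> \<Sigma>"
  using fan zero_face face_in_fan by (fastforce simp: fan_def)

lemma cones_0: "cones \<Sigma> 0 = {{0}}"
  using zero_in_fan zero_in_cone by (auto simp: cones_def)

lemma ray_obtain:
  assumes "\<rho> \<in> cones \<Sigma> 1"
  obtains u where "u \<noteq> 0" "\<rho> = ray u"
  using dim1_cone[OF cone_pointed[OF coneD[OF assms]] cone_dim[OF assms]] by metis

lemma quad_obtain:
  assumes "\<alpha> \<in> cones \<Sigma> 2"
  obtains u v where "indep2 u v" "\<alpha> = quad u v"
  using dim2_cone[OF cone_rational[OF coneD[OF assms]] cone_dim[OF assms]] by metis

lemma quad_ray_obtain:
  assumes "\<alpha> \<in> cones \<Sigma> 2" "\<rho> \<in> cones \<Sigma> 1" "\<rho> face_of \<alpha>"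
  obtains u v where "indep2 u v" "\<alpha> = quad u v" "\<rho> = ray u"
proof -
  obtain u v where uv: "indep2 u v" "\<alpha> = quad u v"
    using quad_obtain[OF assms(1)] .
  then consider "\<rho> = ray u" | "\<rho> = ray v"
    using quad_cases[of \<rho> u v] assms cone_dim by blast
  then show thesis
    using that uv indep2_swap quad_swap by metis
qed

lemma facets_quad:
  assumes "indep2 u v" "quad u v \<in> \<Sigma>"
  shows "{\<rho> \<in> cones \<Sigma> 1. \<rho> face_of quad u v} = {ray u, ray v}"
proof -
  have f: "ray u face_of quad u v" "ray v face_of quad u v"
    using ray_face_quad[OF assms(1)] ray_face_quad[OF indep2_swap[OF assms(1)]] by (auto simp: quad_swap)
  have "ray u \<in> \<Sigma>" "ray v \<in> \<Sigma>"
    using face_in_fan[OF assms(2) f(1)] face_in_fan[OF assms(2) f(2)] ray_base by blast+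
  then have "ray u \<in> cones \<Sigma> 1" "ray v \<in> cones \<Sigma> 1"
    using dim_ray indep2_nonzero[OF assms(1)] by (auto simp: cones_def)
  then show ?thesis
    using f quad_cases[OF _ assms(1)] cone_dim by blast
qed

text \<open>Among the cones that contain \<open>\<sigma>\<close> as a face, one of largest dimension
  is maximal in the fan, and pure dimensionality applies to it.\<close>

lemma in_facet: "\<sigma> \<in> \<Sigma> \<Longrightarrow> \<exists>\<alpha>\<in>cones \<Sigma> 2. \<sigma> face_of \<alpha>"
proof -
  assume \<sigma>: "\<sigma> \<in> \<Sigma>"
  let ?K = "{\<kappa> \<in> \<Sigma>. \<sigma> face_of \<kappa>}"
  have "finite ?K" "?K \<noteq> {}"
    using finite_fan \<sigma> face_refl by auto
  then have "Max (dim ` ?K) \<in> dim ` ?K"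
    by (intro Max_in) auto
  then obtain \<kappa> where \<kappa>: "\<kappa> \<in> ?K" "dim \<kappa> = Max (dim ` ?K)"
    by auto
  have "\<kappa>' = \<kappa>" if "\<kappa>' \<in> \<Sigma>" "\<kappa> face_of \<kappa>'" for \<kappa>'
  proof -
    have "\<kappa>' \<in> ?K"
      using that \<kappa>(1) face_of_trans by blast
    then have "dim \<kappa>' \<le> dim \<kappa>"
      using \<kappa>(2) \<open>finite ?K\<close> by simp
    moreover have "dim \<kappa> \<le> dim \<kappa>'"
      using that(2) dim_subset face_of_imp_subset by blast
    ultimately show ?thesis
      using face_of_dim_eq[OF cone_pointed[OF that(1)] that(2)] zero_in_cone[of \<kappa>] \<kappa>(1) by auto
  qed
  then have "dim \<kappa> = 2"
    using fan \<kappa>(1) fan_dim_2 by (simp add: fan_def)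
  then show ?thesis
    using \<kappa>(1) by (auto simp: cones_def)
qed

text \<open>The intersection is a face of both cones; containing two independent vectors it has full
  dimension, so it equals both.\<close>

lemma facet_overlap:
  assumes "\<alpha> \<in> cones \<Sigma> 2" "\<beta> \<in> cones \<Sigma> 2" "{x, y} \<subseteq> \<alpha> \<inter> \<beta>" "indep2 x y"
  shows "\<alpha> = \<beta>"
proof -
  have "2 \<le> dim (\<alpha> \<inter> \<beta>)"
    using dim_subset[OF assms(3)] dim_indep2[OF assms(4)] by simp
  moreover have "dim (\<alpha> \<inter> \<beta>) \<le> 2"
    using dim_subset[of "\<alpha> \<inter> \<beta>" \<alpha>] cone_dim[OF assms(1)] by simp
  ultimately have d: "dim (\<alpha> \<inter> \<beta>) = 2" by simp
  have ab: "\<alpha> \<in> \<Sigma>" "\<beta> \<in> \<Sigma>" "dim \<alpha> = 2" "dim \<beta> = 2" and ne: "\<alpha> \<inter> \<beta> \<noteq> {}"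
    using coneD[OF assms(1)] coneD[OF assms(2)] cone_dim[OF assms(1)] cone_dim[OF assms(2)] assms(3) by auto
  have "\<alpha> \<inter> \<beta> = \<alpha>"
    using face_of_dim_eq[OF cone_pointed[OF ab(1)] Int_face[OF ab(1,2)] ne] d ab by simp
  moreover have "\<alpha> \<inter> \<beta> = \<beta>"
    using face_of_dim_eq[OF cone_pointed[OF ab(2)] Int_face2[OF ab(1,2)] ne] d ab by simp
  ultimately show ?thesis by simp
qed

lemma face_same_dim: "\<sigma> \<in> \<Sigma> \<Longrightarrow> \<tau> \<in> \<Sigma> \<Longrightarrow> \<tau> face_of \<sigma> \<Longrightarrow> dim \<tau> = dim \<sigma> \<Longrightarrow> \<tau> = \<sigma>"
  using face_of_dim_eq[OF cone_pointed] zero_in_cone by blast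

lemma facets_of_facet: "\<alpha> \<in> cones \<Sigma> 2 \<Longrightarrow> {\<beta> \<in> cones \<Sigma> 2. \<alpha> face_of \<beta>} = {\<alpha>}"
  using face_same_dim face_refl coneD cone_dim by (auto; metis)

lemma lattice_subgroup: "add_subgroup N"
  using lattice by (auto simp: is_lattice_def)

text \<open>The cone is generated by lattice vectors, and these lie in the group generated by
  \<open>ori \<sigma>\<close>.\<close>

lemma ori_span: "\<sigma> \<in> \<Sigma> \<Longrightarrow> span (set (ori \<sigma>)) = span \<sigma>"
  and ori_length: "\<sigma> \<in> \<Sigma> \<Longrightarrow> length (ori \<sigma>) = dim \<sigma>"
  and ori_gen: "\<sigma> \<in> \<Sigma> \<Longrightarrow> subgroup_gen (set (ori \<sigma>)) = cone_lattice N \<sigma>"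
proof -
  assume \<sigma>: "\<sigma> \<in> \<Sigma>"
  have o: "distinct (ori \<sigma>)" "independent (set (ori \<sigma>))" "subgroup_gen (set (ori \<sigma>)) = cone_lattice N \<sigma>"
    using ori \<sigma> by (auto simp: orientation_def)
  show "subgroup_gen (set (ori \<sigma>)) = cone_lattice N \<sigma>" by fact
  obtain S where S: "S \<subseteq> N" "\<sigma> = convex_cone hull S"
    using cone_rational[OF \<sigma>] by (auto simp: rational_cone_def)
  have "S \<subseteq> N \<inter> span \<sigma>"
    using S hull_subset[of S convex_cone] span_superset[of \<sigma>] by blast
  then have "S \<subseteq> span (set (ori \<sigma>))"
    using o(3) subgroup_gen_subset_span[of "set (ori \<sigma>)"] by (auto simp: cone_lattice_def)
  then have "\<sigma> \<subseteq> span (set (ori \<sigma>))"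
    unfolding S(2) by (intro hull_minimal convex_cone_span)
  moreover have "set (ori \<sigma>) \<subseteq> span \<sigma>"
    using o(3) subgroup_gen_superset[of "set (ori \<sigma>)"] by (auto simp: cone_lattice_def)
  ultimately show s: "span (set (ori \<sigma>)) = span \<sigma>"
    by (simp add: span_eq)
  then show "length (ori \<sigma>) = dim \<sigma>"
    using o(1,2) by (metis dim_eq_card_independent dim_span distinct_card)
qed

text \<open>For a ray, a generator of the lattice on its line. The sign is dictated by the
  orientation, so the vector may point away from the ray.\<close>

definition edge :: "'a set \<Rightarrow> 'a" where
  "edge \<rho> = hd (ori \<rho>)"

lemma ori_ray:
  assumes "\<rho> \<in> cones \<Sigma> 1"
  shows "ori \<rho> = [edge \<rho>]" "edge \<rho> \<noteq> 0" "span \<rho> = span {edge \<rho>}"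
    and "cone_lattice N \<rho> = {of_int n *\<^sub>R edge \<rho> | n. True}"
proof -
  have l: "length (ori \<rho>) = 1"
    using ori_length[OF coneD[OF assms]] cone_dim[OF assms] by simp
  then show o: "ori \<rho> = [edge \<rho>]"
    by (cases "ori \<rho>") (auto simp: edge_def)
  show s: "span \<rho> = span {edge \<rho>}"
    using ori_span[OF coneD[OF assms]] o by simp
  show "edge \<rho> \<noteq> 0"
  proof
    assume "edge \<rho> = 0"
    then have "dim \<rho> = 0"
      using s by (metis dim_singleton dim_span)
    then show False using cone_dim[OF assms] by simp
  qed
  show "cone_lattice N \<rho> = {of_int n *\<^sub>R edge \<rho> | n. True}"
    using ori_gen[OF coneD[OF assms]] o by (simp add: subgroup_gen_1)
qed

lemma ori_facet:
  assumes "\<alpha> \<in> cones \<Sigma> 2"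
  obtains x y where "ori \<alpha> = [x, y]" "indep2 x y" "span \<alpha> = span {x, y}"
    "cone_lattice N \<alpha> = {of_int n *\<^sub>R x + of_int m *\<^sub>R y | n m. True}"
proof -
  have "length (ori \<alpha>) = 2"
    using ori_length[OF coneD[OF assms]] cone_dim[OF assms] by simp
  then obtain x y where o: "ori \<alpha> = [x, y]"
    by (metis (no_types, lifting) One_nat_def Suc_1 length_0_conv length_Suc_conv)
  have s: "span \<alpha> = span {x, y}"
    using ori_span[OF coneD[OF assms]] o by simp
  have "indep2 x y"
    using s cone_dim[OF assms] by (metis dim_span indep2_dim)
  moreover have "cone_lattice N \<alpha> = {of_int n *\<^sub>R x + of_int m *\<^sub>R y | n m. True}"
    using ori_gen[OF coneD[OF assms]] o by (simp add: subgroup_gen_2)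
  ultimately show thesis
    using that o s by blast
qed

lemma cone_lattice_mono: "\<sigma> face_of \<kappa> \<Longrightarrow> cone_lattice N \<sigma> \<subseteq> cone_lattice N \<kappa>"
  using face_of_imp_subset[of \<sigma> \<kappa>] span_mono[of \<sigma> \<kappa>] by (auto simp: cone_lattice_def)

lemma add_subgroup_cone_lattice: "add_subgroup (cone_lattice N \<sigma>)"
  using lattice_subgroup by (auto simp: add_subgroup_def cone_lattice_def span_zero span_diff)

lemma edge_in_lattice: "\<rho> \<in> cones \<Sigma> 1 \<Longrightarrow> edge \<rho> \<in> cone_lattice N \<rho>"
  using ori_gen[OF coneD] ori_ray(1) subgroup_gen_base[of "edge \<rho>" "{edge \<rho>}"] by (metis empty_set insertI1 list.simps(15))

text \<open>A primitive vector of a lattice of rank two is part of a basis, and the second basis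
  vector can be chosen to match the given orientation.\<close>

lemma edge_complement:
  assumes "\<rho> \<in> cones \<Sigma> 1" "\<alpha> \<in> cones \<Sigma> 2" "\<rho> face_of \<alpha>"
  obtains f where "f \<in> cone_lattice N \<alpha>" "wedge [edge \<rho>, f] = wedge (ori \<alpha>)"
proof -
  obtain x y where xy: "ori \<alpha> = [x, y]" "indep2 x y"
    "cone_lattice N \<alpha> = {of_int n *\<^sub>R x + of_int m *\<^sub>R y | n m. True}"
    using ori_facet[OF assms(2)] .
  note L = add_subgroup_cone_lattice[of \<alpha>]
  have "edge \<rho> \<in> cone_lattice N \<alpha>"
    using cone_lattice_mono[OF assms(3)] edge_in_lattice[OF assms(1)] by blast
  then obtain a b where e: "edge \<rho> = of_int a *\<^sub>R x + of_int b *\<^sub>R y"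
    using xy(3) by blast
  \<comment> \<open>Dividing \<open>edge \<rho>\<close> by the gcd of its coordinates gives a
    lattice vector on the line of the ray, which is again an integer multiple of
    \<open>edge \<rho>\<close>.\<close>
  have "gcd a b = 1"
  proof -
    let ?g = "gcd a b"
    obtain a' b' where ab': "a = ?g * a'" "b = ?g * b'"
      by (metis dvdE gcd_dvd1 gcd_dvd2)
    define e' where "e' = of_int a' *\<^sub>R x + of_int b' *\<^sub>R y"
    have ee': "edge \<rho> = of_int ?g *\<^sub>R e'"
      unfolding e e'_def by (subst ab'(1), subst ab'(2)) (simp add: scaleR_add_right)
    have g0: "?g \<noteq> 0"
    proof
      assume "?g = 0"
      then have "edge \<rho> = 0" by (subst ee') (simp only: of_int_0 scaleR_zero_left)
      then show False using ori_ray(2)[OF assms(1)] by simp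
    qed
    have "e' \<in> cone_lattice N \<alpha>"
      unfolding xy(3) e'_def by blast
    moreover have "e' = (1 / of_int ?g) *\<^sub>R edge \<rho>"
      using g0 by (subst ee') (simp del: gcd_eq_0_iff)
    then have "e' \<in> span \<rho>"
      unfolding ori_ray(3)[OF assms(1)] by (simp add: span_base span_scale)
    ultimately have "e' \<in> cone_lattice N \<rho>"
      by (auto simp: cone_lattice_def)
    then obtain n where "e' = of_int n *\<^sub>R edge \<rho>"
      using ori_ray(4)[OF assms(1)] by blast
    then have "edge \<rho> = of_int (?g * n) *\<^sub>R edge \<rho>"
      using ee' by (metis of_int_mult scaleR_scaleR)
    then have "of_int 1 *\<^sub>R edge \<rho> = of_int (?g * n) *\<^sub>R edge \<rho>"
      by simp
    then have "1 = ?g * n"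
      using ori_ray(2)[OF assms(1)] by (rule of_int_scaleR_eq)
    then show ?thesis
      by (metis dvd_triv_left gcd_ge_0_int zdvd1_eq abs_of_nonneg)
  qed
  then obtain c d where cd: "c * a + d * b = 1"
    using bezout_int[of a b] by auto
  \<comment> \<open>With this choice the determinant of \<open>edge \<rho>\<close> and
    \<open>f\<close> in the basis \<open>x\<close>, \<open>y\<close> is the Bezout combination
    \<open>c * a + d * b\<close>, which equals 1.\<close>
  define f where "f = of_int (- d) *\<^sub>R x + of_int c *\<^sub>R y"
  have "wedge [edge \<rho>, f] us = of_int (c * a + d * b) * wedge [x, y] us" for us
    by (auto simp: e f_def wedge_2 inner_add_left algebra_simps)
  then have "wedge [edge \<rho>, f] = wedge (ori \<alpha>)"
    unfolding cd xy(1) by (simp add: fun_eq_iff)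
  moreover have "f \<in> cone_lattice N \<alpha>"
    unfolding xy(3) f_def by blast
  ultimately show thesis
    using that by blast
qed

text \<open>The generator \<open>wedge [edge \<rho>, f]\<close> of \<open>\<And>\<^sup>2 L(\<alpha>)\<close> depends only on \<open>edge \<rho>\<close> and on the side
  of \<open>\<rho>\<close> on which \<open>\<alpha>\<close> lies, not on the orientation of \<open>\<alpha>\<close>.\<close>

lemma signed_generator:
  assumes "\<rho> \<in> cones \<Sigma> 1" "\<alpha> \<in> cones \<Sigma> 2" "\<rho> face_of \<alpha>"
  obtains f where "f \<in> cone_lattice N \<alpha>" "indep2 (edge \<rho>) f"
    "of_int (rel_sign ori \<rho> \<alpha>) * wedge (ori \<alpha>) = wedge [edge \<rho>, f]"
    "\<And>x. x \<in> \<alpha> - \<rho> \<Longrightarrow> \<exists>c>0. wedge [edge \<rho>, x] = fscale c (wedge [edge \<rho>, f])"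
proof -
  obtain f where f: "f \<in> cone_lattice N \<alpha>" "wedge [edge \<rho>, f] = wedge (ori \<alpha>)"
    using edge_complement[OF assms] .
  obtain u v where uv: "indep2 u v" "\<alpha> = quad u v" "\<rho> = ray u"
    using quad_ray_obtain[OF assms(2,1,3)] .
  have "edge \<rho> \<in> span {u}"
    using ori_ray(3)[OF assms(1)] uv(3) span_ray span_base[of "edge \<rho>" "{edge \<rho>}"] by (metis insertI1)
  then obtain t where t: "edge \<rho> = t *\<^sub>R u"
    by (auto simp: span_singleton)
  have t0: "t \<noteq> 0"
    using t ori_ray(2)[OF assms(1)] by auto
  have "f \<in> span {u, v}"
    using f(1) uv(2) span_quad by (metis IntD2 cone_lattice_def)
  then obtain a b where ab: "f = a *\<^sub>R u + b *\<^sub>R v"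
    unfolding span_2 by blast
  have ef: "wedge [edge \<rho>, f] = fscale (t * b) (wedge [u, v])"
    by (simp add: t ab wedge_2 fun_eq_iff fscale_apply inner_add_left algebra_simps)
  have x: "wedge [edge \<rho>, c *\<^sub>R u + d *\<^sub>R v] = fscale (t * d) (wedge [u, v])" for c d
    by (simp add: t wedge_2 fun_eq_iff fscale_apply inner_add_left algebra_simps)
  have b0: "b \<noteq> 0"
  proof
    assume "b = 0"
    then have "wedge (ori \<alpha>) = 0" using ef f(2) by simp
    moreover obtain y z where "ori \<alpha> = [y, z]" "indep2 y z"
      using ori_facet[OF assms(2)] .
    ultimately show False using wedge_indep2[of y z] by simp
  qed
  have ind: "indep2 (edge \<rho>) s" if "s = f \<or> s = - f" for s
  proof -
    have "indep2 s (edge \<rho>)"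
    proof (rule not_span_indep2[OF ori_ray(2)[OF assms(1)]])
      show "s \<notin> span {edge \<rho>}"
      proof
        assume "s \<in> span {edge \<rho>}"
        then have "f \<in> span {edge \<rho>}" using that by (metis minus_minus span_neg)
        then obtain k where "f = k *\<^sub>R t *\<^sub>R u" unfolding t by (auto simp: span_singleton)
        then have "a *\<^sub>R u + b *\<^sub>R v = (k * t) *\<^sub>R u + 0 *\<^sub>R v" using ab by simp
        then show False using indep2_eqD(2)[OF uv(1)] b0 by blast
      qed
    qed
    then show ?thesis by (rule indep2_swap)
  qed
  have side: "\<exists>d>0. wedge [edge \<rho>, x] = fscale (d / b) (wedge [edge \<rho>, f])" if xs: "x \<in> \<alpha> - \<rho>" for x
  proof -
    obtain c d where cd: "x = c *\<^sub>R u + d *\<^sub>R v" "c \<ge> 0" "d \<ge> 0"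
      using xs uv(2) by (auto simp: quad_def)
    have "d \<noteq> 0" using xs cd uv(3) by (auto simp: ray_def)
    then show ?thesis
      using cd x[of c d] ef b0 by (intro exI[of _ d]) (simp add: fscale_apply fun_eq_iff)
  qed
  have v: "v \<in> \<alpha> - \<rho>"
    using uv quad_base(2)[of v u] indep2_not_span[OF indep2_swap[OF uv(1)]] by (auto simp: ray_def span_singleton)
  have W: "wedge (ori \<alpha>) \<noteq> 0"
    using ef f(2) wedge_indep2[OF uv(1)] t0 b0 by (simp add: fs.scale_eq_0_iff)
  \<comment> \<open>\<open>b\<close> is the coefficient of \<open>f\<close> along the inward
    direction \<open>v\<close>. Moving the outward vector \<open>- x\<close> behind
    \<open>edge \<rho>\<close> gives \<open>wedge [edge \<rho>, x]\<close>, which is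
    \<open>wedge (ori \<alpha>)\<close> times \<open>d / b\<close>; the factor \<open>t\<close>,
    which holds the direction of \<open>edge \<rho>\<close>, cancels.\<close>
  have rs: "rel_sign ori \<rho> \<alpha> = (if b > 0 then 1 else - 1)"
  proof -
    have "(\<exists>x\<in>\<alpha> - \<rho>. \<exists>c>0. wedge (- x # ori \<rho>) = (\<lambda>us. c * wedge (ori \<alpha>) us)) \<longleftrightarrow> b > 0"
    proof
      assume "\<exists>x\<in>\<alpha> - \<rho>. \<exists>c>0. wedge (- x # ori \<rho>) = (\<lambda>us. c * wedge (ori \<alpha>) us)"
      then obtain x c where xc: "x \<in> \<alpha> - \<rho>" "c > 0" "wedge [edge \<rho>, x] = fscale c (wedge (ori \<alpha>))"
        by (auto simp: ori_ray(1)[OF assms(1)] wedge_2_minus_left fscale_def)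
      obtain d where d: "d > 0" "wedge [edge \<rho>, x] = fscale (d / b) (wedge (ori \<alpha>))"
        using side[OF xc(1)] f(2) by auto
      then have "fscale (c - d / b) (wedge (ori \<alpha>)) = 0"
        using xc(3) by (simp add: fs.scale_left_diff_distrib)
      then have "c = d / b" using W by (simp add: fs.scale_eq_0_iff)
      then show "b > 0" using xc(2) d(1) by (metis zero_less_divide_iff less_asym)
    next
      assume "b > 0"
      obtain d where d: "d > 0" "wedge [edge \<rho>, v] = fscale (d / b) (wedge (ori \<alpha>))"
        using side[OF v] f(2) by auto
      show "\<exists>x\<in>\<alpha> - \<rho>. \<exists>c>0. wedge (- x # ori \<rho>) = (\<lambda>us. c * wedge (ori \<alpha>) us)"
        by (rule bexI[OF _ v], rule exI[of _ "d / b"])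
          (use d \<open>b > 0\<close> in \<open>simp add: ori_ray(1)[OF assms(1)] wedge_2_minus_left fscale_def\<close>)
    qed
    then show ?thesis by (simp add: rel_sign_def)
  qed
  show thesis
  proof (cases "b > 0")
    case True
    show thesis
    proof (rule that[OF f(1) ind])
      show "of_int (rel_sign ori \<rho> \<alpha>) * wedge (ori \<alpha>) = wedge [edge \<rho>, f]"
        using True rs f(2) by simp
      show "\<exists>c>0. wedge [edge \<rho>, x] = fscale c (wedge [edge \<rho>, f])" if "x \<in> \<alpha> - \<rho>" for x
        using side[OF that] True by (metis divide_pos_pos)
    qed simp
  next
    \<comment> \<open>Here \<open>f\<close> points away from \<open>\<alpha>\<close>, and
      \<open>- f\<close> is the required vector.\<close>
    case False
    have neg: "wedge [edge \<rho>, - f] = fscale (- 1) (wedge [edge \<rho>, f])"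
      by (simp add: wedge_2 fun_eq_iff fscale_apply)
    show thesis
    proof (rule that[of "- f"])
      show "- f \<in> cone_lattice N \<alpha>"
        using add_subgroup_uminus[OF add_subgroup_cone_lattice f(1)] .
      show "indep2 (edge \<rho>) (- f)" using ind by blast
      show "of_int (rel_sign ori \<rho> \<alpha>) * wedge (ori \<alpha>) = wedge [edge \<rho>, - f]"
        using False rs f(2) neg by (simp add: fun_eq_iff fscale_apply)
      show "\<exists>c>0. wedge [edge \<rho>, x] = fscale c (wedge [edge \<rho>, - f])" if x: "x \<in> \<alpha> - \<rho>" for x
      proof -
        obtain d where d: "d > 0" "wedge [edge \<rho>, x] = fscale (d / b) (wedge [edge \<rho>, f])"
          using side[OF x] by blast
        have "- (d / b) > 0" using d(1) False b0 by (simp add: divide_less_0_iff)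
        moreover have "wedge [edge \<rho>, x] = fscale (- (d / b)) (wedge [edge \<rho>, - f])"
          using d(2) neg by (simp add: fun_eq_iff fscale_apply)
        ultimately show ?thesis by blast
      qed
    qed
  qed
qed

lemma rel_sign_cases: "rel_sign ori \<tau> \<sigma> = 1 \<or> rel_sign ori \<tau> \<sigma> = - 1"
  by (simp add: rel_sign_def)

lemma ori_zero: "ori {0} = []"
  using ori_length[OF zero_in_fan] by simp

text \<open>The outward vector of the ray at the vertex is \<open>- u\<close>, so the sign is -1
  exactly when \<open>edge\<close> points into the ray.\<close>

lemma rel_sign_zero:
  assumes "ray u \<in> cones \<Sigma> 1" "u \<noteq> 0" "edge (ray u) = t *\<^sub>R u"
  shows "rel_sign ori {0} (ray u) = (if t > 0 then - 1 else 1)"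
proof -
  have t0: "t \<noteq> 0" using ori_ray(2)[OF assms(1)] assms(3) by auto
  have "(\<exists>x\<in>ray u - {0}. \<exists>c>0. wedge [- x] = (\<lambda>us. c * wedge [t *\<^sub>R u] us)) \<longleftrightarrow> \<not> t > 0"
  proof
    assume "\<exists>x\<in>ray u - {0}. \<exists>c>0. wedge [- x] = (\<lambda>us. c * wedge [t *\<^sub>R u] us)"
    then obtain x c where x: "x \<in> ray u" "x \<noteq> 0" "c > 0" "wedge [- x] = fscale c (wedge [t *\<^sub>R u])"
      by (auto simp: fscale_def)
    then have "wedge [- x] = wedge [c *\<^sub>R t *\<^sub>R u]" by (simp add: wedge_1_scale)
    then have eq: "- x = (c * t) *\<^sub>R u" by (metis unwedge_1_wedge scaleR_scaleR)
    obtain d where d: "x = d *\<^sub>R u" "d \<ge> 0" using x(1) by (auto simp: ray_def)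
    have "(- d) *\<^sub>R u = (c * t) *\<^sub>R u" using eq d by simp
    then have "- d = c * t" using assms(2) scaleR_cancel_right by blast
    then show "\<not> t > 0" using x(3) d(2) by (metis mult_pos_pos neg_0_less_iff_less not_less)
  next
    assume t: "\<not> t > 0"
    have "wedge [- u] = fscale (1 / - t) (wedge [t *\<^sub>R u])"
      using t0 by (simp add: wedge_1 fscale_apply fun_eq_iff)
    then show "\<exists>x\<in>ray u - {0}. \<exists>c>0. wedge [- x] = (\<lambda>us. c * wedge [t *\<^sub>R u] us)"
      using t t0 assms(2) ray_base[of u]
      by (intro bexI[of _ u] exI[of _ "1 / - t"]) (auto simp: fscale_def divide_less_0_iff)
  qed
  then show ?thesis
    by (simp add: rel_sign_def ori_ray(1)[OF assms(1)] ori_zero assms(3))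
qed

text \<open>The two ways from the cone to the vertex cancel. Each product of signs compares the
  orientation of the cone with the ordered pair of generators that begins with the ray in question,
  and exchanging the two rays reverses this pair.\<close>

lemma rel_sign_square:
  assumes "indep2 u v" "quad u v \<in> \<Sigma>"
  shows "rel_sign ori {0} (ray u) * rel_sign ori (ray u) (quad u v) +
    rel_sign ori {0} (ray v) * rel_sign ori (ray v) (quad u v) = 0"
proof -
  let ?\<alpha> = "quad u v"
  have \<alpha>: "?\<alpha> \<in> cones \<Sigma> 2"
    using assms dim_quad by (simp add: cones_def)
  have R: "ray u \<in> cones \<Sigma> 1" "ray u face_of ?\<alpha>" "ray v \<in> cones \<Sigma> 1" "ray v face_of ?\<alpha>"
    using facets_quad[OF assms] by blast+
  obtain x y where xy: "ori ?\<alpha> = [x, y]" "indep2 x y" "span ?\<alpha> = span {x, y}"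
    using ori_facet[OF \<alpha>] by metis
  have "x \<in> span {u, v}" "y \<in> span {u, v}"
    using xy(3) span_quad[of u v] span_base[of x "{x, y}"] span_base[of y "{x, y}"] by auto
  then obtain a b c d where abcd: "x = a *\<^sub>R u + b *\<^sub>R v" "y = c *\<^sub>R u + d *\<^sub>R v"
    unfolding span_2 by blast
  have W: "wedge (ori ?\<alpha>) = fscale (a * d - b * c) (wedge [u, v])"
    by (simp add: xy(1) abcd wedge_2 fun_eq_iff fscale_apply inner_add_left algebra_simps)
  have uv0: "wedge [u, v] \<noteq> 0" by (rule wedge_indep2[OF assms(1)])
  have k0: "a * d - b * c \<noteq> 0"
    using W wedge_indep2[OF xy(2)] xy(1) by auto
  \<comment> \<open>The orientation of \<open>ray p\<close> enters both signs and cancels; the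
    product is opposite in sign to \<open>k\<close>, which compares the orientation of the cone with
    the pair \<open>p\<close>, \<open>q\<close>.\<close>
  have main: "of_int (rel_sign ori {0} (ray p)) * of_int (rel_sign ori (ray p) ?\<alpha>) * k < 0"
    if p: "ray p \<in> cones \<Sigma> 1" "ray p face_of ?\<alpha>" "q \<in> ?\<alpha> - ray p" "p \<noteq> 0"
      "wedge (ori ?\<alpha>) = fscale k (wedge [p, q])" "wedge [p, q] \<noteq> 0" for p q and k :: real
  proof -
    obtain t where t: "edge (ray p) = t *\<^sub>R p"
      using ori_ray(3)[OF p(1)] span_ray[of p] span_base[of "edge (ray p)" "{edge (ray p)}"]
      by (auto simp: span_singleton)
    have t0: "t \<noteq> 0" using ori_ray(2)[OF p(1)] t by auto
    obtain f where f: "of_int (rel_sign ori (ray p) ?\<alpha>) * wedge (ori ?\<alpha>) = wedge [edge (ray p), f]"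
        "\<And>x. x \<in> ?\<alpha> - ray p \<Longrightarrow> \<exists>c>0. wedge [edge (ray p), x] = fscale c (wedge [edge (ray p), f])"
      using signed_generator[OF p(1) \<alpha> p(2)] by metis
    obtain c where c: "c > 0" "wedge [t *\<^sub>R p, q] = fscale c (of_int (rel_sign ori (ray p) ?\<alpha>) * wedge (ori ?\<alpha>))"
      using f(2)[OF p(3)] f(1) t by auto
    let ?s = "of_int (rel_sign ori (ray p) ?\<alpha>) :: real"
    have "fscale t (wedge [p, q]) = fscale (c * ?s * k) (wedge [p, q])"
      using c(2) unfolding p(5) wedge_2_scale_left by (simp add: fun_eq_iff fscale_apply of_int_fun_apply mult.assoc)
    then have "fscale (t - c * ?s * k) (wedge [p, q]) = 0"
      unfolding fs.scale_left_diff_distrib by (rule eq_iff_diff_eq_0[THEN iffD1])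
    then have "t - c * ?s * k = 0 \<or> wedge [p, q] = 0"
      by (rule fs.scale_eq_0_iff[THEN iffD1])
    then have "t - c * ?s * k = 0"
      using p(6) by blast
    then have tc: "t = c * (?s * k)"
      by (simp add: mult.assoc)
    have "of_int (rel_sign ori {0} (ray p)) * t < 0"
      using rel_sign_zero[OF p(1,4) t] t0 by auto
    then have "c * (of_int (rel_sign ori {0} (ray p)) * ?s * k) < 0"
      unfolding tc by (simp add: algebra_simps)
    then show ?thesis using c(1) by (simp add: mult_less_0_iff)
  qed
  have nz: "u \<noteq> 0" "v \<noteq> 0" using indep2_nonzero[OF assms(1)] by auto
  have off: "v \<in> ?\<alpha> - ray u" "u \<in> ?\<alpha> - ray v"
    using quad_base[of u v] quad_base[of v u] indep2_not_span[OF assms(1)] indep2_not_span[OF indep2_swap[OF assms(1)]]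
    by (auto simp: ray_def span_singleton)
  have 1: "of_int (rel_sign ori {0} (ray u)) * of_int (rel_sign ori (ray u) ?\<alpha>) * (a * d - b * c) < 0"
    by (rule main[OF R(1,2) off(1) nz(1) W uv0])
  have W': "wedge (ori ?\<alpha>) = fscale (- (a * d - b * c)) (wedge [v, u])"
    unfolding W by (subst wedge_2_swap) (simp add: fun_eq_iff fscale_apply algebra_simps)
  have 2: "of_int (rel_sign ori {0} (ray v)) * of_int (rel_sign ori (ray v) ?\<alpha>) * (- (a * d - b * c)) < 0"
    by (rule main[OF R(3,4) off(2) nz(2) W' wedge_indep2[OF indep2_swap[OF assms(1)]]])
  show ?thesis
    using 1 2 rel_sign_cases[of "{0}" "ray u"] rel_sign_cases[of "{0}" "ray v"]
      rel_sign_cases[of "ray u" ?\<alpha>] rel_sign_cases[of "ray v" ?\<alpha>] by auto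
qed

end

section \<open>Generated groups, cyclic groups and groups of plane forms\<close>

lemma subgroup_gen_image:
  assumes "\<And>x y. h (x - y) = h x - h y"
  shows "subgroup_gen (h ` S) = h ` subgroup_gen S"
proof
  have h0: "h 0 = 0"
    using assms[of 0 0] by simp
  have "add_subgroup (h ` subgroup_gen S)"
    unfolding add_subgroup_def
  proof (intro conjI ballI)
    show "0 \<in> h ` subgroup_gen S"
      using h0 add_subgroup_0[OF add_subgroup_gen, of S] by (metis imageI)
    fix x y assume "x \<in> h ` subgroup_gen S" "y \<in> h ` subgroup_gen S"
    then show "x - y \<in> h ` subgroup_gen S"
      using add_subgroup_diff[OF add_subgroup_gen, of _ S] by (force simp: assms[symmetric])
  qed
  then show "subgroup_gen (h ` S) \<subseteq> h ` subgroup_gen S"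
    using subgroup_gen_superset by (intro subgroup_gen_minimal) auto
  have "add_subgroup {x. h x \<in> subgroup_gen (h ` S)}"
    using add_subgroup_gen[of "h ` S"] by (simp add: add_subgroup_def assms h0)
  then have "subgroup_gen S \<subseteq> {x. h x \<in> subgroup_gen (h ` S)}"
    by (intro subgroup_gen_minimal) (auto intro: subgroup_gen_base)
  then show "h ` subgroup_gen S \<subseteq> subgroup_gen (h ` S)"
    by blast
qed

lemma add_subgroup_sum: "add_subgroup G \<Longrightarrow> (\<And>i. i \<in> I \<Longrightarrow> f i \<in> G) \<Longrightarrow> sum f I \<in> G"
  by (induct I rule: infinite_finite_induct) (auto intro: add_subgroup_0 add_subgroup_add)

lemma subgroup_gen_id: "add_subgroup G \<Longrightarrow> subgroup_gen G = G"
  by (simp add: subgroup_gen_minimal subgroup_gen_superset subset_antisym)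

lemma subgroup_gen_eqI: "S \<subseteq> T \<Longrightarrow> T \<subseteq> subgroup_gen S \<Longrightarrow> subgroup_gen S = subgroup_gen T"
  by (simp add: subgroup_gen_minimal subgroup_gen_mono subset_antisym)

text \<open>Real functions have no torsion, so the group is infinite cyclic, and the multiplicity of
  \<open>g\<close> is read off at a point where \<open>g\<close> does not vanish. The rounding only
  turns an integral real number into an integer.\<close>

lemma functional_cyclic:
  fixes g :: "'x \<Rightarrow> real"
  assumes "g \<noteq> 0"
  obtains \<phi> :: "('x \<Rightarrow> real) \<Rightarrow> 'r::comm_ring_1" where "\<phi> \<in> additive_on (subgroup_gen {g})" "\<phi> g = 1"
proof -
  obtain z where z: "g z \<noteq> 0"
    using assms by (auto simp: fun_eq_iff)
  define \<phi> :: "('x \<Rightarrow> real) \<Rightarrow> 'r" where "\<phi> h = of_int \<lfloor>h z / g z\<rfloor>" for h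
  have \<phi>: "\<phi> (of_int n * g) = of_int n" for n
    using z by (simp add: \<phi>_def of_int_fun_apply)
  have "\<phi> \<in> additive_on (subgroup_gen {g})"
    unfolding additive_on_def
  proof (intro CollectI ballI)
    fix a b assume "a \<in> subgroup_gen {g}" "b \<in> subgroup_gen {g}"
    then obtain n m where ab: "a = of_int n * g" "b = of_int m * g"
      unfolding subgroup_gen_ring_1 by blast
    have "a + b = of_int (n + m) * g"
      by (simp add: ab ring_distribs)
    then have "\<phi> (a + b) = of_int (n + m)"
      by (simp only: \<phi>)
    moreover have "\<phi> a = of_int n" "\<phi> b = of_int m"
      by (simp_all only: ab \<phi>)
    ultimately show "\<phi> (a + b) = \<phi> a + \<phi> b"
      by (simp only: of_int_add)
  qed
  moreover have "\<phi> g = 1"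
    using \<phi>[of 1] by simp
  ultimately show thesis
    using that by blast
qed

lemma dim_span_single: "x \<noteq> 0 \<Longrightarrow> fs.dim (fs.span {x}) = 1"
  by (simp add: fs.dim_span_eq_card_independent fs.dependent_single del: fs.dim_span)

lemma dim_tspace_cyclic:
  fixes g :: "'x \<Rightarrow> real"
  assumes "g \<noteq> 0"
  shows "fs.dim (tspace (subgroup_gen {g}) :: ((('x \<Rightarrow> real) \<Rightarrow> 'k::field) \<Rightarrow> 'k) set) = 1"
proof -
  obtain \<phi> :: "('x \<Rightarrow> real) \<Rightarrow> 'k" where \<phi>: "\<phi> \<in> additive_on (subgroup_gen {g})" "\<phi> g = 1"
    using functional_cyclic[OF assms] by metis
  have "(tdelta (subgroup_gen {g}) g :: (('x \<Rightarrow> real) \<Rightarrow> 'k) \<Rightarrow> 'k) \<phi> = 1"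
    using \<phi> by (simp add: tdelta_def)
  then have "(tdelta (subgroup_gen {g}) g :: (('x \<Rightarrow> real) \<Rightarrow> 'k) \<Rightarrow> 'k) \<noteq> 0"
    by auto
  then show ?thesis
    unfolding tspace_subgroup_gen image_insert image_empty by (rule dim_span_single)
qed

text \<open>The map of tensor products induced by an inclusion: a function additive on
  \<open>A'\<close> is additive on \<open>A\<close>, and the value at all other arguments is set to
  0.\<close>

lemma tspace_restrict:
  assumes "A \<subseteq> A'" "add_subgroup A" "g \<in> tspace A"
  shows "(\<lambda>\<phi>. if \<phi> \<in> additive_on A' then g \<phi> else 0) \<in> tspace A'"
proof -
  obtain X where X: "X \<in> carrier (tensor A)" "g = tval A X"
    using assms(3) by (auto simp: tspace_def)
  have "(\<lambda>\<phi>. if \<phi> \<in> additive_on A' then g \<phi> else 0) = tval A' (tensor_incl A' X)"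
    using X tval_incl[OF assms(1) _ X(1)] by (auto simp: fun_eq_iff tval_outside)
  then show ?thesis
    using tensor_closed(5)[OF assms(2,1) X(1)] by (auto simp: tspace_def)
qed

definition forms :: "'a::euclidean_space set \<Rightarrow> nat \<Rightarrow> 'a set \<Rightarrow> ('a list \<Rightarrow> real) set" where
  "forms N p P = {wedge vs | vs. length vs = p \<and> set vs \<subseteq> N \<inter> P}"

text \<open>Coefficient groups are described by a set of planes, not by cones. Subdividing a cone
  does not change its plane, so groups of fans with different cones can be compared
  (\<open>F_int_star_planes\<close>).\<close>

definition plane_forms :: "'a::euclidean_space set \<Rightarrow> nat \<Rightarrow> 'a set set \<Rightarrow> ('a list \<Rightarrow> real) set" where
  "plane_forms N p \<P> = subgroup_gen (\<Union>P\<in>\<P>. forms N p P)"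

lemma forms_0: "forms N 0 P = {wedge []}"
  by (auto simp: forms_def)

lemma forms_1: "forms N 1 P = (\<lambda>x. wedge [x]) ` (N \<inter> P)"
  by (auto simp: forms_def length_Suc_conv)

lemma forms_2: "forms N 2 P = {wedge [x, y] | x y. x \<in> N \<inter> P \<and> y \<in> N \<inter> P}"
proof -
  have "forms N 2 P = {wedge vs | vs. (\<exists>x y. vs = [x, y]) \<and> set vs \<subseteq> N \<inter> P}"
    unfolding forms_def by (auto simp: numeral_2_eq_2 length_Suc_conv)
  also have "\<dots> = {wedge [x, y] | x y. x \<in> N \<inter> P \<and> y \<in> N \<inter> P}"
    by (auto; metis insert_subset list.simps(15) empty_subsetI empty_set Int_iff)
  finally show ?thesis .
qed

context fan2
begin

section \<open>The coefficient groups of a fan of dimension two\<close>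

definition planes :: "'a set \<Rightarrow> 'a set set" where
  "planes \<sigma> = span ` {\<alpha> \<in> cones \<Sigma> 2. \<sigma> face_of \<alpha>}"

text \<open>Every cone at \<open>\<sigma>\<close> is a face of a two-dimensional cone at
  \<open>\<sigma>\<close>, whose lattice contains its lattice; smaller cones contribute nothing
  new.\<close>

lemma F_int_planes:
  assumes "\<sigma> \<in> \<Sigma>"
  shows "F_int N \<Sigma> p \<sigma> = plane_forms N p (planes \<sigma>)"
proof -
  have "{wedge vs | vs \<gamma>. \<gamma> \<in> \<Sigma> \<and> \<sigma> face_of \<gamma> \<and> length vs = p \<and> set vs \<subseteq> cone_lattice N \<gamma>} =
      (\<Union>P\<in>planes \<sigma>. forms N p P)" (is "?L = ?R")
  proof (intro equalityI subsetI)
    fix g assume "g \<in> ?L"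
    then obtain vs \<gamma> where g: "g = wedge vs" "\<gamma> \<in> \<Sigma>" "\<sigma> face_of \<gamma>" "length vs = p" "set vs \<subseteq> cone_lattice N \<gamma>"
      by blast
    obtain \<alpha> where \<alpha>: "\<alpha> \<in> cones \<Sigma> 2" "\<gamma> face_of \<alpha>"
      using in_facet[OF g(2)] by blast
    have "set vs \<subseteq> N \<inter> span \<alpha>"
      using g(5) cone_lattice_mono[OF \<alpha>(2)] by (auto simp: cone_lattice_def)
    moreover have "\<sigma> face_of \<alpha>"
      using face_of_trans[OF g(3) \<alpha>(2)] .
    ultimately show "g \<in> ?R"
      using g \<alpha>(1) by (auto simp: planes_def forms_def)
  next
    fix g assume "g \<in> ?R"
    then obtain \<alpha> vs where "\<alpha> \<in> cones \<Sigma> 2" "\<sigma> face_of \<alpha>" "g = wedge vs" "length vs = p" "set vs \<subseteq> N \<inter> span \<alpha>"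
      by (auto simp: planes_def forms_def)
    then show "g \<in> ?L"
      using coneD by (auto simp: cone_lattice_def)
  qed
  then show ?thesis
    by (simp only: F_int_def plane_forms_def)
qed

lemma subgroup_F_int [simp]: "add_subgroup (F_int N \<Sigma> p \<sigma>)"
  by (simp add: F_int_def)

lemma F_int_mono: "\<tau> face_of \<sigma> \<Longrightarrow> F_int N \<Sigma> p \<sigma> \<subseteq> F_int N \<Sigma> p \<tau>"
  unfolding F_int_def by (rule subgroup_gen_mono) (use face_of_trans in blast)

lemma planes_facet: "\<alpha> \<in> cones \<Sigma> 2 \<Longrightarrow> planes \<alpha> = {span \<alpha>}"
  by (simp add: planes_def facets_of_facet)

lemma F_int_0: "\<sigma> \<in> \<Sigma> \<Longrightarrow> F_int N \<Sigma> 0 \<sigma> = subgroup_gen {wedge []}"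
proof -
  assume \<sigma>: "\<sigma> \<in> \<Sigma>"
  have "planes \<sigma> \<noteq> {}"
    using in_facet[OF \<sigma>] by (auto simp: planes_def)
  then have "(\<Union>P\<in>planes \<sigma>. forms N 0 P) = {wedge []}"
    by (auto simp: forms_0)
  then show ?thesis
    by (simp only: F_int_planes[OF \<sigma>] plane_forms_def)
qed

text \<open>A product of two lattice vectors is the determinant of their coordinates times the
  product of the basis vectors.\<close>

lemma forms_2_facet:
  assumes "\<alpha> \<in> cones \<Sigma> 2"
  shows "forms N 2 (span \<alpha>) = {of_int n * wedge (ori \<alpha>) | n. True}"
proof -
  obtain x y where xy: "ori \<alpha> = [x, y]" "cone_lattice N \<alpha> = {of_int n *\<^sub>R x + of_int m *\<^sub>R y | n m. True}"
    using ori_facet[OF assms] by metis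
  have x: "x \<in> cone_lattice N \<alpha>" "y \<in> cone_lattice N \<alpha>"
    using ori_gen[OF coneD[OF assms]] subgroup_gen_superset[of "set (ori \<alpha>)"] xy(1) by auto
  show ?thesis
  proof (intro equalityI subsetI)
    fix g assume "g \<in> forms N 2 (span \<alpha>)"
    then obtain u v where "u \<in> cone_lattice N \<alpha>" "v \<in> cone_lattice N \<alpha>" and g: "g = wedge [u, v]"
      by (auto simp: forms_2 cone_lattice_def)
    then obtain a b c d where "u = of_int a *\<^sub>R x + of_int b *\<^sub>R y" "v = of_int c *\<^sub>R x + of_int d *\<^sub>R y"
      using xy(2) by blast
    then have "g = of_int (a * d - b * c) * wedge (ori \<alpha>)"
      unfolding of_int_mult_fscale g xy(1)
      by (simp add: wedge_2 fun_eq_iff fscale_apply inner_add_left algebra_simps)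
    then show "g \<in> {of_int n * wedge (ori \<alpha>) | n. True}"
      by blast
  next
    fix g assume "g \<in> {of_int n * wedge (ori \<alpha>) | n. True}"
    then obtain n where "g = of_int n * wedge [x, y]"
      using xy(1) by auto
    then have "g = wedge [x, of_int n *\<^sub>R y]"
      by (simp add: of_int_mult_fscale wedge_2_scale_right)
    moreover have "of_int n *\<^sub>R y \<in> cone_lattice N \<alpha>"
      by (rule add_subgroup_of_int_scaleR[OF add_subgroup_cone_lattice x(2)])
    ultimately show "g \<in> forms N 2 (span \<alpha>)"
      using x(1) unfolding forms_2 cone_lattice_def by blast
  qed
qed

lemma F_int_2_facet:
  assumes "\<alpha> \<in> cones \<Sigma> 2"
  shows "F_int N \<Sigma> 2 \<alpha> = subgroup_gen {wedge (ori \<alpha>)}"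
proof -
  have "F_int N \<Sigma> 2 \<alpha> = subgroup_gen (subgroup_gen {wedge (ori \<alpha>)})"
    unfolding F_int_planes[OF coneD[OF assms]] plane_forms_def planes_facet[OF assms] subgroup_gen_ring_1[of "wedge (ori \<alpha>)"]
    by (simp add: forms_2_facet[OF assms])
  then show ?thesis
    by (simp add: subgroup_gen_id)
qed

text \<open>F_1(\<sigma>) is a copy of this group. For a ray, multiplication by
  \<open>edge \<rho>\<close> presents F_2(\<rho>) as its quotient by the multiples of
  \<open>edge \<rho>\<close>.\<close>

definition vectors :: "'a set \<Rightarrow> 'a set" where
  "vectors \<sigma> = subgroup_gen (\<Union>\<alpha>\<in>{\<alpha> \<in> cones \<Sigma> 2. \<sigma> face_of \<alpha>}. cone_lattice N \<alpha>)"

lemma add_subgroup_vectors: "add_subgroup (vectors \<sigma>)"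
  by (simp add: vectors_def)

lemma cone_lattice_vectors: "\<alpha> \<in> cones \<Sigma> 2 \<Longrightarrow> \<sigma> face_of \<alpha> \<Longrightarrow> cone_lattice N \<alpha> \<subseteq> vectors \<sigma>"
  unfolding vectors_def by (rule order_trans[OF _ subgroup_gen_superset]) blast

lemma vectors_subset: "vectors \<sigma> \<subseteq> N"
  unfolding vectors_def by (rule subgroup_gen_minimal[OF _ lattice_subgroup]) (auto simp: cone_lattice_def)

lemma F_int_1:
  assumes "\<sigma> \<in> \<Sigma>"
  shows "F_int N \<Sigma> 1 \<sigma> = (\<lambda>x. wedge [x]) ` vectors \<sigma>"
proof -
  have "(\<Union>P\<in>planes \<sigma>. forms N 1 P) = (\<lambda>x. wedge [x]) ` (\<Union>\<alpha>\<in>{\<alpha> \<in> cones \<Sigma> 2. \<sigma> face_of \<alpha>}. cone_lattice N \<alpha>)"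
    unfolding planes_def forms_1 cone_lattice_def by blast
  then show ?thesis
    by (simp only: F_int_planes[OF assms] plane_forms_def vectors_def subgroup_gen_image[OF wedge_1_diff])
qed

lemma edge_in_facet_lattice: "\<rho> \<in> cones \<Sigma> 1 \<Longrightarrow> \<rho> face_of \<alpha> \<Longrightarrow> edge \<rho> \<in> cone_lattice N \<alpha>"
  using cone_lattice_mono edge_in_lattice by blast

lemma edge_vectors: "\<rho> \<in> cones \<Sigma> 1 \<Longrightarrow> edge \<rho> \<in> vectors \<rho>"
  using in_facet[OF coneD] edge_in_facet_lattice cone_lattice_vectors by blast

text \<open>In each cone at \<open>\<rho>\<close> the vector \<open>edge \<rho>\<close> is part of a
  lattice basis, so every 2-form of the cone is \<open>edge \<rho>\<close> times a lattice vector.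
  For fixed first factor the product is additive in the second, so these products already form the
  generated group.\<close>

lemma F_int_2_ray:
  assumes "\<rho> \<in> cones \<Sigma> 1"
  shows "F_int N \<Sigma> 2 \<rho> = (\<lambda>f. wedge [edge \<rho>, f]) ` vectors \<rho>"
proof -
  have *: "forms N 2 (span \<alpha>) = (\<lambda>f. wedge [edge \<rho>, f]) ` cone_lattice N \<alpha>"
    if \<alpha>: "\<alpha> \<in> cones \<Sigma> 2" "\<rho> face_of \<alpha>" for \<alpha>
  proof (intro equalityI subsetI)
    fix g assume "g \<in> forms N 2 (span \<alpha>)"
    then obtain n where n: "g = of_int n * wedge (ori \<alpha>)"
      using forms_2_facet[OF \<alpha>(1)] by blast
    obtain f where f: "f \<in> cone_lattice N \<alpha>" "wedge [edge \<rho>, f] = wedge (ori \<alpha>)"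
      using edge_complement[OF assms \<alpha>] .
    have "g = wedge [edge \<rho>, of_int n *\<^sub>R f]"
      by (simp only: n f(2)[symmetric] of_int_mult_fscale wedge_2_scale_right)
    then show "g \<in> (\<lambda>f. wedge [edge \<rho>, f]) ` cone_lattice N \<alpha>"
      using add_subgroup_of_int_scaleR[OF add_subgroup_cone_lattice f(1)] by blast
  next
    fix g assume "g \<in> (\<lambda>f. wedge [edge \<rho>, f]) ` cone_lattice N \<alpha>"
    then show "g \<in> forms N 2 (span \<alpha>)"
      using edge_in_facet_lattice[OF assms \<alpha>(2)] unfolding forms_2 cone_lattice_def by blast
  qed
  have "(\<Union>P\<in>planes \<rho>. forms N 2 P) =
      (\<lambda>f. wedge [edge \<rho>, f]) ` (\<Union>\<alpha>\<in>{\<alpha> \<in> cones \<Sigma> 2. \<rho> face_of \<alpha>}. cone_lattice N \<alpha>)"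
    unfolding planes_def using * by (simp add: image_UN)
  then show ?thesis
    by (simp only: F_int_planes[OF coneD[OF assms]] plane_forms_def vectors_def subgroup_gen_image[OF wedge_2_diff_right])
qed

text \<open>Finite generating sets, cone by cone, make all coefficient spaces finite dimensional.
  The one for p = 2 has a single element, which bounds the dimension of F_2 at a ray by the number
  of two-dimensional cones there.\<close>

lemma generators:
  assumes "p \<le> 2" "\<alpha> \<in> cones \<Sigma> 2"
  obtains S where "finite S" "S \<subseteq> forms N p (span \<alpha>)" "forms N p (span \<alpha>) \<subseteq> subgroup_gen S"
    "p = 1 \<Longrightarrow> S = (\<lambda>x. wedge [x]) ` set (ori \<alpha>)" "p = 2 \<Longrightarrow> S = {wedge (ori \<alpha>)}"
proof -
  consider "p = 0" | "p = 1" | "p = 2" using assms(1) by linarith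
  then show thesis
  proof cases
    case 1
    then show thesis using that[of "{wedge []}"] subgroup_gen_superset by (auto simp: forms_0)
  next
    case 2
    have L: "subgroup_gen (set (ori \<alpha>)) = N \<inter> span \<alpha>"
      using ori_gen[OF coneD[OF assms(2)]] by (simp add: cone_lattice_def)
    show thesis
    proof (rule that[of "(\<lambda>x. wedge [x]) ` set (ori \<alpha>)"])
      show "(\<lambda>x. wedge [x]) ` set (ori \<alpha>) \<subseteq> forms N p (span \<alpha>)"
        unfolding 2 forms_1 using L subgroup_gen_superset[of "set (ori \<alpha>)"] by blast
      show "forms N p (span \<alpha>) \<subseteq> subgroup_gen ((\<lambda>x. wedge [x]) ` set (ori \<alpha>))"
        unfolding 2 forms_1 subgroup_gen_image[OF wedge_1_diff] L by blast
    qed (use 2 in auto)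
  next
    case 3
    show thesis
    proof (rule that[of "{wedge (ori \<alpha>)}"])
      show "{wedge (ori \<alpha>)} \<subseteq> forms N p (span \<alpha>)"
        unfolding 3 forms_2_facet[OF assms(2)] subgroup_gen_ring_1[symmetric] by (rule subgroup_gen_superset)
      show "forms N p (span \<alpha>) \<subseteq> subgroup_gen {wedge (ori \<alpha>)}"
        unfolding 3 forms_2_facet[OF assms(2)] subgroup_gen_ring_1 by blast
    qed (use 3 in auto)
  qed
qed

lemma F_int_generated:
  assumes "\<sigma> \<in> \<Sigma>" "\<And>\<alpha>. \<alpha> \<in> cones \<Sigma> 2 \<Longrightarrow> S \<alpha> \<subseteq> forms N p (span \<alpha>) \<and> forms N p (span \<alpha>) \<subseteq> subgroup_gen (S \<alpha>)"
  shows "F_int N \<Sigma> p \<sigma> = subgroup_gen (\<Union>\<alpha>\<in>{\<alpha> \<in> cones \<Sigma> 2. \<sigma> face_of \<alpha>}. S \<alpha>)"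
proof -
  let ?M = "{\<alpha> \<in> cones \<Sigma> 2. \<sigma> face_of \<alpha>}"
  have "forms N p (span \<alpha>) \<subseteq> subgroup_gen (\<Union>\<alpha>\<in>?M. S \<alpha>)" if "\<alpha> \<in> ?M" for \<alpha>
    using assms(2)[of \<alpha>] that subgroup_gen_mono[of "S \<alpha>" "\<Union>\<alpha>\<in>?M. S \<alpha>"] by blast
  then have "subgroup_gen (\<Union>\<alpha>\<in>?M. S \<alpha>) = subgroup_gen (\<Union>\<alpha>\<in>?M. forms N p (span \<alpha>))"
    using assms(2) by (intro subgroup_gen_eqI) blast+
  then show ?thesis
    by (simp add: F_int_planes[OF assms(1)] plane_forms_def planes_def)
qed

text \<open>In this form a coefficient splits into summands that come from single two-dimensional
  cones.\<close>

lemma F_int_eq_gen_facets: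
  assumes "\<sigma> \<in> \<Sigma>"
  shows "F_int N \<Sigma> p \<sigma> = subgroup_gen (\<Union>\<alpha>\<in>{\<alpha> \<in> cones \<Sigma> 2. \<sigma> face_of \<alpha>}. F_int N \<Sigma> p \<alpha>)"
proof -
  let ?M = "{\<alpha> \<in> cones \<Sigma> 2. \<sigma> face_of \<alpha>}"
  have f: "F_int N \<Sigma> p \<alpha> = subgroup_gen (forms N p (span \<alpha>))" if "\<alpha> \<in> cones \<Sigma> 2" for \<alpha>
    using that by (simp add: F_int_planes[OF coneD] plane_forms_def planes_facet)
  show ?thesis
  proof
    show "F_int N \<Sigma> p \<sigma> \<subseteq> subgroup_gen (\<Union>\<alpha>\<in>?M. F_int N \<Sigma> p \<alpha>)"
      unfolding F_int_planes[OF assms] plane_forms_def planes_def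
      by (rule subgroup_gen_mono) (use f subgroup_gen_superset in fastforce)
    show "subgroup_gen (\<Union>\<alpha>\<in>?M. F_int N \<Sigma> p \<alpha>) \<subseteq> F_int N \<Sigma> p \<sigma>"
      using F_int_mono by (intro subgroup_gen_minimal) auto
  qed
qed

lemma fin_space_F:
  assumes "p \<le> 2" "\<sigma> \<in> \<Sigma>"
  shows "fin_space (tspace (F_int N \<Sigma> p \<sigma>) :: ((('a list \<Rightarrow> real) \<Rightarrow> 'k::field) \<Rightarrow> 'k) set)"
proof -
  have "\<exists>S. \<forall>\<alpha>\<in>cones \<Sigma> 2. finite (S \<alpha>) \<and> S \<alpha> \<subseteq> forms N p (span \<alpha>) \<and> forms N p (span \<alpha>) \<subseteq> subgroup_gen (S \<alpha>)"
    by (rule bchoice) (use generators[OF assms(1)] in metis)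
  then obtain S where S: "\<And>\<alpha>. \<alpha> \<in> cones \<Sigma> 2 \<Longrightarrow> finite (S \<alpha>) \<and> S \<alpha> \<subseteq> forms N p (span \<alpha>) \<and> forms N p (span \<alpha>) \<subseteq> subgroup_gen (S \<alpha>)"
    by blast
  let ?S = "\<Union>\<alpha>\<in>{\<alpha> \<in> cones \<Sigma> 2. \<sigma> face_of \<alpha>}. S \<alpha>"
  have eq: "F_int N \<Sigma> p \<sigma> = subgroup_gen ?S"
    using S by (intro F_int_generated[OF assms(2)]) blast
  have "finite ?S"
    using S by auto
  then show ?thesis
    unfolding eq by (intro fin_spaceI[of _ "tdelta (subgroup_gen ?S) ` ?S"] subspace_tspace add_subgroup_gen)
      (simp_all only: finite_imageI tspace_subgroup_gen order_refl)
qed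

lemma dim_F_0: "\<sigma> \<in> \<Sigma> \<Longrightarrow> fs.dim (tspace (F_int N \<Sigma> 0 \<sigma>) :: ((('a list \<Rightarrow> real) \<Rightarrow> 'k::field) \<Rightarrow> 'k) set) = 1"
proof -
  assume "\<sigma> \<in> \<Sigma>"
  moreover have "wedge [] \<noteq> (0 :: 'a list \<Rightarrow> real)"
    by (metis wedge_Nil zero_fun_apply zero_neq_one)
  ultimately show ?thesis
    by (simp add: F_int_0 dim_tspace_cyclic)
qed

lemma wedge_ori_nonzero: "\<alpha> \<in> cones \<Sigma> 2 \<Longrightarrow> wedge (ori \<alpha>) \<noteq> 0"
  using ori_facet wedge_indep2 by metis

lemma dim_F_2_facet:
  "\<alpha> \<in> cones \<Sigma> 2 \<Longrightarrow> fs.dim (tspace (F_int N \<Sigma> 2 \<alpha>) :: ((('a list \<Rightarrow> real) \<Rightarrow> 'k::field) \<Rightarrow> 'k) set) = 1"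
  by (simp add: F_int_2_facet dim_tspace_cyclic wedge_ori_nonzero)

lemma F_int_1_facet: "\<alpha> \<in> cones \<Sigma> 2 \<Longrightarrow> F_int N \<Sigma> 1 \<alpha> = (\<lambda>x. wedge [x]) ` cone_lattice N \<alpha>"
  using F_int_1[OF coneD] by (simp add: vectors_def facets_of_facet subgroup_gen_id add_subgroup_cone_lattice)

lemma functional_facet:
  assumes "\<alpha> \<in> cones \<Sigma> 2" "ori \<alpha> = [x, y]"
  obtains \<phi> \<psi> :: "('a list \<Rightarrow> real) \<Rightarrow> 'r::comm_ring_1" where
    "\<phi> \<in> additive_on (F_int N \<Sigma> 1 \<alpha>)" "\<phi> (wedge [x]) = 1" "\<phi> (wedge [y]) = 0"
    "\<psi> \<in> additive_on (F_int N \<Sigma> 1 \<alpha>)" "\<psi> (wedge [x]) = 0" "\<psi> (wedge [y]) = 1"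
proof -
  have xy: "indep2 x y" and L: "cone_lattice N \<alpha> = {of_int n *\<^sub>R x + of_int m *\<^sub>R y | n m. True}"
  proof -
    obtain x' y' where xy': "ori \<alpha> = [x', y']" "indep2 x' y'"
        "cone_lattice N \<alpha> = {of_int n *\<^sub>R x' + of_int m *\<^sub>R y' | n m. True}"
      using ori_facet[OF assms(1)] by metis
    moreover have "x' = x" "y' = y"
      using xy'(1) assms(2) by simp_all
    ultimately show "indep2 x y" "cone_lattice N \<alpha> = {of_int n *\<^sub>R x + of_int m *\<^sub>R y | n m. True}"
      by simp_all
  qed
  \<comment> \<open>Integer coordinates; on lattice points they are unique because \<open>x\<close>
    and \<open>y\<close> are independent.\<close>
  define c where "c z = (SOME nm. z = of_int (fst nm) *\<^sub>R x + of_int (snd nm) *\<^sub>R y)" for z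
  have c: "c (of_int n *\<^sub>R x + of_int m *\<^sub>R y) = (n, m)" for n m
  proof -
    let ?z = "of_int n *\<^sub>R x + of_int m *\<^sub>R y"
    have "?z = of_int (fst (c ?z)) *\<^sub>R x + of_int (snd (c ?z)) *\<^sub>R y"
      unfolding c_def by (rule someI[of _ "(n, m)"]) simp
    then have "real_of_int n = of_int (fst (c ?z))" "real_of_int m = of_int (snd (c ?z))"
      using indep2_eqD[OF xy] by blast+
    then show ?thesis by (simp add: prod_eq_iff)
  qed
  define \<phi> where "\<phi> g = (of_int (fst (c (unwedge_1 g))) :: 'r)" for g
  define \<psi> where "\<psi> g = (of_int (snd (c (unwedge_1 g))) :: 'r)" for g
  have ev: "\<phi> (wedge [of_int n *\<^sub>R x + of_int m *\<^sub>R y]) = of_int n"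
      "\<psi> (wedge [of_int n *\<^sub>R x + of_int m *\<^sub>R y]) = of_int m" for n m
    by (simp_all add: \<phi>_def \<psi>_def c)
  have add: "\<phi> (a + b) = \<phi> a + \<phi> b \<and> \<psi> (a + b) = \<psi> a + \<psi> b"
    if ab: "a \<in> F_int N \<Sigma> 1 \<alpha>" "b \<in> F_int N \<Sigma> 1 \<alpha>" for a b
  proof -
    obtain u v where uv: "u \<in> cone_lattice N \<alpha>" "v \<in> cone_lattice N \<alpha>" "a = wedge [u]" "b = wedge [v]"
      using ab unfolding F_int_1_facet[OF assms(1)] by blast
    then obtain n m n' m' where nm: "u = of_int n *\<^sub>R x + of_int m *\<^sub>R y" "v = of_int n' *\<^sub>R x + of_int m' *\<^sub>R y"
      unfolding L by blast
    have "a + b = wedge [of_int (n + n') *\<^sub>R x + of_int (m + m') *\<^sub>R y]"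
      unfolding uv(3,4) nm wedge_1_add[symmetric] by (simp add: algebra_simps)
    then have "\<phi> (a + b) = of_int (n + n')" "\<psi> (a + b) = of_int (m + m')"
      by (simp_all only: ev)
    moreover have "\<phi> a = of_int n" "\<phi> b = of_int n'" "\<psi> a = of_int m" "\<psi> b = of_int m'"
      by (simp_all only: uv(3,4) nm ev)
    ultimately show ?thesis
      by (simp only: of_int_add simp_thms)
  qed
  show thesis
    by (rule that[of \<phi> \<psi>]) (use add ev[of 1 0] ev[of 0 1] in \<open>auto simp: additive_on_def\<close>)
qed

lemma dim_F_1_facet:
  assumes "\<alpha> \<in> cones \<Sigma> 2"
  shows "fs.dim (tspace (F_int N \<Sigma> 1 \<alpha>) :: ((('a list \<Rightarrow> real) \<Rightarrow> 'k::field) \<Rightarrow> 'k) set) = 2"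
proof -
  let ?A = "F_int N \<Sigma> 1 \<alpha>"
  obtain x y where xy: "ori \<alpha> = [x, y]"
    using ori_facet[OF assms] by metis
  obtain \<phi> \<psi> :: "('a list \<Rightarrow> real) \<Rightarrow> 'k" where
    f: "\<phi> \<in> additive_on ?A" "\<phi> (wedge [x]) = 1" "\<phi> (wedge [y]) = 0"
    "\<psi> \<in> additive_on ?A" "\<psi> (wedge [x]) = 0" "\<psi> (wedge [y]) = 1"
    using functional_facet[OF assms xy] by blast
  have A: "?A = subgroup_gen {wedge [x], wedge [y]}"
    using subgroup_gen_image[of "\<lambda>x. wedge [x]" "{x, y}", OF wedge_1_diff] ori_gen[OF coneD[OF assms]] xy
    unfolding F_int_1_facet[OF assms] by simp
  let ?d = "tdelta ?A :: _ \<Rightarrow> (_ \<Rightarrow> 'k) \<Rightarrow> 'k"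
  have T: "tspace ?A = fs.span {?d (wedge [x]), ?d (wedge [y])}"
    by (simp only: A tspace_subgroup_gen image_insert image_empty)
  have ev: "?d (wedge [x]) \<phi> = 1" "?d (wedge [y]) \<phi> = 0" "?d (wedge [x]) \<psi> = 0" "?d (wedge [y]) \<psi> = 1"
    using f by (simp_all add: tdelta_def)
  have "?d (wedge [y]) \<noteq> 0"
    using ev(4) by auto
  moreover have "?d (wedge [x]) \<notin> fs.span {?d (wedge [y])}"
  proof
    assume "?d (wedge [x]) \<in> fs.span {?d (wedge [y])}"
    then obtain k where "?d (wedge [x]) = fscale k (?d (wedge [y]))"
      by (auto simp: fs.span_singleton)
    then have "?d (wedge [x]) \<phi> = k * ?d (wedge [y]) \<phi>"
      by (simp add: fscale_apply)
    then show False using ev by simp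
  qed
  moreover from this have "?d (wedge [x]) \<noteq> ?d (wedge [y])"
    using fs.span_base by blast
  ultimately have "fs.independent {?d (wedge [x]), ?d (wedge [y])}" "card {?d (wedge [x]), ?d (wedge [y])} = 2"
    by (simp_all add: fs.independent_insert)
  then show ?thesis
    unfolding T using fs.dim_span_eq_card_independent by metis
qed

text \<open>A primitive lattice vector stays nonzero over every field. If all coordinates of
  \<open>edge \<rho>\<close> in a basis of \<open>N\<close> vanished in \<open>'k\<close>, the
  characteristic would divide each of them, and the quotient would be a lattice vector on the line
  of the ray, against primitivity. A coordinate that survives, divided by its value at the edge, is
  the functional.\<close>

lemma functional_ray:
  assumes "\<rho> \<in> cones \<Sigma> 1"
  obtains \<phi> :: "('a list \<Rightarrow> real) \<Rightarrow> 'k::field" where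
    "\<phi> \<in> additive_on (F_int N \<Sigma> 1 \<rho>)" "\<phi> (wedge [edge \<rho>]) = 1"
proof -
  obtain B where B: "independent B" "span B = UNIV" "N = subgroup_gen B"
    using lattice by (auto simp: is_lattice_def)
  have fB: "finite B"
    using B(1) by (rule independent_imp_finite)
  let ?r = "representation B"
  have r_add: "?r (x + y) b = ?r x b + ?r y b" and r_scale: "?r (c *\<^sub>R x) b = c * ?r x b"
    and r_diff: "?r (x - y) b = ?r x b - ?r y b" for x y b c
    using B(1,2) by (simp_all add: representation_add representation_scale representation_diff)
  have N_int: "?r x b \<in> \<int>" if "x \<in> N" for x b
  proof -
    have "add_subgroup {x. ?r x b \<in> \<int>}"
      using B(1) by (simp add: add_subgroup_def r_diff representation_zero)
    moreover have "B \<subseteq> {x. ?r x b \<in> \<int>}"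
      using B(1) by (auto simp: representation_basis)
    ultimately show ?thesis
      using subgroup_gen_minimal[of B "{x. ?r x b \<in> \<int>}"] that B(3) by blast
  qed
  let ?e = "edge \<rho>"
  have eN: "?e \<in> N"
    using edge_in_lattice[OF assms] by (auto simp: cone_lattice_def)
  have "\<exists>b\<in>B. (of_int \<lfloor>?r ?e b\<rfloor> :: 'k) \<noteq> 0"
  proof (rule ccontr)
    let ?p = "int CHAR('k)"
    assume "\<not> (\<exists>b\<in>B. (of_int \<lfloor>?r ?e b\<rfloor> :: 'k) \<noteq> 0)"
    then have "?p dvd \<lfloor>?r ?e b\<rfloor>" if "b \<in> B" for b
      using that by (simp add: of_int_eq_0_iff_char_dvd)
    then have "\<exists>n. \<lfloor>?r ?e b\<rfloor> = ?p * n" if "b \<in> B" for b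
      using that by (auto simp: dvd_def)
    then obtain n where n: "\<And>b. b \<in> B \<Longrightarrow> \<lfloor>?r ?e b\<rfloor> = ?p * n b"
      by metis
    have e_sum: "?e = (\<Sum>b\<in>B. ?r ?e b *\<^sub>R b)"
      using sum_representation_eq[OF B(1) _ fB, of ?e] B(2) by simp
    define e' where "e' = (\<Sum>b\<in>B. of_int (n b) *\<^sub>R b)"
    have ee': "?e = of_int ?p *\<^sub>R e'"
    proof -
      have "?r ?e b = of_int ?p * of_int (n b)" if "b \<in> B" for b
        using n[OF that] N_int[OF eN, of b] by (metis Ints_cases floor_of_int of_int_mult)
      then show ?thesis
        unfolding e'_def scaleR_sum_right by (subst e_sum) (simp add: scaleR_scaleR)
    qed
    \<comment> \<open>Characteristic 0 is excluded here: divisibility by 0 would make all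
      coordinates of the edge vanish.\<close>
    have p0: "?p \<noteq> 0"
      using ee' ori_ray(2)[OF assms] by (metis of_int_0 scaleR_zero_left)
    have "e' \<in> N"
    proof -
      have "of_int (n b) *\<^sub>R b \<in> N" if "b \<in> B" for b
        using that unfolding B(3) by (intro add_subgroup_of_int_scaleR subgroup_gen_base) auto
      then show ?thesis
        unfolding e'_def by (intro add_subgroup_sum[OF lattice_subgroup])
    qed
    moreover have "e' = (1 / of_int ?p) *\<^sub>R ?e"
      using p0 by (subst ee') simp
    then have "e' \<in> span \<rho>"
      unfolding ori_ray(3)[OF assms] by (simp add: span_base span_scale)
    ultimately have "e' \<in> cone_lattice N \<rho>"
      by (simp add: cone_lattice_def)
    then obtain m where "e' = of_int m *\<^sub>R ?e"
      unfolding ori_ray(4)[OF assms] by blast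
    then have "?e = of_int (?p * m) *\<^sub>R ?e"
      using ee' by (metis of_int_mult scaleR_scaleR)
    then have "of_int 1 *\<^sub>R ?e = of_int (?p * m) *\<^sub>R ?e"
      by simp
    then have "1 = ?p * m"
      using ori_ray(2)[OF assms] by (rule of_int_scaleR_eq)
    then have "CHAR('k) = 1"
      by (metis dvd_triv_left int_one_le_iff_zero_less nat_1_eq_mult_iff of_nat_1 of_nat_dvd_iff nat_dvd_1_iff_1)
    then show False by simp
  qed
  then obtain b where b: "(of_int \<lfloor>?r ?e b\<rfloor> :: 'k) \<noteq> 0"
    by blast
  define \<phi> where "\<phi> g = (of_int \<lfloor>?r (unwedge_1 g) b\<rfloor> / of_int \<lfloor>?r ?e b\<rfloor> :: 'k)" for g
  have "\<phi> \<in> additive_on (F_int N \<Sigma> 1 \<rho>)"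
    unfolding additive_on_def
  proof (intro CollectI ballI)
    fix g h assume "g \<in> F_int N \<Sigma> 1 \<rho>" "h \<in> F_int N \<Sigma> 1 \<rho>"
    then obtain x y where xy: "x \<in> N" "y \<in> N" "g = wedge [x]" "h = wedge [y]"
      using F_int_1[OF coneD[OF assms]] vectors_subset[of \<rho>] by auto
    obtain n m where nm: "?r x b = of_int n" "?r y b = of_int m"
      using N_int[OF xy(1), of b] N_int[OF xy(2), of b] by (auto elim!: Ints_cases)
    have "g + h = wedge [x + y]"
      by (simp only: xy wedge_1_add)
    then have "unwedge_1 (g + h) = x + y" by simp
    then have "\<phi> (g + h) = (of_int \<lfloor>?r x b + ?r y b\<rfloor> / of_int \<lfloor>?r ?e b\<rfloor> :: 'k)"
      by (simp only: \<phi>_def r_add)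
    also have "?r x b + ?r y b = of_int (n + m)"
      by (simp add: nm)
    finally have "\<phi> (g + h) = of_int (n + m) / of_int \<lfloor>?r ?e b\<rfloor>"
      by (simp only: floor_of_int)
    moreover have "\<phi> g = of_int n / of_int \<lfloor>?r ?e b\<rfloor>" "\<phi> h = of_int m / of_int \<lfloor>?r ?e b\<rfloor>"
      by (simp_all add: \<phi>_def xy nm)
    ultimately show "\<phi> (g + h) = \<phi> g + \<phi> h"
      by (simp only: of_int_add add_divide_distrib)
  qed
  moreover have "\<phi> (wedge [?e]) = 1"
    using b by (simp add: \<phi>_def)
  ultimately show thesis using that by blast
qed

text \<open>F_2(\<rho>) is the quotient of \<open>vectors \<rho>\<close> by the multiples of
  \<open>edge \<rho>\<close>, so homomorphisms that kill \<open>edge \<rho>\<close> descend. Two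
  vectors with the same product differ by a lattice vector on the line of the ray, which is an
  integer multiple of \<open>edge \<rho>\<close>.\<close>

lemma functional_quotient:
  assumes \<rho>: "\<rho> \<in> cones \<Sigma> 1" and \<theta>: "\<theta> \<in> additive_on (F_int N \<Sigma> 1 \<rho>)" "\<theta> (wedge [edge \<rho>]) = (0 :: 'k::field)"
  obtains \<psi> where "\<psi> \<in> additive_on (F_int N \<Sigma> 2 \<rho>)" "\<forall>f\<in>vectors \<rho>. \<psi> (wedge [edge \<rho>, f]) = \<theta> (wedge [f])"
proof -
  let ?V = "vectors \<rho>" and ?e = "edge \<rho>"
  have in1: "wedge [f] \<in> F_int N \<Sigma> 1 \<rho>" if "f \<in> ?V" for f
    using that F_int_1[OF coneD[OF \<rho>]] by blast
  have wd: "\<theta> (wedge [f]) = \<theta> (wedge [f'])" if f: "f \<in> ?V" "f' \<in> ?V" "wedge [?e, f] = wedge [?e, f']" for f f'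
  proof -
    have "wedge [?e, f - f'] = 0"
      using f(3) by (simp add: wedge_2_diff_right)
    then have "f - f' \<in> span \<rho>"
      using wedge_2_eq_0D ori_ray(2,3)[OF \<rho>] by blast
    moreover have ff: "f - f' \<in> ?V"
      using add_subgroup_diff[OF add_subgroup_vectors f(1,2)] .
    ultimately have "f - f' \<in> cone_lattice N \<rho>"
      using vectors_subset by (auto simp: cone_lattice_def)
    then obtain n where n: "f - f' = of_int n *\<^sub>R ?e"
      unfolding ori_ray(4)[OF \<rho>] by blast
    have "\<theta> (wedge [f - f']) = \<theta> (of_int n * wedge [?e])"
      unfolding n wedge_1_scale of_int_mult_fscale ..
    also have "\<dots> = 0"
      using additive_on_of_int_mult[OF \<theta>(1) subgroup_F_int in1[OF edge_vectors[OF \<rho>]]] \<theta>(2) by simp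
    finally have "\<theta> (wedge [f] - wedge [f']) = 0"
      by (simp only: wedge_1_diff)
    then show ?thesis
      using additive_on_diff[OF \<theta>(1) subgroup_F_int in1[OF f(1)] in1[OF f(2)]] by simp
  qed
  define \<psi> where "\<psi> g = \<theta> (wedge [SOME f. f \<in> ?V \<and> wedge [?e, f] = g])" for g
  have \<psi>: "\<psi> (wedge [?e, f]) = \<theta> (wedge [f])" if f: "f \<in> ?V" for f
  proof -
    have "(SOME f'. f' \<in> ?V \<and> wedge [?e, f'] = wedge [?e, f]) \<in> ?V \<and>
      wedge [?e, SOME f'. f' \<in> ?V \<and> wedge [?e, f'] = wedge [?e, f]] = wedge [?e, f]"
      by (rule someI[of _ f]) (use f in simp)
    then show ?thesis
      unfolding \<psi>_def using wd f by blast
  qed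
  have "\<psi> \<in> additive_on (F_int N \<Sigma> 2 \<rho>)"
    unfolding additive_on_def F_int_2_ray[OF \<rho>]
  proof (intro CollectI ballI)
    fix g h assume "g \<in> (\<lambda>f. wedge [?e, f]) ` ?V" "h \<in> (\<lambda>f. wedge [?e, f]) ` ?V"
    then obtain f f' where f: "f \<in> ?V" "f' \<in> ?V" and gh: "g = wedge [?e, f]" "h = wedge [?e, f']"
      by blast
    show "\<psi> (g + h) = \<psi> g + \<psi> h"
      unfolding gh wedge_2_add_right[symmetric] \<psi>[OF f(1)] \<psi>[OF f(2)] \<psi>[OF add_subgroup_add[OF add_subgroup_vectors f]] wedge_1_add
      by (rule additive_onD[OF \<theta>(1) in1[OF f(1)] in1[OF f(2)]])
  qed
  then show thesis
    using that \<psi> by blast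
qed

text \<open>Multiplication by \<open>edge \<rho>\<close> maps F_1(\<rho>) onto F_2(\<rho>). After
  tensoring with \<open>'k\<close> the kernel is still spanned by the class of
  \<open>edge \<rho>\<close>, and this class is not zero by \<open>functional_ray\<close>.\<close>

lemma dim_F_1_ray:
  assumes \<rho>: "\<rho> \<in> cones \<Sigma> 1"
  shows "fs.dim (tspace (F_int N \<Sigma> 1 \<rho>) :: ((('a list \<Rightarrow> real) \<Rightarrow> 'k::field) \<Rightarrow> 'k) set) =
    fs.dim (tspace (F_int N \<Sigma> 2 \<rho>) :: ((('a list \<Rightarrow> real) \<Rightarrow> 'k) \<Rightarrow> 'k) set) + 1"
proof -
  let ?A1 = "F_int N \<Sigma> 1 \<rho>" and ?A2 = "F_int N \<Sigma> 2 \<rho>" and ?V = "vectors \<rho>" and ?e = "edge \<rho>"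
  let ?T1 = "tspace ?A1 :: ((('a list \<Rightarrow> real) \<Rightarrow> 'k) \<Rightarrow> 'k) set"
  let ?T2 = "tspace ?A2 :: ((('a list \<Rightarrow> real) \<Rightarrow> 'k) \<Rightarrow> 'k) set"
  note A1 = F_int_1[OF coneD[OF \<rho>]] and A2 = F_int_2_ray[OF \<rho>]
  \<comment> \<open>\<open>pb\<close> pulls a function on 2-forms back to 1-forms, and
    \<open>h\<close> is the induced map of tensor products in terms of values.\<close>
  define pb :: "(('a list \<Rightarrow> real) \<Rightarrow> 'k) \<Rightarrow> ('a list \<Rightarrow> real) \<Rightarrow> 'k" where
    "pb \<psi> = (\<lambda>b. \<psi> (wedge [?e, unwedge_1 b]))" for \<psi>
  define h :: "((('a list \<Rightarrow> real) \<Rightarrow> 'k) \<Rightarrow> 'k) \<Rightarrow> (('a list \<Rightarrow> real) \<Rightarrow> 'k) \<Rightarrow> 'k" where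
    "h g = (\<lambda>\<psi>. if \<psi> \<in> additive_on ?A2 then g (pb \<psi>) else 0)" for g
  have h: "flinear h"
    by (rule flinearI) (auto simp: h_def fun_eq_iff fscale_apply)
  have pb_add: "pb \<psi> \<in> additive_on ?A1" if \<psi>: "\<psi> \<in> additive_on ?A2" for \<psi>
    unfolding additive_on_def A1
  proof (intro CollectI ballI)
    fix a b assume "a \<in> (\<lambda>x. wedge [x]) ` ?V" "b \<in> (\<lambda>x. wedge [x]) ` ?V"
    then obtain f f' where f: "f \<in> ?V" "f' \<in> ?V" and ab: "a = wedge [f]" "b = wedge [f']"
      by blast
    have "wedge [?e, f] \<in> ?A2" "wedge [?e, f'] \<in> ?A2"
      using f A2 by blast+
    then show "pb \<psi> (a + b) = pb \<psi> a + pb \<psi> b"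
      unfolding ab wedge_1_add[symmetric] pb_def unwedge_1_wedge wedge_2_add_right by (rule additive_onD[OF \<psi>])
  qed
  have h_delta: "h (tdelta ?A1 (wedge [f])) = tdelta ?A2 (wedge [?e, f])" if "f \<in> ?V" for f
    using pb_add by (auto simp: h_def tdelta_def fun_eq_iff pb_def)
  have img: "h ` ?T1 = ?T2"
  proof -
    have "h ` ?T1 = fs.span (h ` tdelta ?A1 ` ?A1)"
      by (simp add: tspace_eq_span fsp.linear_span_image[OF h])
    also have "h ` tdelta ?A1 ` ?A1 = tdelta ?A2 ` ?A2"
      unfolding A1 A2 image_image using h_delta[unfolded A1 A2] by (intro image_cong) auto
    finally show ?thesis
      by (simp add: tspace_eq_span)
  qed
  obtain \<phi>0 :: "('a list \<Rightarrow> real) \<Rightarrow> 'k" where \<phi>0: "\<phi>0 \<in> additive_on ?A1" "\<phi>0 (wedge [?e]) = 1"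
    using functional_ray[OF \<rho>] .
  let ?d = "tdelta ?A1 (wedge [?e]) :: (('a list \<Rightarrow> real) \<Rightarrow> 'k) \<Rightarrow> 'k"
  have d0: "?d \<noteq> 0"
  proof
    assume "?d = 0"
    from fun_cong[OF this, of \<phi>0] show False using \<phi>0 by (simp add: tdelta_def)
  qed
  have eA1: "wedge [?e] \<in> ?A1"
    using edge_vectors[OF \<rho>] A1 by blast
  have ker: "{g \<in> ?T1. h g = 0} = fs.span {?d}"
  proof (intro equalityI subsetI)
    fix g assume "g \<in> fs.span {?d}"
    then obtain k where g: "g = fscale k ?d" by (auto simp: fs.span_singleton)
    have "tdelta ?A2 (0 :: 'a list \<Rightarrow> real) = (0 :: (('a list \<Rightarrow> real) \<Rightarrow> 'k) \<Rightarrow> 'k)"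
      by (auto simp: fun_eq_iff tdelta_def additive_on_0)
    then have "h ?d = 0"
      using h_delta[OF edge_vectors[OF \<rho>]] by (simp only: wedge_2_same)
    then have "h g = 0"
      unfolding g fsp.linear_scale[OF h] by simp
    moreover have "g \<in> ?T1"
      unfolding g by (rule fs.subspace_scale[OF subspace_tspace[OF subgroup_F_int] tdelta_in_tspace[OF subgroup_F_int eA1]])
    ultimately show "g \<in> {g \<in> ?T1. h g = 0}" by simp
  next
    fix g assume g: "g \<in> {g \<in> ?T1. h g = 0}"
    then have gT: "g \<in> ?T1" and hg: "h g = 0" by simp_all
    have zero: "g \<theta> = 0" if \<theta>: "\<theta> \<in> additive_on ?A1" "\<theta> (wedge [?e]) = 0" for \<theta>
    proof -
      obtain \<psi> where \<psi>: "\<psi> \<in> additive_on ?A2" "\<forall>f\<in>?V. \<psi> (wedge [?e, f]) = \<theta> (wedge [f])"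
        by (rule functional_quotient[OF \<rho> \<theta>])
      have "\<theta> a = pb \<psi> a" if "a \<in> ?A1" for a
        using that \<psi>(2) unfolding A1 by (auto simp: pb_def)
      then have "g \<theta> = g (pb \<psi>)"
        by (rule tspace_cong_arg[OF gT \<theta>(1) _ subgroup_F_int])
      also have "\<dots> = 0"
        using fun_cong[OF hg, of \<psi>] \<psi>(1) by (simp add: h_def)
      finally show ?thesis .
    qed
    \<comment> \<open>Subtracting from \<open>\<theta>\<close> the multiple of
      \<open>\<phi>0\<close> with the same value at the edge leaves a function that kills the edge,
      and there \<open>g\<close> vanishes by \<open>zero\<close>.\<close>
    have "g \<theta> = fscale (g \<phi>0) ?d \<theta>" for \<theta>
    proof (cases "\<theta> \<in> additive_on ?A1")
      case True
      let ?c = "\<theta> (wedge [?e])"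
      have c: "fscale (- ?c) \<phi>0 \<in> additive_on ?A1"
        using \<phi>0(1) by (simp add: additive_on_def fscale_apply algebra_simps)
      have "\<theta> + fscale (- ?c) \<phi>0 \<in> additive_on ?A1"
        using True c by (simp add: additive_on_def algebra_simps)
      moreover have "(\<theta> + fscale (- ?c) \<phi>0) (wedge [?e]) = 0"
        using \<phi>0(2) by (simp add: fscale_apply)
      ultimately have "g (\<theta> + fscale (- ?c) \<phi>0) = 0"
        by (rule zero)
      then have "g \<theta> + - ?c * g \<phi>0 = 0"
        unfolding tspace_add_arg[OF gT True c] tspace_scale_arg[OF gT \<phi>0(1)] .
      then show ?thesis
        using True by (simp add: fscale_apply tdelta_def algebra_simps)
    next
      case False
      then show ?thesis
        using tspace_outside[OF gT False] by (simp add: fscale_apply tdelta_def)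
    qed
    then have "g = fscale (g \<phi>0) ?d"
      by (rule ext)
    then show "g \<in> fs.span {?d}"
      by (metis fs.span_base fs.span_scale singletonI)
  qed
  have "fin_space ?T1"
    by (rule fin_space_F[OF _ coneD[OF \<rho>]]) simp
  from rank_nullity[OF h this] show ?thesis
    unfolding img ker dim_span_single[OF d0] .
qed

end

section \<open>Tropical chains\<close>

lemma additive_zero:
  assumes "A = subgroup_gen S" "\<phi> \<in> additive_on A" "a \<in> A" "\<And>s. s \<in> S \<Longrightarrow> \<phi> s = 0"
  shows "\<phi> a = 0"
  by (rule additive_on_zero_gen[of \<phi> S a]) (use assms in simp_all)

context fan2
begin

abbreviation rays :: "'a set set" where "rays \<equiv> cones \<Sigma> 1"
abbreviation facets :: "'a set set" where "facets \<equiv> cones \<Sigma> 2"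

definition facets_at :: "'a set \<Rightarrow> 'a set set" where
  "facets_at \<rho> = {\<alpha> \<in> facets. \<rho> face_of \<alpha>}"

lemma finite_facets_at [simp]: "finite (facets_at \<rho>)"
  by (simp add: facets_at_def)

lemma facets_atD: "\<alpha> \<in> facets_at \<rho> \<Longrightarrow> \<alpha> \<in> facets" "\<alpha> \<in> facets_at \<rho> \<Longrightarrow> \<rho> face_of \<alpha>"
  by (auto simp: facets_at_def)

lemma sum_rays_facets: "(\<Sum>\<rho>\<in>rays. \<Sum>\<alpha>\<in>facets_at \<rho>. f \<rho> \<alpha>) = (\<Sum>\<alpha>\<in>facets. \<Sum>\<rho>\<in>{\<rho> \<in> rays. \<rho> face_of \<alpha>}. f \<rho> \<alpha>)"
  unfolding facets_at_def by (rule sum.swap_restrict) simp_all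

lemma sum_rays_of_quad:
  assumes "indep2 u v" "quad u v \<in> \<Sigma>"
  shows "(\<Sum>\<rho>\<in>{\<rho> \<in> rays. \<rho> face_of quad u v}. f \<rho>) = f (ray u) + f (ray v)"
  unfolding facets_quad[OF assms] using ray_eq_indep2[OF assms(1)] by simp

text \<open>A chain is encoded by the function that sends \<open>(\<sigma>, \<phi>)\<close> to the value of \<open>\<phi>\<close> on its coefficient at \<open>\<sigma>\<close>.\<close>

definition chains :: "nat \<Rightarrow> 'a set set \<Rightarrow> ('a set \<times> (('a list \<Rightarrow> real) \<Rightarrow> 'k::field) \<Rightarrow> 'k) set" where
  "chains p I = dsum I (\<lambda>\<sigma>. tspace (F_int N \<Sigma> p \<sigma>))"

text \<open>No map \<open>iota\<close> is visible: a function additive at the smaller cone is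
  additive at the larger one, and including a coefficient does not change its value there.\<close>

definition bd1 :: "nat \<Rightarrow> ('a set \<times> (('a list \<Rightarrow> real) \<Rightarrow> 'k::field) \<Rightarrow> 'k) \<Rightarrow> 'a set \<times> (('a list \<Rightarrow> real) \<Rightarrow> 'k) \<Rightarrow> 'k" where
  "bd1 p x = (\<lambda>(\<tau>, \<phi>). if \<tau> = {0} \<and> \<phi> \<in> additive_on (F_int N \<Sigma> p {0})
     then \<Sum>\<rho>\<in>rays. of_int (rel_sign ori {0} \<rho>) * x (\<rho>, \<phi>) else 0)"

definition bd2 :: "nat \<Rightarrow> ('a set \<times> (('a list \<Rightarrow> real) \<Rightarrow> 'k::field) \<Rightarrow> 'k) \<Rightarrow> 'a set \<times> (('a list \<Rightarrow> real) \<Rightarrow> 'k) \<Rightarrow> 'k" where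
  "bd2 p x = (\<lambda>(\<rho>, \<phi>). if \<rho> \<in> rays \<and> \<phi> \<in> additive_on (F_int N \<Sigma> p \<rho>)
     then \<Sum>\<alpha>\<in>facets_at \<rho>. of_int (rel_sign ori \<rho> \<alpha>) * x (\<alpha>, \<phi>) else 0)"

definition cyc :: "nat \<Rightarrow> ('a set \<times> (('a list \<Rightarrow> real) \<Rightarrow> 'k::field) \<Rightarrow> 'k) set" where
  "cyc p = {x \<in> chains p facets. bd2 p x = 0}"

lemma chainsD: "x \<in> chains p I \<Longrightarrow> \<sigma> \<in> I \<Longrightarrow> (\<lambda>\<phi>. x (\<sigma>, \<phi>)) \<in> tspace (F_int N \<Sigma> p \<sigma>)"
  by (simp add: chains_def dsum_def)

lemma chains_outside: "x \<in> chains p I \<Longrightarrow> \<sigma> \<notin> I \<Longrightarrow> x (\<sigma>, \<phi>) = 0"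
  by (simp add: chains_def dsum_def)

lemma chains_outside': "x \<in> chains p I \<Longrightarrow> \<phi> \<notin> additive_on (F_int N \<Sigma> p \<sigma>) \<Longrightarrow> x (\<sigma>, \<phi>) = 0"
  using tspace_outside[OF chainsD] chains_outside by (cases "\<sigma> \<in> I") blast+

lemma subspace_chains: "fs.subspace (chains p I)"
  unfolding chains_def by (rule subspace_dsum) (simp add: subspace_tspace)

lemma fin_space_chains:
  assumes "p \<le> 2" "I \<subseteq> \<Sigma>"
  shows "fin_space (chains p I :: ('a set \<times> (('a list \<Rightarrow> real) \<Rightarrow> 'k::field) \<Rightarrow> 'k) set)"
    and "fs.dim (chains p I :: ('a set \<times> (('a list \<Rightarrow> real) \<Rightarrow> 'k::field) \<Rightarrow> 'k) set) =
      (\<Sum>\<sigma>\<in>I. fs.dim (tspace (F_int N \<Sigma> p \<sigma>) :: ((('a list \<Rightarrow> real) \<Rightarrow> 'k) \<Rightarrow> 'k) set))"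
proof -
  have "finite I" using assms(2) finite_fan finite_subset by blast
  then have "fin_space (dsum I (\<lambda>\<sigma>. tspace (F_int N \<Sigma> p \<sigma>)) :: ('a set \<times> (('a list \<Rightarrow> real) \<Rightarrow> 'k) \<Rightarrow> 'k) set) \<and>
    fs.dim (dsum I (\<lambda>\<sigma>. tspace (F_int N \<Sigma> p \<sigma>)) :: ('a set \<times> (('a list \<Rightarrow> real) \<Rightarrow> 'k) \<Rightarrow> 'k) set) =
      (\<Sum>\<sigma>\<in>I. fs.dim (tspace (F_int N \<Sigma> p \<sigma>) :: ((('a list \<Rightarrow> real) \<Rightarrow> 'k) \<Rightarrow> 'k) set))"
    using assms by (intro dim_dsum fin_space_F) auto
  then show "fin_space (chains p I :: ('a set \<times> (('a list \<Rightarrow> real) \<Rightarrow> 'k::field) \<Rightarrow> 'k) set)"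
    "fs.dim (chains p I :: ('a set \<times> (('a list \<Rightarrow> real) \<Rightarrow> 'k::field) \<Rightarrow> 'k) set) =
      (\<Sum>\<sigma>\<in>I. fs.dim (tspace (F_int N \<Sigma> p \<sigma>) :: ((('a list \<Rightarrow> real) \<Rightarrow> 'k) \<Rightarrow> 'k) set))"
    unfolding chains_def by blast+
qed

lemma flinear_bd1: "flinear (bd1 p)"
  by (rule flinearI) (auto simp: bd1_def fun_eq_iff fscale_apply sum.distrib sum_distrib_left algebra_simps)

lemma flinear_bd2: "flinear (bd2 p)"
  by (rule flinearI) (auto simp: bd2_def fun_eq_iff fscale_apply sum.distrib sum_distrib_left algebra_simps)

text \<open>A linear combination of included coefficients is again a coefficient; the boundary maps
  therefore send chains to chains.\<close>

lemma restricted_sum: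
  fixes c :: "'a set \<Rightarrow> 'k::field"
  assumes "\<And>\<sigma>. \<sigma> \<in> I \<Longrightarrow> \<tau> face_of \<sigma> \<and> g \<sigma> \<in> tspace (F_int N \<Sigma> p \<sigma>)"
  shows "(\<lambda>\<phi>. if \<phi> \<in> additive_on (F_int N \<Sigma> p \<tau>) then \<Sum>\<sigma>\<in>I. c \<sigma> * g \<sigma> \<phi> else 0) \<in> tspace (F_int N \<Sigma> p \<tau>)"
proof -
  have "(\<lambda>\<phi>. if \<phi> \<in> additive_on (F_int N \<Sigma> p \<tau>) then \<Sum>\<sigma>\<in>I. c \<sigma> * g \<sigma> \<phi> else 0) =
    (\<Sum>\<sigma>\<in>I. fscale (c \<sigma>) (\<lambda>\<phi>. if \<phi> \<in> additive_on (F_int N \<Sigma> p \<tau>) then g \<sigma> \<phi> else 0))"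
    by (auto simp: fun_eq_iff sum_fun_apply fscale_apply)
  also have "\<dots> \<in> tspace (F_int N \<Sigma> p \<tau>)"
    by (intro fs.subspace_sum[OF subspace_tspace] fs.subspace_scale[OF subspace_tspace] subgroup_F_int
        tspace_restrict[OF F_int_mono subgroup_F_int]) (use assms in blast)+
  finally show ?thesis .
qed

lemma bd1_chains:
  assumes "x \<in> chains p rays"
  shows "bd1 p x \<in> chains p {{0}}"
proof -
  have "(\<lambda>\<phi>. if \<phi> \<in> additive_on (F_int N \<Sigma> p {0}) then \<Sum>\<rho>\<in>rays. of_int (rel_sign ori {0} \<rho>) * x (\<rho>, \<phi>) else 0) \<in>
    tspace (F_int N \<Sigma> p {0})"
    by (rule restricted_sum) (use chainsD[OF assms] zero_face[OF coneD] in blast)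
  then show ?thesis
    by (auto simp: chains_def dsum_def bd1_def)
qed

lemma bd2_chains:
  assumes "x \<in> chains p facets"
  shows "bd2 p x \<in> chains p rays"
proof -
  have "(\<lambda>\<phi>. if \<phi> \<in> additive_on (F_int N \<Sigma> p \<rho>) then \<Sum>\<alpha>\<in>facets_at \<rho>. of_int (rel_sign ori \<rho> \<alpha>) * x (\<alpha>, \<phi>) else 0) \<in>
    tspace (F_int N \<Sigma> p \<rho>)" for \<rho>
    by (rule restricted_sum) (use chainsD[OF assms] facets_atD in blast)
  then show ?thesis
    by (auto simp: chains_def dsum_def bd2_def)
qed

lemma additive_on_face: "\<tau> face_of \<sigma> \<Longrightarrow> \<phi> \<in> additive_on (F_int N \<Sigma> p \<tau>) \<Longrightarrow> \<phi> \<in> additive_on (F_int N \<Sigma> p \<sigma>)"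
  using additive_on_subset[OF F_int_mono] .

text \<open>After exchanging the sums, a two-dimensional cone contributes through its two rays, and
  these contributions cancel by \<open>rel_sign_square\<close>.\<close>

lemma bd1_bd2: "bd1 p (bd2 p x) = (0 :: 'a set \<times> (('a list \<Rightarrow> real) \<Rightarrow> 'k::field) \<Rightarrow> 'k)"
proof
  fix z :: "'a set \<times> (('a list \<Rightarrow> real) \<Rightarrow> 'k)"
  obtain \<tau> \<phi> where z: "z = (\<tau>, \<phi>)" by fastforce
  show "bd1 p (bd2 p x) z = 0 z"
  proof (cases "\<tau> = {0} \<and> \<phi> \<in> additive_on (F_int N \<Sigma> p {0})")
    case True
    have ad: "\<phi> \<in> additive_on (F_int N \<Sigma> p \<rho>)" if "\<rho> \<in> rays" for \<rho>
      using additive_on_face[OF zero_face[OF coneD[OF that]]] True by blast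
    have "bd1 p (bd2 p x) z = (\<Sum>\<rho>\<in>rays. of_int (rel_sign ori {0} \<rho>) * bd2 p x (\<rho>, \<phi>))"
      using True by (simp add: z bd1_def)
    also have "\<dots> = (\<Sum>\<rho>\<in>rays. \<Sum>\<alpha>\<in>facets_at \<rho>. of_int (rel_sign ori {0} \<rho> * rel_sign ori \<rho> \<alpha>) * x (\<alpha>, \<phi>))"
      by (rule sum.cong[OF refl]) (simp add: bd2_def ad sum_distrib_left mult.assoc)
    also have "\<dots> = (\<Sum>\<alpha>\<in>facets. \<Sum>\<rho>\<in>{\<rho> \<in> rays. \<rho> face_of \<alpha>}. of_int (rel_sign ori {0} \<rho> * rel_sign ori \<rho> \<alpha>) * x (\<alpha>, \<phi>))"
      by (rule sum_rays_facets)
    also have "\<dots> = 0"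
    proof (rule sum.neutral, rule ballI)
      fix \<alpha> assume \<alpha>: "\<alpha> \<in> facets"
      obtain u v where uv: "indep2 u v" "\<alpha> = quad u v"
        using quad_obtain[OF \<alpha>] .
      have q: "quad u v \<in> \<Sigma>" using \<alpha> uv coneD by blast
      show "(\<Sum>\<rho>\<in>{\<rho> \<in> rays. \<rho> face_of \<alpha>}. of_int (rel_sign ori {0} \<rho> * rel_sign ori \<rho> \<alpha>) * x (\<alpha>, \<phi>)) = 0"
        unfolding uv(2) sum_rays_of_quad[OF uv(1) q] distrib_right[symmetric] of_int_add[symmetric]
          rel_sign_square[OF uv(1) q] by simp
    qed
    finally show ?thesis by simp
  qed (auto simp: z bd1_def)
qed

lemma subspace_cyc: "fs.subspace (cyc p)"
  using fs.subspace_inter[OF subspace_chains fsp.linear_subspace_kernel[OF flinear_bd2]] by (simp add: cyc_def Int_def)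

text \<open>Rank and nullity of the two boundary maps are added up; exactness identifies the image
  of \<open>bd2\<close> with the kernel of \<open>bd1\<close> and makes \<open>bd1\<close>
  onto.\<close>

lemma euler_characteristic:
  assumes p: "p \<le> 2"
    and ex1: "\<And>x :: 'a set \<times> (('a list \<Rightarrow> real) \<Rightarrow> 'k::field) \<Rightarrow> 'k. x \<in> chains p rays \<Longrightarrow> bd1 p x = 0 \<Longrightarrow> x \<in> bd2 p ` chains p facets"
    and ex0: "\<And>x :: 'a set \<times> (('a list \<Rightarrow> real) \<Rightarrow> 'k) \<Rightarrow> 'k. x \<in> chains p {{0}} \<Longrightarrow> x \<in> bd1 p ` chains p rays"
  shows "fs.dim (cyc p :: ('a set \<times> (('a list \<Rightarrow> real) \<Rightarrow> 'k) \<Rightarrow> 'k) set) +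
      (\<Sum>\<rho>\<in>rays. fs.dim (tspace (F_int N \<Sigma> p \<rho>) :: ((('a list \<Rightarrow> real) \<Rightarrow> 'k) \<Rightarrow> 'k) set)) =
    (\<Sum>\<alpha>\<in>facets. fs.dim (tspace (F_int N \<Sigma> p \<alpha>) :: ((('a list \<Rightarrow> real) \<Rightarrow> 'k) \<Rightarrow> 'k) set)) +
      fs.dim (tspace (F_int N \<Sigma> p {0}) :: ((('a list \<Rightarrow> real) \<Rightarrow> 'k) \<Rightarrow> 'k) set)"
proof -
  let ?C = "\<lambda>I. chains p I :: ('a set \<times> (('a list \<Rightarrow> real) \<Rightarrow> 'k) \<Rightarrow> 'k) set"
  have sub: "facets \<subseteq> \<Sigma>" "rays \<subseteq> \<Sigma>" "{{0}} \<subseteq> \<Sigma>"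
    using zero_in_fan by (auto simp: cones_def)
  note C = fin_space_chains[OF p sub(1), where 'k = 'k] fin_space_chains[OF p sub(2), where 'k = 'k]
    fin_space_chains[OF p sub(3), where 'k = 'k]
  have im2: "bd2 p ` ?C facets = {x \<in> ?C rays. bd1 p x = 0}"
    using ex1 bd2_chains bd1_bd2 by blast
  have im1: "bd1 p ` ?C rays = ?C {{0}}"
    using ex0 bd1_chains by blast
  have "fs.dim (?C facets) = fs.dim {x \<in> ?C rays. bd1 p x = 0} + fs.dim (cyc p :: ('a set \<times> (('a list \<Rightarrow> real) \<Rightarrow> 'k) \<Rightarrow> 'k) set)"
    using rank_nullity[OF flinear_bd2 C(1), of p] unfolding im2 cyc_def .
  moreover have "fs.dim (?C rays) = fs.dim (?C {{0}}) + fs.dim {x \<in> ?C rays. bd1 p x = 0}"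
    using rank_nullity[OF flinear_bd1 C(3), of p] unfolding im1 .
  ultimately show ?thesis
    unfolding C(2,4,6) by simp
qed

text \<open>Both sides are the value of the exterior product of \<open>\<phi>\<close> and
  \<open>\<psi>\<close> on one element of the second exterior power. The integer \<open>s\<close> is
  the determinant that passes from the basis \<open>ori \<alpha>\<close> to
  \<open>edge \<rho>\<close>, \<open>f\<close>.\<close>

lemma edge_pairing:
  assumes \<rho>: "\<rho> \<in> rays" and \<alpha>: "\<alpha> \<in> facets_at \<rho>" and xy: "ori \<alpha> = [x, y]" and f: "f \<in> cone_lattice N \<alpha>"
    and s: "of_int s * wedge (ori \<alpha>) = wedge [edge \<rho>, f]"
    and \<phi>: "\<phi> \<in> additive_on (F_int N \<Sigma> 1 \<alpha>)" and \<psi>: "\<psi> \<in> additive_on (F_int N \<Sigma> 1 \<alpha>)"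
  shows "of_int s * (\<phi> (wedge [x]) * \<psi> (wedge [y]) - \<phi> (wedge [y]) * \<psi> (wedge [x])) =
    \<phi> (wedge [edge \<rho>]) * \<psi> (wedge [f]) - \<phi> (wedge [f]) * \<psi> (wedge [edge \<rho>])"
proof -
  note \<alpha>' = facets_atD[OF \<alpha>]
  obtain x' y' where xy': "ori \<alpha> = [x', y']" "indep2 x' y'" "span \<alpha> = span {x', y'}"
      "cone_lattice N \<alpha> = {of_int n *\<^sub>R x' + of_int m *\<^sub>R y' | n m. True}"
    using ori_facet[OF \<alpha>'(1)] .
  have eq: "x' = x" "y' = y" using xy xy'(1) by simp_all
  note ind = xy'(2)[unfolded eq] and L = xy'(4)[unfolded eq]
  obtain a b where ab: "edge \<rho> = of_int a *\<^sub>R x + of_int b *\<^sub>R y"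
    using edge_in_facet_lattice[OF \<rho> \<alpha>'(2)] L by blast
  obtain c d where cd: "f = of_int c *\<^sub>R x + of_int d *\<^sub>R y"
    using f L by blast
  have "fscale (of_int s) (wedge [x, y]) = fscale (of_int (a * d - b * c)) (wedge [x, y])"
    using s unfolding xy ab cd of_int_mult_fscale
    by (simp add: wedge_2 fun_eq_iff fscale_apply inner_add_left algebra_simps)
  then have "real_of_int s = of_int (a * d - b * c)"
    using fs.scale_cancel_right wedge_indep2[OF ind] by blast
  then have sd: "s = a * d - b * c"
    by (simp only: of_int_eq_iff)
  have "x \<in> cone_lattice N \<alpha>" "y \<in> cone_lattice N \<alpha>"
    using ori_gen[OF coneD[OF \<alpha>'(1)]] subgroup_gen_superset[of "set (ori \<alpha>)"] xy by auto
  then have in1: "wedge [x] \<in> F_int N \<Sigma> 1 \<alpha>" "wedge [y] \<in> F_int N \<Sigma> 1 \<alpha>"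
    unfolding F_int_1_facet[OF \<alpha>'(1)] by blast+
  have ev: "\<theta> (wedge [of_int n *\<^sub>R x + of_int m *\<^sub>R y]) = of_int n * \<theta> (wedge [x]) + of_int m * \<theta> (wedge [y])"
    if \<theta>: "\<theta> \<in> additive_on (F_int N \<Sigma> 1 \<alpha>)" for n m and \<theta> :: "('a list \<Rightarrow> real) \<Rightarrow> 'b"
  proof -
    have "wedge [of_int n *\<^sub>R x + of_int m *\<^sub>R y] = of_int n * wedge [x] + of_int m * wedge [y]"
      by (simp only: wedge_1_add wedge_1_scale of_int_mult_fscale)
    moreover have "of_int n * wedge [x] \<in> F_int N \<Sigma> 1 \<alpha>" "of_int m * wedge [y] \<in> F_int N \<Sigma> 1 \<alpha>"
      using add_subgroup_of_int_mult[OF subgroup_F_int] in1 by blast+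
    ultimately show ?thesis
      by (simp only: additive_onD[OF \<theta>] additive_on_of_int_mult[OF \<theta> subgroup_F_int in1(1)]
          additive_on_of_int_mult[OF \<theta> subgroup_F_int in1(2)])
  qed
  show ?thesis
    unfolding ab cd ev[OF \<phi>] ev[OF \<psi>] sd by (simp add: algebra_simps)
qed

end

section \<open>The cap product in terms of values, and the numerical criterion\<close>

text \<open>For two vectors \<open>ys\<close>, the value of \<open>\<psi>\<close> at the contraction
  of their product with \<open>\<phi>\<close>. The factor (-1)^(p(p-1)/2) shows as a minus sign for
  p = 2 only.\<close>

definition contr :: "nat \<Rightarrow> (('a::euclidean_space list \<Rightarrow> real) \<Rightarrow> 'k::field) \<Rightarrow> (('a list \<Rightarrow> real) \<Rightarrow> 'k) \<Rightarrow> 'a list \<Rightarrow> 'k" where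
  "contr p \<phi> \<psi> ys = (if p = 0 then \<phi> (wedge []) * \<psi> (wedge ys)
     else if p = 1 then \<phi> (wedge [ys ! 0]) * \<psi> (wedge [ys ! 1]) - \<phi> (wedge [ys ! 1]) * \<psi> (wedge [ys ! 0])
     else - (\<phi> (wedge ys) * \<psi> (wedge [])))"

text \<open>Over a field the weights are nonzero, and the cycle condition on the fundamental chain
  is tested by the additive functions at each ray; \<open>balanced_fan2I\<close> derives this
  form.\<close>

locale balanced_fan2 = fan2 N \<Sigma> ori for N \<Sigma> and ori :: "'a::euclidean_space set \<Rightarrow> 'a list" +
  fixes w :: "'a set \<Rightarrow> 'k::field"
  assumes weight_nonzero: "\<alpha> \<in> cones \<Sigma> 2 \<Longrightarrow> w \<alpha> \<noteq> 0"
    and balance: "\<rho> \<in> cones \<Sigma> 1 \<Longrightarrow> \<psi> \<in> additive_on (F_int N \<Sigma> 2 \<rho>) \<Longrightarrow>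
      (\<Sum>\<alpha>\<in>facets_at \<rho>. of_int (rel_sign ori \<rho> \<alpha>) * w \<alpha> * \<psi> (wedge (ori \<alpha>))) = 0"
begin

lemma nat_le_2_cases: "p \<le> 2 \<Longrightarrow> p = 0 \<or> p = 1 \<or> p = (2::nat)"
  by linarith

lemma dim_F_2_ray_less:
  assumes \<rho>: "\<rho> \<in> rays"
  shows "fs.dim (tspace (F_int N \<Sigma> 2 \<rho>) :: ((('a list \<Rightarrow> real) \<Rightarrow> 'k) \<Rightarrow> 'k) set) + 1 \<le> card (facets_at \<rho>)"
proof -
  let ?A = "F_int N \<Sigma> 2 \<rho>"
  let ?d = "\<lambda>\<alpha>. tdelta ?A (wedge (ori \<alpha>)) :: (('a list \<Rightarrow> real) \<Rightarrow> 'k) \<Rightarrow> 'k"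
  have gen: "?A = subgroup_gen ((\<lambda>\<alpha>. wedge (ori \<alpha>)) ` facets_at \<rho>)"
  proof -
    have "{wedge (ori \<alpha>)} \<subseteq> forms N 2 (span \<alpha>) \<and> forms N 2 (span \<alpha>) \<subseteq> subgroup_gen {wedge (ori \<alpha>)}"
      if "\<alpha> \<in> facets" for \<alpha>
      using generators[OF order_refl that] by metis
    then have "?A = subgroup_gen (\<Union>\<alpha>\<in>{\<alpha> \<in> facets. \<rho> face_of \<alpha>}. {wedge (ori \<alpha>)})"
      by (intro F_int_generated[OF coneD[OF \<rho>]])
    then show ?thesis
      by (simp add: facets_at_def UNION_singleton_eq_range)
  qed
  have T: "tspace ?A = fs.span (?d ` facets_at \<rho>)"
    using tspace_subgroup_gen[of "(\<lambda>\<alpha>. wedge (ori \<alpha>)) ` facets_at \<rho>"] unfolding gen[symmetric] image_image .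
  obtain \<alpha>0 where \<alpha>0: "\<alpha>0 \<in> facets_at \<rho>"
    using in_facet[OF coneD[OF \<rho>]] by (auto simp: facets_at_def)
  let ?c = "\<lambda>\<alpha>. of_int (rel_sign ori \<rho> \<alpha>) * w \<alpha>"
  have c0: "?c \<alpha>0 \<noteq> 0"
    using weight_nonzero[OF facets_atD(1)[OF \<alpha>0]] rel_sign_cases[of \<rho> \<alpha>0] by auto
  have "(\<Sum>\<alpha>\<in>facets_at \<rho>. fscale (?c \<alpha>) (?d \<alpha>)) = 0"
  proof
    fix \<psi>
    show "(\<Sum>\<alpha>\<in>facets_at \<rho>. fscale (?c \<alpha>) (?d \<alpha>)) \<psi> = 0 \<psi>"
      using balance[OF \<rho>, of \<psi>]
      by (cases "\<psi> \<in> additive_on ?A") (simp_all add: sum_fun_apply fscale_apply tdelta_def)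
  qed
  then have "fscale (?c \<alpha>0) (?d \<alpha>0) + (\<Sum>\<alpha>\<in>facets_at \<rho> - {\<alpha>0}. fscale (?c \<alpha>) (?d \<alpha>)) = 0"
    by (simp only: sum.remove[OF finite_facets_at \<alpha>0])
  then have "fscale (?c \<alpha>0) (?d \<alpha>0) = - (\<Sum>\<alpha>\<in>facets_at \<rho> - {\<alpha>0}. fscale (?c \<alpha>) (?d \<alpha>))"
    by (rule eq_neg_iff_add_eq_0[THEN iffD2])
  also have "\<dots> \<in> fs.span (?d ` (facets_at \<rho> - {\<alpha>0}))"
    by (intro fs.span_neg fs.span_sum fs.span_scale fs.span_base) blast
  finally have "fscale (1 / ?c \<alpha>0) (fscale (?c \<alpha>0) (?d \<alpha>0)) \<in> fs.span (?d ` (facets_at \<rho> - {\<alpha>0}))"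
    by (rule fs.span_scale)
  then have d0: "?d \<alpha>0 \<in> fs.span (?d ` (facets_at \<rho> - {\<alpha>0}))"
    using c0 by (simp only: fs.scale_scale) simp
  have "?d ` facets_at \<rho> \<subseteq> fs.span (?d ` (facets_at \<rho> - {\<alpha>0}))"
  proof
    fix g assume "g \<in> ?d ` facets_at \<rho>"
    then obtain \<alpha> where \<alpha>: "\<alpha> \<in> facets_at \<rho>" "g = ?d \<alpha>" by blast
    show "g \<in> fs.span (?d ` (facets_at \<rho> - {\<alpha>0}))"
      using d0 \<alpha> by (cases "\<alpha> = \<alpha>0") (simp, blast intro: fs.span_base)
  qed
  then have "fs.dim (?d ` facets_at \<rho>) \<le> card (?d ` (facets_at \<rho> - {\<alpha>0}))"
    by (rule fs.dim_le_card) simp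
  also have "\<dots> \<le> card (facets_at \<rho> - {\<alpha>0})"
    by (rule card_image_le) simp
  also have "\<dots> + 1 = card (facets_at \<rho>)"
    using \<alpha>0 by (metis Suc_eq_plus1 card_Suc_Diff1 finite_facets_at)
  finally show ?thesis
    unfolding T fs.dim_span by simp
qed

text \<open>The cap product in degree q = 0, in terms of values. A cochain at the vertex is the
  function \<open>\<phi>\<close> itself, and restricting it to \<open>\<alpha>\<close> leaves the
  function as it is.\<close>

definition capv :: "nat \<Rightarrow> (('a list \<Rightarrow> real) \<Rightarrow> 'k) \<Rightarrow> 'a set \<times> (('a list \<Rightarrow> real) \<Rightarrow> 'k) \<Rightarrow> 'k" where
  "capv p \<phi> = (\<lambda>(\<alpha>, \<psi>). if \<alpha> \<in> facets \<and> \<psi> \<in> additive_on (F_int N \<Sigma> (2 - p) \<alpha>)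
     then w \<alpha> * contr p \<phi> \<psi> (ori \<alpha>) else 0)"

lemma flinear_capv: "flinear (capv p)"
  by (rule flinearI) (auto simp: capv_def contr_def fun_eq_iff fscale_apply algebra_simps)

lemma wedge_Nil_in: "\<sigma> \<in> \<Sigma> \<Longrightarrow> wedge [] \<in> F_int N \<Sigma> 0 \<sigma>"
  by (simp add: F_int_0 subgroup_gen_base)

lemma wedge_ori_in: "\<alpha> \<in> facets \<Longrightarrow> wedge (ori \<alpha>) \<in> F_int N \<Sigma> 2 \<alpha>"
  by (simp add: F_int_2_facet subgroup_gen_base)

lemma wedge_ori_1_in: "\<alpha> \<in> facets \<Longrightarrow> ori \<alpha> = [x, y] \<Longrightarrow> wedge [x] \<in> F_int N \<Sigma> 1 \<alpha> \<and> wedge [y] \<in> F_int N \<Sigma> 1 \<alpha>"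
  unfolding F_int_1_facet using ori_gen[OF coneD, of \<alpha> 2] subgroup_gen_superset[of "set (ori \<alpha>)"] by auto

lemma contr_tspace:
  assumes "p \<le> 2" "\<alpha> \<in> facets"
  shows "(\<lambda>\<psi>. if \<psi> \<in> additive_on (F_int N \<Sigma> (2 - p) \<alpha>) then w \<alpha> * contr p \<phi> \<psi> (ori \<alpha>) else 0)
    \<in> tspace (F_int N \<Sigma> (2 - p) \<alpha>)"
proof -
  let ?A = "F_int N \<Sigma> (2 - p) \<alpha>"
  note d = tdelta_in_tspace[OF subgroup_F_int] and sc = fs.subspace_scale[OF subspace_tspace[OF subgroup_F_int]]
  obtain x y where xy: "ori \<alpha> = [x, y]"
    using ori_facet[OF assms(2)] by metis
  consider "p = 0" | "p = 1" | "p = 2" using nat_le_2_cases[OF assms(1)] by blast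
  then show ?thesis
  proof cases
    case 1
    have "(\<lambda>\<psi>. if \<psi> \<in> additive_on ?A then w \<alpha> * contr p \<phi> \<psi> (ori \<alpha>) else 0) =
      fscale (w \<alpha> * \<phi> (wedge [])) (tdelta ?A (wedge (ori \<alpha>)))"
      by (auto simp: fun_eq_iff fscale_apply tdelta_def contr_def 1)
    also have "\<dots> \<in> tspace ?A"
      using wedge_ori_in[OF assms(2)] by (intro sc d) (simp add: 1)
    finally show ?thesis .
  next
    case 2
    have A: "?A = F_int N \<Sigma> 1 \<alpha>" by (simp add: 2)
    have "(\<lambda>\<psi>. if \<psi> \<in> additive_on ?A then w \<alpha> * contr p \<phi> \<psi> (ori \<alpha>) else 0) =
      fscale (w \<alpha> * \<phi> (wedge [x])) (tdelta ?A (wedge [y])) - fscale (w \<alpha> * \<phi> (wedge [y])) (tdelta ?A (wedge [x]))"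
      by (auto simp: fun_eq_iff fscale_apply tdelta_def contr_def 2 xy algebra_simps)
    also have "\<dots> \<in> tspace ?A"
      unfolding A using wedge_ori_1_in[OF assms(2) xy]
      by (intro fs.subspace_diff[OF subspace_tspace[OF subgroup_F_int]] sc d) blast+
    finally show ?thesis .
  next
    case 3
    have "(\<lambda>\<psi>. if \<psi> \<in> additive_on ?A then w \<alpha> * contr p \<phi> \<psi> (ori \<alpha>) else 0) =
      fscale (- w \<alpha> * \<phi> (wedge (ori \<alpha>))) (tdelta ?A (wedge []))"
      by (auto simp: fun_eq_iff fscale_apply tdelta_def contr_def 3)
    also have "\<dots> \<in> tspace ?A"
      using wedge_Nil_in[OF coneD[OF assms(2)]] by (intro sc d) (simp add: 3)
    finally show ?thesis .
  qed
qed

text \<open>For p = 0 and p = 2 the boundary at a ray is a constant times the balancing relation.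
  For p = 1 the two functions are combined to \<open>\<theta>\<close>, which kills the edge vector
  and therefore descends to a function \<open>\<xi>\<close> on F_2(\<rho>); the boundary is the
  balancing relation evaluated at \<open>\<xi>\<close>.\<close>

lemma capv_cyc:
  assumes p: "p \<le> 2" and \<phi>: "\<phi> \<in> additive_on (F_int N \<Sigma> p {0})"
  shows "capv p \<phi> \<in> cyc (2 - p)"
proof -
  have "capv p \<phi> \<in> chains (2 - p) facets"
    using contr_tspace[OF p] by (simp add: chains_def dsum_def capv_def)
  moreover have "bd2 (2 - p) (capv p \<phi>) = 0"
  proof
    fix z :: "'a set \<times> (('a list \<Rightarrow> real) \<Rightarrow> 'k)"
    obtain \<rho> \<psi> where z: "z = (\<rho>, \<psi>)" by fastforce
    show "bd2 (2 - p) (capv p \<phi>) z = 0 z"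
    proof (cases "\<rho> \<in> rays \<and> \<psi> \<in> additive_on (F_int N \<Sigma> (2 - p) \<rho>)")
      case True
      then have \<rho>: "\<rho> \<in> rays" and \<psi>: "\<psi> \<in> additive_on (F_int N \<Sigma> (2 - p) \<rho>)" by blast+
      have \<psi>': "\<psi> \<in> additive_on (F_int N \<Sigma> (2 - p) \<alpha>)" if "\<alpha> \<in> facets_at \<rho>" for \<alpha>
        using additive_on_face[OF facets_atD(2)[OF that] \<psi>] .
      have \<phi>\<rho>: "\<phi> \<in> additive_on (F_int N \<Sigma> p \<rho>)"
        using additive_on_face[OF zero_face[OF coneD[OF \<rho>]] \<phi>] .
      have "bd2 (2 - p) (capv p \<phi>) z = (\<Sum>\<alpha>\<in>facets_at \<rho>. of_int (rel_sign ori \<rho> \<alpha>) * (w \<alpha> * contr p \<phi> \<psi> (ori \<alpha>)))"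
        using True \<psi>' facets_atD(1) by (auto simp: z bd2_def capv_def intro!: sum.cong)
      also have "\<dots> = 0"
      proof -
        consider "p = 0" | "p = 1" | "p = 2" using nat_le_2_cases[OF p] by blast
        then show ?thesis
        proof cases
          case 1
          have "(\<Sum>\<alpha>\<in>facets_at \<rho>. of_int (rel_sign ori \<rho> \<alpha>) * (w \<alpha> * contr p \<phi> \<psi> (ori \<alpha>))) =
            \<phi> (wedge []) * (\<Sum>\<alpha>\<in>facets_at \<rho>. of_int (rel_sign ori \<rho> \<alpha>) * w \<alpha> * \<psi> (wedge (ori \<alpha>)))"
            unfolding sum_distrib_left by (rule sum.cong) (simp_all add: contr_def 1)
          then show ?thesis using balance[OF \<rho>, of \<psi>] \<psi> by (simp add: 1)
        next
          case 3
          have "(\<Sum>\<alpha>\<in>facets_at \<rho>. of_int (rel_sign ori \<rho> \<alpha>) * (w \<alpha> * contr p \<phi> \<psi> (ori \<alpha>))) =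
            - \<psi> (wedge []) * (\<Sum>\<alpha>\<in>facets_at \<rho>. of_int (rel_sign ori \<rho> \<alpha>) * w \<alpha> * \<phi> (wedge (ori \<alpha>)))"
            unfolding sum_distrib_left by (rule sum.cong) (simp_all add: contr_def 3)
          then show ?thesis using balance[OF \<rho>, of \<phi>] \<phi>\<rho> by (simp add: 3)
        next
          case 2
          have \<phi>1: "\<phi> \<in> additive_on (F_int N \<Sigma> 1 \<rho>)" and \<psi>1: "\<psi> \<in> additive_on (F_int N \<Sigma> 1 \<rho>)"
            using \<phi>\<rho> \<psi> by (simp_all add: 2)
          let ?e = "wedge [edge \<rho>]"
          define \<theta> where "\<theta> g = \<phi> ?e * \<psi> g - \<psi> ?e * \<phi> g" for g
          have \<theta>: "\<theta> \<in> additive_on (F_int N \<Sigma> 1 \<rho>)"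
            using \<phi>1 \<psi>1 by (simp add: additive_on_def \<theta>_def algebra_simps)
          obtain \<xi> where \<xi>: "\<xi> \<in> additive_on (F_int N \<Sigma> 2 \<rho>)" "\<forall>f\<in>vectors \<rho>. \<xi> (wedge [edge \<rho>, f]) = \<theta> (wedge [f])"
            using functional_quotient[OF \<rho> \<theta>] by (auto simp: \<theta>_def)
          have "of_int (rel_sign ori \<rho> \<alpha>) * (w \<alpha> * contr p \<phi> \<psi> (ori \<alpha>)) =
              of_int (rel_sign ori \<rho> \<alpha>) * w \<alpha> * \<xi> (wedge (ori \<alpha>))" if \<alpha>: "\<alpha> \<in> facets_at \<rho>" for \<alpha>
          proof -
            let ?s = "rel_sign ori \<rho> \<alpha>"
            obtain x y where xy: "ori \<alpha> = [x, y]"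
              using ori_facet[OF facets_atD(1)[OF \<alpha>]] by metis
            obtain f where f: "f \<in> cone_lattice N \<alpha>" "of_int ?s * wedge (ori \<alpha>) = wedge [edge \<rho>, f]"
              using signed_generator[OF \<rho> facets_atD[OF \<alpha>]] by metis
            have "of_int ?s * contr p \<phi> \<psi> (ori \<alpha>) = \<theta> (wedge [f])"
              using edge_pairing[OF \<rho> \<alpha> xy f additive_on_face[OF facets_atD(2)[OF \<alpha>] \<phi>1] additive_on_face[OF facets_atD(2)[OF \<alpha>] \<psi>1]]
              by (simp add: contr_def 2 xy \<theta>_def algebra_simps)
            also have "\<dots> = \<xi> (wedge [edge \<rho>, f])"
              using \<xi>(2) f(1) cone_lattice_vectors[OF facets_atD[OF \<alpha>]] by auto
            also have "\<dots> = of_int ?s * \<xi> (wedge (ori \<alpha>))"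
              unfolding f(2)[symmetric]
              by (rule additive_on_of_int_mult[OF \<xi>(1) subgroup_F_int])
                (use wedge_ori_in[OF facets_atD(1)[OF \<alpha>]] F_int_mono[OF facets_atD(2)[OF \<alpha>]] in blast)
            finally show ?thesis by (simp add: mult.left_commute mult.assoc)
          qed
          then have "(\<Sum>\<alpha>\<in>facets_at \<rho>. of_int (rel_sign ori \<rho> \<alpha>) * (w \<alpha> * contr p \<phi> \<psi> (ori \<alpha>))) =
            (\<Sum>\<alpha>\<in>facets_at \<rho>. of_int (rel_sign ori \<rho> \<alpha>) * w \<alpha> * \<xi> (wedge (ori \<alpha>)))"
            by (rule sum.cong[OF refl])
          also have "\<dots> = 0" by (rule balance[OF \<rho> \<xi>(1)])
          finally show ?thesis .
        qed
      qed
      finally show ?thesis by simp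
    qed (auto simp: z bd2_def)
  qed
  ultimately show ?thesis
    by (simp add: cyc_def)
qed

text \<open>On each maximal cone \<open>\<phi>\<close> is tested against functions dual to the
  generators, and F_p of the vertex is generated by the groups of the maximal cones.\<close>

lemma capv_inj:
  assumes p: "p \<le> 2" and \<phi>: "\<phi> \<in> addf (F_int N \<Sigma> p {0})" and zero: "capv p \<phi> = 0"
  shows "\<phi> = 0"
proof -
  have \<phi>0: "\<phi> \<in> additive_on (F_int N \<Sigma> p {0})"
    using \<phi> by (simp add: addf_def)
  have contr0: "contr p \<phi> \<psi> (ori \<alpha>) = 0" if "\<alpha> \<in> facets" "\<psi> \<in> additive_on (F_int N \<Sigma> (2 - p) \<alpha>)" for \<alpha> \<psi>
    using fun_cong[OF zero, of "(\<alpha>, \<psi>)"] that weight_nonzero[of \<alpha>] by (simp add: capv_def)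
  have \<alpha>0: "\<phi> g = 0" if \<alpha>: "\<alpha> \<in> facets" and g: "g \<in> F_int N \<Sigma> p \<alpha>" for \<alpha> g
  proof -
    have \<phi>\<alpha>: "\<phi> \<in> additive_on (F_int N \<Sigma> p \<alpha>)"
      using additive_on_face[OF zero_face[OF coneD[OF \<alpha>]] \<phi>0] .
    obtain x y where xy: "ori \<alpha> = [x, y]"
      using ori_facet[OF \<alpha>] by metis
    consider "p = 0" | "p = 1" | "p = 2" using nat_le_2_cases[OF p] by blast
    then show ?thesis
    proof cases
      case 1
      obtain \<psi> :: "('a list \<Rightarrow> real) \<Rightarrow> 'k" where "\<psi> \<in> additive_on (F_int N \<Sigma> 2 \<alpha>)" "\<psi> (wedge (ori \<alpha>)) = 1"
        using functional_cyclic[OF wedge_ori_nonzero[OF \<alpha>]] F_int_2_facet[OF \<alpha>] by metis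
      then have "\<phi> (wedge []) = 0"
        using contr0[OF \<alpha>, of \<psi>] by (simp add: contr_def 1)
      then show ?thesis
        by (intro additive_zero[OF F_int_0[OF coneD[OF \<alpha>]] \<phi>\<alpha>[unfolded 1] g[unfolded 1]]) simp
    next
      case 2
      obtain \<psi> \<theta> :: "('a list \<Rightarrow> real) \<Rightarrow> 'k" where f:
        "\<psi> \<in> additive_on (F_int N \<Sigma> 1 \<alpha>)" "\<psi> (wedge [x]) = 1" "\<psi> (wedge [y]) = 0"
        "\<theta> \<in> additive_on (F_int N \<Sigma> 1 \<alpha>)" "\<theta> (wedge [x]) = 0" "\<theta> (wedge [y]) = 1"
        using functional_facet[OF \<alpha> xy] by metis
      have "\<phi> (wedge [y]) = 0" "\<phi> (wedge [x]) = 0"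
        using contr0[OF \<alpha>, of \<psi>] contr0[OF \<alpha>, of \<theta>] f by (simp_all add: contr_def 2 xy)
      moreover have "F_int N \<Sigma> 1 \<alpha> = subgroup_gen ((\<lambda>x. wedge [x]) ` set (ori \<alpha>))"
        unfolding subgroup_gen_image[OF wedge_1_diff] ori_gen[OF coneD[OF \<alpha>]] F_int_1_facet[OF \<alpha>] ..
      ultimately show ?thesis
        by (intro additive_zero[OF _ \<phi>\<alpha>[unfolded 2] g[unfolded 2]]) (auto simp: xy)
    next
      case 3
      obtain \<psi> :: "('a list \<Rightarrow> real) \<Rightarrow> 'k" where "\<psi> \<in> additive_on (F_int N \<Sigma> 0 \<alpha>)" "\<psi> (wedge []) = 1"
      proof -
        have "wedge [] \<noteq> (0 :: 'a list \<Rightarrow> real)"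
          by (metis wedge_Nil zero_fun_apply zero_neq_one)
        from functional_cyclic[OF this] show thesis
          using that F_int_0[OF coneD[OF \<alpha>]] by metis
      qed
      then have "\<phi> (wedge (ori \<alpha>)) = 0"
        using contr0[OF \<alpha>, of \<psi>] by (simp add: contr_def 3)
      then show ?thesis
        by (intro additive_zero[OF F_int_2_facet[OF \<alpha>] \<phi>\<alpha>[unfolded 3] g[unfolded 3]]) simp
    qed
  qed
  have "\<phi> a = 0" for a
  proof (cases "a \<in> F_int N \<Sigma> p {0}")
    case True
    show ?thesis
      by (rule additive_zero[OF F_int_eq_gen_facets[OF zero_in_fan] \<phi>0 True]) (use \<alpha>0 in blast)
  qed (use \<phi> in \<open>simp add: addf_def\<close>)
  then show ?thesis by (simp add: fun_eq_iff)
qed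

text \<open>Injectivity turns each equality on the left into an equality of dimensions. The Euler
  characteristics involve the local numbers through their sums only; the passage to single rays
  comes from the termwise inequality \<open>dim_F_2_ray_less\<close>.\<close>

theorem duality_criterion:
  assumes ex1: "\<And>p x. p \<le> 2 \<Longrightarrow> x \<in> chains p rays \<Longrightarrow> bd1 p x = 0 \<Longrightarrow>
      x \<in> bd2 p ` (chains p facets :: ('a set \<times> (('a list \<Rightarrow> real) \<Rightarrow> 'k) \<Rightarrow> 'k) set)"
    and ex0: "\<And>p x. p \<le> 2 \<Longrightarrow> x \<in> chains p {{0}} \<Longrightarrow>
      x \<in> bd1 p ` (chains p rays :: ('a set \<times> (('a list \<Rightarrow> real) \<Rightarrow> 'k) \<Rightarrow> 'k) set)"
  shows "(\<forall>p\<le>2. capv p ` addf (F_int N \<Sigma> p {0}) = cyc (2 - p)) \<longleftrightarrow>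
    (\<forall>\<rho>\<in>rays. fs.dim (tspace (F_int N \<Sigma> 2 \<rho>) :: ((('a list \<Rightarrow> real) \<Rightarrow> 'k) \<Rightarrow> 'k) set) + 1 = card (facets_at \<rho>))"
proof -
  let ?T = "\<lambda>p \<sigma>. tspace (F_int N \<Sigma> p \<sigma>) :: ((('a list \<Rightarrow> real) \<Rightarrow> 'k) \<Rightarrow> 'k) set"
  let ?Z = "\<lambda>p. cyc p :: ('a set \<times> (('a list \<Rightarrow> real) \<Rightarrow> 'k) \<Rightarrow> 'k) set"
  let ?U = "\<lambda>p. addf (F_int N \<Sigma> p {0}) :: (('a list \<Rightarrow> real) \<Rightarrow> 'k) set"
  have euler: "fs.dim (?Z p) + (\<Sum>\<rho>\<in>rays. fs.dim (?T p \<rho>)) = (\<Sum>\<alpha>\<in>facets. fs.dim (?T p \<alpha>)) + fs.dim (?T p {0})"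
    if "p \<le> 2" for p
    by (rule euler_characteristic[OF that ex1[OF that] ex0[OF that]])
  have U: "fin_space (?U p)" "fs.dim (?U p) = fs.dim (?T p {0})" if "p \<le> 2" for p
    using dim_addf[OF subgroup_F_int fin_space_F[OF that zero_in_fan]] by blast+
  have Z: "fin_space (?Z p)" if "p \<le> 2" for p
  proof (rule fin_space_subset[OF fin_space_chains(1)[OF that, of facets] subspace_cyc])
    show "facets \<subseteq> \<Sigma>" by (auto simp: cones_def)
    show "?Z p \<subseteq> chains p facets" by (auto simp: cyc_def)
  qed
  have img: "capv p ` ?U p \<subseteq> ?Z (2 - p)" if "p \<le> 2" for p
    using capv_cyc[OF that] by (auto simp: addf_def)
  have dim_img: "fs.dim (capv p ` ?U p) = fs.dim (?T p {0})" if "p \<le> 2" for p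
    using dim_image_inj[OF flinear_capv U(1)[OF that] capv_inj[OF that]] U(2)[OF that] by simp
  have sub_img: "fs.subspace (capv p ` ?U p)" for p
    by (rule fsp.linear_subspace_image[OF flinear_capv subspace_addf])
  have le: "fs.dim (?T p {0}) \<le> fs.dim (?Z (2 - p))" if "p \<le> 2" for p
    using dim_mono[OF Z[of "2 - p"] sub_img img[OF that]] dim_img[OF that] by simp
  have eq_iff: "capv p ` ?U p = ?Z (2 - p) \<longleftrightarrow> fs.dim (?T p {0}) = fs.dim (?Z (2 - p))" if "p \<le> 2" for p
  proof
    assume "capv p ` ?U p = ?Z (2 - p)"
    then show "fs.dim (?T p {0}) = fs.dim (?Z (2 - p))"
      using dim_img[OF that] by simp
  next
    assume "fs.dim (?T p {0}) = fs.dim (?Z (2 - p))"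
    then show "capv p ` ?U p = ?Z (2 - p)"
      using dim_img[OF that] by (intro subspace_dim_equal[OF Z[of "2 - p"] sub_img img[OF that]]) simp_all
  qed
  define r where "r \<rho> = fs.dim (?T 2 \<rho>)" for \<rho>
  define m where "m \<rho> = card (facets_at \<rho>)" for \<rho>
  have rm: "r \<rho> + 1 \<le> m \<rho>" if "\<rho> \<in> rays" for \<rho>
    using dim_F_2_ray_less[OF that] by (simp add: r_def m_def)
  \<comment> \<open>Pairs of a ray and an incident two-dimensional cone are counted in both ways;
    such a cone has exactly two rays.\<close>
  have M: "(\<Sum>\<rho>\<in>rays. m \<rho>) = 2 * card facets"
  proof -
    have "(\<Sum>\<rho>\<in>rays. m \<rho>) = (\<Sum>\<rho>\<in>rays. \<Sum>\<alpha>\<in>facets_at \<rho>. 1)"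
      by (simp add: m_def)
    also have "\<dots> = (\<Sum>\<alpha>\<in>facets. \<Sum>\<rho>\<in>{\<rho> \<in> rays. \<rho> face_of \<alpha>}. 1)"
      by (rule sum_rays_facets)
    also have "\<dots> = (\<Sum>\<alpha>\<in>facets. 2)"
    proof (rule sum.cong[OF refl])
      fix \<alpha> assume \<alpha>: "\<alpha> \<in> facets"
      obtain u v where uv: "indep2 u v" "\<alpha> = quad u v"
        using quad_obtain[OF \<alpha>] .
      then show "(\<Sum>\<rho>\<in>{\<rho> \<in> rays. \<rho> face_of \<alpha>}. 1) = (2::nat)"
        using sum_rays_of_quad[OF uv(1), of "\<lambda>_. 1::nat"] coneD[OF \<alpha>] by simp
    qed
    finally show ?thesis by simp
  qed
  define R where "R = (\<Sum>\<rho>\<in>rays. r \<rho>)"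
  have R1: "(\<Sum>\<rho>\<in>rays. r \<rho> + 1) = R + card rays"
    unfolding R_def sum.distrib by simp
  have e0: "fs.dim (?Z 0) + card rays = card facets + 1"
  proof -
    have "(\<Sum>\<rho>\<in>rays. fs.dim (?T 0 \<rho>)) = (\<Sum>\<rho>\<in>rays. 1)" "(\<Sum>\<alpha>\<in>facets. fs.dim (?T 0 \<alpha>)) = (\<Sum>\<alpha>\<in>facets. 1)"
      by (rule sum.cong[OF refl], rule dim_F_0[OF coneD], assumption)+
    then show ?thesis
      using euler[of 0] dim_F_0[OF zero_in_fan, where 'k = 'k] by simp
  qed
  have e1: "fs.dim (?Z 1) + (R + card rays) = 2 * card facets + fs.dim (?T 1 {0})"
  proof -
    have "(\<Sum>\<rho>\<in>rays. fs.dim (?T 1 \<rho>)) = R + card rays"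
      unfolding R1[symmetric] by (rule sum.cong[OF refl]) (simp only: dim_F_1_ray r_def)
    moreover have "(\<Sum>\<alpha>\<in>facets. fs.dim (?T 1 \<alpha>)) = (\<Sum>\<alpha>\<in>facets. 2)"
      by (rule sum.cong[OF refl]) (rule dim_F_1_facet)
    ultimately show ?thesis
      using euler[of 1] by simp
  qed
  have e2: "fs.dim (?Z 2) + R = card facets + fs.dim (?T 2 {0})"
  proof -
    have "(\<Sum>\<alpha>\<in>facets. fs.dim (?T 2 \<alpha>)) = (\<Sum>\<alpha>\<in>facets. 1)"
      by (rule sum.cong[OF refl]) (rule dim_F_2_facet)
    then show ?thesis
      using euler[of 2] by (simp add: R_def r_def)
  qed
  have T0: "fs.dim (?T 0 {0}) = 1"
    by (rule dim_F_0[OF zero_in_fan])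
  show ?thesis
  proof
    assume "\<forall>p\<le>2. capv p ` ?U p = ?Z (2 - p)"
    then have "fs.dim (?T 1 {0}) = fs.dim (?Z 1)"
      using eq_iff[of 1] by simp
    then have "(\<Sum>\<rho>\<in>rays. r \<rho> + 1) = (\<Sum>\<rho>\<in>rays. m \<rho>)"
      using e1 M R1 by simp
    \<comment> \<open>The sums agree and the terms satisfy an inequality, so the terms
      agree.\<close>
    then have "r \<rho> + 1 = m \<rho>" if "\<rho> \<in> rays" for \<rho>
      using sum_mono_inv[of "\<lambda>\<rho>. r \<rho> + 1" rays m] rm that by auto
    then show "\<forall>\<rho>\<in>rays. fs.dim (?T 2 \<rho>) + 1 = card (facets_at \<rho>)"
      by (simp add: r_def m_def)
  next
    assume "\<forall>\<rho>\<in>rays. fs.dim (?T 2 \<rho>) + 1 = card (facets_at \<rho>)"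
    then have "(\<Sum>\<rho>\<in>rays. r \<rho> + 1) = (\<Sum>\<rho>\<in>rays. m \<rho>)"
      by (intro sum.cong) (auto simp: r_def m_def)
    then have "R + card rays = 2 * card facets"
      using R1 M by simp
    moreover have "1 \<le> fs.dim (?Z 2)" "fs.dim (?T 2 {0}) \<le> fs.dim (?Z 0)"
      using le[of 0] le[of 2] T0 by simp_all
    \<comment> \<open>Adding \<open>e0\<close> and \<open>e2\<close> shows that the cycle spaces for
      0 and 2 have total dimension 1 plus the dimension of F_2 at the vertex. By injectivity neither
      is smaller than its expected share, so both are exact.\<close>
    ultimately have "fs.dim (?T 0 {0}) = fs.dim (?Z 2)" "fs.dim (?T 1 {0}) = fs.dim (?Z 1)" "fs.dim (?T 2 {0}) = fs.dim (?Z 0)"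
      using e0 e1 e2 T0 by linarith+
    then have "fs.dim (?T p {0}) = fs.dim (?Z (2 - p))" if "p \<le> 2" for p
      using nat_le_2_cases[OF that] by auto
    then show "\<forall>p\<le>2. capv p ` ?U p = ?Z (2 - p)"
      using eq_iff by blast
  qed
qed

end

section \<open>The star of a ray\<close>

lemma rayI: "c \<ge> 0 \<Longrightarrow> c *\<^sub>R u \<in> ray u"
  by (auto simp: ray_def)

lemma quad_scale: "c > 0 \<Longrightarrow> quad (c *\<^sub>R u) v = quad u v"
proof (intro equalityI subsetI)
  fix x assume c: "c > 0"
  show "x \<in> quad u v" if "x \<in> quad (c *\<^sub>R u) v"
    using that c by (auto simp: quad_def) (metis less_imp_le mult_nonneg_nonneg)
  assume "x \<in> quad u v"
  then obtain a b where "a \<ge> 0" "b \<ge> 0" "x = (a / c) *\<^sub>R (c *\<^sub>R u) + b *\<^sub>R v"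
    using c by (auto simp: quad_def)
  then show "x \<in> quad (c *\<^sub>R u) v"
    using quadI[of "a / c" b "c *\<^sub>R u" v] c by simp
qed

text \<open>The points x + y / n fall into finitely many closed sets, so one set contains infinitely
  many of them and hence their limit \<open>x\<close>. For a fan this gives a cone that contains
  \<open>x\<close> and leads away from it in the direction \<open>y\<close>.\<close>

lemma finite_closed_cover_limit:
  fixes x y :: "'a::euclidean_space"
  assumes "finite T" "\<And>\<sigma>. \<sigma> \<in> T \<Longrightarrow> closed \<sigma>" "\<And>t. t > 0 \<Longrightarrow> t \<le> 1 \<Longrightarrow> x + t *\<^sub>R y \<in> \<Union>T"
  obtains \<sigma> s where "\<sigma> \<in> T" "x \<in> \<sigma>" "s > 0" "x + s *\<^sub>R y \<in> \<sigma>"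
proof -
  define t where "t n = 1 / real (Suc n)" for n
  have t: "0 < t n" "t n \<le> 1" for n
    by (auto simp: t_def)
  have "\<forall>n. \<exists>\<sigma>\<in>T. x + t n *\<^sub>R y \<in> \<sigma>"
    using assms(3)[OF t] by blast
  then obtain S where S: "\<And>n. S n \<in> T" "\<And>n. x + t n *\<^sub>R y \<in> S n"
    by metis
  have "finite (range S)"
    using S(1) assms(1) by (meson finite_subset image_subsetI)
  then obtain n0 where inf: "infinite {n. S n = S n0}"
    using pigeonhole_infinite[of "UNIV :: nat set" S] by auto
  have "x \<in> closure (S n0)"
    unfolding closure_approachable
  proof (intro allI impI)
    fix \<epsilon> :: real assume \<epsilon>: "\<epsilon> > 0"
    have "(\<lambda>n. x + t n *\<^sub>R y) \<longlonglongrightarrow> x + 0 *\<^sub>R y"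
      unfolding t_def by (intro tendsto_intros LIMSEQ_inverse_real_of_nat[unfolded inverse_eq_divide])
    then have "eventually (\<lambda>n. dist (x + t n *\<^sub>R y) x < \<epsilon>) sequentially"
      using \<epsilon> by (simp add: tendsto_iff)
    then obtain M where M: "\<And>n. n \<ge> M \<Longrightarrow> dist (x + t n *\<^sub>R y) x < \<epsilon>"
      by (auto simp: eventually_sequentially)
    obtain n where "n \<ge> M" "S n = S n0"
      using inf unfolding infinite_nat_iff_unbounded_le by blast
    then show "\<exists>z\<in>S n0. dist z x < \<epsilon>"
      using M S(2) by metis
  qed
  then have "x \<in> S n0"
    using assms(2)[OF S(1)] by (simp add: closure_closed)
  then show thesis
    using that[OF S(1) _ t(1) S(2)] by blast
qed

text \<open>Two generators of one infinite cyclic group agree up to sign, and the sign of the real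
  factor \<open>c\<close> tells which case holds. Rough information about directions thus suffices
  to compare lattice generators.\<close>

lemma cyclic_generator_sign:
  fixes g h :: "'x \<Rightarrow> real"
  assumes "subgroup_gen {g} = subgroup_gen {h}" "h \<noteq> 0" "g = fscale c h"
  shows "c > 0 \<Longrightarrow> g = h" and "c < 0 \<Longrightarrow> g = - h"
proof -
  obtain i where i: "g = of_int i * h"
    using assms(1) subgroup_gen_base[of g "{g}"] by (auto simp: subgroup_gen_ring_1)
  obtain j where j: "h = of_int j * g"
    using assms(1) subgroup_gen_base[of h "{h}"] by (auto simp: subgroup_gen_ring_1)
  have cancel: "a = b" if "fscale a h = fscale b h" for a b
    using that assms(2) unfolding fs.scale_cancel_right by simp
  have "fscale (of_int (j * i)) h = fscale 1 h"
  proof -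
    have "of_int (j * i) * h = of_int j * (of_int i * h)"
      by (simp add: mult.assoc)
    also have "\<dots> = h"
      by (simp only: i[symmetric] j[symmetric])
    finally show ?thesis
      by (simp only: of_int_mult_fscale fs.scale_one)
  qed
  then have "real_of_int (j * i) = 1"
    by (rule cancel)
  then have "j * i = 1" by linarith
  then have i1: "i = 1 \<or> i = - 1" by (metis mult.commute zmult_eq_1_iff)
  have "fscale (of_int i) h = fscale c h"
    by (simp only: i[symmetric] assms(3)[symmetric] of_int_mult_fscale[symmetric])
  then have c: "real_of_int i = c"
    by (rule cancel)
  show "c > 0 \<Longrightarrow> g = h" "c < 0 \<Longrightarrow> g = - h"
    using i1 c i by auto
qed

context fan2
begin

text \<open>The generator with which \<open>\<alpha>\<close> enters the balancing relation at
  \<open>\<rho>\<close>. It does not depend on the orientation of \<open>\<alpha>\<close>, so cones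
  of a fan and of a star can be compared although their orientations are unrelated.\<close>

definition signed_gen :: "'a set \<Rightarrow> 'a set \<Rightarrow> 'a list \<Rightarrow> real" where
  "signed_gen \<rho> \<alpha> = of_int (rel_sign ori \<rho> \<alpha>) * wedge (ori \<alpha>)"

lemma subgroup_gen_signed_gen: "\<alpha> \<in> cones \<Sigma> 2 \<Longrightarrow> subgroup_gen {signed_gen \<rho> \<alpha>} = forms N 2 (span \<alpha>)"
proof -
  assume \<alpha>: "\<alpha> \<in> cones \<Sigma> 2"
  have "{of_int n * (- wedge (ori \<alpha>)) | n. True} = {of_int n * wedge (ori \<alpha>) | n. True}"
    by (metis (no_types, opaque_lifting) minus_mult_commute of_int_minus minus_minus)
  moreover have "signed_gen \<rho> \<alpha> = wedge (ori \<alpha>) \<or> signed_gen \<rho> \<alpha> = - wedge (ori \<alpha>)"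
    using rel_sign_cases[of \<rho> \<alpha>] by (auto simp: signed_gen_def)
  ultimately show ?thesis
    unfolding forms_2_facet[OF \<alpha>] subgroup_gen_ring_1 by (elim disjE) simp_all
qed

lemma signed_gen_nonzero: "\<alpha> \<in> cones \<Sigma> 2 \<Longrightarrow> signed_gen \<rho> \<alpha> \<noteq> 0"
  using rel_sign_cases[of \<rho> \<alpha>] wedge_ori_nonzero by (auto simp: signed_gen_def)

lemma signed_gen_direction:
  assumes "\<rho> \<in> rays" "\<alpha> \<in> facets_at \<rho>" "x \<in> \<alpha> - \<rho>"
  obtains c where "c > 0" "wedge [edge \<rho>, x] = fscale c (signed_gen \<rho> \<alpha>)"
  using signed_generator[OF assms(1) facets_atD[OF assms(2)]] assms(3) unfolding signed_gen_def by metis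

lemma additive_signed_gen:
  fixes \<psi> :: "('a list \<Rightarrow> real) \<Rightarrow> 'k::field"
  assumes "\<alpha> \<in> facets_at \<rho>" "\<psi> \<in> additive_on (F_int N \<Sigma> 2 \<rho>)"
  shows "of_int (rel_sign ori \<rho> \<alpha>) * \<psi> (wedge (ori \<alpha>)) = \<psi> (signed_gen \<rho> \<alpha>)"
    and "signed_gen \<rho> \<alpha> \<in> F_int N \<Sigma> 2 \<rho>"
proof -
  have in2: "wedge (ori \<alpha>) \<in> F_int N \<Sigma> 2 \<rho>"
    using F_int_mono[OF facets_atD(2)[OF assms(1)]] F_int_2_facet[OF facets_atD(1)[OF assms(1)]] subgroup_gen_base by blast
  show "of_int (rel_sign ori \<rho> \<alpha>) * \<psi> (wedge (ori \<alpha>)) = \<psi> (signed_gen \<rho> \<alpha>)"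
    unfolding signed_gen_def by (rule additive_on_of_int_mult[OF assms(2) subgroup_F_int in2, symmetric])
  show "signed_gen \<rho> \<alpha> \<in> F_int N \<Sigma> 2 \<rho>"
    unfolding signed_gen_def by (rule add_subgroup_of_int_mult[OF subgroup_F_int in2])
qed

lemma ray_subset_cone: "\<sigma> \<in> \<Sigma> \<Longrightarrow> x \<in> \<sigma> \<Longrightarrow> ray x \<subseteq> \<sigma>"
  using pointed_cone_facts(3)[OF cone_pointed] by (auto simp: ray_def)

lemma ray_face_of_cone:
  assumes "ray x \<in> \<Sigma>" "\<sigma> \<in> \<Sigma>" "x \<in> \<sigma>"
  shows "ray x face_of \<sigma>"
  using Int_face2[OF assms(1,2)] ray_subset_cone[OF assms(2,3)] by (simp add: Int_absorb2)

lemma facetI: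
  assumes "\<sigma> \<in> \<Sigma>" "x \<in> \<sigma>" "y \<in> \<sigma>" "indep2 x y"
  shows "\<sigma> \<in> facets"
proof -
  have "dim {x, y} \<le> dim \<sigma>"
    using assms by (intro dim_subset) auto
  then show ?thesis
    using dim_indep2[OF assms(4)] dim_le_2[OF assms(1)] assms(1) by (simp add: cones_def)
qed

text \<open>Existence of a facet entered from \<open>x\<close> in the direction \<open>y\<close>;
  \<open>facet_direction_unique\<close> gives its uniqueness. Together they determine the facets of
  a subdivision around a ray when only the covered set is known.\<close>

lemma facet_in_direction:
  assumes "x \<noteq> 0" "indep2 x y" "\<And>t. t > 0 \<Longrightarrow> t \<le> 1 \<Longrightarrow> x + t *\<^sub>R y \<in> \<Union>\<Sigma>"
  obtains \<sigma> s where "\<sigma> \<in> facets" "x \<in> \<sigma>" "s > 0" "x + s *\<^sub>R y \<in> \<sigma>"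
proof -
  obtain \<sigma> s where \<sigma>: "\<sigma> \<in> \<Sigma>" "x \<in> \<sigma>" "s > 0" "x + s *\<^sub>R y \<in> \<sigma>"
    using finite_closed_cover_limit[OF finite_fan cone_closed assms(3)] by blast
  have "indep2 x (x + s *\<^sub>R y)"
    unfolding indep2_def
  proof (intro allI impI)
    fix a b assume "a *\<^sub>R x + b *\<^sub>R (x + s *\<^sub>R y) = 0"
    then have "(a + b) *\<^sub>R x + (b * s) *\<^sub>R y = 0" by (simp add: algebra_simps)
    then have "a + b = 0 \<and> b * s = 0" by (rule indep2D[OF assms(2)])
    then show "a = 0 \<and> b = 0" using \<sigma>(3) by auto
  qed
  then show thesis
    using that facetI[OF \<sigma>(1,2,4)] \<sigma> by blast
qed

text \<open>By convexity both cones contain the point with the smaller parameter, and together with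
  \<open>x\<close> it spans a plane.\<close>

lemma facet_direction_unique:
  assumes "\<sigma> \<in> facets" "\<sigma>' \<in> facets" "x \<in> \<sigma>" "x \<in> \<sigma>'" "indep2 x y"
    "s > 0" "x + s *\<^sub>R y \<in> \<sigma>" "s' > 0" "x + s' *\<^sub>R y \<in> \<sigma>'"
  shows "\<sigma> = \<sigma>'"
proof -
  let ?m = "min s s'"
  have mem: "x + ?m *\<^sub>R y \<in> \<kappa>" if "\<kappa> \<in> facets" "x \<in> \<kappa>" "r > 0" "?m \<le> r" "x + r *\<^sub>R y \<in> \<kappa>" for \<kappa> r
  proof -
    have "(1 - ?m / r) *\<^sub>R x + (?m / r) *\<^sub>R (x + r *\<^sub>R y) \<in> \<kappa>"
      using that assms(6,8) by (intro convexD[OF pointed_cone_facts(5)[OF cone_pointed[OF coneD[OF that(1)]]]]) auto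
    moreover have "(1 - ?m / r) *\<^sub>R x + (?m / r) *\<^sub>R (x + r *\<^sub>R y) = x + ?m *\<^sub>R y"
      using that(3) by (simp add: algebra_simps)
    ultimately show ?thesis by simp
  qed
  have m: "?m > 0" using assms by simp
  have "indep2 x (x + ?m *\<^sub>R y)"
    unfolding indep2_def
  proof (intro allI impI)
    fix a b assume "a *\<^sub>R x + b *\<^sub>R (x + ?m *\<^sub>R y) = 0"
    then have "(a + b) *\<^sub>R x + (b * ?m) *\<^sub>R y = 0" by (simp add: algebra_simps)
    then have "a + b = 0 \<and> b * ?m = 0" by (rule indep2D[OF assms(5)])
    then show "a = 0 \<and> b = 0" using m by auto
  qed
  then show ?thesis
    using mem[OF assms(1,3,6) _ assms(7)] mem[OF assms(2,4,8) _ assms(9)] assms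
    by (intro facet_overlap[of \<sigma> \<sigma>' x "x + ?m *\<^sub>R y"]) auto
qed

end

text \<open>\<open>T\<close> is an arbitrary subdivision of the star and \<open>ori'\<close> an
  arbitrary orientation of it. Besides the fan axioms only the union of its cones is known, and that
  each lies in one of the sets \<open>star_cone\<close>; the facets of \<open>T\<close> at a ray
  have to be recovered from that.\<close>

locale star_fan = fan2 N \<Sigma> ori for N :: "'a::euclidean_space set" and \<Sigma> ori +
  fixes \<tau> :: "'a set" and T :: "'a set set" and ori' :: "'a set \<Rightarrow> 'a list"
  assumes ray_\<tau>: "\<tau> \<in> cones \<Sigma> 1" and star: "is_star N \<Sigma> \<tau> T" and ori': "orientation N T ori'"
begin

text \<open>A vector in the ray itself, in contrast to \<open>edge \<tau>\<close>, which may be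
  opposite.\<close>

definition dir :: 'a where
  "dir = (SOME u. u \<noteq> 0 \<and> \<tau> = ray u)"

lemma dir: "dir \<noteq> 0" "\<tau> = ray dir"
  using someI_ex[of "\<lambda>u. u \<noteq> 0 \<and> \<tau> = ray u"] ray_obtain[OF ray_\<tau>] unfolding dir_def by metis+

definition side :: "'a set \<Rightarrow> 'a" where
  "side \<alpha> = (SOME f. indep2 dir f \<and> \<alpha> = quad dir f)"

lemma side:
  assumes "\<alpha> \<in> facets_at \<tau>"
  shows "indep2 dir (side \<alpha>)" "\<alpha> = quad dir (side \<alpha>)"
proof -
  obtain u v where uv: "indep2 u v" "\<alpha> = quad u v" "\<tau> = ray u"
    using quad_ray_obtain[OF facets_atD(1)[OF assms] ray_\<tau> facets_atD(2)[OF assms]] .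
  have "dir \<in> ray u"
    using uv(3) dir(2) ray_base by metis
  then obtain c where c: "dir = c *\<^sub>R u" "c \<ge> 0" by (auto simp: ray_def)
  then have c0: "c > 0" using dir(1) by (cases "c = 0") auto
  have "indep2 dir v"
    unfolding indep2_def
  proof (intro allI impI)
    fix a b assume "a *\<^sub>R dir + b *\<^sub>R v = 0"
    then have "(a * c) *\<^sub>R u + b *\<^sub>R v = 0" by (simp add: c)
    then show "a = 0 \<and> b = 0" using indep2D[OF uv(1)] c0 by fastforce
  qed
  moreover have "\<alpha> = quad dir v"
    by (simp only: uv(2) c(1) quad_scale[OF c0])
  ultimately have "\<exists>f. indep2 dir f \<and> \<alpha> = quad dir f" by blast
  then show "indep2 dir (side \<alpha>)" "\<alpha> = quad dir (side \<alpha>)"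
    using someI_ex[of "\<lambda>f. indep2 dir f \<and> \<alpha> = quad dir f"] unfolding side_def by blast+
qed

text \<open>The half-plane that contains \<open>\<alpha>\<close> and is bounded by the line of
  \<open>\<tau>\<close>. The star is a book, whose pages are glued along this line.\<close>

definition page :: "'a set \<Rightarrow> 'a set" where
  "page \<alpha> = {a *\<^sub>R dir + b *\<^sub>R side \<alpha> | a b. b \<ge> 0}"

lemma pageI: "b \<ge> 0 \<Longrightarrow> a *\<^sub>R dir + b *\<^sub>R side \<alpha> \<in> page \<alpha>"
  by (auto simp: page_def)

lemma pageE:
  assumes "x \<in> page \<alpha>"
  obtains a b where "x = a *\<^sub>R dir + b *\<^sub>R side \<alpha>" "b \<ge> 0"
  using assms by (auto simp: page_def)

lemma star_cone_facet:
  assumes "\<alpha> \<in> facets_at \<tau>"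
  shows "star_cone \<tau> \<alpha> = page \<alpha>"
proof (intro equalityI subsetI)
  fix x assume "x \<in> star_cone \<tau> \<alpha>"
  then obtain t y z where x: "x = t *\<^sub>R (y - z)" "t \<ge> 0" "y \<in> \<alpha>" "z \<in> \<tau>"
    unfolding star_cone_def by blast
  obtain a b where y: "y = a *\<^sub>R dir + b *\<^sub>R side \<alpha>" "b \<ge> 0"
    using x(3) by (subst (asm) side(2)[OF assms]) (auto simp: quad_def)
  obtain c where z: "z = c *\<^sub>R dir"
    using x(4) dir(2) by (auto simp: ray_def)
  have "x = (t * (a - c)) *\<^sub>R dir + (t * b) *\<^sub>R side \<alpha>"
    by (simp add: x(1) y(1) z algebra_simps)
  then show "x \<in> page \<alpha>"
    using x(2) y(2) pageI[of "t * b"] by simp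
next
  fix x assume "x \<in> page \<alpha>"
  then obtain a b where x: "x = a *\<^sub>R dir + b *\<^sub>R side \<alpha>" "b \<ge> 0"
    by (rule pageE)
  \<comment> \<open>The positive part of \<open>a\<close> stays in \<open>\<alpha>\<close>, the
    negative part is subtracted as an element of \<open>\<tau>\<close>.\<close>
  have "max a 0 *\<^sub>R dir + b *\<^sub>R side \<alpha> \<in> \<alpha>"
    by (subst side(2)[OF assms]) (rule quadI, use x in auto)
  moreover have "max (- a) 0 *\<^sub>R dir \<in> ray dir"
    by (rule rayI) simp
  then have "max (- a) 0 *\<^sub>R dir \<in> \<tau>"
    using dir(2) by blast
  moreover have "x = 1 *\<^sub>R ((max a 0 *\<^sub>R dir + b *\<^sub>R side \<alpha>) - max (- a) 0 *\<^sub>R dir)"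
    using x by (auto simp: max_def algebra_simps)
  ultimately show "x \<in> star_cone \<tau> \<alpha>"
    unfolding star_cone_def using zero_le_one by blast
qed

lemma star_cone_ray: "star_cone \<tau> \<tau> \<subseteq> page \<alpha>"
proof
  fix x assume "x \<in> star_cone \<tau> \<tau>"
  then obtain t p q where x: "x = t *\<^sub>R (p - q)" "p \<in> \<tau>" "q \<in> \<tau>"
    unfolding star_cone_def by blast
  then have "p \<in> ray dir" "q \<in> ray dir"
    using dir(2) by blast+
  then obtain a b where "x = t *\<^sub>R (a *\<^sub>R dir - b *\<^sub>R dir)"
    using x(1) by (auto simp: ray_def)
  then have "x = (t * (a - b)) *\<^sub>R dir + 0 *\<^sub>R side \<alpha>"
    by (simp add: algebra_simps)
  then show "x \<in> page \<alpha>"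
    using pageI[of 0] by simp
qed

lemma cones_at_ray: "{\<kappa> \<in> \<Sigma>. \<tau> face_of \<kappa>} = insert \<tau> (facets_at \<tau>)"
proof -
  have "\<kappa> = \<tau> \<or> \<kappa> \<in> facets_at \<tau>" if \<kappa>: "\<kappa> \<in> \<Sigma>" "\<tau> face_of \<kappa>" for \<kappa>
  proof (cases "dim \<kappa> = 2")
    case False
    have "dim \<tau> \<le> dim \<kappa>"
      using \<kappa>(2) dim_subset face_of_imp_subset by blast
    then have "dim \<tau> = dim \<kappa>"
      using False dim_le_2[OF \<kappa>(1)] cone_dim[OF ray_\<tau>] by linarith
    then show ?thesis
      using face_same_dim[OF \<kappa>(1) coneD[OF ray_\<tau>] \<kappa>(2)] by simp
  qed (use \<kappa> in \<open>simp add: facets_at_def cones_def\<close>)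
  then show ?thesis
    using coneD[OF ray_\<tau>] face_refl facets_atD coneD by blast
qed

lemma facets_at_ne: "facets_at \<tau> \<noteq> {}"
  using in_facet[OF coneD[OF ray_\<tau>]] by (auto simp: facets_at_def)

lemma fan_T: "fan N T"
  using star by (simp add: is_star_def)

lemma Union_T: "\<Union>T = (\<Union>\<alpha>\<in>facets_at \<tau>. page \<alpha>)"
proof -
  have "\<Union>T = (\<Union>\<kappa>\<in>insert \<tau> (facets_at \<tau>). star_cone \<tau> \<kappa>)"
    using star unfolding is_star_def cones_at_ray by blast
  also have "\<dots> = star_cone \<tau> \<tau> \<union> (\<Union>\<alpha>\<in>facets_at \<tau>. page \<alpha>)"
    using star_cone_facet by simp
  also have "\<dots> = (\<Union>\<alpha>\<in>facets_at \<tau>. page \<alpha>)"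
    using star_cone_ray facets_at_ne by blast
  finally show ?thesis .
qed

lemma T_in_page:
  assumes "\<sigma> \<in> T"
  obtains \<alpha> where "\<alpha> \<in> facets_at \<tau>" "\<sigma> \<subseteq> page \<alpha>"
proof -
  have "\<exists>\<kappa>\<in>{\<kappa> \<in> \<Sigma>. \<tau> face_of \<kappa>}. \<sigma> \<subseteq> star_cone \<tau> \<kappa>"
    using star assms by (auto simp: is_star_def)
  then have "\<exists>\<kappa>\<in>insert \<tau> (facets_at \<tau>). \<sigma> \<subseteq> star_cone \<tau> \<kappa>"
    unfolding cones_at_ray .
  then obtain \<kappa> where \<kappa>: "\<kappa> = \<tau> \<or> \<kappa> \<in> facets_at \<tau>" "\<sigma> \<subseteq> star_cone \<tau> \<kappa>" by blast
  obtain \<beta> where \<beta>: "\<beta> \<in> facets_at \<tau>" using facets_at_ne by blast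
  show thesis
  proof (cases "\<kappa> = \<tau>")
    case True
    then show thesis using that[OF \<beta>] \<kappa>(2) star_cone_ray by blast
  next
    case False
    then show thesis using that \<kappa> star_cone_facet by blast
  qed
qed

text \<open>Translating a common point along the spine moves it into both cones
  \<open>\<alpha>\<close> and \<open>\<beta>\<close>, which then share two independent
  vectors.\<close>

lemma page_unique:
  assumes \<alpha>: "\<alpha> \<in> facets_at \<tau>" and \<beta>: "\<beta> \<in> facets_at \<tau>"
    and x: "x = a *\<^sub>R dir + b *\<^sub>R side \<alpha>" "b > 0" "x \<in> page \<beta>"
  shows "\<alpha> = \<beta>"
proof -
  obtain a' b' where x': "x = a' *\<^sub>R dir + b' *\<^sub>R side \<beta>" "b' \<ge> 0"
    using x(3) by (rule pageE)
  \<comment> \<open>This is \<open>x\<close> minus min(a, a') times \<open>dir\<close>: its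
    coordinate along \<open>dir\<close> is nonnegative in both pages.\<close>
  define y where "y = max (a - a') 0 *\<^sub>R dir + b *\<^sub>R side \<alpha>"
  have "y = max (a' - a) 0 *\<^sub>R dir + b' *\<^sub>R side \<beta>"
    using x(1) x'(1) by (auto simp: y_def max_def algebra_simps)
  then have "y \<in> \<beta>"
    using quadI[of "max (a' - a) 0" b' dir "side \<beta>"] x'(2) side(2)[OF \<beta>] by simp
  moreover have "y \<in> \<alpha>"
    using quadI[of "max (a - a') 0" b dir "side \<alpha>"] x(2) side(2)[OF \<alpha>] by (simp add: y_def)
  moreover have "dir \<in> \<alpha>" "dir \<in> \<beta>"
    using side(2)[OF \<alpha>] side(2)[OF \<beta>] quad_base(1) by metis+
  moreover have "indep2 dir y"
    unfolding indep2_def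
  proof (intro allI impI)
    fix p q assume "p *\<^sub>R dir + q *\<^sub>R y = 0"
    then have "(p + q * max (a - a') 0) *\<^sub>R dir + (q * b) *\<^sub>R side \<alpha> = 0"
      by (simp add: y_def algebra_simps)
    then have "p + q * max (a - a') 0 = 0 \<and> q * b = 0"
      by (rule indep2D[OF side(1)[OF \<alpha>]])
    then show "p = 0 \<and> q = 0" using x(2) by auto
  qed
  ultimately show ?thesis
    using facet_overlap[OF facets_atD(1)[OF \<alpha>] facets_atD(1)[OF \<beta>], of dir y] by blast
qed

lemma page_span:
  assumes "\<alpha> \<in> facets_at \<tau>"
  shows "page \<alpha> \<subseteq> span \<alpha>" "dim (span \<alpha>) = 2"
proof -
  have "span \<alpha> = span {dir, side \<alpha>}"
    by (subst side(2)[OF assms]) (rule span_quad)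
  then show "page \<alpha> \<subseteq> span \<alpha>"
    by (auto simp: page_def span_2)
  show "dim (span \<alpha>) = 2"
    using cone_dim[OF facets_atD(1)[OF assms]] by simp
qed

text \<open>Pages have dimension two, which bounds the dimension of \<open>T\<close>; a cone of
  \<open>T\<close> entered from \<open>dir\<close> towards a page contains two independent
  vectors.\<close>

lemma fan_dim_T: "fan_dim T = 2"
proof -
  have fin: "finite T" and rat: "\<And>\<sigma>. \<sigma> \<in> T \<Longrightarrow> rational_cone N \<sigma>"
    using fan_T by (auto simp: fan_def)
  have le: "dim \<sigma> \<le> 2" if "\<sigma> \<in> T" for \<sigma>
  proof -
    obtain \<alpha> where \<alpha>: "\<alpha> \<in> facets_at \<tau>" "\<sigma> \<subseteq> page \<alpha>" using T_in_page[OF \<open>\<sigma> \<in> T\<close>] .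
    then have "dim \<sigma> \<le> dim (span \<alpha>)"
      using page_span(1)[OF \<alpha>(1)] by (intro dim_subset) auto
    then show ?thesis using page_span(2)[OF \<alpha>(1)] by simp
  qed
  obtain \<alpha> where \<alpha>: "\<alpha> \<in> facets_at \<tau>" using facets_at_ne by blast
  have "dir + t *\<^sub>R side \<alpha> \<in> \<Union>T" if "t > 0" for t
    using pageI[of t 1 \<alpha>] that \<alpha> unfolding Union_T by auto
  then obtain \<sigma> s where \<sigma>: "\<sigma> \<in> T" "dir \<in> \<sigma>" "s > 0" "dir + s *\<^sub>R side \<alpha> \<in> \<sigma>"
    using finite_closed_cover_limit[OF fin rational_cone_pointed(2)[OF rat]] by blast
  have "indep2 dir (dir + s *\<^sub>R side \<alpha>)"
    unfolding indep2_def
  proof (intro allI impI)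
    fix p q assume "p *\<^sub>R dir + q *\<^sub>R (dir + s *\<^sub>R side \<alpha>) = 0"
    then have "(p + q) *\<^sub>R dir + (q * s) *\<^sub>R side \<alpha> = 0" by (simp add: algebra_simps)
    then have "p + q = 0 \<and> q * s = 0" by (rule indep2D[OF side(1)[OF \<alpha>]])
    then show "p = 0 \<and> q = 0" using \<sigma>(3) by auto
  qed
  then have "2 \<le> dim \<sigma>"
    using \<sigma> dim_subset[of "{dir, dir + s *\<^sub>R side \<alpha>}" \<sigma>] dim_indep2 by fastforce
  then have "2 \<in> dim ` T"
    using le[OF \<sigma>(1)] \<sigma>(1) by (metis dual_order.antisym imageI)
  then show ?thesis
    unfolding fan_dim_def using fin le by (intro Max_eqI) auto
qed

sublocale T: fan2 N T ori'
  by unfold_locales (rule lattice fan_T fan_dim_T ori')+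

lemma page_subset_T: "\<alpha> \<in> facets_at \<tau> \<Longrightarrow> x \<in> page \<alpha> \<Longrightarrow> x \<in> \<Union>T"
  unfolding Union_T by blast

text \<open>This is the choice made in \<open>star_weight\<close>, so the weight of a cone of the
  star is \<open>w\<close> of its page. It is well defined on two-dimensional cones of
  \<open>T\<close>, because such a cone contains points off the spine
  (\<open>page_of_eq\<close>).\<close>

definition page_of :: "'a set \<Rightarrow> 'a set" where
  "page_of \<sigma> = (THE \<alpha>. \<alpha> \<in> cones \<Sigma> (fan_dim \<Sigma>) \<and> \<tau> face_of \<alpha> \<and> \<sigma> \<subseteq> star_cone \<tau> \<alpha>)"

lemma not_on_line:
  assumes "\<sigma> \<in> T.facets" "\<sigma> \<subseteq> page \<alpha>" "\<alpha> \<in> facets_at \<tau>"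
  obtains a b where "a *\<^sub>R dir + b *\<^sub>R side \<alpha> \<in> \<sigma>" "b > 0"
proof (rule ccontr)
  assume no: "\<not> thesis"
  have "\<sigma> \<subseteq> span {dir}"
  proof
    fix x assume "x \<in> \<sigma>"
    then obtain a b where x: "x = a *\<^sub>R dir + b *\<^sub>R side \<alpha>" "b \<ge> 0"
      using assms(2) pageE by blast
    then have "b = 0" using no that \<open>x \<in> \<sigma>\<close> by (metis less_eq_real_def)
    then show "x \<in> span {dir}" using x by (auto simp: span_singleton)
  qed
  then have "dim \<sigma> \<le> dim (span {dir})" by (rule dim_subset)
  then show False using T.cone_dim[OF assms(1)] dir(1) by (simp add: dim_insert)
qed

lemma page_of_eq:
  assumes "\<sigma> \<in> T.facets" "\<alpha> \<in> facets_at \<tau>" "\<sigma> \<subseteq> page \<alpha>"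
  shows "page_of \<sigma> = \<alpha>"
  unfolding page_of_def
proof (rule the_equality)
  show "\<alpha> \<in> cones \<Sigma> (fan_dim \<Sigma>) \<and> \<tau> face_of \<alpha> \<and> \<sigma> \<subseteq> star_cone \<tau> \<alpha>"
    using assms facets_atD[OF assms(2)] star_cone_facet[OF assms(2)] fan_dim_2 by simp
  fix \<beta> assume "\<beta> \<in> cones \<Sigma> (fan_dim \<Sigma>) \<and> \<tau> face_of \<beta> \<and> \<sigma> \<subseteq> star_cone \<tau> \<beta>"
  then have \<beta>: "\<beta> \<in> facets_at \<tau>" "\<sigma> \<subseteq> page \<beta>"
    using star_cone_facet fan_dim_2 by (auto simp: facets_at_def)
  obtain a b where "a *\<^sub>R dir + b *\<^sub>R side \<alpha> \<in> \<sigma>" "b > 0"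
    using not_on_line[OF assms(1,3,2)] .
  then show "\<beta> = \<alpha>"
    using page_unique[OF assms(2) \<beta>(1) refl] \<beta>(2) by blast
qed

lemma page_of:
  assumes "\<sigma> \<in> T.facets"
  shows "page_of \<sigma> \<in> facets_at \<tau>" "\<sigma> \<subseteq> page (page_of \<sigma>)" "span \<sigma> = span (page_of \<sigma>)"
proof -
  obtain \<alpha> where \<alpha>: "\<alpha> \<in> facets_at \<tau>" "\<sigma> \<subseteq> page \<alpha>" using T_in_page[OF T.coneD[OF assms]] .
  show *: "page_of \<sigma> \<in> facets_at \<tau>" "\<sigma> \<subseteq> page (page_of \<sigma>)"
    using page_of_eq[OF assms \<alpha>] \<alpha> by simp_all
  have "\<sigma> \<subseteq> span (page_of \<sigma>)"
    using *(2) page_span(1)[OF *(1)] by blast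
  then have "span \<sigma> = span (span (page_of \<sigma>))"
    using page_span(2)[OF *(1)] T.cone_dim[OF assms] by (intro dim_eq_span) auto
  then show "span \<sigma> = span (page_of \<sigma>)" by simp
qed

lemma page_of_point:
  assumes "\<sigma> \<in> T.facets" "\<alpha> \<in> facets_at \<tau>" "a *\<^sub>R dir + b *\<^sub>R side \<alpha> \<in> \<sigma>" "b > 0"
  shows "page_of \<sigma> = \<alpha>"
  using page_unique[OF assms(2) page_of(1)[OF assms(1)] refl assms(4)] page_of(2)[OF assms(1)] assms(3) by blast

text \<open>The spine of the star is the line through \<open>dir\<close>; its two rays \<open>ray (s *\<^sub>R dir)\<close>, \<open>s = \<plusminus>1\<close>,
  lie in every page, all other rays of \<open>T\<close> lie in the interior of a single page.\<close>

lemma spine_facet: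
  assumes "\<sigma> \<in> T.facets" "s *\<^sub>R dir \<in> \<sigma>" "s \<noteq> 0"
  shows "ray (s *\<^sub>R dir) face_of \<sigma>" "ray (s *\<^sub>R dir) \<in> T.rays"
proof -
  let ?\<alpha> = "page_of \<sigma>"
  note \<alpha> = page_of(1,2)[OF assms(1)]
  obtain p q where pq: "indep2 p q" "\<sigma> = quad p q" using T.quad_obtain[OF assms(1)] .
  obtain a b where ab: "s *\<^sub>R dir = a *\<^sub>R p + b *\<^sub>R q" "a \<ge> 0" "b \<ge> 0"
    using assms(2) pq(2) by (auto simp: quad_def)
  obtain p1 p2 where p: "p = p1 *\<^sub>R dir + p2 *\<^sub>R side ?\<alpha>" "p2 \<ge> 0"
    using \<alpha>(2) quad_base(1)[of p q] pq(2) pageE by blast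
  obtain q1 q2 where q: "q = q1 *\<^sub>R dir + q2 *\<^sub>R side ?\<alpha>" "q2 \<ge> 0"
    using \<alpha>(2) quad_base(2)[of q p] pq(2) pageE by blast
  have "(a * p1 + b * q1) *\<^sub>R dir + (a * p2 + b * q2) *\<^sub>R side ?\<alpha> = s *\<^sub>R dir + 0 *\<^sub>R side ?\<alpha>"
    unfolding ab(1) by (simp add: p q algebra_simps)
  then have "a * p2 + b * q2 = 0"
    by (rule indep2_eqD(2)[OF side(1)[OF \<alpha>(1)]])
  moreover have "a * p2 \<ge> 0" "b * q2 \<ge> 0" using ab p q by simp_all
  ultimately have z: "a * p2 = 0" "b * q2 = 0" by linarith+
  have sd: "s *\<^sub>R dir \<noteq> 0" using assms(3) dir(1) by simp
  \<comment> \<open>If both coefficients were positive, \<open>p\<close> and \<open>q\<close> would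
    lie on the spine and be dependent. So a spine vector in the cone lies on one of its boundary
    rays.\<close>
  have "a = 0 \<or> b = 0"
  proof (rule ccontr)
    assume "\<not> (a = 0 \<or> b = 0)"
    then have "p2 = 0" "q2 = 0" using z by auto
    then have "q1 *\<^sub>R p + (- p1) *\<^sub>R q = 0" by (simp add: p q)
    then have "q1 = 0" using indep2D[OF pq(1)] by blast
    then have "q = 0" using \<open>q2 = 0\<close> q by simp
    then show False using indep2_nonzero[OF pq(1)] by blast
  qed
  then consider "b = 0" "a > 0" | "a = 0" "b > 0"
    using ab sd by (cases "a = 0"; cases "b = 0") auto
  then have "ray (s *\<^sub>R dir) = ray p \<or> ray (s *\<^sub>R dir) = ray q"
    by cases (use ab ray_scale in auto)
  then have "ray (s *\<^sub>R dir) \<in> {ray p, ray q}" by blast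
  then have "ray (s *\<^sub>R dir) \<in> {\<rho> \<in> T.rays. \<rho> face_of quad p q}"
    using T.facets_quad[OF pq(1)] T.coneD[OF assms(1)] pq(2) by simp
  then show "ray (s *\<^sub>R dir) face_of \<sigma>" "ray (s *\<^sub>R dir) \<in> T.rays"
    using pq(2) by blast+
qed

lemma indep2_spine: "\<alpha> \<in> facets_at \<tau> \<Longrightarrow> s \<noteq> 0 \<Longrightarrow> indep2 (s *\<^sub>R dir) (side \<alpha>)"
  unfolding indep2_def
proof (intro allI impI)
  fix p q assume \<alpha>: "\<alpha> \<in> facets_at \<tau>" "s \<noteq> 0" "p *\<^sub>R s *\<^sub>R dir + q *\<^sub>R side \<alpha> = 0"
  then have "(p * s) *\<^sub>R dir + q *\<^sub>R side \<alpha> = 0" by simp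
  then show "p = 0 \<and> q = 0" using indep2D[OF side(1)[OF \<alpha>(1)]] \<alpha>(2) by fastforce
qed

lemma spine_facet_exists:
  assumes "\<alpha> \<in> facets_at \<tau>" "s \<noteq> 0"
  obtains \<sigma> t where "\<sigma> \<in> T.facets_at (ray (s *\<^sub>R dir))" "t > 0" "s *\<^sub>R dir + t *\<^sub>R side \<alpha> \<in> \<sigma>" "page_of \<sigma> = \<alpha>"
proof -
  have "s *\<^sub>R dir + t *\<^sub>R side \<alpha> \<in> \<Union>T" if "t > 0" for t
    using page_subset_T[OF assms(1) pageI] that by simp
  then obtain \<sigma> t where \<sigma>: "\<sigma> \<in> T.facets" "s *\<^sub>R dir \<in> \<sigma>" "t > 0" "s *\<^sub>R dir + t *\<^sub>R side \<alpha> \<in> \<sigma>"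
    using T.facet_in_direction[of "s *\<^sub>R dir" "side \<alpha>"] indep2_spine[OF assms] indep2_nonzero by metis
  then show thesis
    using that[of \<sigma> t] spine_facet(1)[OF \<sigma>(1,2) assms(2)] page_of_point[OF \<sigma>(1) assms(1) \<sigma>(4,3)]
    by (auto simp: T.facets_at_def)
qed

lemma spine_ray: "s \<noteq> 0 \<Longrightarrow> ray (s *\<^sub>R dir) \<in> T.rays"
proof -
  assume s: "s \<noteq> 0"
  obtain \<alpha> where "\<alpha> \<in> facets_at \<tau>" using facets_at_ne by blast
  then obtain \<sigma> where "\<sigma> \<in> T.facets_at (ray (s *\<^sub>R dir))"
    using spine_facet_exists s by metis
  then show ?thesis
    using spine_facet(2)[of \<sigma> s] s T.facets_atD face_of_imp_subset ray_base by blast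
qed

lemma spine_facet_point:
  assumes "\<sigma> \<in> T.facets_at (ray (s *\<^sub>R dir))" "s \<noteq> 0"
  obtains t where "t > 0" "s *\<^sub>R dir + t *\<^sub>R side (page_of \<sigma>) \<in> \<sigma>"
proof -
  note \<sigma> = T.facets_atD[OF assms(1)]
  let ?f = "side (page_of \<sigma>)"
  obtain a b where ab: "a *\<^sub>R dir + b *\<^sub>R ?f \<in> \<sigma>" "b > 0"
    using not_on_line[OF \<sigma>(1) page_of(2,1)[OF \<sigma>(1)]] .
  have sd: "s *\<^sub>R dir \<in> \<sigma>"
    using face_of_imp_subset[OF \<sigma>(2)] ray_base by blast
  note P = pointed_cone_facts[OF T.cone_pointed[OF T.coneD[OF \<sigma>(1)]]]
  \<comment> \<open>\<open>k\<close> is large enough for the multiple of the spine vector added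
    below to be nonnegative; after division by \<open>k\<close> the coordinate along
    \<open>dir\<close> is again \<open>s\<close>.\<close>
  define k where "k = 1 + \<bar>a / s\<bar>"
  have k: "k > 0" "k - a / s \<ge> 0"
    unfolding k_def using abs_ge_zero[of "a / s"] abs_ge_self[of "a / s"] by linarith+
  have "(1 / k) *\<^sub>R (a *\<^sub>R dir + b *\<^sub>R ?f) + ((k - a / s) / k) *\<^sub>R (s *\<^sub>R dir) \<in> \<sigma>"
    using k by (intro P(2) P(3) ab sd) auto
  moreover have "(1 / k) *\<^sub>R (a *\<^sub>R dir + b *\<^sub>R ?f) + ((k - a / s) / k) *\<^sub>R (s *\<^sub>R dir) =
    (a / k + (k - a / s) / k * s) *\<^sub>R dir + (b / k) *\<^sub>R ?f"
    by (simp add: algebra_simps)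
  moreover have "a / k + (k - a / s) / k * s = s"
    using k assms(2) by (simp add: field_simps)
  ultimately have "s *\<^sub>R dir + (b / k) *\<^sub>R ?f \<in> \<sigma>" by simp
  then show thesis
    using that[of "b / k"] ab(2) k(1) by simp
qed

text \<open>However fine the subdivision, every page has exactly one facet of \<open>T\<close> at
  each end of the spine, namely the one entered in the direction \<open>side \<alpha>\<close>. Both
  spine rays thus see the same pages as \<open>\<tau>\<close> does in
  \<open>\<Sigma>\<close>.\<close>

lemma page_of_bij:
  assumes "s \<noteq> 0"
  shows "bij_betw page_of (T.facets_at (ray (s *\<^sub>R dir))) (facets_at \<tau>)"
proof (rule bij_betwI')
  fix \<sigma> \<sigma>' assume \<sigma>: "\<sigma> \<in> T.facets_at (ray (s *\<^sub>R dir))" and \<sigma>': "\<sigma>' \<in> T.facets_at (ray (s *\<^sub>R dir))"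
  show "(page_of \<sigma> = page_of \<sigma>') = (\<sigma> = \<sigma>')"
  proof
    assume eq: "page_of \<sigma> = page_of \<sigma>'"
    obtain t where t: "t > 0" "s *\<^sub>R dir + t *\<^sub>R side (page_of \<sigma>) \<in> \<sigma>"
      using spine_facet_point[OF \<sigma> assms] .
    obtain t' where t': "t' > 0" "s *\<^sub>R dir + t' *\<^sub>R side (page_of \<sigma>) \<in> \<sigma>'"
      using spine_facet_point[OF \<sigma>' assms] eq by metis
    show "\<sigma> = \<sigma>'"
      using T.facet_direction_unique[OF T.facets_atD(1)[OF \<sigma>] T.facets_atD(1)[OF \<sigma>'] _ _
          indep2_spine[OF page_of(1)[OF T.facets_atD(1)[OF \<sigma>]] assms] t t']
        face_of_imp_subset[OF T.facets_atD(2)[OF \<sigma>]] face_of_imp_subset[OF T.facets_atD(2)[OF \<sigma>']] ray_base by blast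
  qed simp
next
  fix \<sigma> assume "\<sigma> \<in> T.facets_at (ray (s *\<^sub>R dir))"
  then show "page_of \<sigma> \<in> facets_at \<tau>"
    using page_of(1) T.facets_atD by blast
next
  fix \<alpha> assume "\<alpha> \<in> facets_at \<tau>"
  then show "\<exists>\<sigma>\<in>T.facets_at (ray (s *\<^sub>R dir)). \<alpha> = page_of \<sigma>"
    using spine_facet_exists[OF _ assms] by metis
qed

text \<open>Coefficient groups depend only on the planes of the adjacent facets, and a facet of
  \<open>T\<close> spans the plane of its page.\<close>

lemma F_int_star_planes:
  assumes "\<sigma> \<in> T" "page_of ` T.facets_at \<sigma> = facets_at \<kappa>" "\<kappa> \<in> \<Sigma>"
  shows "F_int N T p \<sigma> = F_int N \<Sigma> p \<kappa>"
proof -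
  have "T.planes \<sigma> = (span \<circ> page_of) ` T.facets_at \<sigma>"
    unfolding T.planes_def T.facets_at_def[symmetric] using page_of(3) T.facets_atD(1) by (auto simp: image_def)
  also have "\<dots> = planes \<kappa>"
    unfolding image_comp[symmetric] assms(2) planes_def facets_at_def ..
  finally show ?thesis
    using T.F_int_planes[OF assms(1)] F_int_planes[OF assms(3)] by simp
qed

lemma F_int_spine: "s \<noteq> 0 \<Longrightarrow> F_int N T p (ray (s *\<^sub>R dir)) = F_int N \<Sigma> p \<tau>"
  using F_int_star_planes[OF T.coneD[OF spine_ray] bij_betw_imp_surj_on[OF page_of_bij] coneD[OF ray_\<tau>]] .

text \<open>Every page reaches the vertex, so the vertex sees the same planes as the spine. That the
  groups at the vertex and at \<open>\<tau>\<close> coincide is what makes the complex of the star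
  exact.\<close>

lemma F_int_zero: "F_int N T p {0} = F_int N \<Sigma> p \<tau>"
proof (rule F_int_star_planes[OF T.zero_in_fan _ coneD[OF ray_\<tau>]])
  have "T.facets_at (ray (1 *\<^sub>R dir)) \<subseteq> T.facets_at {0}"
    using T.zero_face[OF T.coneD] by (auto simp: T.facets_at_def)
  moreover have "page_of ` T.facets_at (ray (1 *\<^sub>R dir)) = facets_at \<tau>"
    by (rule bij_betw_imp_surj_on[OF page_of_bij]) simp
  ultimately have "facets_at \<tau> \<subseteq> page_of ` T.facets_at {0}"
    by blast
  then show "page_of ` T.facets_at {0} = facets_at \<tau>"
    using page_of(1) T.facets_atD(1) by blast
qed

lemma facets_at_facet: "\<alpha> \<in> facets \<Longrightarrow> facets_at \<alpha> = {\<alpha>}"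
  by (simp add: facets_at_def facets_of_facet)

lemma F_int_facet: "\<sigma> \<in> T.facets \<Longrightarrow> F_int N T p \<sigma> = F_int N \<Sigma> p (page_of \<sigma>)"
  using facets_atD(1)[OF page_of(1)] coneD[OF facets_atD(1)[OF page_of(1)]]
  by (intro F_int_star_planes) (simp_all add: T.facets_at_def T.facets_of_facet facets_at_facet T.coneD)

text \<open>A ray in the interior of the page of \<open>\<alpha>\<close> is spanned by a unique vector \<open>r *\<^sub>R dir + side \<alpha>\<close>.\<close>

lemma interior_direction:
  assumes "\<alpha> \<in> facets_at \<tau>" "c \<noteq> 0"
  shows "indep2 (r *\<^sub>R dir + side \<alpha>) (c *\<^sub>R dir)"
  unfolding indep2_def
proof (intro allI impI)
  fix p q assume "p *\<^sub>R (r *\<^sub>R dir + side \<alpha>) + q *\<^sub>R c *\<^sub>R dir = 0"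
  then have "(p * r + q * c) *\<^sub>R dir + p *\<^sub>R side \<alpha> = 0" by (simp add: algebra_simps)
  then have "p * r + q * c = 0 \<and> p = 0" by (rule indep2D[OF side(1)[OF assms(1)]])
  then show "p = 0 \<and> q = 0" using assms(2) by auto
qed

lemma ray_of_T_cases:
  assumes "\<rho> \<in> T.rays"
  obtains (spine) s where "s = 1 \<or> s = - 1" "\<rho> = ray (s *\<^sub>R dir)"
    | (interior) \<alpha> r where "\<alpha> \<in> facets_at \<tau>" "\<rho> = ray (r *\<^sub>R dir + side \<alpha>)"
proof -
  obtain x where x: "x \<noteq> 0" "\<rho> = ray x" using T.ray_obtain[OF assms] .
  obtain \<alpha> where \<alpha>: "\<alpha> \<in> facets_at \<tau>" "\<rho> \<subseteq> page \<alpha>" using T_in_page[OF T.coneD[OF assms]] .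
  obtain a b where ab: "x = a *\<^sub>R dir + b *\<^sub>R side \<alpha>" "b \<ge> 0"
    using \<alpha>(2) x(2) ray_base pageE by blast
  show thesis
  proof (cases "b = 0")
    case True
    then have "a \<noteq> 0" using x ab by auto
    have "x = \<bar>a\<bar> *\<^sub>R (sgn a *\<^sub>R dir)"
      using ab True by (simp add: abs_mult_sgn)
    then have "\<rho> = ray (sgn a *\<^sub>R dir)"
      using ray_scale[of "\<bar>a\<bar>" "sgn a *\<^sub>R dir"] \<open>a \<noteq> 0\<close> x(2) by simp
    then show thesis using spine[of "sgn a"] \<open>a \<noteq> 0\<close> by (auto simp: sgn_if)
  next
    case False
    then have "x = b *\<^sub>R ((a / b) *\<^sub>R dir + side \<alpha>)" "b > 0"
      using ab by (simp_all add: algebra_simps)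
    then show thesis using interior[OF \<alpha>(1)] x(2) ray_scale by metis
  qed
qed

lemma interior_facet_page:
  assumes "\<alpha> \<in> facets_at \<tau>" "\<sigma> \<in> T.facets" "r *\<^sub>R dir + side \<alpha> \<in> \<sigma>"
  shows "page_of \<sigma> = \<alpha>"
  using page_of_point[OF assms(2,1), of r 1] assms(3) by simp

lemma interior_facet_exists:
  assumes \<alpha>: "\<alpha> \<in> facets_at \<tau>" and \<rho>: "ray (r *\<^sub>R dir + side \<alpha>) \<in> T.rays" and c: "c \<noteq> 0"
  obtains \<sigma> t where "\<sigma> \<in> T.facets_at (ray (r *\<^sub>R dir + side \<alpha>))" "t > 0" "r *\<^sub>R dir + side \<alpha> + t *\<^sub>R c *\<^sub>R dir \<in> \<sigma>"
proof -
  let ?x = "r *\<^sub>R dir + side \<alpha>"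
  have "?x + t *\<^sub>R c *\<^sub>R dir \<in> \<Union>T" for t
  proof -
    have "?x + t *\<^sub>R c *\<^sub>R dir = (r + t * c) *\<^sub>R dir + 1 *\<^sub>R side \<alpha>" by (simp add: algebra_simps)
    then show ?thesis using page_subset_T[OF \<alpha> pageI[of 1 "r + t * c"]] by (simp only: zero_le_one simp_thms)
  qed
  then obtain \<sigma> t where \<sigma>: "\<sigma> \<in> T.facets" "?x \<in> \<sigma>" "t > 0" "?x + t *\<^sub>R c *\<^sub>R dir \<in> \<sigma>"
    using T.facet_in_direction[of ?x "c *\<^sub>R dir"] interior_direction[OF \<alpha> c, of r] indep2_nonzero by metis
  then show thesis
    using that[of \<sigma> t] T.ray_face_of_cone[OF T.coneD[OF \<rho>] T.coneD[OF \<sigma>(1)] \<sigma>(2)] by (simp add: T.facets_at_def)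
qed

lemma interior_facet_point:
  assumes \<alpha>: "\<alpha> \<in> facets_at \<tau>" and \<rho>: "ray (r *\<^sub>R dir + side \<alpha>) \<in> T.rays" and \<sigma>: "\<sigma> \<in> T.facets_at (ray (r *\<^sub>R dir + side \<alpha>))"
  obtains c t where "c = 1 \<or> c = - 1" "t > 0" "r *\<^sub>R dir + side \<alpha> + t *\<^sub>R c *\<^sub>R dir \<in> \<sigma>"
proof -
  let ?x = "r *\<^sub>R dir + side \<alpha>"
  note \<sigma>' = T.facets_atD[OF \<sigma>]
  have x\<sigma>: "?x \<in> \<sigma>" using face_of_imp_subset[OF \<sigma>'(2)] ray_base by blast
  have pg: "page_of \<sigma> = \<alpha>" by (rule interior_facet_page[OF \<alpha> \<sigma>'(1) x\<sigma>])
  obtain p q where pq: "indep2 p q" "\<sigma> = quad p q" "ray ?x = ray p"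
    using T.quad_ray_obtain[OF \<sigma>'(1) \<rho> \<sigma>'(2)] .
  obtain a b where q: "q = a *\<^sub>R dir + b *\<^sub>R side \<alpha>" "b \<ge> 0"
    using page_of(2)[OF \<sigma>'(1)] quad_base(2)[of q p] pq(2) pg pageE by blast
  have "a - b * r \<noteq> 0"
  proof
    assume "a - b * r = 0"
    then have "q = b *\<^sub>R ?x" by (simp add: q algebra_simps)
    moreover obtain k where "?x = k *\<^sub>R p"
      using ray_base[of ?x] unfolding pq(3) by (auto simp: ray_def)
    ultimately have "q \<in> span {p}" by (auto simp: span_singleton)
    then show False using indep2_not_span[OF indep2_swap[OF pq(1)]] by blast
  qed
  note P = pointed_cone_facts[OF T.cone_pointed[OF T.coneD[OF \<sigma>'(1)]]]
  \<comment> \<open>The combination below has nonnegative coefficients, keeps the coordinate along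
    \<open>side \<alpha>\<close> equal to 1 and changes the one along \<open>dir\<close> by
    \<open>k * (a - b * r)\<close>; so it differs from \<open>?x\<close> by a multiple of
    \<open>dir\<close>.\<close>
  define k where "k = 1 / (1 + b)"
  have k: "k > 0" "1 - k * b \<ge> 0" using q(2) by (auto simp: k_def field_simps)
  have "(1 - k * b) *\<^sub>R ?x + k *\<^sub>R q \<in> \<sigma>"
    using k by (intro P(2) P(3) x\<sigma>) (auto simp: pq(2) quad_base)
  moreover have "(1 - k * b) *\<^sub>R ?x + k *\<^sub>R q = ?x + (k * \<bar>a - b * r\<bar>) *\<^sub>R sgn (a - b * r) *\<^sub>R dir"
  proof -
    have "k * \<bar>a - b * r\<bar> * sgn (a - b * r) = k * (a - b * r)"
      by (simp add: mult.assoc abs_mult_sgn)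
    then have "(k * \<bar>a - b * r\<bar>) *\<^sub>R sgn (a - b * r) *\<^sub>R dir = (k * (a - b * r)) *\<^sub>R dir"
      by (simp only: scaleR_scaleR)
    then show ?thesis by (simp add: q algebra_simps)
  qed
  ultimately have "?x + (k * \<bar>a - b * r\<bar>) *\<^sub>R sgn (a - b * r) *\<^sub>R dir \<in> \<sigma>" by simp
  moreover have "sgn (a - b * r) = 1 \<or> sgn (a - b * r) = - 1" using \<open>a - b * r \<noteq> 0\<close> by (auto simp: sgn_if)
  ultimately show thesis
    using that k(1) \<open>a - b * r \<noteq> 0\<close> by (metis mult_pos_pos zero_less_abs_iff)
qed

text \<open>A facet at an interior ray leaves it in the direction \<open>dir\<close> or
  \<open>- dir\<close> (\<open>interior_facet_point\<close>), and for each direction there is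
  exactly one.\<close>

lemma interior_facets:
  assumes \<alpha>: "\<alpha> \<in> facets_at \<tau>" and \<rho>: "ray (r *\<^sub>R dir + side \<alpha>) \<in> T.rays"
  obtains \<sigma> \<sigma>' t t' where "T.facets_at (ray (r *\<^sub>R dir + side \<alpha>)) = {\<sigma>, \<sigma>'}" "\<sigma> \<noteq> \<sigma>'"
    "t > 0" "r *\<^sub>R dir + side \<alpha> + t *\<^sub>R dir \<in> \<sigma>" "t' > 0" "r *\<^sub>R dir + side \<alpha> - t' *\<^sub>R dir \<in> \<sigma>'"
proof -
  let ?x = "r *\<^sub>R dir + side \<alpha>"
  obtain \<sigma> t where \<sigma>: "\<sigma> \<in> T.facets_at (ray ?x)" "t > 0" "?x + t *\<^sub>R 1 *\<^sub>R dir \<in> \<sigma>"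
    using interior_facet_exists[OF \<alpha> \<rho>, of 1] by auto
  obtain \<sigma>' t' where \<sigma>': "\<sigma>' \<in> T.facets_at (ray ?x)" "t' > 0" "?x + t' *\<^sub>R (- 1) *\<^sub>R dir \<in> \<sigma>'"
    using interior_facet_exists[OF \<alpha> \<rho>, of "- 1"] by auto
  have x_in: "?x \<in> \<kappa>" if "\<kappa> \<in> T.facets_at (ray ?x)" for \<kappa>
    using face_of_imp_subset[OF T.facets_atD(2)[OF that]] ray_base by blast
  have "\<sigma> \<noteq> \<sigma>'"
  proof
    \<comment> \<open>A positive combination of the two chosen points lies on the ray. If one facet
      contained both, the face property would put each of them on the ray.\<close>
    assume eq: "\<sigma> = \<sigma>'"
    note P = pointed_cone_facts[OF T.cone_pointed[OF T.coneD[OF T.facets_atD(1)[OF \<sigma>(1)]]]]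
    have "t' *\<^sub>R (?x + t *\<^sub>R 1 *\<^sub>R dir) + t *\<^sub>R (?x + t' *\<^sub>R (- 1) *\<^sub>R dir) = (t' + t) *\<^sub>R ?x"
      by (simp add: algebra_simps)
    also have "\<dots> \<in> ray ?x"
      using \<sigma>(2) \<sigma>'(2) by (intro rayI) simp
    finally have "t' *\<^sub>R (?x + t *\<^sub>R 1 *\<^sub>R dir) \<in> ray ?x"
      using face_of_pointed_cone(3)[OF T.cone_pointed[OF T.coneD[OF T.facets_atD(1)[OF \<sigma>(1)]]] T.facets_atD(2)[OF \<sigma>(1)]]
        P(3)[of t' "?x + t *\<^sub>R 1 *\<^sub>R dir"] P(3)[of t "?x + t' *\<^sub>R (- 1) *\<^sub>R dir"] \<sigma> \<sigma>' eq ray_base by (metis empty_iff less_imp_le)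
    then obtain k where "t' *\<^sub>R (?x + t *\<^sub>R 1 *\<^sub>R dir) = k *\<^sub>R ?x" by (auto simp: ray_def)
    then have "(t' - k) *\<^sub>R ?x + (t' * t) *\<^sub>R 1 *\<^sub>R dir = 0" by (simp add: algebra_simps)
    then have "t' * t = 0" using indep2D[OF interior_direction[OF \<alpha>, of 1 r]] by fastforce
    then show False using \<sigma>(2) \<sigma>'(2) by simp
  qed
  moreover have "\<kappa> = \<sigma> \<or> \<kappa> = \<sigma>'" if \<kappa>: "\<kappa> \<in> T.facets_at (ray ?x)" for \<kappa>
  proof -
    obtain c k where c: "c = 1 \<or> c = - 1" "k > 0" "?x + k *\<^sub>R c *\<^sub>R dir \<in> \<kappa>"
      using interior_facet_point[OF \<alpha> \<rho> \<kappa>] .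
    have uniq: "\<kappa> = \<sigma>''" if "\<sigma>'' \<in> T.facets_at (ray ?x)" "s > 0" "?x + s *\<^sub>R c *\<^sub>R dir \<in> \<sigma>''" for \<sigma>'' s
      using T.facet_direction_unique[OF T.facets_atD(1)[OF \<kappa>] T.facets_atD(1)[OF that(1)] x_in[OF \<kappa>] x_in[OF that(1)]
          interior_direction[OF \<alpha>, of c r] c(2,3) that(2,3)] c(1) by auto
    show ?thesis
      using c(1) uniq \<sigma> \<sigma>' by blast
  qed
  ultimately show thesis
    using that[of \<sigma> \<sigma>' t t'] \<sigma> \<sigma>' by auto
qed

text \<open>All facets at an interior ray span the plane of the page, so the coefficient group is
  constant in the interior of a page.\<close>

lemma F_int_interior:
  assumes \<alpha>: "\<alpha> \<in> facets_at \<tau>" and \<rho>: "ray (r *\<^sub>R dir + side \<alpha>) \<in> T.rays"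
  shows "F_int N T p (ray (r *\<^sub>R dir + side \<alpha>)) = F_int N \<Sigma> p \<alpha>"
proof (rule F_int_star_planes[OF T.coneD[OF \<rho>] _ coneD[OF facets_atD(1)[OF \<alpha>]]])
  have "page_of \<sigma> = \<alpha>" if "\<sigma> \<in> T.facets_at (ray (r *\<^sub>R dir + side \<alpha>))" for \<sigma>
    using interior_facet_page[OF \<alpha> T.facets_atD(1)[OF that]] face_of_imp_subset[OF T.facets_atD(2)[OF that]] ray_base by blast
  moreover have "T.facets_at (ray (r *\<^sub>R dir + side \<alpha>)) \<noteq> {}"
    using T.in_facet[OF T.coneD[OF \<rho>]] by (auto simp: T.facets_at_def)
  ultimately show "page_of ` T.facets_at (ray (r *\<^sub>R dir + side \<alpha>)) = facets_at \<alpha>"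
    unfolding facets_at_facet[OF facets_atD(1)[OF \<alpha>]] by auto
qed

lemma ray_criterion:
  "(\<forall>\<rho>\<in>T.rays. fs.dim (tspace (F_int N T 2 \<rho>) :: ((('a list \<Rightarrow> real) \<Rightarrow> 'k::field) \<Rightarrow> 'k) set) + 1 = card (T.facets_at \<rho>)) \<longleftrightarrow>
    fs.dim (tspace (F_int N \<Sigma> 2 \<tau>) :: ((('a list \<Rightarrow> real) \<Rightarrow> 'k) \<Rightarrow> 'k) set) + 1 = card (facets_at \<tau>)"
proof -
  have spine_eq: "F_int N T 2 (ray (s *\<^sub>R dir)) = F_int N \<Sigma> 2 \<tau> \<and> card (T.facets_at (ray (s *\<^sub>R dir))) = card (facets_at \<tau>)"
    if "s \<noteq> 0" for s
    using F_int_spine[OF that] bij_betw_same_card[OF page_of_bij[OF that]] by simp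
  have interior_eq: "fs.dim (tspace (F_int N T 2 \<rho>) :: ((('a list \<Rightarrow> real) \<Rightarrow> 'k) \<Rightarrow> 'k) set) + 1 = card (T.facets_at \<rho>)"
    if \<rho>: "\<rho> \<in> T.rays" "\<rho> = ray (r *\<^sub>R dir + side \<alpha>)" "\<alpha> \<in> facets_at \<tau>" for \<rho> r \<alpha>
  proof -
    obtain \<sigma> \<sigma>' where "T.facets_at \<rho> = {\<sigma>, \<sigma>'}" "\<sigma> \<noteq> \<sigma>'"
      using interior_facets[OF \<rho>(3) \<rho>(1)[unfolded \<rho>(2)]] unfolding \<rho>(2) by metis
    then have "card (T.facets_at \<rho>) = 2" by simp
    moreover have "fs.dim (tspace (F_int N T 2 \<rho>) :: ((('a list \<Rightarrow> real) \<Rightarrow> 'k) \<Rightarrow> 'k) set) = 1"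
      unfolding \<rho>(2) F_int_interior[OF \<rho>(3) \<rho>(1)[unfolded \<rho>(2)]] by (rule dim_F_2_facet[OF facets_atD(1)[OF \<rho>(3)]])
    ultimately show ?thesis by simp
  qed
  show ?thesis
  proof
    assume "\<forall>\<rho>\<in>T.rays. fs.dim (tspace (F_int N T 2 \<rho>) :: ((('a list \<Rightarrow> real) \<Rightarrow> 'k) \<Rightarrow> 'k) set) + 1 = card (T.facets_at \<rho>)"
    then show "fs.dim (tspace (F_int N \<Sigma> 2 \<tau>) :: ((('a list \<Rightarrow> real) \<Rightarrow> 'k) \<Rightarrow> 'k) set) + 1 = card (facets_at \<tau>)"
      using spine_ray[of 1] spine_eq[of 1] by (metis zero_neq_one)
  next
    assume *: "fs.dim (tspace (F_int N \<Sigma> 2 \<tau>) :: ((('a list \<Rightarrow> real) \<Rightarrow> 'k) \<Rightarrow> 'k) set) + 1 = card (facets_at \<tau>)"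
    show "\<forall>\<rho>\<in>T.rays. fs.dim (tspace (F_int N T 2 \<rho>) :: ((('a list \<Rightarrow> real) \<Rightarrow> 'k) \<Rightarrow> 'k) set) + 1 = card (T.facets_at \<rho>)"
    proof
      fix \<rho> assume \<rho>: "\<rho> \<in> T.rays"
      then show "fs.dim (tspace (F_int N T 2 \<rho>) :: ((('a list \<Rightarrow> real) \<Rightarrow> 'k) \<Rightarrow> 'k) set) + 1 = card (T.facets_at \<rho>)"
      proof (cases rule: ray_of_T_cases)
        case (spine s)
        then have "s \<noteq> 0" by auto
        then show ?thesis using * spine_eq[of s] spine(2) by simp
      next
        case (interior \<alpha> r)
        then show ?thesis using interior_eq[OF \<rho>] by blast
      qed
    qed
  qed
qed

end

section \<open>Moving coefficients through two-dimensional cones\<close>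

definition single :: "'i \<Rightarrow> ('y \<Rightarrow> 'k::zero) \<Rightarrow> 'i \<times> 'y \<Rightarrow> 'k" where
  "single \<rho> g = (\<lambda>(\<sigma>, \<phi>). if \<sigma> = \<rho> then g \<phi> else 0)"

lemma single_minus: "single \<rho> (fscale (- c) g) = - single \<rho> (fscale c g)"
  for g :: "'y \<Rightarrow> 'k::field"
  by (auto simp: single_def fun_eq_iff fscale_apply)

lemma add_eq_rearrange: "f = x + (y + h) \<Longrightarrow> x = (f - y) + - h" for f :: "'b::ab_group_add"
  by (simp add: algebra_simps)

lemma single_add: "single \<rho> (g + h) = single \<rho> g + single \<rho> h"
  and single_scale: "single \<rho> (fscale c g) = fscale c (single \<rho> g)"
  for g :: "'y \<Rightarrow> 'k::field"
  by (auto simp: single_def fun_eq_iff fscale_apply)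

context fan2
begin

text \<open>The map \<open>iota\<close> to the face \<open>\<tau>\<close>, in terms of
  values.\<close>

definition restr :: "nat \<Rightarrow> 'a set \<Rightarrow> ((('a list \<Rightarrow> real) \<Rightarrow> 'k::field) \<Rightarrow> 'k) \<Rightarrow> (('a list \<Rightarrow> real) \<Rightarrow> 'k) \<Rightarrow> 'k" where
  "restr p \<tau> g = (\<lambda>\<phi>. if \<phi> \<in> additive_on (F_int N \<Sigma> p \<tau>) then g \<phi> else 0)"

lemma single_chains: "g \<in> tspace (F_int N \<Sigma> p \<sigma>) \<Longrightarrow> \<sigma> \<in> I \<Longrightarrow> single \<sigma> g \<in> chains p I"
proof -
  assume g: "g \<in> tspace (F_int N \<Sigma> p \<sigma>)" "\<sigma> \<in> I"
  have "(\<lambda>y. single \<sigma> g (i, y)) \<in> tspace (F_int N \<Sigma> p i)" for i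
    using g fs.subspace_0[OF subspace_tspace[OF subgroup_F_int]] by (cases "i = \<sigma>") (simp_all add: single_def)
  then show ?thesis
    using g(2) by (auto simp: chains_def dsum_def single_def)
qed

lemma bd2_single:
  fixes g :: "(('a list \<Rightarrow> real) \<Rightarrow> 'k::field) \<Rightarrow> 'k"
  assumes "indep2 x z" "quad x z \<in> facets"
  shows "bd2 p (single (quad x z) g) =
    fscale (of_int (rel_sign ori (ray x) (quad x z))) (single (ray x) (restr p (ray x) g)) +
    fscale (of_int (rel_sign ori (ray z) (quad x z))) (single (ray z) (restr p (ray z) g))"
proof
  fix y :: "'a set \<times> (('a list \<Rightarrow> real) \<Rightarrow> 'k)"
  obtain \<rho> \<phi> where y: "y = (\<rho>, \<phi>)" by (cases y)
  note F = facets_quad[OF assms(1) coneD[OF assms(2)]]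
  have inc: "\<rho> \<in> rays \<and> quad x z \<in> facets_at \<rho> \<longleftrightarrow> \<rho> = ray x \<or> \<rho> = ray z"
    using F assms(2) by (auto simp: facets_at_def)
  have eq: "(\<Sum>\<alpha>\<in>facets_at \<rho>. of_int (rel_sign ori \<rho> \<alpha>) * single (quad x z) g (\<alpha>, \<phi>)) =
    (if quad x z \<in> facets_at \<rho> then of_int (rel_sign ori \<rho> (quad x z)) * g \<phi> else 0)"
  proof -
    have "(\<Sum>\<alpha>\<in>facets_at \<rho>. of_int (rel_sign ori \<rho> \<alpha>) * single (quad x z) g (\<alpha>, \<phi>)) =
      (\<Sum>\<alpha>\<in>facets_at \<rho>. if \<alpha> = quad x z then of_int (rel_sign ori \<rho> (quad x z)) * g \<phi> else 0)"
      by (rule sum.cong) (auto simp: single_def)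
    then show ?thesis by simp
  qed
  have "bd2 p (single (quad x z) g) y =
    (if (\<rho> = ray x \<or> \<rho> = ray z) \<and> \<phi> \<in> additive_on (F_int N \<Sigma> p \<rho>) then of_int (rel_sign ori \<rho> (quad x z)) * g \<phi> else 0)"
  proof (cases "\<rho> = ray x \<or> \<rho> = ray z")
    case True
    then have "\<rho> \<in> rays \<and> quad x z \<in> facets_at \<rho>" by (simp only: inc)
    with eq True show ?thesis unfolding y bd2_def by simp
  next
    case False
    then have "\<not> (\<rho> \<in> rays \<and> quad x z \<in> facets_at \<rho>)" unfolding inc .
    with eq False show ?thesis unfolding y bd2_def by auto
  qed
  then show "bd2 p (single (quad x z) g) y =
    (fscale (of_int (rel_sign ori (ray x) (quad x z))) (single (ray x) (restr p (ray x) g)) +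
    fscale (of_int (rel_sign ori (ray z) (quad x z))) (single (ray z) (restr p (ray z) g))) y"
    using ray_eq_indep2[OF assms(1)] by (auto simp: y fscale_apply single_def restr_def)
qed

text \<open>On the star of \<open>\<tau>\<close> every coefficient can be pushed, one two-dimensional cone after the other, to the
  ray \<open>\<tau>\<close>, whose coefficient groups are those of the vertex. This is the reason for exactness.\<close>

definition pushable :: "nat \<Rightarrow> 'a set \<Rightarrow> 'a set \<Rightarrow> ((('a list \<Rightarrow> real) \<Rightarrow> 'k::field) \<Rightarrow> 'k) \<Rightarrow> bool" where
  "pushable p \<rho>0 \<rho> g \<longleftrightarrow> (\<exists>y\<in>chains p facets. \<exists>h\<in>tspace (F_int N \<Sigma> p \<rho>0). single \<rho> g = bd2 p y + single \<rho>0 h)"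

lemma pushable_self: "g \<in> tspace (F_int N \<Sigma> p \<rho>) \<Longrightarrow> pushable p \<rho> \<rho> g"
  unfolding pushable_def
  by (rule bexI[OF _ fs.subspace_0[OF subspace_chains]], rule bexI) (simp_all add: fsp.linear_0[OF flinear_bd2])

lemma pushable_add: "pushable p \<rho>0 \<rho> g \<Longrightarrow> pushable p \<rho>0 \<rho> g' \<Longrightarrow> pushable p \<rho>0 \<rho> (g + g')"
proof -
  assume "pushable p \<rho>0 \<rho> g" "pushable p \<rho>0 \<rho> g'"
  then obtain y h y' h' where y: "y \<in> chains p facets" "y' \<in> chains p facets"
    and h: "h \<in> tspace (F_int N \<Sigma> p \<rho>0)" "h' \<in> tspace (F_int N \<Sigma> p \<rho>0)"
    and eq: "single \<rho> g = bd2 p y + single \<rho>0 h" "single \<rho> g' = bd2 p y' + single \<rho>0 h'"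
    unfolding pushable_def by blast
  have "single \<rho> (g + g') = bd2 p (y + y') + single \<rho>0 (h + h')"
    unfolding single_add eq fsp.linear_add[OF flinear_bd2] by (simp only: add_ac)
  then show ?thesis
    unfolding pushable_def
    using fs.subspace_add[OF subspace_chains y] fs.subspace_add[OF subspace_tspace[OF subgroup_F_int] h] by blast
qed

lemma pushable_scale: "pushable p \<rho>0 \<rho> g \<Longrightarrow> pushable p \<rho>0 \<rho> (fscale c g)"
proof -
  assume "pushable p \<rho>0 \<rho> g"
  then obtain y h where y: "y \<in> chains p facets" and h: "h \<in> tspace (F_int N \<Sigma> p \<rho>0)"
    and eq: "single \<rho> g = bd2 p y + single \<rho>0 h"
    unfolding pushable_def by blast
  have "single \<rho> (fscale c g) = bd2 p (fscale c y) + single \<rho>0 (fscale c h)"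
    unfolding single_scale eq fsp.linear_scale[OF flinear_bd2] fs.scale_right_distrib ..
  then show ?thesis
    unfolding pushable_def
    using fs.subspace_scale[OF subspace_chains y] fs.subspace_scale[OF subspace_tspace[OF subgroup_F_int] h] by blast
qed

text \<open>The boundary of \<open>g\<close> on the quadrant has one term at each of its two rays,
  so the term at \<open>ray x\<close> is traded for the one at \<open>ray z\<close>. The signs are
  their own inverses, so no division occurs.\<close>

lemma pushable_step:
  assumes "indep2 x z" "quad x z \<in> facets" "g \<in> tspace (F_int N \<Sigma> p (quad x z))"
    "pushable p \<rho>0 (ray z) (restr p (ray z) g)"
  shows "pushable p \<rho>0 (ray x) (restr p (ray x) g)"
proof -
  let ?s = "of_int (rel_sign ori (ray x) (quad x z)) :: 'b" and ?s' = "of_int (rel_sign ori (ray z) (quad x z)) :: 'b"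
  obtain y h where y: "y \<in> chains p facets" and h: "h \<in> tspace (F_int N \<Sigma> p \<rho>0)"
    and eq: "single (ray z) (restr p (ray z) g) = bd2 p y + single \<rho>0 h"
    using assms(4) unfolding pushable_def by blast
  have ss: "?s * ?s = 1"
    using rel_sign_cases[of "ray x" "quad x z"] by auto
  have "fscale ?s (bd2 p (single (quad x z) g)) =
    single (ray x) (restr p (ray x) g) + fscale (?s * ?s') (bd2 p y + single \<rho>0 h)"
    unfolding bd2_single[OF assms(1,2)] eq fs.scale_right_distrib fs.scale_scale ss fs.scale_one ..
  then have "fscale ?s (bd2 p (single (quad x z) g)) = single (ray x) (restr p (ray x) g) +
      (fscale (?s * ?s') (bd2 p y) + single \<rho>0 (fscale (?s * ?s') h))"
    by (simp only: fs.scale_right_distrib single_scale)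
  then have "single (ray x) (restr p (ray x) g) = (fscale ?s (bd2 p (single (quad x z) g)) - fscale (?s * ?s') (bd2 p y)) +
      - single \<rho>0 (fscale (?s * ?s') h)"
    by (rule add_eq_rearrange)
  then have "single (ray x) (restr p (ray x) g) =
    bd2 p (fscale ?s (single (quad x z) g) - fscale (?s * ?s') y) + single \<rho>0 (fscale (- (?s * ?s')) h)"
    unfolding fsp.linear_diff[OF flinear_bd2] fsp.linear_scale[OF flinear_bd2] single_minus .
  moreover have "fscale ?s (single (quad x z) g) - fscale (?s * ?s') y \<in> chains p facets"
    by (intro fs.subspace_diff[OF subspace_chains] fs.subspace_scale[OF subspace_chains] y single_chains[OF assms(3,2)])
  moreover have "fscale (- (?s * ?s')) h \<in> tspace (F_int N \<Sigma> p \<rho>0)"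
    by (intro fs.subspace_scale[OF subspace_tspace[OF subgroup_F_int]] h)
  ultimately show ?thesis
    unfolding pushable_def by blast
qed

lemma chains_eq_sum:
  fixes x :: "'a set \<times> (('a list \<Rightarrow> real) \<Rightarrow> 'k) \<Rightarrow> 'k::field"
  assumes "finite I" "x \<in> chains p I"
  shows "x = (\<Sum>\<rho>\<in>I. single \<rho> (\<lambda>\<phi>. x (\<rho>, \<phi>)))"
proof
  fix z :: "'a set \<times> (('a list \<Rightarrow> real) \<Rightarrow> 'k)"
  obtain \<sigma> \<phi> where z: "z = (\<sigma>, \<phi>)" by (cases z)
  have "(\<Sum>\<rho>\<in>I. single \<rho> (\<lambda>\<phi>. x (\<rho>, \<phi>))) z = (\<Sum>\<rho>\<in>I. if \<sigma> = \<rho> then x (\<rho>, \<phi>) else 0)"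
    unfolding sum_fun_apply z single_def by simp
  also have "\<dots> = x z"
    using assms(1) chains_outside[OF assms(2), of \<sigma> \<phi>] by (simp add: z)
  finally show "x z = (\<Sum>\<rho>\<in>I. single \<rho> (\<lambda>\<phi>. x (\<rho>, \<phi>))) z" ..
qed

end

section \<open>Balancing of the star\<close>

context star_fan
begin

lemma edge_parallel: "\<exists>k. k \<noteq> 0 \<and> edge \<tau> = k *\<^sub>R dir"
proof -
  have "edge \<tau> \<in> span {dir}"
    using ori_ray(3)[OF ray_\<tau>] dir(2) span_ray span_base[of "edge \<tau>" "{edge \<tau>}"] by (metis singletonI)
  then show ?thesis
    using ori_ray(2)[OF ray_\<tau>] by (auto simp: span_singleton)
qed

text \<open>Both rays lie on the line of \<open>\<tau>\<close> and have the same lattice, so the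
  generators agree up to sign. This sign is unrelated to that of \<open>s\<close>, since the
  orientations are arbitrary.\<close>

lemma spine_edge:
  assumes "s \<noteq> 0"
  obtains n :: int where "n = 1 \<or> n = - 1" "T.edge (ray (s *\<^sub>R dir)) = of_int n *\<^sub>R edge \<tau>"
proof -
  let ?\<rho> = "ray (s *\<^sub>R dir)"
  note \<rho> = spine_ray[OF assms]
  have "span ?\<rho> = span \<tau>"
  proof -
    have "span {s *\<^sub>R dir} = span {dir}"
    proof (rule span_eq[THEN iffD2], intro conjI)
      show "{s *\<^sub>R dir} \<subseteq> span {dir}" by (simp add: span_base span_scale)
      have "(1 / s) *\<^sub>R (s *\<^sub>R dir) \<in> span {s *\<^sub>R dir}" by (simp only: span_base span_scale singletonI)
      then show "{dir} \<subseteq> span {s *\<^sub>R dir}" using assms by simp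
    qed
    then show ?thesis using dir(2) span_ray by metis
  qed
  then have L: "cone_lattice N ?\<rho> = cone_lattice N \<tau>"
    by (simp add: cone_lattice_def)
  obtain n where n: "T.edge ?\<rho> = of_int n *\<^sub>R edge \<tau>"
    using T.edge_in_lattice[OF \<rho>] ori_ray(4)[OF ray_\<tau>] L by blast
  obtain m where m: "edge \<tau> = of_int m *\<^sub>R T.edge ?\<rho>"
    using edge_in_lattice[OF ray_\<tau>] T.ori_ray(4)[OF \<rho>] L by blast
  have "of_int 1 *\<^sub>R edge \<tau> = of_int (m * n) *\<^sub>R edge \<tau>"
    using n m by (metis of_int_1 of_int_mult scaleR_one scaleR_scaleR)
  then have "1 = m * n"
    using ori_ray(2)[OF ray_\<tau>] by (rule of_int_scaleR_eq)
  then have "n = 1 \<or> n = - 1"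
    by (metis mult.commute zmult_eq_1_iff)
  then show thesis using that n by blast
qed

text \<open>The facet lies on the same side of the line as its page, whichever spine ray is taken:
  the component along \<open>dir\<close> drops out of the product with the edge vector. Only the
  sign between the two edge vectors remains.\<close>

lemma signed_gen_spine:
  assumes s: "s \<noteq> 0" and \<sigma>: "\<sigma> \<in> T.facets_at (ray (s *\<^sub>R dir))"
    and n: "n = 1 \<or> n = - 1" "T.edge (ray (s *\<^sub>R dir)) = of_int n *\<^sub>R edge \<tau>"
  shows "T.signed_gen (ray (s *\<^sub>R dir)) \<sigma> = of_int n * signed_gen \<tau> (page_of \<sigma>)"
proof -
  let ?\<rho> = "ray (s *\<^sub>R dir)" and ?\<alpha> = "page_of \<sigma>"
  note \<sigma>' = T.facets_atD[OF \<sigma>] and \<alpha> = page_of(1)[OF T.facets_atD(1)[OF \<sigma>]]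
  let ?f = "side ?\<alpha>"
  obtain t where t: "t > 0" "s *\<^sub>R dir + t *\<^sub>R ?f \<in> \<sigma>"
    using spine_facet_point[OF \<sigma> s] .
  have "s *\<^sub>R dir + t *\<^sub>R ?f \<notin> ?\<rho>"
  proof
    assume "s *\<^sub>R dir + t *\<^sub>R ?f \<in> ?\<rho>"
    then obtain c where "s *\<^sub>R dir + t *\<^sub>R ?f = c *\<^sub>R s *\<^sub>R dir" by (auto simp: ray_def)
    then have "(1 - c) *\<^sub>R (s *\<^sub>R dir) + t *\<^sub>R ?f = 0" by (simp add: algebra_simps)
    then show False using indep2D[OF indep2_spine[OF \<alpha> s]] t(1) by fastforce
  qed
  then obtain c where c: "c > 0" "wedge [T.edge ?\<rho>, s *\<^sub>R dir + t *\<^sub>R ?f] = fscale c (T.signed_gen ?\<rho> \<sigma>)"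
    using T.signed_gen_direction[OF spine_ray[OF s] \<sigma>, of "s *\<^sub>R dir + t *\<^sub>R ?f"] t(2) by blast
  have "?f \<in> ?\<alpha>"
    using side(2)[OF \<alpha>] quad_base(2) by metis
  moreover have "?f \<notin> \<tau>"
  proof
    assume "?f \<in> \<tau>"
    then have "?f \<in> ray dir" using dir(2) by blast
    then have "?f \<in> span {dir}" by (auto simp: ray_def span_singleton)
    then show False using indep2_not_span[OF indep2_swap[OF side(1)[OF \<alpha>]]] by blast
  qed
  ultimately obtain c' where c': "c' > 0" "wedge [edge \<tau>, ?f] = fscale c' (signed_gen \<tau> ?\<alpha>)"
    using signed_gen_direction[OF ray_\<tau> \<alpha>, of ?f] by blast
  obtain k where k: "edge \<tau> = k *\<^sub>R dir" using edge_parallel by blast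
  have "wedge [edge \<tau>, s *\<^sub>R dir + t *\<^sub>R ?f] = fscale t (wedge [edge \<tau>, ?f])"
    by (simp add: k wedge_2 fun_eq_iff fscale_apply inner_add_left algebra_simps)
  then have "fscale c (T.signed_gen ?\<rho> \<sigma>) = fscale (of_int n * t * c') (signed_gen \<tau> ?\<alpha>)"
    unfolding c(2)[symmetric] n(2) wedge_2_scale_left by (simp only: c'(2) fs.scale_scale mult.assoc)
  then have "fscale (1 / c) (fscale c (T.signed_gen ?\<rho> \<sigma>)) = fscale (of_int n * t * c' / c) (signed_gen \<tau> ?\<alpha>)"
    by (simp only: fs.scale_scale) (simp add: mult.commute)
  then have eq: "T.signed_gen ?\<rho> \<sigma> = fscale (of_int n * t * c' / c) (signed_gen \<tau> ?\<alpha>)"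
    using c(1) by (simp only: fs.scale_scale) simp
  have gen: "subgroup_gen {T.signed_gen ?\<rho> \<sigma>} = subgroup_gen {signed_gen \<tau> ?\<alpha>}"
    unfolding T.subgroup_gen_signed_gen[OF \<sigma>'(1)] subgroup_gen_signed_gen[OF facets_atD(1)[OF \<alpha>]] page_of(3)[OF \<sigma>'(1)] ..
  note sg = cyclic_generator_sign[OF gen signed_gen_nonzero[OF facets_atD(1)[OF \<alpha>]] eq]
  show ?thesis
  proof (cases "n = 1")
    case True
    then show ?thesis using sg(1) t(1) c(1) c'(1) by simp
  next
    case False
    then have "n = - 1" using n(1) by simp
    moreover have "of_int n * t * c' / c < 0"
      using \<open>n = - 1\<close> t(1) c(1) c'(1) by (simp add: divide_neg_pos)
    ultimately show ?thesis using sg(2) by simp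
  qed
qed

text \<open>The two facets span the same plane and lie on opposite sides of the ray.\<close>

lemma signed_gen_interior:
  assumes \<alpha>: "\<alpha> \<in> facets_at \<tau>" and \<rho>: "ray (r *\<^sub>R dir + side \<alpha>) \<in> T.rays"
    and \<sigma>: "\<sigma> \<in> T.facets_at (ray (r *\<^sub>R dir + side \<alpha>))" "t > 0" "r *\<^sub>R dir + side \<alpha> + t *\<^sub>R dir \<in> \<sigma>"
    and \<sigma>': "\<sigma>' \<in> T.facets_at (ray (r *\<^sub>R dir + side \<alpha>))" "t' > 0" "r *\<^sub>R dir + side \<alpha> - t' *\<^sub>R dir \<in> \<sigma>'"
  shows "T.signed_gen (ray (r *\<^sub>R dir + side \<alpha>)) \<sigma> = - T.signed_gen (ray (r *\<^sub>R dir + side \<alpha>)) \<sigma>'"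
proof -
  let ?x = "r *\<^sub>R dir + side \<alpha>"
  let ?\<rho> = "ray ?x"
  have off: "?x + u *\<^sub>R dir \<notin> ?\<rho>" if "u \<noteq> 0" for u
  proof
    assume "?x + u *\<^sub>R dir \<in> ?\<rho>"
    then obtain c where "?x + u *\<^sub>R dir = c *\<^sub>R ?x" by (auto simp: ray_def)
    then have "(1 - c) *\<^sub>R ?x + u *\<^sub>R 1 *\<^sub>R dir = 0" by (simp add: algebra_simps)
    then show False using indep2D[OF interior_direction[OF \<alpha>, of 1 r]] that by fastforce
  qed
  have "T.edge ?\<rho> \<in> span {?x}"
    using T.ori_ray(3)[OF \<rho>] span_ray span_base[of "T.edge ?\<rho>" "{T.edge ?\<rho>}"] by (metis singletonI)
  then obtain k where k: "T.edge ?\<rho> = k *\<^sub>R ?x"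
    by (auto simp: span_singleton)
  have k0: "k \<noteq> 0" using k T.ori_ray(2)[OF \<rho>] by auto
  obtain c where c: "c > 0" "wedge [T.edge ?\<rho>, ?x + t *\<^sub>R dir] = fscale c (T.signed_gen ?\<rho> \<sigma>)"
    using T.signed_gen_direction[OF \<rho> \<sigma>(1), of "?x + t *\<^sub>R dir"] \<sigma>(2,3) off[of t] by auto
  obtain c' where c': "c' > 0" "wedge [T.edge ?\<rho>, ?x + (- t') *\<^sub>R dir] = fscale c' (T.signed_gen ?\<rho> \<sigma>')"
    using T.signed_gen_direction[OF \<rho> \<sigma>'(1), of "?x + (- t') *\<^sub>R dir"] \<sigma>'(2,3) off[of "- t'"] by auto
  have w: "wedge [T.edge ?\<rho>, ?x + u *\<^sub>R dir] = fscale (k * u) (wedge [?x, dir])" for u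
    by (simp add: k wedge_2 fun_eq_iff fscale_apply inner_add_left) (simp add: algebra_simps)?
  have 1: "T.signed_gen ?\<rho> \<sigma> = fscale (k * t / c) (wedge [?x, dir])"
  proof -
    have "fscale (1 / c) (fscale c (T.signed_gen ?\<rho> \<sigma>)) = fscale (1 / c) (fscale (k * t) (wedge [?x, dir]))"
      using c(2) w by simp
    then show ?thesis using c(1) by (simp only: fs.scale_scale) simp
  qed
  have 2: "fscale c' (T.signed_gen ?\<rho> \<sigma>') = fscale (k * - t') (wedge [?x, dir])"
    using c'(2) w[of "- t'"] by simp
  have 3: "wedge [?x, dir] = fscale (c' / (k * - t')) (T.signed_gen ?\<rho> \<sigma>')"
  proof -
    have "fscale (1 / (k * - t')) (fscale c' (T.signed_gen ?\<rho> \<sigma>')) = fscale (1 / (k * - t')) (fscale (k * - t') (wedge [?x, dir]))"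
      using 2 by simp
    then show ?thesis using k0 \<sigma>'(2) by (simp only: fs.scale_scale) simp
  qed
  have eq: "T.signed_gen ?\<rho> \<sigma> = fscale (k * t / c * (c' / (k * - t'))) (T.signed_gen ?\<rho> \<sigma>')"
    unfolding 1 by (subst 3) (simp only: fs.scale_scale)
  have neg: "k * t / c * (c' / (k * - t')) < 0"
    using k0 \<sigma>(2) \<sigma>'(2) c(1) c'(1) by (simp add: field_simps)
  have pg: "page_of \<sigma> = \<alpha>" "page_of \<sigma>' = \<alpha>"
    using interior_facet_page[OF \<alpha> T.facets_atD(1)[OF \<sigma>(1)]] interior_facet_page[OF \<alpha> T.facets_atD(1)[OF \<sigma>'(1)]]
      face_of_imp_subset[OF T.facets_atD(2)[OF \<sigma>(1)]] face_of_imp_subset[OF T.facets_atD(2)[OF \<sigma>'(1)]] ray_base by blast+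
  have gen: "subgroup_gen {T.signed_gen ?\<rho> \<sigma>} = subgroup_gen {T.signed_gen ?\<rho> \<sigma>'}"
    using page_of(3)[OF T.facets_atD(1)[OF \<sigma>(1)]] page_of(3)[OF T.facets_atD(1)[OF \<sigma>'(1)]] pg
    by (simp add: T.subgroup_gen_signed_gen[OF T.facets_atD(1)[OF \<sigma>(1)]] T.subgroup_gen_signed_gen[OF T.facets_atD(1)[OF \<sigma>'(1)]])
  show ?thesis
    by (rule cyclic_generator_sign(2)[OF gen T.signed_gen_nonzero[OF T.facets_atD(1)[OF \<sigma>'(1)]] eq neg])
qed

lemma star_weight_page: "star_weight \<Sigma> \<tau> w \<sigma> = w (page_of \<sigma>)"
  by (simp add: star_weight_def page_of_def)

text \<open>At a spine ray the relation is, up to a common sign, the one at \<open>\<tau>\<close>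
  reindexed by pages. At an interior ray it has two terms with equal weights and opposite
  generators.\<close>

lemma balanced_star:
  fixes w :: "'a set \<Rightarrow> 'k::field"
  assumes "balanced_fan2 N \<Sigma> ori w"
  shows "balanced_fan2 N T ori' (star_weight \<Sigma> \<tau> w)"
proof -
  interpret W: balanced_fan2 N \<Sigma> ori w by (rule assms)
  show ?thesis
  proof unfold_locales
    show "star_weight \<Sigma> \<tau> w \<sigma> \<noteq> 0" if "\<sigma> \<in> T.facets" for \<sigma>
      unfolding star_weight_page using W.weight_nonzero facets_atD(1) page_of(1)[OF that] by blast
  next
    fix \<rho> and \<psi> :: "('a list \<Rightarrow> real) \<Rightarrow> 'k"
    assume \<rho>: "\<rho> \<in> T.rays" and \<psi>: "\<psi> \<in> additive_on (F_int N T 2 \<rho>)"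
    have "(\<Sum>\<sigma>\<in>T.facets_at \<rho>. of_int (rel_sign ori' \<rho> \<sigma>) * star_weight \<Sigma> \<tau> w \<sigma> * \<psi> (wedge (ori' \<sigma>))) =
      (\<Sum>\<sigma>\<in>T.facets_at \<rho>. w (page_of \<sigma>) * \<psi> (T.signed_gen \<rho> \<sigma>))"
    proof (rule sum.cong[OF refl])
      fix \<sigma> assume \<sigma>: "\<sigma> \<in> T.facets_at \<rho>"
      show "of_int (rel_sign ori' \<rho> \<sigma>) * star_weight \<Sigma> \<tau> w \<sigma> * \<psi> (wedge (ori' \<sigma>)) = w (page_of \<sigma>) * \<psi> (T.signed_gen \<rho> \<sigma>)"
        unfolding T.additive_signed_gen(1)[OF \<sigma> \<psi>, symmetric] star_weight_page by (simp only: mult_ac)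
    qed
    also have "\<dots> = 0"
      using \<rho>
    proof (cases rule: ray_of_T_cases)
      case (spine s)
      then have s: "s \<noteq> 0" by auto
      obtain n :: int where n: "n = 1 \<or> n = - 1" "T.edge (ray (s *\<^sub>R dir)) = of_int n *\<^sub>R edge \<tau>"
        using spine_edge[OF s] .
      have \<psi>': "\<psi> \<in> additive_on (F_int N \<Sigma> 2 \<tau>)"
        using \<psi> F_int_spine[OF s] spine(2) by simp
      have "(\<Sum>\<sigma>\<in>T.facets_at \<rho>. w (page_of \<sigma>) * \<psi> (T.signed_gen \<rho> \<sigma>)) =
        (\<Sum>\<sigma>\<in>T.facets_at \<rho>. w (page_of \<sigma>) * \<psi> (of_int n * signed_gen \<tau> (page_of \<sigma>)))"
        using signed_gen_spine[OF s _ n] unfolding spine(2) by (intro sum.cong) auto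
      also have "\<dots> = (\<Sum>\<alpha>\<in>facets_at \<tau>. w \<alpha> * \<psi> (of_int n * signed_gen \<tau> \<alpha>))"
        unfolding spine(2) by (rule sum.reindex_bij_betw[OF page_of_bij[OF s]])
      also have "\<dots> = (\<Sum>\<alpha>\<in>facets_at \<tau>. of_int n * (of_int (rel_sign ori \<tau> \<alpha>) * w \<alpha> * \<psi> (wedge (ori \<alpha>))))"
      proof (rule sum.cong[OF refl])
        fix \<alpha> assume \<alpha>: "\<alpha> \<in> facets_at \<tau>"
        have "\<psi> (of_int n * signed_gen \<tau> \<alpha>) = of_int n * (of_int (rel_sign ori \<tau> \<alpha>) * \<psi> (wedge (ori \<alpha>)))"
          unfolding additive_signed_gen(1)[OF \<alpha> \<psi>']
          by (rule additive_on_of_int_mult[OF \<psi>' subgroup_F_int additive_signed_gen(2)[OF \<alpha> \<psi>']])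
        then show "w \<alpha> * \<psi> (of_int n * signed_gen \<tau> \<alpha>) = of_int n * (of_int (rel_sign ori \<tau> \<alpha>) * w \<alpha> * \<psi> (wedge (ori \<alpha>)))"
          by (simp only: mult_ac)
      qed
      also have "\<dots> = 0"
        unfolding sum_distrib_left[symmetric] W.balance[OF ray_\<tau> \<psi>'] by simp
      finally show ?thesis .
    next
      case (interior \<alpha> r)
      note \<rho>' = \<rho>[unfolded interior(2)]
      obtain \<sigma> \<sigma>' t t' where S: "T.facets_at (ray (r *\<^sub>R dir + side \<alpha>)) = {\<sigma>, \<sigma>'}" "\<sigma> \<noteq> \<sigma>'"
        "t > 0" "r *\<^sub>R dir + side \<alpha> + t *\<^sub>R dir \<in> \<sigma>" "t' > 0" "r *\<^sub>R dir + side \<alpha> - t' *\<^sub>R dir \<in> \<sigma>'"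
        using interior_facets[OF interior(1) \<rho>'] .
      have in_S: "\<sigma> \<in> T.facets_at (ray (r *\<^sub>R dir + side \<alpha>))" "\<sigma>' \<in> T.facets_at (ray (r *\<^sub>R dir + side \<alpha>))"
        using S(1) by simp_all
      have pg: "page_of \<sigma> = page_of \<sigma>'"
        using interior_facet_page[OF interior(1) T.facets_atD(1)[OF in_S(1)]] interior_facet_page[OF interior(1) T.facets_atD(1)[OF in_S(2)]]
          face_of_imp_subset[OF T.facets_atD(2)[OF in_S(1)]] face_of_imp_subset[OF T.facets_atD(2)[OF in_S(2)]] ray_base by (metis subsetD)
      have "T.signed_gen \<rho> \<sigma> = - T.signed_gen \<rho> \<sigma>'"
        unfolding interior(2) by (rule signed_gen_interior[OF interior(1) \<rho>' in_S(1) S(3,4) in_S(2) S(5,6)])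
      moreover have "\<psi> (- T.signed_gen \<rho> \<sigma>') = - \<psi> (T.signed_gen \<rho> \<sigma>')"
        by (rule additive_on_uminus[OF \<psi> T.subgroup_F_int T.additive_signed_gen(2)[OF in_S(2)[folded interior(2)] \<psi>]])
      ultimately show ?thesis
        using S(1,2) pg unfolding interior(2) by simp
    qed
    finally show "(\<Sum>\<sigma>\<in>T.facets_at \<rho>. of_int (rel_sign ori' \<rho> \<sigma>) * star_weight \<Sigma> \<tau> w \<sigma> * \<psi> (wedge (ori' \<sigma>))) = 0" .
  qed
qed

section \<open>Exactness of the chain complex of the star\<close>

lemma restr_interior:
  assumes "F_int N T p \<rho> = F_int N T p \<sigma>" "g \<in> tspace (F_int N T p \<sigma>)"
  shows "T.restr p \<rho> g = g"
  using tspace_outside[OF assms(2)] by (auto simp: T.restr_def assms(1) fun_eq_iff)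

text \<open>The rays inside a page are ordered by \<open>r\<close>. Passing through the facet on the
  \<open>dir\<close> side leads to a ray with larger \<open>r\<close>, or to \<open>\<tau>\<close>
  at the end of the page. There are finitely many rays, so a largest \<open>r\<close> at which
  pushing fails would be refuted by its neighbour. The coefficient is unchanged along the way,
  because the groups inside the page all equal that of \<open>\<alpha>\<close>.\<close>

lemma pushable_interior:
  fixes g :: "(('a list \<Rightarrow> real) \<Rightarrow> 'k::field) \<Rightarrow> 'k"
  assumes \<alpha>: "\<alpha> \<in> facets_at \<tau>" and "ray (r *\<^sub>R dir + side \<alpha>) \<in> T.rays" "g \<in> tspace (F_int N \<Sigma> p \<alpha>)"
  shows "T.pushable p \<tau> (ray (r *\<^sub>R dir + side \<alpha>)) g"
proof (rule ccontr)
  let ?x = "\<lambda>r. r *\<^sub>R dir + side \<alpha>"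
  define Bad where "Bad = {r. ray (?x r) \<in> T.rays \<and> (\<exists>g \<in> tspace (F_int N \<Sigma> p \<alpha>) :: ((('a list \<Rightarrow> real) \<Rightarrow> 'k) \<Rightarrow> 'k) set.
    \<not> T.pushable p \<tau> (ray (?x r)) g)}"
  assume "\<not> T.pushable p \<tau> (ray (?x r)) g"
  then have ne: "Bad \<noteq> {}"
    using assms(2,3) by (auto simp: Bad_def)
  have "inj (\<lambda>r. ray (?x r))"
  proof (rule injI)
    fix r r' assume "ray (?x r) = ray (?x r')"
    then have "?x r \<in> ray (?x r')" using ray_base by metis
    then obtain c where "?x r = c *\<^sub>R ?x r'" by (auto simp: ray_def)
    then have eq: "r *\<^sub>R dir + 1 *\<^sub>R side \<alpha> = (c * r') *\<^sub>R dir + c *\<^sub>R side \<alpha>" by (simp add: algebra_simps)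
    show "r = r'"
      using indep2_eqD[OF side(1)[OF \<alpha>] eq] by simp
  qed
  moreover have "(\<lambda>r. ray (?x r)) ` Bad \<subseteq> T.rays"
    by (auto simp: Bad_def)
  ultimately have "finite Bad"
    by (meson T.finite_cones finite_subset inj_on_finite inj_on_subset subset_UNIV)
  define r where "r = Max Bad"
  have r: "r \<in> Bad" and max: "\<And>r'. r' \<in> Bad \<Longrightarrow> r' \<le> r"
    unfolding r_def using \<open>finite Bad\<close> ne by auto
  have \<rho>: "ray (?x r) \<in> T.rays" using r by (simp add: Bad_def)
  obtain g :: "(('a list \<Rightarrow> real) \<Rightarrow> 'k) \<Rightarrow> 'k" where g: "g \<in> tspace (F_int N \<Sigma> p \<alpha>)" "\<not> T.pushable p \<tau> (ray (?x r)) g"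
    using r by (auto simp: Bad_def)
  obtain \<sigma> t where \<sigma>: "\<sigma> \<in> T.facets_at (ray (?x r))" "t > 0" "?x r + t *\<^sub>R 1 *\<^sub>R dir \<in> \<sigma>"
    using interior_facet_exists[OF \<alpha> \<rho>, of 1] by auto
  note \<sigma>' = T.facets_atD[OF \<sigma>(1)]
  obtain u z where uz: "indep2 u z" "\<sigma> = quad u z" "ray (?x r) = ray u"
    using T.quad_ray_obtain[OF \<sigma>'(1) \<rho> \<sigma>'(2)] .
  have pg: "page_of \<sigma> = \<alpha>"
    using interior_facet_page[OF \<alpha> \<sigma>'(1)] face_of_imp_subset[OF \<sigma>'(2)] ray_base by blast
  have g\<sigma>: "g \<in> tspace (F_int N T p \<sigma>)"
    using g(1) F_int_facet[OF \<sigma>'(1)] pg by simp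
  have z: "ray z \<in> T.rays"
    using T.facets_quad[OF uz(1)] T.coneD[OF \<sigma>'(1)] uz(2) by blast
  obtain z1 z2 where zc: "z = z1 *\<^sub>R dir + z2 *\<^sub>R side \<alpha>" "z2 \<ge> 0"
    using page_of(2)[OF \<sigma>'(1)] quad_base(2)[of z u] uz(2) pg pageE by blast
  obtain a b where ab: "?x r + t *\<^sub>R 1 *\<^sub>R dir = a *\<^sub>R u + b *\<^sub>R z" "a \<ge> 0" "b \<ge> 0"
    using \<sigma>(3) unfolding uz(2) quad_def by blast
  have "u \<in> ray (?x r)" unfolding uz(3) by (rule ray_base)
  then obtain k where k: "u = k *\<^sub>R ?x r" by (auto simp: ray_def)
  have "(r + t) *\<^sub>R dir + 1 *\<^sub>R side \<alpha> = (a * k * r + b * z1) *\<^sub>R dir + (a * k + b * z2) *\<^sub>R side \<alpha>"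
    using ab(1) unfolding k zc(1) by (simp add: algebra_simps)
  note co = indep2_eqD[OF side(1)[OF \<alpha>] this]
  \<comment> \<open>Comparison of coordinates in the basis \<open>dir\<close>,
    \<open>side \<alpha>\<close>. As \<open>t\<close> is positive and \<open>b\<close> is
    nonnegative, \<open>z1 - z2 * r\<close> is positive: the other ray of the facet lies further
    towards \<open>dir\<close>.\<close>
  have bt: "b * (z1 - z2 * r) = t"
  proof -
    have "a * k = 1 - b * z2" using co(2) by simp
    then have "r + t = (1 - b * z2) * r + b * z1" using co(1) by simp
    then show ?thesis by (simp add: algebra_simps)
  qed
  have b: "b > 0" "z1 - z2 * r > 0"
  proof -
    have "b \<noteq> 0" using bt \<sigma>(2) by auto
    then show "b > 0" using ab(3) by simp
    then show "z1 - z2 * r > 0" using bt \<sigma>(2) by (metis zero_less_mult_pos)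
  qed
  \<comment> \<open>For z2 = 0 the neighbouring ray is \<open>\<tau>\<close> itself; otherwise it is
    an interior ray with a larger parameter, where pushing succeeds by maximality.\<close>
  have "T.pushable p \<tau> (ray z) (T.restr p (ray z) g)"
  proof (cases "z2 = 0")
    case True
    then have "z1 > 0" using b(2) by simp
    have "z = z1 *\<^sub>R dir" using zc(1) True by simp
    then have "ray z = ray dir" using ray_scale[OF \<open>z1 > 0\<close>] by simp
    then have "ray z = \<tau>" using dir(2) by (rule trans[OF _ sym])
    moreover have "T.restr p \<tau> g \<in> tspace (F_int N T p \<tau>)"
      unfolding T.restr_def
    proof (rule tspace_restrict[OF T.F_int_mono T.subgroup_F_int g\<sigma>])
      show "\<tau> face_of \<sigma>"
        using T.facets_quad[OF uz(1)] T.coneD[OF \<sigma>'(1)] uz(2) \<open>ray z = \<tau>\<close> by blast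
    qed
    ultimately show ?thesis by (simp add: T.pushable_self)
  next
    case False
    then have z2: "z2 > 0" using zc(2) by simp
    have "z = z2 *\<^sub>R ?x (z1 / z2)"
      using z2 by (simp add: zc algebra_simps)
    then have rz: "ray z = ray (?x (z1 / z2))" using ray_scale[OF z2] by metis
    have "r < z1 / z2" using b(2) z2 by (simp add: field_simps)
    then have "z1 / z2 \<notin> Bad" using max by fastforce
    then have "T.pushable p \<tau> (ray z) g"
      using z g(1) unfolding rz Bad_def by blast
    moreover have "T.restr p (ray z) g = g"
      using F_int_interior[OF \<alpha> z[unfolded rz], folded rz] F_int_facet[OF \<sigma>'(1)] pg g\<sigma>
      by (intro restr_interior[of p _ \<sigma>]) simp_all
    ultimately show ?thesis by simp
  qed
  then have "T.pushable p \<tau> (ray u) (T.restr p (ray u) g)"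
    using \<sigma>'(1) g\<sigma> unfolding uz(2) by (intro T.pushable_step[OF uz(1)])
  moreover have "T.restr p (ray u) g = g"
    using F_int_interior[OF \<alpha> \<rho>, unfolded uz(3)] F_int_facet[OF \<sigma>'(1)] pg g\<sigma>
    by (intro restr_interior[of p _ \<sigma>]) simp_all
  ultimately show False
    using g(2) uz(3) by simp
qed

text \<open>A coefficient at the opposite ray need not come from a single facet, but it is a linear
  combination of coefficients that do. Each of these passes through its facet to an interior ray of
  the page, where \<open>pushable_interior\<close> takes over.\<close>

lemma pushable_opposite:
  fixes g :: "(('a list \<Rightarrow> real) \<Rightarrow> 'k::field) \<Rightarrow> 'k"
  assumes "g \<in> tspace (F_int N T p (ray (- dir)))"
  shows "T.pushable p \<tau> (ray (- dir)) g"
proof -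
  let ?\<rho> = "ray (- dir)"
  have \<rho>: "?\<rho> \<in> T.rays" using spine_ray[of "- 1"] by simp
  let ?A = "F_int N T p ?\<rho>"
  let ?S = "\<Union>\<sigma>\<in>{\<sigma> \<in> T.facets. ?\<rho> face_of \<sigma>}. F_int N T p \<sigma>"
  have delta: "T.pushable p \<tau> ?\<rho> (tdelta ?A a :: (('a list \<Rightarrow> real) \<Rightarrow> 'k) \<Rightarrow> 'k)" if a: "a \<in> ?S" for a
  proof -
    obtain \<sigma> where \<sigma>: "\<sigma> \<in> T.facets" "?\<rho> face_of \<sigma>" "a \<in> F_int N T p \<sigma>" using a by blast
    let ?\<alpha> = "page_of \<sigma>" and ?g = "tdelta (F_int N T p \<sigma>) a :: (('a list \<Rightarrow> real) \<Rightarrow> 'k) \<Rightarrow> 'k"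
    note \<alpha> = page_of(1)[OF \<sigma>(1)]
    obtain u z where uz: "indep2 u z" "\<sigma> = quad u z" "?\<rho> = ray u"
      using T.quad_ray_obtain[OF \<sigma>(1) \<rho> \<sigma>(2)] .
    have g: "?g \<in> tspace (F_int N T p \<sigma>)"
      by (rule tdelta_in_tspace[OF T.subgroup_F_int \<sigma>(3)])
    have z: "ray z \<in> T.rays"
      using T.facets_quad[OF uz(1)] T.coneD[OF \<sigma>(1)] uz(2) by blast
    obtain z1 z2 where zc: "z = z1 *\<^sub>R dir + z2 *\<^sub>R side ?\<alpha>" "z2 \<ge> 0"
      using page_of(2)[OF \<sigma>(1)] quad_base(2)[of z u] uz(2) pageE by blast
    \<comment> \<open>The two generators of the facet are independent and \<open>u\<close> already
      lies on the spine, so \<open>z\<close> does not.\<close>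
    have "z2 \<noteq> 0"
    proof
      assume "z2 = 0"
      have "u \<in> ray (- dir)" unfolding uz(3) by (rule ray_base)
      then obtain k where "u = k *\<^sub>R (- dir)" by (auto simp: ray_def)
      then have "z1 *\<^sub>R u + k *\<^sub>R z = 0" using zc(1) \<open>z2 = 0\<close> by simp
      then have "z1 = 0" using indep2D[OF uz(1)] by blast
      then show False using zc(1) \<open>z2 = 0\<close> indep2_nonzero[OF uz(1)] by simp
    qed
    then have z2: "z2 > 0" using zc(2) by simp
    have "z = z2 *\<^sub>R ((z1 / z2) *\<^sub>R dir + side ?\<alpha>)"
      using z2 by (simp add: algebra_simps) (use zc(1) in simp)
    then have rz: "ray z = ray ((z1 / z2) *\<^sub>R dir + side ?\<alpha>)" using ray_scale[OF z2] by metis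
    have "T.pushable p \<tau> (ray z) ?g"
      unfolding rz using z[unfolded rz] g F_int_facet[OF \<sigma>(1)] by (intro pushable_interior[OF \<alpha>]) simp_all
    moreover have "T.restr p (ray z) ?g = ?g"
      using F_int_interior[OF \<alpha> z[unfolded rz], folded rz] F_int_facet[OF \<sigma>(1)] g
      by (intro restr_interior[of p _ \<sigma>]) simp_all
    ultimately have "T.pushable p \<tau> (ray u) (T.restr p (ray u) ?g)"
      using \<sigma>(1) g unfolding uz(2) by (intro T.pushable_step[OF uz(1)]) simp_all
    moreover have "T.restr p (ray u) ?g = tdelta ?A a"
      unfolding uz(3)[symmetric]
      using T.additive_on_face[OF \<sigma>(2)] by (auto simp: T.restr_def tdelta_def fun_eq_iff)
    ultimately show ?thesis using uz(3) by simp
  qed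
  have "tspace ?A = fs.span (tdelta ?A ` ?S)"
    using tspace_subgroup_gen[of ?S] unfolding T.F_int_eq_gen_facets[OF T.coneD[OF \<rho>], of p, symmetric] .
  from this assms have "g \<in> fs.span (tdelta ?A ` ?S)" by (rule subst)
  moreover have "fs.subspace {g. T.pushable p \<tau> ?\<rho> (g :: (('a list \<Rightarrow> real) \<Rightarrow> 'k) \<Rightarrow> 'k)}"
  proof (rule fs.subspaceI)
    obtain a where a: "a \<in> ?S"
    proof -
      obtain \<sigma> where "\<sigma> \<in> T.facets" "?\<rho> face_of \<sigma>" using T.in_facet[OF T.coneD[OF \<rho>]] by blast
      then show thesis using that[of 0] add_subgroup_0[OF T.subgroup_F_int] by blast
    qed
    show "0 \<in> {g. T.pushable p \<tau> ?\<rho> (g :: (('a list \<Rightarrow> real) \<Rightarrow> 'k) \<Rightarrow> 'k)}"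
      using T.pushable_scale[OF delta[OF a], of 0] by simp
  qed (auto intro: T.pushable_add T.pushable_scale)
  moreover have "tdelta ?A ` ?S \<subseteq> {g. T.pushable p \<tau> ?\<rho> (g :: (('a list \<Rightarrow> real) \<Rightarrow> 'k) \<Rightarrow> 'k)}"
    using delta by blast
  ultimately show ?thesis
    using fs.span_minimal by blast
qed

lemma F_int_ray_\<tau>: "F_int N T p \<tau> = F_int N T p {0}" "\<tau> \<in> T.rays"
proof -
  have *: "\<tau> = ray (1 *\<^sub>R dir)" using dir(2) by simp
  show "\<tau> \<in> T.rays"
    by (subst *) (rule spine_ray, simp)
  have "F_int N T p (ray (1 *\<^sub>R dir)) = F_int N \<Sigma> p \<tau>"
    by (rule F_int_spine) simp
  then show "F_int N T p \<tau> = F_int N T p {0}"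
    using * F_int_zero by metis
qed

lemma pushable_all:
  assumes "\<rho> \<in> T.rays" "g \<in> tspace (F_int N T p \<rho>)"
  shows "T.pushable p \<tau> \<rho> g"
  using assms(1)
proof (cases rule: ray_of_T_cases)
  case (spine s)
  show ?thesis
  proof (cases "s = 1")
    case True
    then have "\<rho> = \<tau>" using spine(2) dir(2) by simp
    then show ?thesis using assms(2) T.pushable_self by blast
  next
    case False
    then have "\<rho> = ray (- dir)" using spine by simp
    then show ?thesis using assms(2) pushable_opposite by simp
  qed
next
  case (interior \<alpha> r)
  then show ?thesis
    using assms F_int_interior[OF interior(1)] pushable_interior[OF interior(1)] by simp
qed

lemma bd1_single_\<tau>: "T.bd1 p (single \<tau> h) ({0}, \<phi>) =
  (if \<phi> \<in> additive_on (F_int N T p {0}) then of_int (rel_sign ori' {0} \<tau>) * h \<phi> else 0)"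
proof -
  have "(\<Sum>\<rho>\<in>T.rays. of_int (rel_sign ori' {0} \<rho>) * single \<tau> h (\<rho>, \<phi>)) =
    (\<Sum>\<rho>\<in>T.rays. if \<rho> = \<tau> then of_int (rel_sign ori' {0} \<tau>) * h \<phi> else 0)"
    by (rule sum.cong) (auto simp: single_def)
  also have "\<dots> = of_int (rel_sign ori' {0} \<tau>) * h \<phi>"
    using F_int_ray_\<tau>(2) by simp
  finally show ?thesis
    by (simp add: T.bd1_def)
qed

text \<open>The groups at the vertex and at \<open>\<tau>\<close> coincide, so the coefficient at
  the vertex is placed at \<open>\<tau>\<close> as it stands, up to sign.\<close>

lemma star_exact_0:
  fixes x :: "'a set \<times> (('a list \<Rightarrow> real) \<Rightarrow> 'k) \<Rightarrow> 'k::field"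
  assumes "x \<in> T.chains p {{0}}"
  shows "x \<in> T.bd1 p ` (T.chains p T.rays)"
proof -
  let ?s = "of_int (rel_sign ori' {0} \<tau>) :: 'k"
  let ?g = "fscale ?s (\<lambda>\<phi>. x ({0}, \<phi>))"
  have ss: "?s * ?s = 1"
    using T.rel_sign_cases[of "{0}" \<tau>] by auto
  have "?g \<in> tspace (F_int N T p \<tau>)"
    unfolding F_int_ray_\<tau>(1)
    by (intro fs.subspace_scale[OF subspace_tspace[OF T.subgroup_F_int]] T.chainsD[OF assms]) simp
  then have c: "single \<tau> ?g \<in> T.chains p T.rays"
    using T.single_chains F_int_ray_\<tau>(2) by blast
  have "T.bd1 p (single \<tau> ?g) = x"
  proof
    fix z :: "'a set \<times> (('a list \<Rightarrow> real) \<Rightarrow> 'k)"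
    obtain \<sigma> \<phi> where z: "z = (\<sigma>, \<phi>)" by (cases z)
    show "T.bd1 p (single \<tau> ?g) z = x z"
    proof (cases "\<sigma> = {0}")
      case True
      then show ?thesis
        using ss T.chains_outside'[OF assms, of \<phi> "{0}"] by (auto simp: z bd1_single_\<tau> fscale_apply mult.assoc[symmetric])
    next
      case False
      then show ?thesis
        using T.chains_outside[OF assms, of \<sigma> \<phi>] by (simp add: z T.bd1_def)
    qed
  qed
  then show ?thesis by (rule image_eqI[OF sym c])
qed

text \<open>Modulo boundaries the cycle is concentrated at \<open>\<tau>\<close>. Its coefficient
  \<open>h\<close> there maps to 0 in the group at the vertex, which is the same group, so
  \<open>h\<close> is 0.\<close>

lemma star_exact_1:
  assumes x: "x \<in> T.chains p T.rays" and cyc: "T.bd1 p x = 0"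
  shows "x \<in> T.bd2 p ` (T.chains p T.facets)"
proof -
  have "\<forall>\<rho>\<in>T.rays. \<exists>yh. fst yh \<in> T.chains p T.facets \<and> snd yh \<in> tspace (F_int N T p \<tau>) \<and>
      single \<rho> (\<lambda>\<phi>. x (\<rho>, \<phi>)) = T.bd2 p (fst yh) + single \<tau> (snd yh)"
  proof
    fix \<rho> assume \<rho>: "\<rho> \<in> T.rays"
    have "T.pushable p \<tau> \<rho> (\<lambda>\<phi>. x (\<rho>, \<phi>))"
      by (rule pushable_all[OF \<rho> T.chainsD[OF x \<rho>]])
    then obtain y h where "y \<in> T.chains p T.facets" "h \<in> tspace (F_int N T p \<tau>)"
      "single \<rho> (\<lambda>\<phi>. x (\<rho>, \<phi>)) = T.bd2 p y + single \<tau> h"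
      unfolding T.pushable_def by blast
    then show "\<exists>yh. fst yh \<in> T.chains p T.facets \<and> snd yh \<in> tspace (F_int N T p \<tau>) \<and>
      single \<rho> (\<lambda>\<phi>. x (\<rho>, \<phi>)) = T.bd2 p (fst yh) + single \<tau> (snd yh)"
      by (intro exI[of _ "(y, h)"]) simp
  qed
  then obtain yh where yh: "\<And>\<rho>. \<rho> \<in> T.rays \<Longrightarrow> fst (yh \<rho>) \<in> T.chains p T.facets"
    "\<And>\<rho>. \<rho> \<in> T.rays \<Longrightarrow> snd (yh \<rho>) \<in> tspace (F_int N T p \<tau>)"
    "\<And>\<rho>. \<rho> \<in> T.rays \<Longrightarrow> single \<rho> (\<lambda>\<phi>. x (\<rho>, \<phi>)) = T.bd2 p (fst (yh \<rho>)) + single \<tau> (snd (yh \<rho>))"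
    by metis
  define y where "y = (\<Sum>\<rho>\<in>T.rays. fst (yh \<rho>))"
  define h where "h = (\<Sum>\<rho>\<in>T.rays. snd (yh \<rho>))"
  have y: "y \<in> T.chains p T.facets"
    unfolding y_def by (rule fs.subspace_sum[OF T.subspace_chains yh(1)])
  have h: "h \<in> tspace (F_int N T p \<tau>)"
    unfolding h_def by (rule fs.subspace_sum[OF subspace_tspace[OF T.subgroup_F_int] yh(2)])
  have "single \<tau> h = (\<Sum>\<rho>\<in>T.rays. single \<tau> (snd (yh \<rho>)))"
    by (auto simp: h_def single_def fun_eq_iff sum_fun_apply)
  moreover have "x = (\<Sum>\<rho>\<in>T.rays. single \<rho> (\<lambda>\<phi>. x (\<rho>, \<phi>)))"
    by (rule T.chains_eq_sum[OF T.finite_cones x])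
  then have "x = (\<Sum>\<rho>\<in>T.rays. T.bd2 p (fst (yh \<rho>)) + single \<tau> (snd (yh \<rho>)))"
    using yh(3) by (metis (no_types, lifting) sum.cong)
  ultimately have x_eq: "x = T.bd2 p y + single \<tau> h"
    by (simp only: sum.distrib y_def fsp.linear_sum[OF T.flinear_bd2])
  have "T.bd1 p (single \<tau> h) = 0"
    using cyc unfolding x_eq fsp.linear_add[OF T.flinear_bd1] T.bd1_bd2 by simp
  then have hz: "T.bd1 p (single \<tau> h) ({0}, \<phi>) = 0" for \<phi>
    by simp
  have "h \<phi> = 0" for \<phi>
  proof (cases "\<phi> \<in> additive_on (F_int N T p \<tau>)")
    case True
    then show ?thesis
      using hz[of \<phi>] T.rel_sign_cases[of "{0}" \<tau>] unfolding bd1_single_\<tau> F_int_ray_\<tau>(1) by auto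
  qed (rule tspace_outside[OF h])
  then have "single \<tau> h = 0"
    by (auto simp: single_def fun_eq_iff)
  then show ?thesis
    using x_eq y by auto
qed

end

section \<open>Homology modules and the cap product\<close>

lemma carrier_quotient_module:
  "carrier (quotient_module (M\<lparr>carrier := C\<rparr>) B) = (\<lambda>a. B +>\<^bsub>M\<^esub> a) ` C"
  by (auto simp: quotient_module_def A_RCOSETS_def RCOSETS_def a_r_coset_def r_coset_def)

lemma quotient_module_simps:
  "\<zero>\<^bsub>quotient_module M B\<^esub> = B"
  "X \<oplus>\<^bsub>quotient_module M B\<^esub> Y = (\<Union>x\<in>X. \<Union>y\<in>Y. {x \<oplus>\<^bsub>M\<^esub> y})"
  "c \<odot>\<^bsub>quotient_module M B\<^esub> X = (\<Union>x\<in>X. B +>\<^bsub>M\<^esub> (c \<odot>\<^bsub>M\<^esub> x))"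
  by (simp_all add: quotient_module_def set_add_def set_mult_def)

text \<open>Module records carry no laws. An injective linear map \<open>\<Phi>\<close> into a
  function space supplies them: identities in \<open>M\<close> are checked after applying
  \<open>\<Phi>\<close>.\<close>

locale embedded =
  fixes M :: "('k::field, 'm, 'z) module_scheme" and \<Phi> :: "'m \<Rightarrow> 'y \<Rightarrow> 'k"
  assumes inj: "inj_on \<Phi> (carrier M)"
    and zero: "\<zero>\<^bsub>M\<^esub> \<in> carrier M" "\<Phi> \<zero>\<^bsub>M\<^esub> = 0"
    and add: "x \<in> carrier M \<Longrightarrow> y \<in> carrier M \<Longrightarrow> x \<oplus>\<^bsub>M\<^esub> y \<in> carrier M"
      "x \<in> carrier M \<Longrightarrow> y \<in> carrier M \<Longrightarrow> \<Phi> (x \<oplus>\<^bsub>M\<^esub> y) = \<Phi> x + \<Phi> y"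
    and smult: "x \<in> carrier M \<Longrightarrow> c \<odot>\<^bsub>M\<^esub> x \<in> carrier M"
      "x \<in> carrier M \<Longrightarrow> \<Phi> (c \<odot>\<^bsub>M\<^esub> x) = fscale c (\<Phi> x)"
begin

lemma eqI: "x \<in> carrier M \<Longrightarrow> y \<in> carrier M \<Longrightarrow> \<Phi> x = \<Phi> y \<Longrightarrow> x = y"
  by (rule inj_onD[OF inj])

lemma zero_add: "x \<in> carrier M \<Longrightarrow> \<zero>\<^bsub>M\<^esub> \<oplus>\<^bsub>M\<^esub> x = x"
  by (rule eqI) (simp_all add: zero add)

lemma coset_trivial: "a \<in> carrier M \<Longrightarrow> {\<zero>\<^bsub>M\<^esub>} +>\<^bsub>M\<^esub> a = {a}"
  by (simp add: a_r_coset_def' zero_add)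

lemma mem_iff: "B \<subseteq> carrier M \<Longrightarrow> x \<in> carrier M \<Longrightarrow> x \<in> B \<longleftrightarrow> \<Phi> x \<in> \<Phi> ` B"
  using inj_on_image_mem_iff[OF inj] by metis

context
  fixes B
  assumes B: "B \<subseteq> carrier M" and sub: "fs.subspace (\<Phi> ` B)"
begin

lemma zero_in: "\<zero>\<^bsub>M\<^esub> \<in> B"
  using mem_iff[OF B zero(1)] fs.subspace_0[OF sub] zero(2) by simp

lemma add_in: "a \<in> B \<Longrightarrow> b \<in> B \<Longrightarrow> a \<oplus>\<^bsub>M\<^esub> b \<in> B"
  using mem_iff[OF B add(1)] fs.subspace_add[OF sub] B by (simp add: add subset_iff)

lemma smult_in: "a \<in> B \<Longrightarrow> c \<odot>\<^bsub>M\<^esub> a \<in> B"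
  using mem_iff[OF B smult(1)] fs.subspace_scale[OF sub] B by (simp add: smult subset_iff)

lemma coset_absorb:
  assumes a: "a \<in> B"
  shows "B +>\<^bsub>M\<^esub> a = B"
proof (intro equalityI subsetI)
  fix x assume "x \<in> B +>\<^bsub>M\<^esub> a"
  then show "x \<in> B" using add_in[OF _ a] by (auto simp: a_r_coset_def')
next
  fix x assume x: "x \<in> B"
  obtain b where b: "b \<in> B" "\<Phi> x - \<Phi> a = \<Phi> b"
    using fs.subspace_diff[OF sub imageI[OF x] imageI[OF a]] by blast
  have "x = b \<oplus>\<^bsub>M\<^esub> a"
  proof (rule eqI)
    have ab: "a \<in> carrier M" "b \<in> carrier M" using a b(1) B by blast+
    show "x \<in> carrier M" using x B by blast
    show "b \<oplus>\<^bsub>M\<^esub> a \<in> carrier M" by (rule add(1)[OF ab(2,1)])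
    show "\<Phi> x = \<Phi> (b \<oplus>\<^bsub>M\<^esub> a)" using b(2) unfolding add(2)[OF ab(2,1)] by (simp only: diff_eq_eq)
  qed
  then show "x \<in> B +>\<^bsub>M\<^esub> a"
    using b(1) by (auto simp: a_r_coset_def')
qed

lemma zero_module_quotient_iff:
  assumes "C \<subseteq> carrier M" "\<zero>\<^bsub>M\<^esub> \<in> C"
  shows "zero_module (quotient_module (M\<lparr>carrier := C\<rparr>) B) \<longleftrightarrow> C \<subseteq> B"
proof -
  have "zero_module (quotient_module (M\<lparr>carrier := C\<rparr>) B) \<longleftrightarrow> (\<lambda>a. B +>\<^bsub>M\<^esub> a) ` C = {B}"
    by (simp add: zero_module_def carrier_quotient_module quotient_module_simps)
  also have "\<dots> \<longleftrightarrow> (\<forall>a\<in>C. B +>\<^bsub>M\<^esub> a = B)"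
    using assms(2) by auto
  also have "\<dots> \<longleftrightarrow> C \<subseteq> B"
  proof
    assume R: "\<forall>a\<in>C. B +>\<^bsub>M\<^esub> a = B"
    show "C \<subseteq> B"
    proof
      fix a assume a: "a \<in> C"
      then have "\<zero>\<^bsub>M\<^esub> \<oplus>\<^bsub>M\<^esub> a \<in> B" using R zero_in by (auto simp: a_r_coset_def')
      then show "a \<in> B" using a assms(1) by (auto simp: zero_add)
    qed
  qed (auto simp: coset_absorb)
  finally show ?thesis .
qed

text \<open>Both modules are zero. The source is a quotient of a one-element set because cochains of
  positive degree form such a set; what matters is that its only coset is sent to
  \<open>B\<close>.\<close>

lemma linear_isos_trivial:
  assumes z: "z \<oplus>\<^bsub>L\<^esub> z = z" "\<And>c. c \<odot>\<^bsub>L\<^esub> z = z"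
    and F: "F {z} = B"
    and zero: "zero_module (quotient_module (M\<lparr>carrier := C\<rparr>) B)"
  shows "F \<in> linear_isos (quotient_module (L\<lparr>carrier := {z}\<rparr>) {z}) (quotient_module (M\<lparr>carrier := C\<rparr>) B)"
proof -
  have c: "carrier (quotient_module (L\<lparr>carrier := {z}\<rparr>) {z}) = {{z}}"
    by (simp add: carrier_quotient_module a_r_coset_def' z(1))
  have c': "carrier (quotient_module (M\<lparr>carrier := C\<rparr>) B) = {B}"
    using zero by (simp add: zero_module_def quotient_module_simps)
  have coset: "D +>\<^bsub>K\<lparr>carrier := E\<rparr>\<^esub> a = D +>\<^bsub>K\<^esub> a" for D E a and K :: "('x, 'y, 'w) module_scheme"
    by (simp add: a_r_coset_def')
  have "(\<Union>x\<in>B. \<Union>y\<in>B. {x \<oplus>\<^bsub>M\<^esub> y}) = B"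
    using add_in zero_in zero_add B by (auto 0 4)
  moreover have "(\<Union>x\<in>B. B +>\<^bsub>M\<^esub> (c \<odot>\<^bsub>M\<^esub> x)) = B" for c
    using coset_absorb[OF smult_in] zero_in by blast
  ultimately show ?thesis
    unfolding linear_isos_def linear_maps_def bij_betw_def c c'
    by (simp add: quotient_module_simps F z coset) (simp add: a_r_coset_def' z F)
qed

end

end

text \<open>The case q = 0, in which both quotients are by the zero submodule: there are no nonzero
  coboundaries in degree 0 and no chains of degree 3. Injectivity being assumed, only the equality
  of the images is left.\<close>

lemma linear_isos_trivial_quotient:
  fixes M :: "('k::field, 'm, 'z) module_scheme" and M' :: "('k, 'n, 'w) module_scheme"
    and \<Phi> :: "'m \<Rightarrow> 'y \<Rightarrow> 'k" and \<Phi>' :: "'n \<Rightarrow> 'x \<Rightarrow> 'k"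
  assumes "embedded M \<Phi>" "embedded M' \<Phi>'"
    and C': "C' \<subseteq> carrier M'" "f \<in> carrier M \<rightarrow> C'"
    and L: "flinear L" "\<And>u. u \<in> carrier M \<Longrightarrow> \<Phi>' (f u) = L (\<Phi> u)"
    and inj: "\<And>u. u \<in> carrier M \<Longrightarrow> L (\<Phi> u) = 0 \<Longrightarrow> \<Phi> u = 0"
  shows "induced_map M' {\<zero>\<^bsub>M'\<^esub>} f \<in> linear_isos (quotient_module (M\<lparr>carrier := carrier M\<rparr>) {\<zero>\<^bsub>M\<^esub>})
      (quotient_module (M'\<lparr>carrier := C'\<rparr>) {\<zero>\<^bsub>M'\<^esub>}) \<longleftrightarrow> L ` \<Phi> ` carrier M = \<Phi>' ` C'"
proof -
  interpret E: embedded M \<Phi> by fact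
  interpret E': embedded M' \<Phi>' by fact
  let ?F = "induced_map M' {\<zero>\<^bsub>M'\<^esub>} f"
  have fC: "f u \<in> carrier M'" if "u \<in> carrier M" for u
    using C' that by blast
  have F: "?F {u} = {f u}" if "u \<in> carrier M" for u
    using E'.coset_trivial[OF fC[OF that]] by (simp add: induced_map_def)
  have c: "carrier (quotient_module (M\<lparr>carrier := carrier M\<rparr>) {\<zero>\<^bsub>M\<^esub>}) = (\<lambda>u. {u}) ` carrier M"
    unfolding carrier_quotient_module using E.coset_trivial by (intro image_cong refl)
  have c': "carrier (quotient_module (M'\<lparr>carrier := C'\<rparr>) {\<zero>\<^bsub>M'\<^esub>}) = (\<lambda>u. {u}) ` C'"
    unfolding carrier_quotient_module using E'.coset_trivial C'(1) by (intro image_cong refl) auto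
  have f_add: "f (u \<oplus>\<^bsub>M\<^esub> v) = f u \<oplus>\<^bsub>M'\<^esub> f v" if "u \<in> carrier M" "v \<in> carrier M" for u v
    using that fC by (intro E'.eqI) (simp_all add: E.add E'.add L(2) fsp.linear_add[OF L(1)])
  have f_smult: "f (c \<odot>\<^bsub>M\<^esub> u) = c \<odot>\<^bsub>M'\<^esub> f u" if "u \<in> carrier M" for u c
    using that fC by (intro E'.eqI) (simp_all add: E.smult E'.smult L(2) fsp.linear_scale[OF L(1)])
  have "inj_on f (carrier M)"
  proof (rule inj_onI)
    fix u v assume uv: "u \<in> carrier M" "v \<in> carrier M" "f u = f v"
    let ?d = "u \<oplus>\<^bsub>M\<^esub> ((- 1) \<odot>\<^bsub>M\<^esub> v)"
    have d: "?d \<in> carrier M" "\<Phi> ?d = \<Phi> u - \<Phi> v"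
      using uv(1,2) by (simp_all add: E.add E.smult)
    have "L (\<Phi> ?d) = 0"
      unfolding d(2) fsp.linear_diff[OF L(1)] using L(2)[OF uv(1)] L(2)[OF uv(2)] uv(3) by simp
    then have "\<Phi> ?d = 0" by (rule inj[OF d(1)])
    then have "\<Phi> u = \<Phi> v" unfolding d(2) by simp
    with uv(1,2) show "u = v" by (rule E.eqI)
  qed
  then have injF: "inj_on ?F ((\<lambda>u. {u}) ` carrier M)"
    by (auto simp: inj_on_def F)
  have coset: "D +>\<^bsub>K\<lparr>carrier := X\<rparr>\<^esub> a = D +>\<^bsub>K\<^esub> a" for D X a and K :: "('x1, 'y1, 'w1) module_scheme"
    by (simp add: a_r_coset_def')
  have "?F \<in> linear_maps (quotient_module (M\<lparr>carrier := carrier M\<rparr>) {\<zero>\<^bsub>M\<^esub>}) (quotient_module (M'\<lparr>carrier := C'\<rparr>) {\<zero>\<^bsub>M'\<^esub>})"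
    unfolding linear_maps_def c c'
  proof (intro CollectI conjI ballI allI funcsetI)
    fix X assume "X \<in> (\<lambda>u. {u}) ` carrier M"
    then show "?F X \<in> (\<lambda>u. {u}) ` C'" using F C'(2) by auto
  next
    fix X Y assume "X \<in> (\<lambda>u. {u}) ` carrier M" "Y \<in> (\<lambda>u. {u}) ` carrier M"
    then obtain u v where uv: "u \<in> carrier M" "v \<in> carrier M" "X = {u}" "Y = {v}" by blast
    show "?F (X \<oplus>\<^bsub>quotient_module (M\<lparr>carrier := carrier M\<rparr>) {\<zero>\<^bsub>M\<^esub>}\<^esub> Y) =
        ?F X \<oplus>\<^bsub>quotient_module (M'\<lparr>carrier := C'\<rparr>) {\<zero>\<^bsub>M'\<^esub>}\<^esub> ?F Y"
      using F[OF E.add(1)[OF uv(1,2)]] by (simp add: uv F quotient_module_simps f_add)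
  next
    fix c X assume "X \<in> (\<lambda>u. {u}) ` carrier M"
    then obtain u where u: "u \<in> carrier M" "X = {u}" by blast
    show "?F (c \<odot>\<^bsub>quotient_module (M\<lparr>carrier := carrier M\<rparr>) {\<zero>\<^bsub>M\<^esub>}\<^esub> X) =
        c \<odot>\<^bsub>quotient_module (M'\<lparr>carrier := C'\<rparr>) {\<zero>\<^bsub>M'\<^esub>}\<^esub> ?F X"
      using u F[OF E.smult(1)[OF u(1)]] E.coset_trivial[OF E.smult(1)[OF u(1)]] E'.coset_trivial[OF E'.smult(1)[OF fC[OF u(1)]]]
      by (simp add: F quotient_module_simps coset f_smult)
  qed
  then have "?F \<in> linear_isos (quotient_module (M\<lparr>carrier := carrier M\<rparr>) {\<zero>\<^bsub>M\<^esub>}) (quotient_module (M'\<lparr>carrier := C'\<rparr>) {\<zero>\<^bsub>M'\<^esub>})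
      \<longleftrightarrow> ?F ` (\<lambda>u. {u}) ` carrier M = (\<lambda>u. {u}) ` C'"
    unfolding linear_isos_def bij_betw_def c c' using injF by blast
  also have "?F ` (\<lambda>u. {u}) ` carrier M = (\<lambda>u. {u}) ` f ` carrier M"
    unfolding image_image using F by (intro image_cong refl)
  also have "(\<lambda>u. {u}) ` f ` carrier M = (\<lambda>u. {u}) ` C' \<longleftrightarrow> f ` carrier M = C'"
    by (rule inj_image_eq_iff) (simp add: inj_def)
  also have "\<dots> \<longleftrightarrow> \<Phi>' ` f ` carrier M = \<Phi>' ` C'"
    using fC C'(1) by (intro inj_on_image_eq_iff[OF E'.inj, symmetric]) auto
  also have "\<Phi>' ` f ` carrier M = L ` \<Phi> ` carrier M"
    unfolding image_image using L(2) by (intro image_cong refl)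
  finally show ?thesis .
qed

lemma tensor_of_add:
  fixes A :: "'b::ab_group_add set"
  assumes "add_subgroup A" "a \<in> A" "b \<in> A"
  shows "(tensor_of A (a + b) :: ('b \<Rightarrow>\<^sub>0 'k::field) set) = tensor_of A a \<oplus>\<^bsub>tensor A\<^esub> tensor_of A b"
proof (rule tval_inj)
  note c = tensor_closed(4)[OF assms(1)] and ab = add_subgroup_add[OF assms]
  show "tensor_of A (a + b) \<in> carrier (tensor A)" by (rule c[OF ab])
  show "tensor_of A a \<oplus>\<^bsub>tensor A\<^esub> tensor_of A b \<in> carrier (tensor A)"
    by (rule tensor_closed(2)[OF assms(1) c[OF assms(2)] c[OF assms(3)]])
  show "tval A (tensor_of A (a + b)) \<phi> = tval A (tensor_of A a \<oplus>\<^bsub>tensor A\<^esub> tensor_of A b) \<phi>"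
    if \<phi>: "\<phi> \<in> additive_on A" for \<phi> :: "'b \<Rightarrow> 'k"
    unfolding tval_simps(2)[OF assms(1) \<phi> c[OF assms(2)] c[OF assms(3)]] tval_simps(4)[OF assms(1) \<phi>]
    by (rule additive_onD[OF \<phi> assms(2,3)])
qed

lemma tensor_incl_tensor_of:
  fixes A :: "'b::ab_group_add set"
  assumes "add_subgroup A" "add_subgroup A'" "A \<subseteq> A'" "a \<in> A"
  shows "tensor_incl A' (tensor_of A a) = (tensor_of A' a :: ('b \<Rightarrow>\<^sub>0 'k::field) set)"
proof (rule tval_inj[of _ A'])
  show "tensor_incl A' (tensor_of A a) \<in> carrier (tensor A')"
    by (rule tensor_closed(5)[OF assms(1,3) tensor_closed(4)[OF assms(1,4)]])
  show "tensor_of A' a \<in> carrier (tensor A')"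
    using assms(3,4) by (intro tensor_closed(4)[OF assms(2)]) auto
  show "tval A' (tensor_incl A' (tensor_of A a)) \<phi> = tval A' (tensor_of A' a) \<phi>" if "\<phi> \<in> additive_on A'" for \<phi> :: "'b \<Rightarrow> 'k"
    using tval_incl[OF assms(3) that tensor_closed(4)[OF assms(1,4)]] tval_simps(4)[OF assms(2) that]
      tval_simps(4)[OF assms(1) additive_on_subset[OF assms(3) that]] by simp
qed

lemma carrier_dual_tensor:
  "u \<in> carrier (dual_module (tensor A)) \<longleftrightarrow> u \<in> extensional (carrier (tensor A)) \<and>
    (\<forall>X\<in>carrier (tensor A). \<forall>Y\<in>carrier (tensor A). u (X \<oplus>\<^bsub>tensor A\<^esub> Y) = u X + u Y) \<and>
    (\<forall>c. \<forall>X\<in>carrier (tensor A). u (c \<odot>\<^bsub>tensor A\<^esub> X) = c * u X)"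
  by (auto simp: dual_module_def linear_maps_def scalar_module_def)

text \<open>The elements a \<otimes> 1 span the tensor product. The set where the two forms agree is
  carried to functions by \<open>tval\<close>, where it becomes a subspace containing all
  evaluations \<open>tdelta A a\<close>.\<close>

lemma dual_tensor_eqI:
  fixes u v :: "('b::ab_group_add \<Rightarrow>\<^sub>0 'k::field) set \<Rightarrow> 'k"
  assumes A: "add_subgroup A" and u: "u \<in> carrier (dual_module (tensor A))" and v: "v \<in> carrier (dual_module (tensor A))"
    and eq: "\<And>a. a \<in> A \<Longrightarrow> u (tensor_of A a) = v (tensor_of A a)"
  shows "u = v"
proof (rule extensionalityI)
  let ?M = "tensor A :: ('k, ('b \<Rightarrow>\<^sub>0 'k) set) module"
  show "u \<in> extensional (carrier ?M)" "v \<in> extensional (carrier ?M)"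
    using u v by (simp_all add: carrier_dual_tensor)
  fix X assume X: "X \<in> carrier ?M"
  define W where "W = tval A ` {X \<in> carrier ?M. u X = v X}"
  have lin: "u (Y \<oplus>\<^bsub>?M\<^esub> Z) = u Y + u Z" "v (Y \<oplus>\<^bsub>?M\<^esub> Z) = v Y + v Z"
    "u (c \<odot>\<^bsub>?M\<^esub> Y) = c * u Y" "v (c \<odot>\<^bsub>?M\<^esub> Y) = c * v Y"
    if "Y \<in> carrier ?M" "Z \<in> carrier ?M" for Y Z c
    using u v that by (simp_all add: carrier_dual_tensor)
  have tv: "tval A (Y \<oplus>\<^bsub>?M\<^esub> Z) = tval A Y + tval A Z" "tval A (c \<odot>\<^bsub>?M\<^esub> Y) = fscale c (tval A Y)"
    if "Y \<in> carrier ?M" "Z \<in> carrier ?M" for Y Z c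
  proof -
    show "tval A (Y \<oplus>\<^bsub>?M\<^esub> Z) = tval A Y + tval A Z"
    proof
      show "tval A (Y \<oplus>\<^bsub>?M\<^esub> Z) \<phi> = (tval A Y + tval A Z) \<phi>" for \<phi>
        using that by (cases "\<phi> \<in> additive_on A") (simp_all add: tval_simps[OF A] tval_outside)
    qed
    show "tval A (c \<odot>\<^bsub>?M\<^esub> Y) = fscale c (tval A Y)"
    proof
      show "tval A (c \<odot>\<^bsub>?M\<^esub> Y) \<phi> = fscale c (tval A Y) \<phi>" for \<phi>
        using that by (cases "\<phi> \<in> additive_on A") (simp_all add: tval_simps[OF A] tval_outside fscale_apply)
    qed
  qed
  have delta: "tdelta A a \<in> W" if "a \<in> A" for a
    unfolding W_def tdelta_tensor_of[OF A] using eq[OF that] tensor_closed(4)[OF A that] by blast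
  have "fs.subspace W"
  proof (rule fs.subspaceI)
    have "fscale 0 (tdelta A (0 :: 'b)) \<in> W" if "\<And>c g. g \<in> W \<Longrightarrow> fscale c g \<in> W"
      using that delta add_subgroup_0[OF A] by blast
    moreover show sc: "fscale c g \<in> W" if "g \<in> W" for c g
    proof -
      obtain Y where Y: "Y \<in> carrier ?M" "u Y = v Y" "g = tval A Y" using \<open>g \<in> W\<close> unfolding W_def by blast
      have "c \<odot>\<^bsub>?M\<^esub> Y \<in> {X \<in> carrier ?M. u X = v X}"
        using tensor_closed(3)[OF A Y(1), of c] lin(3,4)[OF Y(1,1), of c] Y(2) by simp
      then show ?thesis unfolding W_def Y(3) tv(2)[OF Y(1,1), symmetric] by (rule imageI)
    qed
    ultimately show "0 \<in> W" by simp
    show "g + h \<in> W" if "g \<in> W" "h \<in> W" for g h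
    proof -
      obtain Y Z where Y: "Y \<in> carrier ?M" "u Y = v Y" "g = tval A Y" and Z: "Z \<in> carrier ?M" "u Z = v Z" "h = tval A Z"
        using \<open>g \<in> W\<close> \<open>h \<in> W\<close> unfolding W_def by blast
      have "Y \<oplus>\<^bsub>?M\<^esub> Z \<in> {X \<in> carrier ?M. u X = v X}"
        using tensor_closed(2)[OF A Y(1) Z(1)] lin(1,2)[OF Y(1) Z(1)] Y(2) Z(2) by simp
      then show ?thesis unfolding W_def Y(3) Z(3) tv(1)[OF Y(1) Z(1), symmetric] by (rule imageI)
    qed
  qed
  then have "fs.span (tdelta A ` A) \<subseteq> W"
    using delta by (intro fs.span_minimal) auto
  moreover have "fs.span (tdelta A ` A) = (tspace A :: (('b \<Rightarrow> 'k) \<Rightarrow> 'k) set)"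
    by (rule tspace_subgroup_gen[of A, unfolded subgroup_gen_id[OF A], symmetric])
  ultimately have "tval A X \<in> W"
    using X unfolding tspace_def by blast
  then obtain Y where Y: "Y \<in> carrier ?M" "u Y = v Y" "tval A X = tval A Y" unfolding W_def by blast
  have "X = Y"
    by (rule tval_inj[OF X Y(1)]) (simp only: Y(3))
  then show "u X = v X" using Y(2) by simp
qed

context fan2
begin

definition chain_val :: "nat \<Rightarrow> nat \<Rightarrow> ('a set \<Rightarrow> ('a, 'k::field) coef) \<Rightarrow> 'a set \<times> (('a list \<Rightarrow> real) \<Rightarrow> 'k) \<Rightarrow> 'k" where
  "chain_val p q x = (\<lambda>(\<sigma>, \<phi>). if \<sigma> \<in> cones \<Sigma> q then tval (F_int N \<Sigma> p \<sigma>) (x \<sigma>) \<phi> else 0)"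

lemma carrier_bm_chains: "carrier (bm_chains N \<Sigma> p q) = (\<Pi>\<^sub>E \<sigma>\<in>cones \<Sigma> q. carrier (tensor (F_int N \<Sigma> p \<sigma>)))"
  by (simp add: bm_chains_def direct_sum_def F_lower_def)

lemma chain_val_eqI:
  assumes "\<And>\<sigma> \<phi>. \<sigma> \<in> cones \<Sigma> q \<Longrightarrow> \<phi> \<in> additive_on (F_int N \<Sigma> p \<sigma>) \<Longrightarrow> tval (F_int N \<Sigma> p \<sigma>) (x \<sigma>) \<phi> = y (\<sigma>, \<phi>)"
    and "\<And>\<sigma> \<phi>. \<sigma> \<notin> cones \<Sigma> q \<or> \<phi> \<notin> additive_on (F_int N \<Sigma> p \<sigma>) \<Longrightarrow> y (\<sigma>, \<phi>) = 0"
  shows "chain_val p q x = y"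
proof
  fix z :: "'a set \<times> (('a list \<Rightarrow> real) \<Rightarrow> 'b)"
  obtain \<sigma> \<phi> where z: "z = (\<sigma>, \<phi>)" by (cases z)
  show "chain_val p q x z = y z"
    using assms[of \<sigma> \<phi>] tval_outside[of \<phi> "F_int N \<Sigma> p \<sigma>"] unfolding z chain_val_def
    by (cases "\<sigma> \<in> cones \<Sigma> q"; cases "\<phi> \<in> additive_on (F_int N \<Sigma> p \<sigma>)") simp_all
qed

lemma embedded_chains: "embedded (bm_chains N \<Sigma> p q :: ('k::field, 'a set \<Rightarrow> ('a, 'k) coef) module) (chain_val p q)"
proof
  let ?M = "bm_chains N \<Sigma> p q :: ('k, 'a set \<Rightarrow> ('a, 'k) coef) module"
  let ?t = "\<lambda>\<sigma>. tensor (F_int N \<Sigma> p \<sigma>) :: ('k, ('a, 'k) coef) module"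
  note defs = bm_chains_def direct_sum_def F_lower_def
  show "inj_on (chain_val p q) (carrier ?M)"
  proof (rule inj_onI)
    fix x y assume x: "x \<in> carrier ?M" and y: "y \<in> carrier ?M" and eq: "chain_val p q x = chain_val p q y"
    show "x = y"
    proof (rule PiE_ext[OF x[unfolded carrier_bm_chains] y[unfolded carrier_bm_chains]])
      fix \<sigma> assume \<sigma>: "\<sigma> \<in> cones \<Sigma> q"
      show "x \<sigma> = y \<sigma>"
      proof (rule tval_inj)
        show "x \<sigma> \<in> carrier (?t \<sigma>)" "y \<sigma> \<in> carrier (?t \<sigma>)"
          using x y \<sigma> unfolding carrier_bm_chains by auto
        show "tval (F_int N \<Sigma> p \<sigma>) (x \<sigma>) \<phi> = tval (F_int N \<Sigma> p \<sigma>) (y \<sigma>) \<phi>" for \<phi>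
          using fun_cong[OF eq, of "(\<sigma>, \<phi>)"] \<sigma> by (simp add: chain_val_def)
      qed
    qed
  qed
  have z: "\<zero>\<^bsub>?M\<^esub> = (\<lambda>\<sigma>\<in>cones \<Sigma> q. \<zero>\<^bsub>?t \<sigma>\<^esub>)"
    by (simp add: defs)
  show "\<zero>\<^bsub>?M\<^esub> \<in> carrier ?M"
    unfolding z carrier_bm_chains by (auto intro!: tensor_closed(1)[OF subgroup_F_int])
  show "chain_val p q \<zero>\<^bsub>?M\<^esub> = 0"
    unfolding z by (rule chain_val_eqI) (simp_all add: tval_simps)
  fix x y and c :: 'k
  have ad: "x \<oplus>\<^bsub>?M\<^esub> y = (\<lambda>\<sigma>\<in>cones \<Sigma> q. x \<sigma> \<oplus>\<^bsub>?t \<sigma>\<^esub> y \<sigma>)" and sc: "c \<odot>\<^bsub>?M\<^esub> x = (\<lambda>\<sigma>\<in>cones \<Sigma> q. c \<odot>\<^bsub>?t \<sigma>\<^esub> x \<sigma>)"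
    by (simp_all add: defs)
  assume x: "x \<in> carrier ?M"
  have x': "x \<sigma> \<in> carrier (?t \<sigma>)" if "\<sigma> \<in> cones \<Sigma> q" for \<sigma>
    using x that unfolding carrier_bm_chains by auto
  show "c \<odot>\<^bsub>?M\<^esub> x \<in> carrier ?M"
    unfolding sc carrier_bm_chains by (auto intro!: tensor_closed(3)[OF subgroup_F_int] x')
  show "chain_val p q (c \<odot>\<^bsub>?M\<^esub> x) = fscale c (chain_val p q x)"
    unfolding sc by (rule chain_val_eqI) (auto simp: tval_simps tval_outside x' fscale_apply chain_val_def)
  assume y: "y \<in> carrier ?M"
  have y': "y \<sigma> \<in> carrier (?t \<sigma>)" if "\<sigma> \<in> cones \<Sigma> q" for \<sigma>
    using y that unfolding carrier_bm_chains by auto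
  show "x \<oplus>\<^bsub>?M\<^esub> y \<in> carrier ?M"
    unfolding ad carrier_bm_chains by (auto intro!: tensor_closed(2)[OF subgroup_F_int] x' y')
  show "chain_val p q (x \<oplus>\<^bsub>?M\<^esub> y) = chain_val p q x + chain_val p q y"
    unfolding ad by (rule chain_val_eqI) (auto simp: tval_simps tval_outside x' y' chain_val_def)
qed

lemma chain_val_image:
  "chain_val p q ` carrier (bm_chains N \<Sigma> p q :: ('k::field, 'a set \<Rightarrow> ('a, 'k) coef) module) = chains p (cones \<Sigma> q)"
proof (intro equalityI subsetI)
  fix y assume "y \<in> chain_val p q ` carrier (bm_chains N \<Sigma> p q :: ('k, 'a set \<Rightarrow> ('a, 'k) coef) module)"
  then obtain x where x: "y = chain_val p q x" "x \<in> carrier (bm_chains N \<Sigma> p q :: ('k, 'a set \<Rightarrow> ('a, 'k) coef) module)"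
    by blast
  then show "y \<in> chains p (cones \<Sigma> q)"
    by (auto simp: chains_def dsum_def chain_val_def tspace_def carrier_bm_chains)
next
  fix y :: "'a set \<times> (('a list \<Rightarrow> real) \<Rightarrow> 'k) \<Rightarrow> 'k"
  assume y: "y \<in> chains p (cones \<Sigma> q)"
  have "\<forall>\<sigma>\<in>cones \<Sigma> q. \<exists>X. X \<in> carrier (tensor (F_int N \<Sigma> p \<sigma>)) \<and> tval (F_int N \<Sigma> p \<sigma>) X = (\<lambda>\<phi>. y (\<sigma>, \<phi>))"
  proof
    fix \<sigma> assume "\<sigma> \<in> cones \<Sigma> q"
    note chainsD[OF y this, unfolded tspace_def]
    then obtain X where "(\<lambda>\<phi>. y (\<sigma>, \<phi>)) = tval (F_int N \<Sigma> p \<sigma>) X" "X \<in> carrier (tensor (F_int N \<Sigma> p \<sigma>))"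
      by (rule imageE)
    then show "\<exists>X. X \<in> carrier (tensor (F_int N \<Sigma> p \<sigma>)) \<and> tval (F_int N \<Sigma> p \<sigma>) X = (\<lambda>\<phi>. y (\<sigma>, \<phi>))"
      by (intro exI[of _ X]) simp
  qed
  then obtain X where X: "\<forall>\<sigma>\<in>cones \<Sigma> q. X \<sigma> \<in> carrier (tensor (F_int N \<Sigma> p \<sigma>)) \<and>
      tval (F_int N \<Sigma> p \<sigma>) (X \<sigma>) = (\<lambda>\<phi>. y (\<sigma>, \<phi>))"
    using bchoice by meson
  have "chain_val p q (restrict X (cones \<Sigma> q)) = y"
    using X chains_outside[OF y] chains_outside'[OF y] by (intro chain_val_eqI) auto
  moreover have "restrict X (cones \<Sigma> q) \<in> carrier (bm_chains N \<Sigma> p q)"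
    using X by (auto simp: carrier_bm_chains)
  ultimately show "y \<in> chain_val p q ` carrier (bm_chains N \<Sigma> p q :: ('k, 'a set \<Rightarrow> ('a, 'k) coef) module)"
    by blast
qed

text \<open>One formula for all degrees, matching \<open>bm_boundary\<close>; in degrees 0 and 1 it
  specialises to \<open>bd1\<close> and \<open>bd2\<close>.\<close>

definition bd :: "nat \<Rightarrow> nat \<Rightarrow> ('a set \<times> (('a list \<Rightarrow> real) \<Rightarrow> 'k::field) \<Rightarrow> 'k) \<Rightarrow> 'a set \<times> (('a list \<Rightarrow> real) \<Rightarrow> 'k) \<Rightarrow> 'k" where
  "bd p q x = (\<lambda>(\<tau>, \<phi>). if \<tau> \<in> cones \<Sigma> q \<and> \<phi> \<in> additive_on (F_int N \<Sigma> p \<tau>)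
     then \<Sum>\<sigma>\<in>{\<sigma> \<in> cones \<Sigma> (Suc q). \<tau> face_of \<sigma>}. of_int (rel_sign ori \<tau> \<sigma>) * x (\<sigma>, \<phi>) else 0)"

lemma flinear_bd: "flinear (bd p q)"
  by (rule flinearI) (auto simp: bd_def fun_eq_iff fscale_apply algebra_simps sum.distrib sum_distrib_left)

lemma bd_1: "bd p 1 = bd2 p"
  unfolding bd_def bd2_def facets_at_def One_nat_def numeral_2_eq_2 ..

lemma bd_0: "bd p 0 = bd1 p"
proof -
  have "{\<sigma> \<in> cones \<Sigma> (Suc 0). {0} face_of \<sigma>} = rays"
    using zero_face coneD by auto
  then show ?thesis
    by (auto simp: bd_def bd1_def cones_0 fun_eq_iff)
qed

lemma chain_val_boundary:
  fixes x :: "'a set \<Rightarrow> ('a, 'k::field) coef"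
  assumes x: "x \<in> carrier (bm_chains N \<Sigma> p (Suc q))"
  shows "bm_boundary N \<Sigma> ori p q x \<in> carrier (bm_chains N \<Sigma> p q)"
    and "chain_val p q (bm_boundary N \<Sigma> ori p q x) = bd p q (chain_val p (Suc q) x)"
proof -
  let ?t = "\<lambda>\<sigma>. tensor (F_int N \<Sigma> p \<sigma>) :: ('k, ('a, 'k) coef) module"
  let ?f = "\<lambda>\<tau> \<sigma>. of_int (rel_sign ori \<tau> \<sigma>) \<odot>\<^bsub>?t \<tau>\<^esub> tensor_incl (F_int N \<Sigma> p \<tau>) (x \<sigma>)"
  have x': "x \<sigma> \<in> carrier (?t \<sigma>)" if "\<sigma> \<in> cones \<Sigma> (Suc q)" for \<sigma>
    using x that unfolding carrier_bm_chains by auto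
  have inc: "tensor_incl (F_int N \<Sigma> p \<tau>) (x \<sigma>) \<in> carrier (?t \<tau>)" if "\<sigma> \<in> {\<sigma> \<in> cones \<Sigma> (Suc q). \<tau> face_of \<sigma>}" for \<sigma> \<tau>
    using that by (intro tensor_closed(5)[OF subgroup_F_int F_int_mono x']) auto
  then have in_t: "?f \<tau> \<sigma> \<in> carrier (?t \<tau>)" if "\<sigma> \<in> {\<sigma> \<in> cones \<Sigma> (Suc q). \<tau> face_of \<sigma>}" for \<sigma> \<tau>
    using that by (intro tensor_closed(3)[OF subgroup_F_int])
  have b: "bm_boundary N \<Sigma> ori p q x = (\<lambda>\<tau>\<in>cones \<Sigma> q. finsum (?t \<tau>) (?f \<tau>) {\<sigma> \<in> cones \<Sigma> (Suc q). \<tau> face_of \<sigma>})"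
    by (simp add: bm_boundary_def F_lower_def iota_def)
  show "bm_boundary N \<Sigma> ori p q x \<in> carrier (bm_chains N \<Sigma> p q)"
    unfolding b carrier_bm_chains
    by (rule iffD2[OF restrict_PiE_iff]) (rule ballI, rule finsum_tensor(1)[OF subgroup_F_int in_t], simp_all)
  show "chain_val p q (bm_boundary N \<Sigma> ori p q x) = bd p q (chain_val p (Suc q) x)"
    unfolding b
  proof (rule chain_val_eqI)
    fix \<tau> and \<phi> :: "('a list \<Rightarrow> real) \<Rightarrow> 'k"
    assume \<tau>: "\<tau> \<in> cones \<Sigma> q" and \<phi>: "\<phi> \<in> additive_on (F_int N \<Sigma> p \<tau>)"
    let ?I = "{\<sigma> \<in> cones \<Sigma> (Suc q). \<tau> face_of \<sigma>}"
    have "tval (F_int N \<Sigma> p \<tau>) (finsum (?t \<tau>) (?f \<tau>) ?I) \<phi> = (\<Sum>\<sigma>\<in>?I. tval (F_int N \<Sigma> p \<tau>) (?f \<tau> \<sigma>) \<phi>)"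
      by (rule finsum_tensor(2)[OF subgroup_F_int in_t _ \<phi>]) simp_all
    also have "\<dots> = (\<Sum>\<sigma>\<in>?I. of_int (rel_sign ori \<tau> \<sigma>) * chain_val p (Suc q) x (\<sigma>, \<phi>))"
    proof (rule sum.cong[OF refl])
      fix \<sigma> assume \<sigma>: "\<sigma> \<in> ?I"
      have "tval (F_int N \<Sigma> p \<tau>) (tensor_incl (F_int N \<Sigma> p \<tau>) (x \<sigma>)) \<phi> = tval (F_int N \<Sigma> p \<sigma>) (x \<sigma>) \<phi>"
        using \<sigma> by (intro tval_incl F_int_mono \<phi> x') auto
      then show "tval (F_int N \<Sigma> p \<tau>) (?f \<tau> \<sigma>) \<phi> = of_int (rel_sign ori \<tau> \<sigma>) * chain_val p (Suc q) x (\<sigma>, \<phi>)"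
        using \<sigma> tval_simps(3)[OF subgroup_F_int \<phi> inc[OF \<sigma>]] by (simp add: chain_val_def)
    qed
    finally show "tval (F_int N \<Sigma> p \<tau>) ((\<lambda>\<tau>\<in>cones \<Sigma> q. finsum (?t \<tau>) (?f \<tau>) {\<sigma> \<in> cones \<Sigma> (Suc q). \<tau> face_of \<sigma>}) \<tau>) \<phi> =
        bd p q (chain_val p (Suc q) x) (\<tau>, \<phi>)"
      using \<tau> \<phi> by (simp add: bd_def)
  qed (auto simp: bd_def)
qed

lemma bm_boundaries_image:
  shows "bm_boundaries N \<Sigma> ori p q \<subseteq> carrier (bm_chains N \<Sigma> p q :: ('k::field, 'a set \<Rightarrow> ('a, 'k) coef) module)"
    and "chain_val p q ` (bm_boundaries N \<Sigma> ori p q :: ('a set \<Rightarrow> ('a, 'k) coef) set) = bd p q ` chains p (cones \<Sigma> (Suc q))"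
  unfolding bm_boundaries_def image_image chain_val_image[symmetric]
  using chain_val_boundary(1) by (auto simp: chain_val_boundary(2) intro!: image_cong)

lemma bm_cycles_0: "bm_cycles N \<Sigma> ori p 0 = carrier (bm_chains N \<Sigma> p 0)"
  by (simp add: bm_cycles_def)

lemma bm_cycles_Suc:
  "bm_cycles N \<Sigma> ori p (Suc q) = {x \<in> carrier (bm_chains N \<Sigma> p (Suc q) :: ('k::field, 'a set \<Rightarrow> ('a, 'k) coef) module).
     bd p q (chain_val p (Suc q) x) = 0}"
proof -
  interpret E: embedded "bm_chains N \<Sigma> p q :: ('k, 'a set \<Rightarrow> ('a, 'k) coef) module" "chain_val p q"
    by (rule embedded_chains)
  have "bm_boundary N \<Sigma> ori p q x = \<zero>\<^bsub>bm_chains N \<Sigma> p q\<^esub> \<longleftrightarrow> bd p q (chain_val p (Suc q) x) = 0"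
    if "x \<in> carrier (bm_chains N \<Sigma> p (Suc q))" for x :: "'a set \<Rightarrow> ('a, 'k) coef"
    using chain_val_boundary[OF that] E.eqI[OF _ E.zero(1)] E.zero(2) by metis
  then show ?thesis
    unfolding bm_cycles_def by auto
qed

lemma subspace_boundaries: "fs.subspace (chain_val p q ` (bm_boundaries N \<Sigma> ori p q :: ('a set \<Rightarrow> ('a, 'k::field) coef) set))"
  unfolding bm_boundaries_image by (rule fsp.linear_subspace_image[OF flinear_bd subspace_chains])

lemma zero_bm_homology_iff:
  "zero_module (bm_homology N \<Sigma> ori p q :: ('k::field, ('a set \<Rightarrow> ('a, 'k) coef) set) module) \<longleftrightarrow>
    chain_val p q ` (bm_cycles N \<Sigma> ori p q :: ('a set \<Rightarrow> ('a, 'k) coef) set) \<subseteq> bd p q ` chains p (cones \<Sigma> (Suc q))"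
proof -
  interpret E: embedded "bm_chains N \<Sigma> p q :: ('k, 'a set \<Rightarrow> ('a, 'k) coef) module" "chain_val p q"
    by (rule embedded_chains)
  let ?Z = "bm_cycles N \<Sigma> ori p q :: ('a set \<Rightarrow> ('a, 'k) coef) set"
  let ?B = "bm_boundaries N \<Sigma> ori p q :: ('a set \<Rightarrow> ('a, 'k) coef) set"
  have Z: "?Z \<subseteq> carrier (bm_chains N \<Sigma> p q)"
    by (cases q) (auto simp: bm_cycles_0 bm_cycles_Suc)
  have "\<zero>\<^bsub>bm_chains N \<Sigma> p q\<^esub> \<in> ?Z"
    using E.zero by (cases q) (simp_all add: bm_cycles_0 bm_cycles_Suc fsp.linear_0[OF flinear_bd])
  then have "zero_module (bm_homology N \<Sigma> ori p q :: ('k, ('a set \<Rightarrow> ('a, 'k) coef) set) module) \<longleftrightarrow> ?Z \<subseteq> ?B"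
    unfolding bm_homology_def by (intro E.zero_module_quotient_iff bm_boundaries_image(1) subspace_boundaries Z)
  also have "\<dots> \<longleftrightarrow> chain_val p q ` ?Z \<subseteq> chain_val p q ` ?B"
    by (rule inj_on_image_subset_iff[OF E.inj Z bm_boundaries_image(1), symmetric])
  finally show ?thesis
    unfolding bm_boundaries_image .
qed

lemma cycles_image_Suc:
  "chain_val p (Suc q) ` (bm_cycles N \<Sigma> ori p (Suc q) :: ('a set \<Rightarrow> ('a, 'k::field) coef) set) =
    {y \<in> chains p (cones \<Sigma> (Suc q)). bd p q y = 0}"
  unfolding bm_cycles_Suc chain_val_image[symmetric] by auto

lemma zero_bm_homology_0:
  "zero_module (bm_homology N \<Sigma> ori p 0 :: ('k::field, ('a set \<Rightarrow> ('a, 'k) coef) set) module) \<longleftrightarrow>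
    (\<forall>x\<in>chains p {{0}}. x \<in> bd1 p ` (chains p rays :: ('a set \<times> (('a list \<Rightarrow> real) \<Rightarrow> 'k) \<Rightarrow> 'k) set))"
  unfolding zero_bm_homology_iff bm_cycles_0 chain_val_image cones_0 bd_0 One_nat_def subset_eq ..

lemma zero_bm_homology_1:
  "zero_module (bm_homology N \<Sigma> ori p 1 :: ('k::field, ('a set \<Rightarrow> ('a, 'k) coef) set) module) \<longleftrightarrow>
    (\<forall>x\<in>chains p rays. bd1 p x = 0 \<longrightarrow> x \<in> bd2 p ` (chains p facets :: ('a set \<times> (('a list \<Rightarrow> real) \<Rightarrow> 'k) \<Rightarrow> 'k) set))"
  unfolding zero_bm_homology_iff One_nat_def cycles_image_Suc bd_0 bd_1[unfolded One_nat_def] numeral_2_eq_2 subset_eq Ball_def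
  by (simp only: mem_Collect_eq imp_conjL)

text \<open>A cochain of degree 0 is a linear form on the tensor product at the vertex; its values
  at the elements a \<otimes> 1 give a homomorphism, extended by 0 to match
  \<open>addf\<close>.\<close>

definition dual_val :: "nat \<Rightarrow> ('a set \<Rightarrow> ('a, 'k::field) coef \<Rightarrow> 'k) \<Rightarrow> ('a list \<Rightarrow> real) \<Rightarrow> 'k" where
  "dual_val p u = (\<lambda>a. if a \<in> F_int N \<Sigma> p {0} then u {0} (tensor_of (F_int N \<Sigma> p {0}) a) else 0)"

lemma compact_cones_0: "compact_cones \<Sigma> 0 = {{0}}"
  by (auto simp: compact_cones_def cones_0)

text \<open>A nonzero vector of a cone has arbitrarily large multiples in it.\<close>

lemma compact_cones_Suc: "compact_cones \<Sigma> (Suc q) = {}"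
proof -
  have False if \<sigma>: "\<sigma> \<in> cones \<Sigma> (Suc q)" "compact \<sigma>" for \<sigma>
  proof -
    have "\<sigma> \<noteq> {0}" using \<sigma>(1) by (auto simp: cones_def)
    moreover have "0 \<in> \<sigma>" using zero_face[OF coneD[OF \<sigma>(1)]] face_of_imp_subset by blast
    ultimately obtain x where x: "x \<in> \<sigma>" "x \<noteq> 0" by blast
    obtain b where b: "\<forall>y\<in>\<sigma>. norm y \<le> b"
      using compact_imp_bounded[OF \<sigma>(2)] unfolding bounded_iff by blast
    have "((b + 1) / norm x) *\<^sub>R x \<in> \<sigma>"
    proof (rule pointed_cone_facts(3)[OF cone_pointed[OF coneD[OF \<sigma>(1)]] _ x(1)])
      have "0 \<le> norm x" by simp
      also have "norm x \<le> b" using b x(1) by blast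
      finally show "0 \<le> (b + 1) / norm x" by simp
    qed
    then have "norm (((b + 1) / norm x) *\<^sub>R x) \<le> b" using b by blast
    moreover have "norm (((b + 1) / norm x) *\<^sub>R x) = \<bar>b + 1\<bar>" using x(2) by simp
    ultimately show False by linarith
  qed
  then show ?thesis by (auto simp: compact_cones_def)
qed

lemma carrier_cochains_0: "carrier (cochains N \<Sigma> p 0) = ({{0}} \<rightarrow>\<^sub>E carrier (dual_module (tensor (F_int N \<Sigma> p {0}))))"
  by (simp add: cochains_def direct_sum_def F_upper_def F_lower_def compact_cones_0 PiE_def Pi_def cong: conj_cong)

lemma embedded_cochains: "embedded (cochains N \<Sigma> p 0 :: ('k::field, 'a set \<Rightarrow> ('a, 'k) coef \<Rightarrow> 'k) module) (dual_val p)"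
  and dual_val_image: "dual_val p ` carrier (cochains N \<Sigma> p 0 :: ('k::field, 'a set \<Rightarrow> ('a, 'k) coef \<Rightarrow> 'k) module) = addf (F_int N \<Sigma> p {0})"
proof -
  let ?M = "cochains N \<Sigma> p 0 :: ('k, 'a set \<Rightarrow> ('a, 'k) coef \<Rightarrow> 'k) module"
  let ?A = "F_int N \<Sigma> p {0}"
  let ?t = "tensor ?A :: ('k, ('a, 'k) coef) module"
  let ?D = "dual_module ?t"
  note defs = cochains_def direct_sum_def F_upper_def F_lower_def compact_cones_0 dual_module_def
  note closed = tensor_closed[OF subgroup_F_int[of p "{0}"]]
  have mem: "u \<in> carrier ?M \<longleftrightarrow> u \<in> extensional {{0}} \<and> u {0} \<in> carrier ?D" for u
    unfolding carrier_cochains_0 PiE_def by auto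
  have mem_ext: "(\<lambda>\<gamma>\<in>{{0}}. v \<gamma>) \<in> carrier ?M \<longleftrightarrow> v {0} \<in> carrier ?D" for v
    unfolding mem by simp
  have z: "\<zero>\<^bsub>?M\<^esub> = (\<lambda>\<gamma>\<in>{{0}}. \<lambda>X\<in>carrier ?t. 0)"
    by (auto simp: defs fun_eq_iff restrict_def)
  have ad: "x \<oplus>\<^bsub>?M\<^esub> y = (\<lambda>\<gamma>\<in>{{0}}. \<lambda>X\<in>carrier ?t. x \<gamma> X + y \<gamma> X)" for x y
    by (auto simp: defs fun_eq_iff restrict_def)
  have sc: "c \<odot>\<^bsub>?M\<^esub> x = (\<lambda>\<gamma>\<in>{{0}}. \<lambda>X\<in>carrier ?t. c * x \<gamma> X)" for x c
    by (auto simp: defs fun_eq_iff restrict_def)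
  show "embedded ?M (dual_val p)"
  proof
    show "inj_on (dual_val p) (carrier ?M)"
    proof (rule inj_onI)
      fix u v assume u: "u \<in> carrier ?M" and v: "v \<in> carrier ?M" and eq: "dual_val p u = dual_val p v"
      have "u {0} = v {0}"
      proof (rule dual_tensor_eqI[OF subgroup_F_int])
        show "u {0} \<in> carrier ?D" "v {0} \<in> carrier ?D" using u v mem by blast+
        show "u {0} (tensor_of ?A a) = v {0} (tensor_of ?A a)" if "a \<in> ?A" for a
          using fun_cong[OF eq, of a] that by (simp add: dual_val_def)
      qed
      then show "u = v"
        using u v unfolding mem by (intro extensionalityI[of u "{{0}}" v]) auto
    qed
    show "\<zero>\<^bsub>?M\<^esub> \<in> carrier ?M"
      unfolding z mem_ext carrier_dual_tensor by (auto simp: closed)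
    show "dual_val p \<zero>\<^bsub>?M\<^esub> = 0"
      unfolding z dual_val_def by (auto simp: fun_eq_iff closed)
    fix x y :: "'a set \<Rightarrow> ('a, 'k) coef \<Rightarrow> 'k" and c
    assume x: "x \<in> carrier ?M"
    then have x': "x {0} \<in> carrier ?D" using mem by blast
    show "c \<odot>\<^bsub>?M\<^esub> x \<in> carrier ?M"
      using x' unfolding sc mem_ext carrier_dual_tensor by (auto simp: closed algebra_simps)
    show "dual_val p (c \<odot>\<^bsub>?M\<^esub> x) = fscale c (dual_val p x)"
      unfolding sc dual_val_def by (auto simp: fun_eq_iff closed fscale_apply)
    assume y: "y \<in> carrier ?M"
    then have y': "y {0} \<in> carrier ?D" using mem by blast
    show "x \<oplus>\<^bsub>?M\<^esub> y \<in> carrier ?M"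
      using x' y' unfolding ad mem_ext carrier_dual_tensor by (auto simp: closed algebra_simps)
    show "dual_val p (x \<oplus>\<^bsub>?M\<^esub> y) = dual_val p x + dual_val p y"
      unfolding ad dual_val_def by (auto simp: fun_eq_iff closed)
  qed
  show "dual_val p ` carrier ?M = addf ?A"
  proof (intro equalityI subsetI)
    fix \<phi> assume "\<phi> \<in> dual_val p ` carrier ?M"
    then obtain u where \<phi>: "\<phi> = dual_val p u" and u: "u {0} \<in> carrier ?D" using mem by blast
    have "u {0} (tensor_of ?A (a + b)) = u {0} (tensor_of ?A a) + u {0} (tensor_of ?A b)" if "a \<in> ?A" "b \<in> ?A" for a b
      using u closed(4)[OF that(1)] closed(4)[OF that(2)]
      unfolding tensor_of_add[OF subgroup_F_int that] carrier_dual_tensor by blast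
    then show "\<phi> \<in> addf ?A"
      unfolding \<phi> addf_def additive_on_def dual_val_def using add_subgroup_add[OF subgroup_F_int[of p "{0}"]] by simp
  next
    fix \<phi> :: "('a list \<Rightarrow> real) \<Rightarrow> 'k" assume "\<phi> \<in> addf ?A"
    then have \<phi>: "\<phi> \<in> additive_on ?A" "\<And>a. a \<notin> ?A \<Longrightarrow> \<phi> a = 0"
      by (auto simp: addf_def)
    let ?u = "\<lambda>\<gamma>\<in>{{0}}. \<lambda>X\<in>carrier ?t. tval ?A X \<phi>"
    have u: "?u \<in> carrier ?M"
      unfolding mem_ext carrier_dual_tensor by (auto simp: closed tval_simps[OF subgroup_F_int \<phi>(1)])
    have "dual_val p ?u = \<phi>"
    proof
      show "dual_val p ?u a = \<phi> a" for a
        using \<phi>(2)[of a] closed(4)[of a] tval_simps(4)[OF subgroup_F_int \<phi>(1), of a]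
        by (cases "a \<in> ?A") (simp_all add: dual_val_def closed(4))
    qed
    from this[symmetric] u show "\<phi> \<in> dual_val p ` carrier ?M" by (rule image_eqI)
  qed
qed

lemma cocycles_0: "cocycles N \<Sigma> ori p 0 = carrier (cochains N \<Sigma> p 0)"
  unfolding cocycles_def coboundary_def by (simp add: cochains_def direct_sum_def compact_cones_Suc restrict_def)

lemma coboundaries_0: "coboundaries N \<Sigma> ori p 0 = {\<zero>\<^bsub>cochains N \<Sigma> p 0\<^esub>}"
  by (simp add: coboundaries_def)

text \<open>The index set is empty, so in this encoding the zero module consists of the function
  that is \<open>undefined\<close> everywhere.\<close>

lemma carrier_cochains_Suc: "carrier (cochains N \<Sigma> p (Suc q)) = {\<lambda>\<gamma>. undefined}"
  by (simp add: cochains_def direct_sum_def compact_cones_Suc)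

lemma cocycles_Suc: "cocycles N \<Sigma> ori p (Suc q) = {\<lambda>\<gamma>. undefined}"
  unfolding cocycles_def carrier_cochains_Suc coboundary_def
  by (simp add: cochains_def direct_sum_def compact_cones_Suc restrict_def)

lemma coboundaries_Suc: "(coboundaries N \<Sigma> ori p (Suc q) :: ('a set \<Rightarrow> ('a, 'k::field) coef \<Rightarrow> 'k) set) = {\<lambda>\<gamma>. undefined}"
proof -
  \<comment> \<open>The coboundary map is constant, and its image is a singleton because there is
    some cochain to apply it to.\<close>
  have "carrier (cochains N \<Sigma> p q) \<noteq> ({} :: ('a set \<Rightarrow> ('a, 'k) coef \<Rightarrow> 'k) set)"
  proof (cases q)
    case 0
    interpret E: embedded "cochains N \<Sigma> p 0 :: ('k, 'a set \<Rightarrow> ('a, 'k) coef \<Rightarrow> 'k) module" "dual_val p"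
      by (rule embedded_cochains)
    show ?thesis using E.zero(1) unfolding 0 by auto
  qed (simp add: carrier_cochains_Suc)
  then show ?thesis
    unfolding coboundaries_def coboundary_def by (auto simp: compact_cones_Suc restrict_def)
qed

end

section \<open>The cap product as a map of homology modules\<close>

lemma permutes_2: "{a. a permutes {..<2::nat}} = {id, Transposition.transpose 0 1}"
  unfolding lessThan_2 permutes_doubleton_iff by auto

text \<open>For p = 0 and p = 2 one of the two blocks is everything, and only the identity is
  increasing on it.\<close>

lemma shuffles_2:
  "{a. a permutes {..<2::nat} \<and> strict_mono_on {..<p} a \<and> strict_mono_on {p..<2} a} =
    (if p = 1 then {id, Transposition.transpose 0 1} else {id})" if p2: "p \<le> 2"
proof -
  have t: "strict_mono_on {..<p} (Transposition.transpose (0::nat) 1) \<and> strict_mono_on {p..<2} (Transposition.transpose (0::nat) 1) \<longleftrightarrow> p = 1"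
  proof
    assume *: "strict_mono_on {..<p} (Transposition.transpose (0::nat) 1) \<and> strict_mono_on {p..<2} (Transposition.transpose (0::nat) 1)"
    show "p = 1"
    proof (rule ccontr)
      assume "p \<noteq> 1"
      then consider "p = 0" | "p = 2" using p2 by linarith
      then show False
        using strict_mono_onD[of "{..<p}" "Transposition.transpose (0::nat) 1" 0 1]
          strict_mono_onD[of "{p..<2}" "Transposition.transpose (0::nat) 1" 0 1] * by cases auto
    qed
  qed (auto simp: strict_mono_on_def)
  have "{a. a permutes {..<2::nat} \<and> strict_mono_on {..<p} a \<and> strict_mono_on {p..<2} a} =
      {a \<in> {a. a permutes {..<2::nat}}. strict_mono_on {..<p} a \<and> strict_mono_on {p..<2} a}"
    by blast
  also have "\<dots> = (if p = 1 then {id, Transposition.transpose 0 1} else {id})"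
    unfolding permutes_2 using t by (auto simp: strict_mono_on_def)
  finally show ?thesis .
qed

context balanced_fan2
begin

text \<open>The linear form \<open>u\<close> enters the contraction only through its values at
  elements g \<otimes> 1, which are given by \<open>\<phi>\<close>. With that, the shuffle sum is
  the expression \<open>contr\<close>, signs included.\<close>

lemma contraction_val:
  fixes u :: "('a, 'k) coef \<Rightarrow> 'k"
  assumes p: "p \<le> 2" and \<alpha>: "\<alpha> \<in> facets"
    and u: "\<And>g. g \<in> F_int N \<Sigma> p \<alpha> \<Longrightarrow> u (tensor_of (F_int N \<Sigma> p \<alpha>) g) = \<phi> g"
  shows "contraction N \<Sigma> \<alpha> p u (ori \<alpha>) \<in> carrier (tensor (F_int N \<Sigma> (2 - p) \<alpha>))"
    and "\<psi> \<in> additive_on (F_int N \<Sigma> (2 - p) \<alpha>) \<Longrightarrow>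
      tval (F_int N \<Sigma> (2 - p) \<alpha>) (contraction N \<Sigma> \<alpha> p u (ori \<alpha>)) \<psi> = contr p \<phi> \<psi> (ori \<alpha>)"
proof -
  obtain x y where xy: "ori \<alpha> = [x, y]"
    using ori_facet[OF \<alpha>] by metis
  let ?A = "F_int N \<Sigma> (2 - p) \<alpha>" and ?B = "F_int N \<Sigma> p \<alpha>"
  let ?I = "if p = 1 then {id, Transposition.transpose 0 1} else {id :: nat \<Rightarrow> nat}"
  let ?c = "\<lambda>a. (- 1) ^ (p * (p - 1) div 2) * of_int (sign a) * u (tensor_of ?B (wedge (map (\<lambda>i. [x, y] ! a i) [0..<p]))) :: 'k"
  let ?f = "\<lambda>a. wedge (map (\<lambda>i. [x, y] ! a i) [p..<2])"
  let ?X = "\<lambda>a. ?c a \<odot>\<^bsub>tensor ?A\<^esub> tensor_of ?A (?f a)"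
  have eq: "contraction N \<Sigma> \<alpha> p u (ori \<alpha>) = finsum (tensor ?A) ?X ?I"
    unfolding contraction_def Let_def xy F_lower_def shuffles_2[OF p, symmetric] by (simp add: numeral_2_eq_2)
  note in0 = wedge_Nil_in[OF coneD[OF \<alpha>]] and in1 = wedge_ori_1_in[OF \<alpha> xy] and in2 = wedge_ori_in[OF \<alpha>, unfolded xy]
  have f: "?f a \<in> ?A" if "a \<in> ?I" for a
    using nat_le_2_cases[OF p] that in0 in1 in2 by (auto simp: upt_rec split: if_splits)
  have X: "?X a \<in> carrier (tensor ?A)" if "a \<in> ?I" for a
    by (intro tensor_closed(3,4)[OF subgroup_F_int] f that)
  show "contraction N \<Sigma> \<alpha> p u (ori \<alpha>) \<in> carrier (tensor ?A)"
    unfolding eq by (rule finsum_tensor(1)[OF subgroup_F_int X]) simp_all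
  assume \<psi>: "\<psi> \<in> additive_on ?A"
  have "tval ?A (contraction N \<Sigma> \<alpha> p u (ori \<alpha>)) \<psi> = (\<Sum>a\<in>?I. tval ?A (?X a) \<psi>)"
    unfolding eq by (rule finsum_tensor(2)[OF subgroup_F_int X _ \<psi>]) simp_all
  also have "\<dots> = (\<Sum>a\<in>?I. ?c a * \<psi> (?f a))"
    by (rule sum.cong[OF refl]) (simp only: tval_simps(3)[OF subgroup_F_int \<psi> tensor_closed(4)[OF subgroup_F_int f]] tval_simps(4)[OF subgroup_F_int \<psi>])
  also have "\<dots> = contr p \<phi> \<psi> (ori \<alpha>)"
  proof -
    have ne: "id \<noteq> Transposition.transpose (0::nat) 1"
      by (metis id_apply transpose_apply_first zero_neq_one)
    consider "p = 0" | "p = 1" | "p = 2" using nat_le_2_cases[OF p] by blast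
    then show ?thesis
    proof cases
      case 1
      then show ?thesis using u[of "wedge []"] in0 by (simp add: contr_def xy upt_rec)
    next
      case 2
      then show ?thesis
        using u[of "wedge [x]"] u[of "wedge [y]"] in1 ne by (simp add: contr_def xy upt_rec sign_swap_id)
    next
      case 3
      then show ?thesis using u[of "wedge [x, y]"] in2 by (simp add: contr_def xy upt_rec)
    qed
  qed
  finally show "tval ?A (contraction N \<Sigma> \<alpha> p u (ori \<alpha>)) \<psi> = contr p \<phi> \<psi> (ori \<alpha>)" .
qed

lemma cap_0:
  fixes u :: "'a set \<Rightarrow> ('a, 'k) coef \<Rightarrow> 'k"
  assumes p: "p \<le> 2"
  shows "cap N \<Sigma> ori w p 0 u \<in> carrier (bm_chains N \<Sigma> (2 - p) 2)"
    and "chain_val (2 - p) 2 (cap N \<Sigma> ori w p 0 u) = capv p (dual_val p u)"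
proof -
  let ?C = "\<lambda>\<alpha>. contraction N \<Sigma> \<alpha> p (rho N \<Sigma> p {0} \<alpha> (u {0})) (ori \<alpha>)"
  let ?A = "\<lambda>\<alpha>. F_int N \<Sigma> (2 - p) \<alpha>"
  let ?X = "\<lambda>\<alpha>. w \<alpha> \<odot>\<^bsub>tensor (?A \<alpha>)\<^esub> tensor_incl (?A \<alpha>) (?C \<alpha>)"
  have u: "rho N \<Sigma> p {0} \<alpha> (u {0}) (tensor_of (F_int N \<Sigma> p \<alpha>) g) = dual_val p u g"
    if "\<alpha> \<in> facets" "g \<in> F_int N \<Sigma> p \<alpha>" for \<alpha> g
  proof -
    note sub = F_int_mono[OF zero_face[OF coneD[OF that(1)]], of p]
    have "g \<in> F_int N \<Sigma> p {0}" using that(2) sub by blast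
    moreover have "tensor_of (F_int N \<Sigma> p \<alpha>) g \<in> (carrier (tensor (F_int N \<Sigma> p \<alpha>) :: ('k, ('a, 'k) coef) module))"
      by (rule tensor_closed(4)[OF subgroup_F_int that(2)])
    moreover have "tensor_incl (F_int N \<Sigma> p {0}) (tensor_of (F_int N \<Sigma> p \<alpha>) g) = (tensor_of (F_int N \<Sigma> p {0}) g :: ('a, 'k) coef)"
      by (rule tensor_incl_tensor_of[OF subgroup_F_int subgroup_F_int sub that(2)])
    ultimately show ?thesis
      unfolding rho_def iota_def F_lower_def dual_val_def by simp
  qed
  have C: "?C \<alpha> \<in> carrier (tensor (?A \<alpha>))"
      "\<psi> \<in> additive_on (?A \<alpha>) \<Longrightarrow> tval (?A \<alpha>) (?C \<alpha>) \<psi> = contr p (dual_val p u) \<psi> (ori \<alpha>)" if "\<alpha> \<in> facets" for \<alpha> \<psi>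
    using contraction_val[where u = "rho N \<Sigma> p {0} \<alpha> (u {0})" and \<phi> = "dual_val p u", OF p that] u[OF that] by simp_all
  have incl: "tensor_incl (?A \<alpha>) (?C \<alpha>) \<in> carrier (tensor (?A \<alpha>))" if "\<alpha> \<in> facets" for \<alpha>
    by (rule tensor_closed(5)[OF subgroup_F_int order_refl C(1)[OF that]])
  have X: "?X \<alpha> \<in> carrier (tensor (?A \<alpha>))" if "\<alpha> \<in> facets" for \<alpha>
    by (rule tensor_closed(3)[OF subgroup_F_int incl[OF that]])
  have cap: "cap N \<Sigma> ori w p 0 u = (\<lambda>\<alpha>\<in>facets. finsum (tensor (?A \<alpha>)) (\<lambda>(\<gamma>, \<beta>). w \<beta> \<odot>\<^bsub>tensor (?A \<alpha>)\<^esub>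
      tensor_incl (?A \<alpha>) (contraction N \<Sigma> \<beta> p (rho N \<Sigma> p \<gamma> \<beta> (u \<gamma>)) (ori \<beta>))) {({0}, \<alpha>)})"
  proof -
    \<comment> \<open>The vertex is the only compact cone of dimension 0 and \<open>\<alpha>\<close>
      is a face of no other maximal cone, so the sum that defines the cap product has a single
      term.\<close>
    have "{(\<gamma>, \<beta>). \<gamma> \<in> compact_cones \<Sigma> 0 \<and> \<beta> \<in> facets \<and> \<gamma> face_of \<beta> \<and> \<alpha> face_of \<beta>} = {({0}, \<alpha>)}" if "\<alpha> \<in> facets" for \<alpha>
      using facets_of_facet[OF that] zero_face[OF coneD[OF that]] that unfolding compact_cones_0 by auto
    then show ?thesis
      unfolding cap_def Let_def fan_dim_2 iota_def F_lower_def diff_zero by (intro restrict_ext) (simp only:)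
  qed
  have fin: "finsum (tensor (?A \<alpha>)) (\<lambda>(\<gamma>, \<beta>). w \<beta> \<odot>\<^bsub>tensor (?A \<alpha>)\<^esub>
      tensor_incl (?A \<alpha>) (contraction N \<Sigma> \<beta> p (rho N \<Sigma> p \<gamma> \<beta> (u \<gamma>)) (ori \<beta>))) {({0}, \<alpha>)} \<in> carrier (tensor (?A \<alpha>))"
    "\<psi> \<in> additive_on (?A \<alpha>) \<Longrightarrow> tval (?A \<alpha>) (finsum (tensor (?A \<alpha>)) (\<lambda>(\<gamma>, \<beta>). w \<beta> \<odot>\<^bsub>tensor (?A \<alpha>)\<^esub>
      tensor_incl (?A \<alpha>) (contraction N \<Sigma> \<beta> p (rho N \<Sigma> p \<gamma> \<beta> (u \<gamma>)) (ori \<beta>))) {({0}, \<alpha>)}) \<psi> = w \<alpha> * contr p (dual_val p u) \<psi> (ori \<alpha>)"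
    if \<alpha>: "\<alpha> \<in> facets" for \<alpha> \<psi>
  proof -
    let ?g = "\<lambda>(\<gamma>, \<beta>). w \<beta> \<odot>\<^bsub>tensor (?A \<alpha>)\<^esub>
      tensor_incl (?A \<alpha>) (contraction N \<Sigma> \<beta> p (rho N \<Sigma> p \<gamma> \<beta> (u \<gamma>)) (ori \<beta>))"
    have g: "?g i \<in> carrier (tensor (?A \<alpha>))" if "i \<in> {({0}, \<alpha>)}" for i
      using X[OF \<alpha>] that by simp
    show "finsum (tensor (?A \<alpha>)) ?g {({0}, \<alpha>)} \<in> carrier (tensor (?A \<alpha>))"
      by (rule finsum_tensor(1)[OF subgroup_F_int g]) simp_all
    assume \<psi>: "\<psi> \<in> additive_on (?A \<alpha>)"
    have "tval (?A \<alpha>) (finsum (tensor (?A \<alpha>)) ?g {({0}, \<alpha>)}) \<psi> = (\<Sum>i\<in>{({0}, \<alpha>)}. tval (?A \<alpha>) (?g i) \<psi>)"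
      by (rule finsum_tensor(2)[OF subgroup_F_int g _ \<psi>]) simp_all
    also have "\<dots> = tval (?A \<alpha>) (?X \<alpha>) \<psi>" by simp
    also have "\<dots> = w \<alpha> * tval (?A \<alpha>) (?C \<alpha>) \<psi>"
      unfolding tval_simps(3)[OF subgroup_F_int \<psi> incl[OF \<alpha>]] tval_incl[OF order_refl \<psi> C(1)[OF \<alpha>]] ..
    also have "\<dots> = w \<alpha> * contr p (dual_val p u) \<psi> (ori \<alpha>)"
      unfolding C(2)[OF \<alpha> \<psi>] ..
    finally show "tval (?A \<alpha>) (finsum (tensor (?A \<alpha>)) ?g {({0}, \<alpha>)}) \<psi> = w \<alpha> * contr p (dual_val p u) \<psi> (ori \<alpha>)" .
  qed
  show "cap N \<Sigma> ori w p 0 u \<in> carrier (bm_chains N \<Sigma> (2 - p) 2)"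
    unfolding cap carrier_bm_chains by (rule iffD2[OF restrict_PiE_iff]) (rule ballI, rule fin(1))
  show "chain_val (2 - p) 2 (cap N \<Sigma> ori w p 0 u) = capv p (dual_val p u)"
    unfolding cap
  proof (rule chain_val_eqI)
    fix \<alpha> and \<psi> :: "('a list \<Rightarrow> real) \<Rightarrow> 'k"
    assume "\<alpha> \<in> facets" "\<psi> \<in> additive_on (?A \<alpha>)"
    then show "tval (?A \<alpha>) ((\<lambda>\<alpha>\<in>facets. finsum (tensor (?A \<alpha>)) (\<lambda>(\<gamma>, \<beta>). w \<beta> \<odot>\<^bsub>tensor (?A \<alpha>)\<^esub>
      tensor_incl (?A \<alpha>) (contraction N \<Sigma> \<beta> p (rho N \<Sigma> p \<gamma> \<beta> (u \<gamma>)) (ori \<beta>))) {({0}, \<alpha>)}) \<alpha>) \<psi> = capv p (dual_val p u) (\<alpha>, \<psi>)"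
      by (simp add: fin(2) capv_def)
  qed (auto simp: capv_def)
qed

lemma bm_cycles_2: "bm_cycles N \<Sigma> ori p 2 =
    {x \<in> carrier (bm_chains N \<Sigma> p 2 :: ('k, 'a set \<Rightarrow> ('a, 'k) coef) module). bd2 p (chain_val p 2 x) = 0}"
  unfolding numeral_2_eq_2 bm_cycles_Suc bd_1[unfolded One_nat_def] ..

lemma cycles_image_2: "chain_val p 2 ` (bm_cycles N \<Sigma> ori p 2 :: ('a set \<Rightarrow> ('a, 'k) coef) set) = cyc p"
  unfolding cyc_def numeral_2_eq_2 cycles_image_Suc bd_1[unfolded One_nat_def] ..

text \<open>There are no cones of dimension three, so nothing but 0 is a boundary in degree
  two.\<close>

lemma bm_boundaries_2: "bm_boundaries N \<Sigma> ori p 2 = {\<zero>\<^bsub>bm_chains N \<Sigma> p 2 :: ('k, 'a set \<Rightarrow> ('a, 'k) coef) module\<^esub>}"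
proof -
  let ?M = "bm_chains N \<Sigma> p 2 :: ('k, 'a set \<Rightarrow> ('a, 'k) coef) module"
  interpret E: embedded ?M "chain_val p 2"
    by (rule embedded_chains)
  have "bd p 2 y = 0" for y :: "'a set \<times> (('a list \<Rightarrow> real) \<Rightarrow> 'k) \<Rightarrow> 'k"
    by (auto simp: bd_def fun_eq_iff cones_empty)
  then have "chain_val p 2 x = 0" if "x \<in> bm_boundaries N \<Sigma> ori p 2" for x :: "'a set \<Rightarrow> ('a, 'k) coef"
    using that unfolding bm_boundaries_def by (auto simp: chain_val_boundary(2))
  then have "x = \<zero>\<^bsub>?M\<^esub>" if "x \<in> bm_boundaries N \<Sigma> ori p 2" for x :: "'a set \<Rightarrow> ('a, 'k) coef"
    using that bm_boundaries_image(1)[of p 2] E.zero by (intro E.eqI) auto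
  moreover have "\<zero>\<^bsub>?M\<^esub> \<in> bm_boundaries N \<Sigma> ori p 2"
    by (rule E.zero_in[OF bm_boundaries_image(1) subspace_boundaries])
  ultimately show ?thesis by blast
qed

text \<open>Nothing nonzero is divided out for q = 0, so the isomorphism becomes an equality of
  subspaces; injectivity is \<open>capv_inj\<close>.\<close>

lemma cap_product_0_iff:
  assumes p: "p \<le> 2"
  shows "cap_product N \<Sigma> ori w p 0 \<in> linear_isos
      (cohomology N \<Sigma> ori p 0 :: ('k, ('a set \<Rightarrow> ('a, 'k) coef \<Rightarrow> 'k) set) module)
      (bm_homology N \<Sigma> ori (2 - p) 2 :: ('k, ('a set \<Rightarrow> ('a, 'k) coef) set) module) \<longleftrightarrow>
    capv p ` addf (F_int N \<Sigma> p {0}) = cyc (2 - p)"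
proof -
  have dual: "dual_val p u \<in> addf (F_int N \<Sigma> p {0})"
    if "u \<in> carrier (cochains N \<Sigma> p 0 :: ('k, 'a set \<Rightarrow> ('a, 'k) coef \<Rightarrow> 'k) module)" for u
    using that dual_val_image[of p] by blast
  have cyc: "cap N \<Sigma> ori w p 0 \<in> carrier (cochains N \<Sigma> p 0 :: ('k, 'a set \<Rightarrow> ('a, 'k) coef \<Rightarrow> 'k) module) \<rightarrow> bm_cycles N \<Sigma> ori (2 - p) 2"
  proof
    fix u assume "u \<in> carrier (cochains N \<Sigma> p 0 :: ('k, 'a set \<Rightarrow> ('a, 'k) coef \<Rightarrow> 'k) module)"
    then have "dual_val p u \<in> additive_on (F_int N \<Sigma> p {0})"
      using dual unfolding addf_def by blast
    from capv_cyc[OF p this] show "cap N \<Sigma> ori w p 0 u \<in> bm_cycles N \<Sigma> ori (2 - p) 2"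
      unfolding bm_cycles_2 cyc_def using cap_0[OF p, of u] by simp
  qed
  let ?C = "cochains N \<Sigma> p 0 :: ('k, 'a set \<Rightarrow> ('a, 'k) coef \<Rightarrow> 'k) module"
  let ?M = "bm_chains N \<Sigma> (2 - p) 2 :: ('k, 'a set \<Rightarrow> ('a, 'k) coef) module"
  let ?Z = "bm_cycles N \<Sigma> ori (2 - p) 2 :: ('a set \<Rightarrow> ('a, 'k) coef) set"
  have "induced_map ?M {\<zero>\<^bsub>?M\<^esub>} (cap N \<Sigma> ori w p 0) \<in> linear_isos (quotient_module (?C\<lparr>carrier := carrier ?C\<rparr>) {\<zero>\<^bsub>?C\<^esub>})
      (quotient_module (?M\<lparr>carrier := ?Z\<rparr>) {\<zero>\<^bsub>?M\<^esub>}) \<longleftrightarrow> capv p ` dual_val p ` carrier ?C = chain_val (2 - p) 2 ` ?Z"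
  proof (rule linear_isos_trivial_quotient[where f = "cap N \<Sigma> ori w p 0" and L = "capv p" and C' = ?Z, OF embedded_cochains embedded_chains])
    show "cap N \<Sigma> ori w p 0 \<in> carrier ?C \<rightarrow> ?Z" by (rule cyc)
    show "flinear (capv p)" by (rule flinear_capv)
    show "chain_val (2 - p) 2 (cap N \<Sigma> ori w p 0 u) = capv p (dual_val p u)" for u by (rule cap_0(2)[OF p])
    show "bm_cycles N \<Sigma> ori (2 - p) 2 \<subseteq> carrier (bm_chains N \<Sigma> (2 - p) 2 :: ('k, 'a set \<Rightarrow> ('a, 'k) coef) module)"
      unfolding bm_cycles_2 by blast
    show "dual_val p u = 0" if "u \<in> carrier (cochains N \<Sigma> p 0 :: ('k, 'a set \<Rightarrow> ('a, 'k) coef \<Rightarrow> 'k) module)" "capv p (dual_val p u) = 0" for u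
      by (rule capv_inj[OF p dual[OF that(1)] that(2)])
  qed
  then show ?thesis
    unfolding cap_product_def Let_def fan_dim_2 cohomology_def bm_homology_def cocycles_0 coboundaries_0 diff_zero
      bm_boundaries_2 dual_val_image cycles_image_2 .
qed

text \<open>No cone of positive dimension is compact, so the cohomology vanishes in positive degree,
  and vanishing of the homology in the complementary degree makes the cap product an isomorphism of
  zero modules.\<close>

lemma cap_product_Suc:
  assumes "zero_module (bm_homology N \<Sigma> ori (2 - p) (2 - Suc q) :: ('k, ('a set \<Rightarrow> ('a, 'k) coef) set) module)"
  shows "cap_product N \<Sigma> ori w p (Suc q) \<in> linear_isos
      (cohomology N \<Sigma> ori p (Suc q) :: ('k, ('a set \<Rightarrow> ('a, 'k) coef \<Rightarrow> 'k) set) module)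
      (bm_homology N \<Sigma> ori (2 - p) (2 - Suc q) :: ('k, ('a set \<Rightarrow> ('a, 'k) coef) set) module)"
proof -
  let ?M = "bm_chains N \<Sigma> (2 - p) (2 - Suc q) :: ('k, 'a set \<Rightarrow> ('a, 'k) coef) module"
  let ?B = "bm_boundaries N \<Sigma> ori (2 - p) (2 - Suc q) :: ('a set \<Rightarrow> ('a, 'k) coef) set"
  let ?z = "\<lambda>\<gamma>. undefined :: ('a, 'k) coef \<Rightarrow> 'k"
  interpret E: embedded ?M "chain_val (2 - p) (2 - Suc q)"
    by (rule embedded_chains)
  note B = bm_boundaries_image(1) subspace_boundaries
  have "cap N \<Sigma> ori w p (Suc q) ?z = \<zero>\<^bsub>?M\<^esub>"
  proof -
    have "finsum (tensor A) f {} = \<zero>\<^bsub>tensor A :: ('k, ('a, 'k) coef) module\<^esub>" if "add_subgroup A" for A and f :: "'a set \<times> 'a set \<Rightarrow> _"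
      by (rule abelian_monoid.finsum_empty[OF abelian_monoid_tensor[OF that]])
    then show ?thesis
      unfolding cap_def Let_def fan_dim_2 by (simp add: compact_cones_Suc F_lower_def bm_chains_def direct_sum_def)
  qed
  then have F: "cap_product N \<Sigma> ori w p (Suc q) {?z} = ?B"
    unfolding cap_product_def Let_def fan_dim_2 induced_map_def
    using E.coset_absorb[OF B E.zero_in[OF B]] by simp
  show ?thesis
    unfolding cohomology_def bm_homology_def cocycles_Suc coboundaries_Suc
    by (rule E.linear_isos_trivial[where B = ?B and z = ?z and F = "cap_product N \<Sigma> ori w p (Suc q)", OF B _ _ F])
      (use assms in \<open>simp_all add: bm_homology_def cochains_def direct_sum_def compact_cones_Suc restrict_def\<close>)
qed

text \<open>For q > 0 duality holds by the vanishing of the homology in degrees 0 and 1, so the case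
  q = 0 decides, and there \<open>duality_criterion\<close> applies.\<close>

lemma tropical_poincare_duality_iff:
  assumes "\<And>p q. q < 2 \<Longrightarrow> zero_module (bm_homology N \<Sigma> ori p q :: ('k, ('a set \<Rightarrow> ('a, 'k) coef) set) module)"
  shows "tropical_poincare_duality N \<Sigma> ori w \<longleftrightarrow>
    (\<forall>\<rho>\<in>rays. fs.dim (tspace (F_int N \<Sigma> 2 \<rho>) :: ((('a list \<Rightarrow> real) \<Rightarrow> 'k) \<Rightarrow> 'k) set) + 1 = card (facets_at \<rho>))"
proof -
  have "tropical_poincare_duality N \<Sigma> ori w \<longleftrightarrow> (\<forall>p\<le>2. capv p ` addf (F_int N \<Sigma> p {0}) = cyc (2 - p))"
  proof
    assume TPD: "tropical_poincare_duality N \<Sigma> ori w"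
    show "\<forall>p\<le>2. capv p ` addf (F_int N \<Sigma> p {0}) = cyc (2 - p)"
    proof (intro allI impI)
      fix p :: nat assume p: "p \<le> 2"
      have "p \<in> {0..2}" "0 \<in> {0..2::nat}" using p by simp_all
      from TPD[unfolded tropical_poincare_duality_def fan_dim_2, rule_format, OF this]
      show "capv p ` addf (F_int N \<Sigma> p {0}) = cyc (2 - p)"
        unfolding diff_zero cap_product_0_iff[OF p] .
    qed
  next
    assume R: "\<forall>p\<le>2. capv p ` addf (F_int N \<Sigma> p {0}) = cyc (2 - p)"
    show "tropical_poincare_duality N \<Sigma> ori w"
      unfolding tropical_poincare_duality_def fan_dim_2
    proof (intro ballI)
      fix p q :: nat assume pq: "p \<in> {0..2}" "q \<in> {0..2}"
      show "cap_product N \<Sigma> ori w p q \<in> linear_isos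
          (cohomology N \<Sigma> ori p q :: ('k, ('a set \<Rightarrow> ('a, 'k) coef \<Rightarrow> 'k) set) module)
          (bm_homology N \<Sigma> ori (2 - p) (2 - q) :: ('k, ('a set \<Rightarrow> ('a, 'k) coef) set) module)"
      proof (cases q)
        case 0
        have "p \<le> 2" using pq by simp
        then show ?thesis using R unfolding 0 diff_zero cap_product_0_iff[OF \<open>p \<le> 2\<close>] by blast
      next
        case (Suc r)
        show ?thesis
          unfolding Suc by (rule cap_product_Suc[OF assms]) simp
      qed
    qed
  qed
  also have "\<dots> \<longleftrightarrow> (\<forall>\<rho>\<in>rays. fs.dim (tspace (F_int N \<Sigma> 2 \<rho>) :: ((('a list \<Rightarrow> real) \<Rightarrow> 'k) \<Rightarrow> 'k) set) + 1 = card (facets_at \<rho>))"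
  proof (rule duality_criterion)
    fix p x assume x: "x \<in> chains p rays" "bd1 p x = (0 :: 'a set \<times> (('a list \<Rightarrow> real) \<Rightarrow> 'k) \<Rightarrow> 'k)"
    show "x \<in> bd2 p ` chains p facets"
      using assms[of 1 p] x unfolding zero_bm_homology_1 by simp
  next
    fix p and x :: "'a set \<times> (('a list \<Rightarrow> real) \<Rightarrow> 'k) \<Rightarrow> 'k" assume x: "x \<in> chains p {{0}}"
    show "x \<in> bd1 p ` chains p rays"
      using assms[of 0 p] x unfolding zero_bm_homology_0 by simp
  qed
  finally show ?thesis .
qed

end

section \<open>Comparison of the fan with its stars\<close>

text \<open>Evaluating the boundary of the fundamental chain at a ray and an additive function gives
  the balancing relation. That a weight is nonzero follows from the condition on zero divisors,
  tested with 1.\<close>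

lemma (in fan2) balanced_fan2I:
  fixes w :: "'a set \<Rightarrow> 'k::field"
  assumes "balanced N \<Sigma> ori w"
  shows "balanced_fan2 N \<Sigma> ori w"
proof unfold_locales
  have w: "weight_function \<Sigma> w" and c: "fundamental_chain N \<Sigma> ori w \<in> bm_cycles N \<Sigma> ori 2 2"
    using assms by (simp_all add: balanced_def fan_dim_2)
  show "w \<alpha> \<noteq> 0" if "\<alpha> \<in> facets" for \<alpha>
  proof
    assume "w \<alpha> = 0"
    then have "w \<alpha> * 1 = 0" by simp
    then have "(1 :: 'k) = 0"
      using w[unfolded weight_function_def fan_dim_2, rule_format, OF that, of 1] by blast
    then show False by simp
  qed
  fix \<rho> and \<psi> :: "('a list \<Rightarrow> real) \<Rightarrow> 'k"
  assume \<rho>: "\<rho> \<in> rays" and \<psi>: "\<psi> \<in> additive_on (F_int N \<Sigma> 2 \<rho>)"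
  have "bd2 2 (chain_val 2 2 (fundamental_chain N \<Sigma> ori w)) = 0"
    using c unfolding numeral_2_eq_2[of] bm_cycles_Suc[of _ 1, unfolded One_nat_def] bd_1[unfolded One_nat_def] by simp
  from fun_cong[OF this, of "(\<rho>, \<psi>)"]
  have "(\<Sum>\<alpha>\<in>facets_at \<rho>. of_int (rel_sign ori \<rho> \<alpha>) * chain_val 2 2 (fundamental_chain N \<Sigma> ori w) (\<alpha>, \<psi>)) = 0"
    using \<rho> \<psi> by (simp add: bd2_def)
  moreover have "chain_val 2 2 (fundamental_chain N \<Sigma> ori w) (\<alpha>, \<psi>) = w \<alpha> * \<psi> (wedge (ori \<alpha>))" if \<alpha>: "\<alpha> \<in> facets_at \<rho>" for \<alpha>
  proof -
    note \<alpha>' = facets_atD[OF \<alpha>]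
    have \<psi>': "\<psi> \<in> additive_on (F_int N \<Sigma> 2 \<alpha>)"
      by (rule additive_on_subset[OF F_int_mono[OF \<alpha>'(2)] \<psi>])
    have "wedge (ori \<alpha>) \<in> F_int N \<Sigma> 2 \<alpha>"
      using F_int_2_facet[OF \<alpha>'(1)] by (simp add: subgroup_gen_base)
    then show ?thesis
      using \<alpha>'(1) tval_simps(3)[OF subgroup_F_int \<psi>' tensor_closed(4)[OF subgroup_F_int]] tval_simps(4)[OF subgroup_F_int \<psi>']
      by (simp add: chain_val_def fundamental_chain_def fan_dim_2 F_lower_def)
  qed
  ultimately show "(\<Sum>\<alpha>\<in>facets_at \<rho>. of_int (rel_sign ori \<rho> \<alpha>) * w \<alpha> * \<psi> (wedge (ori \<alpha>))) = 0"
    by (simp add: mult.assoc)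
qed

theorem proposition5p7:
  fixes N :: "'a::euclidean_space set"
    and \<Sigma> :: "'a set set"
    and ori :: "'a set \<Rightarrow> 'a list"
    and w :: "'a set \<Rightarrow> 'k::field"
    and Star :: "'a set \<Rightarrow> 'a set set"
    and star_ori :: "'a set \<Rightarrow> 'a set \<Rightarrow> 'a list"
  assumes "is_lattice N"
    and "fan N \<Sigma>"
    and "fan_dim \<Sigma> = 2"
    and "orientation N \<Sigma> ori"
    and "balanced N \<Sigma> ori w"
    and "\<And>p q. q \<noteq> 2 \<Longrightarrow>
      zero_module (bm_homology N \<Sigma> ori p q :: ('k, ('a set \<Rightarrow> ('a, 'k) coef) set) module)"
    and "\<And>\<tau>. \<tau> \<in> cones \<Sigma> 1 \<Longrightarrow> is_star N \<Sigma> \<tau> (Star \<tau>)"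
    and "\<And>\<tau>. \<tau> \<in> cones \<Sigma> 1 \<Longrightarrow> orientation N (Star \<tau>) (star_ori \<tau>)"
  shows "tropical_poincare_duality N \<Sigma> ori w \<longleftrightarrow>
    (\<forall>\<tau>\<in>cones \<Sigma> 1. tropical_poincare_duality N (Star \<tau>) (star_ori \<tau>) (star_weight \<Sigma> \<tau> w))"
proof -
  interpret fan2 N \<Sigma> ori
    using assms(1-4) by unfold_locales
  interpret balanced_fan2 N \<Sigma> ori w
    by (rule balanced_fan2I[OF assms(5)])
  have "tropical_poincare_duality N (Star \<tau>) (star_ori \<tau>) (star_weight \<Sigma> \<tau> w) \<longleftrightarrow>
      fs.dim (tspace (F_int N \<Sigma> 2 \<tau>) :: ((('a list \<Rightarrow> real) \<Rightarrow> 'k) \<Rightarrow> 'k) set) + 1 = card (facets_at \<tau>)"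
    if \<tau>: "\<tau> \<in> rays" for \<tau>
  proof -
    interpret S: star_fan N \<Sigma> ori \<tau> "Star \<tau>" "star_ori \<tau>"
      using \<tau> assms(7,8)[OF \<tau>] by unfold_locales
    interpret B: balanced_fan2 N "Star \<tau>" "star_ori \<tau>" "star_weight \<Sigma> \<tau> w"
      by (rule S.balanced_star) unfold_locales
    have "zero_module (bm_homology N (Star \<tau>) (star_ori \<tau>) p q :: ('k, ('a set \<Rightarrow> ('a, 'k) coef) set) module)"
      if "q < 2" for p q
    proof -
      consider "q = 0" | "q = 1" using \<open>q < 2\<close> by linarith
      then show ?thesis
      proof cases
        case 1
        show ?thesis unfolding 1 S.T.zero_bm_homology_0 using S.star_exact_0 by blast
      next
        case 2
        show ?thesis unfolding 2 S.T.zero_bm_homology_1 using S.star_exact_1 by blast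
      qed
    qed
    from B.tropical_poincare_duality_iff[OF this] show ?thesis
      unfolding S.ray_criterion .
  qed
  moreover have "tropical_poincare_duality N \<Sigma> ori w \<longleftrightarrow>
    (\<forall>\<rho>\<in>rays. fs.dim (tspace (F_int N \<Sigma> 2 \<rho>) :: ((('a list \<Rightarrow> real) \<Rightarrow> 'k) \<Rightarrow> 'k) set) + 1 = card (facets_at \<rho>))"
    by (rule tropical_poincare_duality_iff[OF assms(6)]) simp
  ultimately show ?thesis by simp
qed

end
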